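(* Let $F$ be a random variable in $\mathbb{R}^N$ with law $\mu_F$ such that $\mu_F\succeq\mathrm{Leb}_N$ and $\mathbb{E}(F)=0$. Let $r\ge2$ be an integer and $\mathbb{E}(|F|^{r+1})<\infty$. Let $F_k$, $k\ge1$, be independent copies of $F$, let $C(F)$ be the covariance matrix of $F$, let $A(F)$ be the inverse of $C(F)^{1/2}$, and let $\mu_n$ denote the law of $S_n=\frac1{\sqrt n}\sum_{k=1}^nA(F)F_k$. Then there exist polynomials $\mathcal{K}_m(x)$ on $\mathbb{R}^N$, $m=1,\dots,[r/3]$, where $\mathcal{K}_m(x)$ is a polynomial of order $m$ (no polynomials are needed for $r=2$), and a constant $C>0$ depending on $r$, $N$, $\underline\lambda(F)$ and $\overline\lambda(F)$, such that, setting $$\Gamma_{n,r}(dx)=\gamma(x)\Bigl(1+\sum_{m=1}^{[r/3]}\frac1{n^{m/2}}\mathcal{K}_m(x)\Bigr)dx ,$$ where $\gamma$ is the probability density function of a standard normal random variable in $\mathbb{R}^N$, one has for every $n\ge1$ $$d_{TV}(\mu_n,\Gamma_{n,r})\le C\,\bigl(1+\mathbb{E}(|F|^{r+1})\bigr)^{[r/3]\vee1}\times\frac1{n^{([r/3]+1)/2}} .$$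
   Context: $\mu_F\succeq\mathrm{Leb}_N$ means: there exist $\varepsilon_0>0$ and a non-empty open set $D_0\subset\mathbb{R}^N$ such that $\mu_F(A)\ge\varepsilon_0\,\mathrm{Leb}_N(A\cap D_0)$ for every Borel set $A$, where $\mathrm{Leb}_N$ is the Lebesgue measure. Under this assumption $C(F)$ is invertible; $\underline\lambda(F)$ and $\overline\lambda(F)$ denote the smallest and the largest eigenvalue of $C(F)^{-1}$. $[\cdot]$ is the integer part and $a\vee b=\max(a,b)$; for $r=2$ the sum in $\Gamma_{n,r}$ is empty and $\Gamma_{n,2}$ is the standard Gaussian law. The total variation distance between two (possibly signed) measures is $d_{TV}(\mu,\nu)=\sup\{|\int f\,d\mu-\int f\,d\nu| : f \text{ measurable},\ \|f\|_\infty\le1\}$.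
   Formalization: C may depend also on ε₀ and D₀ from the lower bound by Lebesgue measure (uniformity over them is false) and formally on the sample-space type, removable via a canonical space; "polynomial of order m" is rendered as degree at most 3m, since degree m fails already for m=1. *)

theory Defs
  imports "HOL-Probability.Probability"
begin

section \<open>Laws bounded from below by Lebesgue measure\<close>

text \<open>The relation between the law \<open>\<mu>\<close> and Lebesgue measure is split so that the witnesses
  \<open>\<epsilon>\<^sub>0\<close> and \<open>D\<^sub>0\<close> can be named: constants in total variation estimates necessarily depend on them.\<close>

definition dominates_Leb_on :: "real \<Rightarrow> (real^'n) set \<Rightarrow> (real^'n) measure \<Rightarrow> bool" where
  "dominates_Leb_on \<epsilon>\<^sub>0 D\<^sub>0 \<mu> \<longleftrightarrow> 0 < \<epsilon>\<^sub>0 \<and> open D\<^sub>0 \<and> D\<^sub>0 \<noteq> {} \<and>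
     (\<forall>A\<in>sets borel. ennreal \<epsilon>\<^sub>0 * emeasure lborel (A \<inter> D\<^sub>0) \<le> emeasure \<mu> A)"

definition dominates_Leb :: "(real^'n) measure \<Rightarrow> bool" where
  "dominates_Leb \<mu> \<longleftrightarrow> (\<exists>\<epsilon>\<^sub>0 D\<^sub>0. dominates_Leb_on \<epsilon>\<^sub>0 D\<^sub>0 \<mu>)"

section \<open>Covariance matrix, its square root and its spectrum\<close>

definition cov_matrix :: "'a measure \<Rightarrow> ('a \<Rightarrow> real^'n) \<Rightarrow> real^'n^'n" where
  "cov_matrix M X =
     (\<chi> i j. LINT \<omega>|M. (X \<omega> $ i - (LINT \<omega>'|M. X \<omega>' $ i)) * (X \<omega> $ j - (LINT \<omega>'|M. X \<omega>' $ j)))"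

definition pos_semidef :: "real^'n^'n \<Rightarrow> bool" where
  "pos_semidef B \<longleftrightarrow> transpose B = B \<and> (\<forall>x. 0 \<le> x \<bullet> (B *v x))"

text \<open>Meaningful for positive semidefinite arguments, where the root exists and is unique.\<close>

definition matrix_sqrt :: "real^'n^'n \<Rightarrow> real^'n^'n" where
  "matrix_sqrt C = (THE B. pos_semidef B \<and> B ** B = C)"

definition normalizer :: "'a measure \<Rightarrow> ('a \<Rightarrow> real^'n) \<Rightarrow> real^'n^'n" where
  "normalizer M X = matrix_inv (matrix_sqrt (cov_matrix M X))"

definition eigenvalues :: "real^'n^'n \<Rightarrow> real set" where
  "eigenvalues B = {l. \<exists>v. v \<noteq> 0 \<and> B *v v = l *\<^sub>R v}"

definition min_eig_inv_cov :: "'a measure \<Rightarrow> ('a \<Rightarrow> real^'n) \<Rightarrow> real" where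
  "min_eig_inv_cov M X = Min (eigenvalues (matrix_inv (cov_matrix M X)))"

definition max_eig_inv_cov :: "'a measure \<Rightarrow> ('a \<Rightarrow> real^'n) \<Rightarrow> real" where
  "max_eig_inv_cov M X = Max (eigenvalues (matrix_inv (cov_matrix M X)))"

section \<open>Signed measures and total variation distance\<close>

text \<open>A finite signed measure is represented by a pair of finite positive measures standing for their
  difference; the pair need not be the Jordan decomposition.\<close>

type_synonym 'a signed_measure = "'a measure \<times> 'a measure"

definition signed_integral :: "'a signed_measure \<Rightarrow> ('a \<Rightarrow> real) \<Rightarrow> real" where
  "signed_integral \<nu> f = (LINT x|fst \<nu>. f x) - (LINT x|snd \<nu>. f x)"

definition of_measure :: "'a measure \<Rightarrow> 'a signed_measure" where
  "of_measure \<mu> = (\<mu>, null_measure \<mu>)"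

text \<open>\<open>ennreal\<close> truncates negative reals to 0, so the two components are the positive and the
  negative part of the signed measure with Lebesgue density \<open>g\<close>.\<close>

definition signed_density :: "(real^'n \<Rightarrow> real) \<Rightarrow> (real^'n) signed_measure" where
  "signed_density g =
     (density lborel (\<lambda>x. ennreal (g x)), density lborel (\<lambda>x. ennreal (- g x)))"

definition d_TV :: "(real^'n) signed_measure \<Rightarrow> (real^'n) signed_measure \<Rightarrow> real" where
  "d_TV \<mu> \<nu> = (SUP f\<in>{f. f \<in> borel_measurable borel \<and> (\<forall>x. \<bar>f x\<bar> \<le> 1)}.
     \<bar>signed_integral \<mu> f - signed_integral \<nu> f\<bar>)"

section \<open>The normalized sum and the corrected Gaussian law\<close>

definition normalized_sum ::
  "'a measure \<Rightarrow> ('a \<Rightarrow> real^'n) \<Rightarrow> (nat \<Rightarrow> 'a \<Rightarrow> real^'n) \<Rightarrow> nat \<Rightarrow> 'a \<Rightarrow> real^'n" where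
  "normalized_sum M F Fs n \<omega> = (1 / sqrt (real n)) *\<^sub>R (\<Sum>k=1..n. normalizer M F *v Fs k \<omega>)"

definition std_gauss_density :: "real^'n \<Rightarrow> real" where
  "std_gauss_density x = (\<Prod>i\<in>UNIV. std_normal_density (x $ i))"

definition polynomial_deg_le :: "nat \<Rightarrow> (real^'n \<Rightarrow> real) \<Rightarrow> bool" where
  "polynomial_deg_le d p \<longleftrightarrow>
     (\<exists>c :: ('n \<Rightarrow> nat) \<Rightarrow> real.
        \<forall>x. p x = (\<Sum>\<alpha> | (\<Sum>i\<in>UNIV. \<alpha> i) \<le> d. c \<alpha> * (\<Prod>i\<in>UNIV. (x $ i) ^ \<alpha> i)))"

lemma finite_multi_indices: "finite {\<alpha> :: 'n::finite \<Rightarrow> nat. (\<Sum>i\<in>UNIV. \<alpha> i) \<le> d}"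
proof (rule finite_subset)
  show "{\<alpha> :: 'n \<Rightarrow> nat. (\<Sum>i\<in>UNIV. \<alpha> i) \<le> d} \<subseteq> (UNIV :: 'n set) \<rightarrow>\<^sub>E {..d}"
  proof
    fix \<alpha> :: "'n \<Rightarrow> nat"
    assume "\<alpha> \<in> {\<alpha>. (\<Sum>i\<in>UNIV. \<alpha> i) \<le> d}"
    then have "\<alpha> i \<le> d" for i
      using member_le_sum[of i UNIV \<alpha>] by simp
    then show "\<alpha> \<in> UNIV \<rightarrow>\<^sub>E {..d}"
      by auto
  qed
  show "finite ((UNIV :: 'n set) \<rightarrow>\<^sub>E {..d})"
    by (intro finite_PiE) auto
qed

text \<open>\<open>K m\<close> is the coefficient of order \<open>m\<close> in the expansion in powers of \<open>n powr (- 1/2)\<close>. As usual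
  in Edgeworth expansions, its degree as a polynomial is at most \<open>3 * m\<close>; already \<open>K 1\<close> is in dimension
  one the third Hermite polynomial up to a factor.\<close>

definition Gamma_signed ::
  "nat \<Rightarrow> nat \<Rightarrow> (nat \<Rightarrow> real^'n \<Rightarrow> real) \<Rightarrow> (real^'n) signed_measure" where
  "Gamma_signed n r K = signed_density (\<lambda>x. std_gauss_density x *
     (1 + (\<Sum>m=1..r div 3. 1 / real n powr (real m / 2) * K m x)))"

end

theory Submission
  imports Defs "HOL-Computational_Algebra.Polynomial"
begin

text \<open>Averaging over a law acts on bounded measurable functions, and these operators lie in one commutative
  Banach algebra. If \<open>P\<close> and \<open>Q\<close> belong to the normalized law and to the standard Gaussian law, then, with \<open>s = r div 3\<close>,
  \<open>P ^ n\<close> is the sum over \<open>j \<le> s\<close> of \<open>n choose j\<close> times \<open>Q ^ (n - j) * (P - Q) ^ j\<close>, up to a remainder that is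
  \<open>(P - Q) ^ (s + 1)\<close> times a combination of products of powers of \<open>P\<close> and \<open>Q\<close>. The moments of the two laws up
  to order two agree, so a Taylor expansion turns each factor \<open>P - Q\<close> into derivatives of order at least three,
  and a derivative that falls on \<open>P ^ n\<close> or \<open>Q ^ n\<close> costs \<open>n powr (- 1/2)\<close>. For \<open>Q\<close> this is the Gaussian score;
  for \<open>P\<close> one splits off a multiple of a smooth compactly supported density of finite Fisher information, so that
  \<open>P ^ n\<close> contains a binomially distributed number of smooth factors. Derivatives of the Gaussian kernel produce
  Hermite polynomials. An estimate of the third moment by the second and a higher one yields
  the power \<open>s\<close> of the moment instead of \<open>s + 1\<close>.\<close>

section \<open>The algebra of convolution operators\<close>

text \<open>Differentiation is unbounded, so a derivative never stands alone: it always falls on a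
  convolution factor that is present in the product, and the bookkeeping counts the factors that
  remain. A block \<open>Q ^ b\<close> with \<open>b\<close> proportional to \<open>n\<close> pays
  for one derivative. The terms \<open>Q ^ (n - j) * (P - Q) ^ j\<close> do not yet yield
  polynomials independent of \<open>n\<close>, because their Gaussian factor has variance
  \<open>n - j\<close>. Restoring the variance \<open>n\<close> would require the
  \<open>j\<close>-th power of the inverse of \<open>Q\<close>, which is unbounded; the substitute
  is the truncated Neumann series \<open>\<Sum>i<s. (1 - Q) ^ i\<close>. Since \<open>1 - Q\<close>
  starts with second derivatives, the truncation costs only \<open>n powr (- s)\<close>. What is
  left is a fixed differential operator with constant coefficients, applied to a Gaussian of
  variance \<open>n\<close>. Rescaling turns every derivative into a factor
  \<open>1 / sqrt n\<close>, the binomial coefficients are polynomials in \<open>n\<close>, and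
  sorting by powers of \<open>n\<close> gives the corrections.\<close>

typedef 'n bmeas = "{f :: real^'n \<Rightarrow> real. f \<in> borel_measurable borel \<and> bounded (range f)}"
  morphisms bapp Bmeas
  by (rule exI[of _ "\<lambda>_. 0"]) auto

lemma bapp_measurable [measurable]: "bapp f \<in> borel_measurable borel"
  and bapp_bounded: "bounded (range (bapp f))"
  using bapp[of f] by auto

lemma bapp_Bmeas:
  assumes "f \<in> borel_measurable borel" "\<And>x. \<bar>f x\<bar> \<le> b"
  shows "bapp (Bmeas f) = f"
  by (rule Bmeas_inverse) (use assms in \<open>auto simp: bounded_iff\<close>)

lemma bmeas_eqI: "(\<And>x. bapp f x = bapp g x) \<Longrightarrow> f = g"
  by (metis bapp_inject ext)

instantiation bmeas :: (finite) real_vector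
begin

definition "0 = Bmeas (\<lambda>_. 0)"
definition "f + g = Bmeas (\<lambda>x. bapp f x + bapp g x)"
definition "f - g = Bmeas (\<lambda>x. bapp f x - bapp g x)"
definition "- f = Bmeas (\<lambda>x. - bapp f x)"
definition "c *\<^sub>R f = Bmeas (\<lambda>x. c * bapp f x)"

lemma bapp_abs_le: obtains b where "\<And>x. \<bar>bapp f x\<bar> \<le> b"
  using bapp_bounded[of f] by (auto simp: bounded_iff)

lemma bapp_zero [simp]: "bapp 0 x = 0"
  unfolding zero_bmeas_def by (subst bapp_Bmeas[of _ 0]) auto

lemma bapp_add [simp]: "bapp (f + g) x = bapp f x + bapp g x"
proof -
  obtain b c where "\<And>x. \<bar>bapp f x\<bar> \<le> b" "\<And>x. \<bar>bapp g x\<bar> \<le> c" by (metis bapp_abs_le)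
  then have "\<And>x. \<bar>bapp f x + bapp g x\<bar> \<le> b + c" by (meson abs_triangle_ineq add_mono order_trans)
  then show ?thesis unfolding plus_bmeas_def by (subst bapp_Bmeas[of _ "b + c"]) auto
qed

lemma bapp_uminus [simp]: "bapp (- f) x = - bapp f x"
proof -
  obtain b where "\<And>x. \<bar>bapp f x\<bar> \<le> b" by (metis bapp_abs_le)
  then show ?thesis unfolding uminus_bmeas_def by (subst bapp_Bmeas[of _ b]) auto
qed

lemma bapp_scaleR [simp]: "bapp (c *\<^sub>R f) x = c * bapp f x"
proof -
  obtain b where "\<And>x. \<bar>bapp f x\<bar> \<le> b" by (metis bapp_abs_le)
  then show ?thesis unfolding scaleR_bmeas_def
    by (subst bapp_Bmeas[of _ "\<bar>c\<bar> * b"]) (auto simp: abs_mult mult_left_mono)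
qed

lemma bapp_diff [simp]: "bapp (f - g) x = bapp f x - bapp g x"
proof -
  have "f - g = f + - g"
    unfolding minus_bmeas_def plus_bmeas_def by simp
  then show ?thesis by simp
qed

instance
proof
  fix f g h :: "'a bmeas" and a b :: real
  show "f + g + h = f + (g + h)" "f + g = g + f" "0 + f = f" "- f + f = 0" "f - g = f + - g"
    "a *\<^sub>R (f + g) = a *\<^sub>R f + a *\<^sub>R g" "(a + b) *\<^sub>R f = a *\<^sub>R f + b *\<^sub>R f"
    "a *\<^sub>R b *\<^sub>R f = (a * b) *\<^sub>R f" "1 *\<^sub>R f = f"
    by (auto intro!: bmeas_eqI simp: algebra_simps)
qed

end

instantiation bmeas :: (finite) real_normed_vector
begin

definition "norm f = (SUP x. \<bar>bapp f x\<bar>)"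
definition "sgn (f :: 'a bmeas) = f /\<^sub>R norm f"
definition "dist (f :: 'a bmeas) g = norm (f - g)"
definition "uniformity = (INF e\<in>{0<..}. principal {(x :: 'a bmeas, y). dist x y < e})"
definition "open (U :: 'a bmeas set) \<longleftrightarrow> (\<forall>x\<in>U. \<forall>\<^sub>F (x', y) in uniformity. x' = x \<longrightarrow> y \<in> U)"

lemma bapp_le_norm: "\<bar>bapp f x\<bar> \<le> norm f"
proof -
  obtain b where "\<And>x. \<bar>bapp f x\<bar> \<le> b" by (metis bapp_abs_le)
  then show ?thesis unfolding norm_bmeas_def by (intro cSUP_upper bdd_aboveI2[of _ _ b]) auto
qed

lemma bmeas_norm_le: "(\<And>x. \<bar>bapp f x\<bar> \<le> b) \<Longrightarrow> norm f \<le> b"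
  unfolding norm_bmeas_def by (rule cSUP_least) auto

instance
proof
  fix f g h :: "'a bmeas" and a b :: real
  show "dist f g = norm (f - g)" "sgn f = f /\<^sub>R norm f"
    by (simp_all add: dist_bmeas_def sgn_bmeas_def)
  show "norm f = 0 \<longleftrightarrow> f = 0"
  proof
    assume "norm f = 0"
    then have "\<bar>bapp f x\<bar> \<le> 0" for x using bapp_le_norm[of f x] by simp
    then show "f = 0" by (intro bmeas_eqI) simp
  next
    assume "f = 0"
    have "norm f \<le> 0" by (rule bmeas_norm_le) (simp add: \<open>f = 0\<close>)
    then show "norm f = 0" using bapp_le_norm[of f undefined] by linarith
  qed
  show "norm (f + g) \<le> norm f + norm g"
    by (rule bmeas_norm_le) (metis abs_triangle_ineq add_mono bapp_add bapp_le_norm order_trans)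
  show "norm (a *\<^sub>R f) = \<bar>a\<bar> * norm f"
  proof -
    have le: "norm (a *\<^sub>R f) \<le> \<bar>a\<bar> * norm f" for a and f :: "'a bmeas"
      by (rule bmeas_norm_le) (simp add: abs_mult bapp_le_norm mult_left_mono)
    show ?thesis
    proof (cases "a = 0")
      case True
      then show ?thesis
        using le[of 0 f] bapp_le_norm[of "0 *\<^sub>R f" undefined] by simp
    next
      case False
      have "f = inverse a *\<^sub>R (a *\<^sub>R f)" by (rule bmeas_eqI) (use False in simp)
      then have "norm f \<le> \<bar>inverse a\<bar> * norm (a *\<^sub>R f)" by (metis le)
      then have "\<bar>a\<bar> * norm f \<le> norm (a *\<^sub>R f)"
        using False by (simp add: abs_inverse field_simps)
      then show ?thesis using le[of a f] by simp
    qed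
  qed
qed (simp_all add: uniformity_bmeas_def open_bmeas_def)

end

definition bconst :: "real \<Rightarrow> 'n::finite bmeas" where
  "bconst c = Bmeas (\<lambda>_. c)"

lemma bapp_bconst [simp]: "bapp (bconst c) x = c"
  unfolding bconst_def by (subst bapp_Bmeas[of _ "\<bar>c\<bar>"]) auto

definition bmult :: "'n::finite bmeas \<Rightarrow> 'n bmeas \<Rightarrow> 'n bmeas" where
  "bmult f g = Bmeas (\<lambda>x. bapp f x * bapp g x)"

lemma bapp_bmult [simp]: "bapp (bmult f g) x = bapp f x * bapp g x"
  unfolding bmult_def
  by (subst bapp_Bmeas[of _ "norm f * norm g"]) (auto simp: abs_mult bapp_le_norm mult_mono)

section \<open>Averaging operators with a weight\<close>

definition kernel_ok :: "(real^'n) measure \<Rightarrow> (real^'n \<Rightarrow> real) \<Rightarrow> bool" where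
  "kernel_ok \<mu> w \<longleftrightarrow> prob_space \<mu> \<and> sets \<mu> = sets borel \<and> integrable \<mu> w"

text \<open>Convolution with the reflection of the signed measure of density \<open>w\<close> with
  respect to \<open>\<mu>\<close>. Keeping the pair instead of the signed measure treats averaging
  (\<open>w\<close> constant 1) and its derivatives (\<open>w\<close> a score) alike.\<close>

definition kernel_fun :: "(real^'n::finite) measure \<Rightarrow> (real^'n \<Rightarrow> real) \<Rightarrow> 'n bmeas \<Rightarrow> 'n bmeas" where
  "kernel_fun \<mu> w f = Bmeas (\<lambda>x. LINT y|\<mu>. bapp f (x + y) * w y)"

lemma kernel_integrable:
  assumes "kernel_ok \<mu> w"
  shows "integrable \<mu> (\<lambda>y. bapp f (x + y) * w y)"
proof -
  have w: "integrable \<mu> w" and [measurable_cong]: "sets \<mu> = sets borel"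
    using assms by (auto simp: kernel_ok_def)
  note [measurable] = borel_measurable_integrable[OF w]
  show ?thesis
  proof (rule Bochner_Integration.integrable_bound[where f = "\<lambda>y. norm f * w y"])
    show "integrable \<mu> (\<lambda>y. norm f * w y)" using w by simp
    show "AE y in \<mu>. norm (bapp f (x + y) * w y) \<le> norm (norm f * w y)"
      by (auto simp: abs_mult bapp_le_norm mult_right_mono)
  qed simp
qed

lemma kernel_abs_le:
  assumes "kernel_ok \<mu> w"
  shows "\<bar>LINT y|\<mu>. bapp f (x + y) * w y\<bar> \<le> (LINT y|\<mu>. \<bar>w y\<bar>) * norm f"
proof -
  have w: "integrable \<mu> w" using assms by (auto simp: kernel_ok_def)
  have "\<bar>LINT y|\<mu>. bapp f (x + y) * w y\<bar> \<le> (LINT y|\<mu>. \<bar>bapp f (x + y) * w y\<bar>)"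
    by simp
  also have "\<dots> \<le> (LINT y|\<mu>. norm f * \<bar>w y\<bar>)"
    using w integrable_abs[OF kernel_integrable[OF assms]]
    by (intro integral_mono) (auto simp: abs_mult bapp_le_norm mult_right_mono)
  finally show ?thesis by (simp add: mult.commute)
qed

lemma bapp_kernel_fun:
  assumes "kernel_ok \<mu> w"
  shows "bapp (kernel_fun \<mu> w f) x = (LINT y|\<mu>. bapp f (x + y) * w y)"
proof -
  have w: "integrable \<mu> w" and [measurable_cong]: "sets \<mu> = sets borel"
    and "prob_space \<mu>"
    using assms by (auto simp: kernel_ok_def)
  then interpret prob_space \<mu> by simp
  note [measurable] = borel_measurable_integrable[OF w]
  show ?thesis
    unfolding kernel_fun_def
    by (subst bapp_Bmeas[of _ "(LINT y|\<mu>. \<bar>w y\<bar>) * norm f"])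
       (auto intro!: kernel_abs_le[OF assms] borel_measurable_lebesgue_integral)
qed

lemma kernel_fun_bounded_linear:
  assumes "kernel_ok \<mu> w"
  shows "bounded_linear (kernel_fun \<mu> w)"
proof (rule bounded_linear_intro)
  fix f g :: "'a bmeas" and c :: real
  show "kernel_fun \<mu> w (f + g) = kernel_fun \<mu> w f + kernel_fun \<mu> w g"
    by (rule bmeas_eqI) (simp add: bapp_kernel_fun[OF assms] kernel_integrable[OF assms] distrib_right)
  show "kernel_fun \<mu> w (c *\<^sub>R f) = c *\<^sub>R kernel_fun \<mu> w f"
    by (rule bmeas_eqI) (simp add: bapp_kernel_fun[OF assms] mult.assoc)
  show "norm (kernel_fun \<mu> w f) \<le> norm f * (LINT y|\<mu>. \<bar>w y\<bar>)"
    by (rule bmeas_norm_le)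
       (use kernel_abs_le[OF assms] in \<open>simp add: bapp_kernel_fun[OF assms] mult.commute[of "norm f"]\<close>)
qed

text \<open>Both sides integrate \<open>f (x + y + z)\<close> against the product of the two
  weighted laws, so commutativity of addition and Fubini suffice, with majorant
  \<open>norm f * (w y * v z)\<close> in absolute value.\<close>

lemma kernel_fun_commute:
  assumes "kernel_ok \<mu> w" "kernel_ok \<nu> v"
  shows "kernel_fun \<mu> w (kernel_fun \<nu> v f) = kernel_fun \<nu> v (kernel_fun \<mu> w f)"
proof (rule bmeas_eqI)
  fix x
  have w: "integrable \<mu> w" and [measurable_cong]: "sets \<mu> = sets borel" and "prob_space \<mu>"
    using assms by (auto simp: kernel_ok_def)
  then interpret M: prob_space \<mu> by simp
  have v: "integrable \<nu> v" and [measurable_cong]: "sets \<nu> = sets borel" and "prob_space \<nu>"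
    using assms by (auto simp: kernel_ok_def)
  then interpret N: prob_space \<nu> by simp
  interpret pair_sigma_finite \<mu> \<nu> ..
  note [measurable] = borel_measurable_integrable[OF w] borel_measurable_integrable[OF v]
  have wv: "integrable (\<mu> \<Otimes>\<^sub>M \<nu>) (\<lambda>(y, z). w y * v z)"
    using w v by (intro Fubini_integrable) (auto simp: abs_mult)
  have int: "integrable (\<mu> \<Otimes>\<^sub>M \<nu>) (\<lambda>(y, z). bapp f (x + y + z) * v z * w y)"
  proof (rule Bochner_Integration.integrable_bound)
    show "integrable (\<mu> \<Otimes>\<^sub>M \<nu>) (\<lambda>(y, z). norm f * (w y * v z))"
      using integrable_mult_right[OF wv, of "norm f"] by (simp add: case_prod_unfold)
    show "AE p in \<mu> \<Otimes>\<^sub>M \<nu>. norm (case p of (y, z) \<Rightarrow> bapp f (x + y + z) * v z * w y)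
        \<le> norm (case p of (y, z) \<Rightarrow> norm f * (w y * v z))"
    proof (rule AE_I2, clarify)
      fix y z
      have "\<bar>bapp f (x + y + z)\<bar> * (\<bar>w y\<bar> * \<bar>v z\<bar>) \<le> norm f * (\<bar>w y\<bar> * \<bar>v z\<bar>)"
        by (intro mult_right_mono bapp_le_norm) auto
      then show "norm (bapp f (x + y + z) * v z * w y) \<le> norm (norm f * (w y * v z))"
        by (simp add: abs_mult mult_ac)
    qed
  qed measurable
  have "bapp (kernel_fun \<mu> w (kernel_fun \<nu> v f)) x = (LINT y|\<mu>. LINT z|\<nu>. bapp f (x + y + z) * v z * w y)"
    by (simp add: bapp_kernel_fun assms)
  also have "\<dots> = (LINT z|\<nu>. LINT y|\<mu>. bapp f (x + y + z) * v z * w y)"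
    by (rule Fubini_integral[symmetric, OF int])
  also have "\<dots> = (LINT z|\<nu>. (LINT y|\<mu>. bapp f (x + z + y) * w y) * v z)"
    by (intro Bochner_Integration.integral_cong refl)
       (simp add: mult_ac add_ac flip: integral_mult_left_zero integral_mult_right_zero)
  also have "\<dots> = bapp (kernel_fun \<nu> v (kernel_fun \<mu> w f)) x"
    by (simp add: bapp_kernel_fun assms)
  finally show "bapp (kernel_fun \<mu> w (kernel_fun \<nu> v f)) x = bapp (kernel_fun \<nu> v (kernel_fun \<mu> w f)) x" .
qed

definition kernels :: "('n::finite bmeas \<Rightarrow>\<^sub>L 'n bmeas) set" where
  "kernels = {Blinfun (kernel_fun \<mu> w) |\<mu> w. kernel_ok \<mu> w}"

lemma kernels_commute: "S \<in> kernels \<Longrightarrow> T \<in> kernels \<Longrightarrow> S o\<^sub>L T = T o\<^sub>L S"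
  by (auto simp: kernels_def intro!: blinfun_eqI
    simp: bounded_linear_Blinfun_apply kernel_fun_bounded_linear kernel_fun_commute)

text \<open>The bicommutant of a commuting family is a commutative algebra that contains the family, so
  that computations with convolution operators become ring computations.\<close>

definition kernel_comm :: "('n::finite bmeas \<Rightarrow>\<^sub>L 'n bmeas) set" where
  "kernel_comm = {U. \<forall>V\<in>kernels. U o\<^sub>L V = V o\<^sub>L U}"

typedef (overloaded) 'n cop = "{T :: 'n::finite bmeas \<Rightarrow>\<^sub>L 'n bmeas. \<forall>U\<in>kernel_comm. T o\<^sub>L U = U o\<^sub>L T}"
  morphisms cop_blinfun Cop
  by (rule exI[of _ 0]) (auto intro!: blinfun_eqI simp: blinfun.bilinear_simps)

setup_lifting type_definition_cop

lemma blinfun_eq_iff: "S = T \<longleftrightarrow> (\<forall>x. blinfun_apply S x = blinfun_apply T x)"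
  by (auto intro: blinfun_eqI)

text \<open>Since the kernels commute with each other, they lie in their own commutant. Hence the
  bicommutant is contained in the commutant and therefore commutes with itself.\<close>

lemma cop_blinfun_commute: "cop_blinfun S o\<^sub>L cop_blinfun T = cop_blinfun T o\<^sub>L cop_blinfun S"
proof -
  have "kernels \<subseteq> kernel_comm" unfolding kernel_comm_def using kernels_commute by auto
  then have "cop_blinfun S \<in> kernel_comm" using cop_blinfun[of S] unfolding kernel_comm_def by auto
  then show ?thesis using cop_blinfun[of T] by auto
qed

instantiation cop :: (finite) real_vector
begin

lift_definition zero_cop :: "'a cop" is 0
  by (auto intro!: blinfun_eqI simp: blinfun.bilinear_simps)
lift_definition plus_cop :: "'a cop \<Rightarrow> 'a cop \<Rightarrow> 'a cop" is "(+)"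
  by (auto simp: blinfun_eq_iff blinfun.bilinear_simps)
lift_definition minus_cop :: "'a cop \<Rightarrow> 'a cop \<Rightarrow> 'a cop" is "(-)"
  by (auto simp: blinfun_eq_iff blinfun.bilinear_simps)
lift_definition uminus_cop :: "'a cop \<Rightarrow> 'a cop" is uminus
  by (auto simp: blinfun_eq_iff blinfun.bilinear_simps)
lift_definition scaleR_cop :: "real \<Rightarrow> 'a cop \<Rightarrow> 'a cop" is scaleR
  by (auto simp: blinfun_eq_iff blinfun.bilinear_simps)

instance
proof
  fix a b c :: "'a cop" and r s :: real
  show "a + b + c = a + (b + c)" "a + b = b + a" "0 + a = a" "- a + a = 0" "a - b = a + - b"
    "r *\<^sub>R (a + b) = r *\<^sub>R a + r *\<^sub>R b" "(r + s) *\<^sub>R a = r *\<^sub>R a + s *\<^sub>R a"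
    "r *\<^sub>R s *\<^sub>R a = (r * s) *\<^sub>R a" "1 *\<^sub>R a = a"
    by (transfer; simp add: algebra_simps)+
qed

end

instantiation cop :: (finite) "{comm_ring_1, real_normed_algebra_1}"
begin

lift_definition one_cop :: "'a cop" is id_blinfun
  by (auto intro!: blinfun_eqI)
lift_definition times_cop :: "'a cop \<Rightarrow> 'a cop \<Rightarrow> 'a cop" is "(o\<^sub>L)"
  by (auto simp: blinfun_eq_iff)
lift_definition norm_cop :: "'a cop \<Rightarrow> real" is norm .
definition "sgn (f :: 'a cop) = f /\<^sub>R norm f"
definition "dist (f :: 'a cop) g = norm (f - g)"
definition "uniformity = (INF e\<in>{0<..}. principal {(x :: 'a cop, y). dist x y < e})"
definition "open (U :: 'a cop set) \<longleftrightarrow> (\<forall>x\<in>U. \<forall>\<^sub>F (x', y) in uniformity. x' = x \<longrightarrow> y \<in> U)"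

instance
proof
  fix a b c :: "'a cop" and r s :: real
  show "a * b * c = a * (b * c)" "1 * a = a" "(a + b) * c = a * c + b * c"
    "a * 1 = a" "a * (b + c) = a * b + a * c"
    "r *\<^sub>R a * b = r *\<^sub>R (a * b)" "a * r *\<^sub>R b = r *\<^sub>R (a * b)"
    by (transfer; simp add: blinfun_eq_iff blinfun.bilinear_simps)+
  show "a * b = b * a" by (metis cop_blinfun_commute cop_blinfun_inverse times_cop.rep_eq)
  show "dist a b = norm (a - b)" "sgn a = a /\<^sub>R norm a"
    by (simp_all add: dist_cop_def sgn_cop_def)
  show "norm a = 0 \<longleftrightarrow> a = 0" "norm (a + b) \<le> norm a + norm b" "norm (r *\<^sub>R a) = \<bar>r\<bar> * norm a"
    by (transfer; simp add: norm_triangle_ineq)+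
  show "norm (a * b) \<le> norm a * norm b" by transfer (rule norm_blinfun_compose)
  have "\<exists>f :: 'a bmeas. f \<noteq> 0"
    by (rule exI[of _ "bconst 1"]) (metis bapp_bconst bapp_zero zero_neq_one)
  \<comment> \<open>The constant function 1 has norm one and is fixed by the identity, which
    excludes a norm below one.\<close>
  then have "norm (id_blinfun :: 'a bmeas \<Rightarrow>\<^sub>L 'a bmeas) = 1"
  proof -
    have nb: "norm (bconst 1 :: 'a bmeas) = 1"
      by (rule antisym) (auto intro: bmeas_norm_le simp: order_trans[OF _ bapp_le_norm[of _ undefined]])
    have "norm (id_blinfun :: 'a bmeas \<Rightarrow>\<^sub>L 'a bmeas) \<le> 1" by (rule norm_blinfun_bound) auto
    moreover have "norm (blinfun_apply id_blinfun (bconst 1 :: 'a bmeas)) \<le> norm (id_blinfun :: 'a bmeas \<Rightarrow>\<^sub>L 'a bmeas) * norm (bconst 1 :: 'a bmeas)"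
      by (rule norm_blinfun)
    ultimately show ?thesis using nb by simp
  qed
  then show "norm (1 :: 'a cop) = 1" by transfer
  show "(0 :: 'a cop) \<noteq> 1"
  proof
    assume "(0 :: 'a cop) = 1"
    then have "norm (0 :: 'a cop) = 1" using \<open>norm (1 :: 'a cop) = 1\<close> by simp
    then show False by transfer simp
  qed
qed (simp_all add: uniformity_cop_def open_cop_def)

end

definition capp :: "'n::finite cop \<Rightarrow> 'n bmeas \<Rightarrow> real^'n \<Rightarrow> real" where
  "capp T f x = bapp (blinfun_apply (cop_blinfun T) f) x"

definition cfun :: "'n::finite cop \<Rightarrow> 'n bmeas \<Rightarrow> 'n bmeas" where
  "cfun T f = blinfun_apply (cop_blinfun T) f"

lemma capp_eq: "capp T f x = bapp (cfun T f) x"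
  by (simp add: capp_def cfun_def)

lemma cfun_times: "cfun (S * T) f = cfun S (cfun T f)"
  by (simp add: cfun_def times_cop.rep_eq)

lemma capp_times: "capp (S * T) f x = capp S (cfun T f) x"
  by (simp add: capp_eq cfun_times)

text \<open>Either factor may be applied last. The outer factor is the one through which the result
  depends on \<open>x\<close>, so a smooth factor can be brought to the outside before
  differentiating.\<close>

lemma capp_times': "capp (S * T) f x = capp T (cfun S f) x"
  by (subst mult.commute) (rule capp_times)

lemma cfun_one [simp]: "cfun 1 f = f"
  by (simp add: cfun_def one_cop.rep_eq)

lemma capp_one [simp]: "capp 1 f x = bapp f x"
  by (simp add: capp_eq)

lemma capp_zero [simp]: "capp 0 f x = 0"
  by (simp add: capp_def zero_cop.rep_eq blinfun.bilinear_simps)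

lemma capp_add [simp]: "capp (S + T) f x = capp S f x + capp T f x"
  by (simp add: capp_def plus_cop.rep_eq blinfun.bilinear_simps)

lemma capp_diff [simp]: "capp (S - T) f x = capp S f x - capp T f x"
  by (simp add: capp_def minus_cop.rep_eq blinfun.bilinear_simps)

lemma capp_scaleR [simp]: "capp (c *\<^sub>R T) f x = c * capp T f x"
  by (simp add: capp_def scaleR_cop.rep_eq blinfun.bilinear_simps)

lemma capp_sum [simp]: "capp (sum T A) f x = (\<Sum>i\<in>A. capp (T i) f x)"
  by (induct A rule: infinite_finite_induct) auto

lemma capp_bmeas_diff: "capp T (f - g) x = capp T f x - capp T g x"
  by (simp add: capp_def blinfun.bilinear_simps)

lemma capp_bmeas_add: "capp T (f + g) x = capp T f x + capp T g x"
  by (simp add: capp_def blinfun.bilinear_simps)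

lemma capp_bmeas_scaleR: "capp T (c *\<^sub>R f) x = c * capp T f x"
  by (simp add: capp_def blinfun.bilinear_simps)

lemma capp_abs_le: "\<bar>capp T f x\<bar> \<le> norm T * norm f"
  by (metis bapp_le_norm capp_def norm_blinfun norm_cop.rep_eq order_trans)

lemma norm_cop_le:
  assumes "\<And>f x. \<bar>capp T f x\<bar> \<le> b * norm f" "0 \<le> b"
  shows "norm T \<le> b"
  unfolding norm_cop.rep_eq
  by (rule norm_blinfun_bound) (use assms in \<open>auto intro!: bmeas_norm_le simp: capp_def\<close>)

text \<open>\<open>Blinfun\<close> and \<open>Cop\<close> are unspecified outside their carriers, so
  this is the intended operator only under \<open>kernel_ok\<close>.\<close>

definition ker :: "(real^'n::finite) measure \<Rightarrow> (real^'n \<Rightarrow> real) \<Rightarrow> 'n cop" where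
  "ker \<mu> w = Cop (Blinfun (kernel_fun \<mu> w))"

lemma capp_ker:
  assumes "kernel_ok \<mu> w"
  shows "capp (ker \<mu> w) f x = (LINT y|\<mu>. bapp f (x + y) * w y)"
proof -
  have "Blinfun (kernel_fun \<mu> w) \<in> kernels" using assms by (auto simp: kernels_def)
  then have "cop_blinfun (ker \<mu> w) = Blinfun (kernel_fun \<mu> w)"
    unfolding ker_def by (intro Cop_inverse) (auto simp: kernel_comm_def)
  then show ?thesis
    by (simp add: capp_def bounded_linear_Blinfun_apply kernel_fun_bounded_linear assms bapp_kernel_fun)
qed

lemma norm_ker_le: "kernel_ok \<mu> w \<Longrightarrow> norm (ker \<mu> w) \<le> (LINT y|\<mu>. \<bar>w y\<bar>)"
  by (rule norm_cop_le) (auto simp: capp_ker kernel_abs_le)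

lemma kernel_ok_prob: "prob_space \<mu> \<Longrightarrow> sets \<mu> = sets borel \<Longrightarrow> kernel_ok \<mu> (\<lambda>_. 1)"
  by (simp add: kernel_ok_def finite_measure.integrable_const prob_space_imp_sigma_finite prob_space.finite_measure)

lemma norm_ker_prob_le: "prob_space \<mu> \<Longrightarrow> sets \<mu> = sets borel \<Longrightarrow> norm (ker \<mu> (\<lambda>_. 1)) \<le> 1"
  using norm_ker_le[OF kernel_ok_prob, of \<mu>] by (simp add: prob_space.prob_space)

section \<open>Smoothing by powers of an operator and Taylor expansion\<close>

lemma cop_eqI: "(\<And>f x. capp S f x = capp T f x) \<Longrightarrow> S = T"
  by (metis blinfun_eqI bmeas_eqI capp_def cop_blinfun_inject)

lemma norm_power_le_one:
  fixes x :: "'n::finite cop"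
  shows "norm x \<le> 1 \<Longrightarrow> norm (x ^ k) \<le> 1"
  by (meson norm_ge_zero norm_power_ineq order_trans power_le_one)

text \<open>\<open>E i\<close> plays the role of the partial derivative of \<open>S\<close> in
  direction \<open>i\<close>. Differentiability at parameter 0 on every line through every base
  point is what the one-dimensional Taylor formula uses; continuity of the derivative is not
  demanded.\<close>

definition deriv_fam :: "'n::finite cop \<Rightarrow> ('n \<Rightarrow> 'n cop) \<Rightarrow> bool" where
  "deriv_fam S E \<longleftrightarrow> (\<forall>f x v. ((\<lambda>t. capp S f (x + t *\<^sub>R v)) has_real_derivative
     (\<Sum>i\<in>UNIV. v $ i * capp (E i) f x)) (at 0))"

lemma deriv_fam_at:
  assumes "deriv_fam S E"
  shows "((\<lambda>t. capp S f (x + t *\<^sub>R v)) has_real_derivative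
     (\<Sum>i\<in>UNIV. v $ i * capp (E i) f (x + t *\<^sub>R v))) (at t)"
proof -
  have "((\<lambda>h. capp S f ((x + t *\<^sub>R v) + h *\<^sub>R v)) has_real_derivative
     (\<Sum>i\<in>UNIV. v $ i * capp (E i) f (x + t *\<^sub>R v))) (at 0)"
    using assms unfolding deriv_fam_def by blast
  then have "((\<lambda>h. capp S f (x + (h + t) *\<^sub>R v)) has_real_derivative
     (\<Sum>i\<in>UNIV. v $ i * capp (E i) f (x + t *\<^sub>R v))) (at 0)"
    by (simp add: algebra_simps)
  then show ?thesis
    using DERIV_shift[of "\<lambda>t. capp S f (x + t *\<^sub>R v)" _ 0 t] by (simp add: add.commute)
qed

text \<open>With \<open>S\<close> applied last, \<open>T\<close> merely changes the test function. A
  derivative of a product thus falls on a single factor of choice, and there is no Leibniz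
  sum.\<close>

lemma deriv_fam_mult:
  assumes "deriv_fam S E"
  shows "deriv_fam (T * S) (\<lambda>i. T * E i)"
  using assms unfolding deriv_fam_def capp_times' by blast

section \<open>Fisher information and the size of a derivative\<close>

lemma capp_ker_const:
  assumes "prob_space \<mu>" "sets \<mu> = sets borel"
  shows "cfun (ker \<mu> (\<lambda>_. 1) ^ m) (bconst c) = bconst c"
proof (induct m)
  case (Suc m)
  have "cfun (ker \<mu> (\<lambda>_. 1)) (bconst c) = bconst c"
    using assms by (intro bmeas_eqI) (simp flip: capp_eq add: capp_ker kernel_ok_prob prob_space.prob_space)
  then show ?case using Suc by (simp add: cfun_times)
qed simp

text \<open>For independent \<open>Y_i\<close> of law \<open>\<mu>\<close> the expression dominates
  the mean of the square of \<open>f (x + Y_1 + ... + Y_m) - \<tau> * (w Y_1 + ... + w Y_m)\<close>: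
  zero mean kills the products of different scores, and by symmetry the mixed terms with
  \<open>f\<close> all coincide. Conditioning on one summand turns this into an induction on
  operator powers.\<close>

lemma score_quadratic:
  assumes P: "prob_space \<mu>" and sets: "sets \<mu> = sets borel"
    and w: "integrable \<mu> w" and w0: "(LINT y|\<mu>. w y) = 0"
    and w2: "integrable \<mu> (\<lambda>y. (w y)\<^sup>2)" and I: "(LINT y|\<mu>. (w y)\<^sup>2) \<le> I"
  defines "\<Phi> \<equiv> ker \<mu> (\<lambda>_. 1)" and "B \<equiv> ker \<mu> w"
  shows "0 \<le> capp (\<Phi> ^ m) (bmult f f) x - 2 * \<tau> * real m * capp (\<Phi> ^ (m - 1) * B) f x
    + \<tau>\<^sup>2 * real m * I"
proof (induct m arbitrary: f x)
  case 0
  then show ?case by simp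
next
  case (Suc m)
  interpret prob_space \<mu> by (rule P)
  note [measurable_cong] = sets
  have ok1: "kernel_ok \<mu> (\<lambda>_. 1)" and okw: "kernel_ok \<mu> w"
    using P sets w by (auto simp: kernel_ok_def)
  let ?a = "\<lambda>y. capp (\<Phi> ^ m) (bmult f f) (x + y)"
  let ?b = "\<lambda>y. capp (\<Phi> ^ m) f (x + y)"
  let ?d = "\<lambda>y. capp (\<Phi> ^ (m - 1) * B) f (x + y)"
  have B0: "cfun B (bconst c) = 0" for c
    using w w0 by (intro bmeas_eqI) (simp flip: capp_eq add: B_def capp_ker[OF okw])
  have "0 \<le> ?a y - 2 * \<tau> * (?b y * w y) + \<tau>\<^sup>2 * (w y)\<^sup>2 - 2 * \<tau> * real m * ?d y + \<tau>\<^sup>2 * real m * I" for y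
  proof -
    \<comment> \<open>Once the new summand is fixed at \<open>y\<close>, its score is a constant
      subtracted from the test function; the induction hypothesis is used for this shifted
      function.\<close>
    define g where "g = f - bconst (\<tau> * w y)"
    have "bmult g g = bmult f f - (2 * \<tau> * w y) *\<^sub>R f + bconst ((\<tau> * w y)\<^sup>2)"
      by (rule bmeas_eqI) (simp add: g_def power2_eq_square algebra_simps)
    then have 1: "capp (\<Phi> ^ m) (bmult g g) (x + y) = ?a y - 2 * \<tau> * w y * ?b y + (\<tau> * w y)\<^sup>2"
      by (simp add: capp_bmeas_add capp_bmeas_diff capp_bmeas_scaleR
          capp_eq[of _ "bconst _"] capp_ker_const[OF P sets] \<Phi>_def)
    have "capp (\<Phi> ^ (m - 1) * B) (bconst c) (x + y) = 0" for c
      by (simp only: capp_times B0) (simp add: capp_def blinfun.bilinear_simps)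
    then have 2: "capp (\<Phi> ^ (m - 1) * B) g (x + y) = ?d y"
      by (simp add: g_def capp_bmeas_diff)
    show ?thesis
      using Suc[of g "x + y"] unfolding 1 2 by (simp add: power_mult_distrib mult_ac)
  qed
  note quad = this
  have "(LINT y|\<mu>. ?d y) = capp (\<Phi> * (\<Phi> ^ (m - 1) * B)) f x"
    unfolding \<Phi>_def capp_times[of "ker \<mu> (\<lambda>_. 1)"] capp_ker[OF ok1] by (simp add: capp_eq)
  \<comment> \<open>For \<open>m = 0\<close> the truncated exponent would break the identity, but
    there the term has the factor \<open>m\<close>.\<close>
  moreover have "\<Phi> * (\<Phi> ^ (m - 1) * B) = \<Phi> ^ m * B" if "m > 0"
    using that by (cases m) (simp_all add: mult.assoc)
  ultimately have dint: "2 * \<tau> * real m * (LINT y|\<mu>. ?d y) = 2 * \<tau> * real m * capp (\<Phi> ^ m * B) f x"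
    by (cases "m = 0") simp_all
  from quad have "0 \<le> (LINT y|\<mu>. ?a y - 2 * \<tau> * (?b y * w y) + \<tau>\<^sup>2 * (w y)\<^sup>2 - 2 * \<tau> * real m * ?d y
      + \<tau>\<^sup>2 * real m * I)"
    by (intro integral_nonneg_AE) auto
  also have "\<dots> = (LINT y|\<mu>. ?a y) - 2 * \<tau> * (LINT y|\<mu>. ?b y * w y) + \<tau>\<^sup>2 * (LINT y|\<mu>. (w y)\<^sup>2)
      - 2 * \<tau> * real m * (LINT y|\<mu>. ?d y) + \<tau>\<^sup>2 * real m * I"
    using kernel_integrable[OF ok1] kernel_integrable[OF okw] w2
    by (simp add: capp_eq prob_space)
  also have "(LINT y|\<mu>. ?a y) = capp (\<Phi> ^ Suc m) (bmult f f) x"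
    by (simp add: capp_times \<Phi>_def capp_ker[OF ok1] flip: capp_eq)
  also have "(LINT y|\<mu>. ?b y * w y) = capp (\<Phi> ^ m * B) f x"
    by (simp add: capp_times' B_def capp_ker[OF okw] flip: capp_eq)
  also note dint
  finally have "0 \<le> capp (\<Phi> ^ Suc m) (bmult f f) x - 2 * \<tau> * capp (\<Phi> ^ m * B) f x
      + \<tau>\<^sup>2 * (LINT y|\<mu>. (w y)\<^sup>2) - 2 * \<tau> * real m * capp (\<Phi> ^ m * B) f x + \<tau>\<^sup>2 * real m * I" .
  moreover have "\<tau>\<^sup>2 * (LINT y|\<mu>. (w y)\<^sup>2) \<le> \<tau>\<^sup>2 * I" using I by (intro mult_left_mono) auto
  ultimately show ?case by (simp add: algebra_simps)
qed

text \<open>A quadratic in \<open>\<tau>\<close> that is never negative bounds its linear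
  coefficient. The gain \<open>1 / sqrt m\<close> reflects that the variance of a sum of
  \<open>m\<close> independent centred scores grows like \<open>m\<close>, not like its
  square.\<close>

lemma norm_score_power:
  assumes P: "prob_space \<mu>" and sets: "sets \<mu> = sets borel"
    and w: "integrable \<mu> w" and w0: "(LINT y|\<mu>. w y) = 0"
    and w2: "integrable \<mu> (\<lambda>y. (w y)\<^sup>2)" and I: "(LINT y|\<mu>. (w y)\<^sup>2) \<le> I" "I > 0" and m: "m \<ge> 1"
  shows "norm (ker \<mu> (\<lambda>_. 1) ^ (m - 1) * ker \<mu> w) \<le> sqrt (I / real m)"
proof (rule norm_cop_le)
  fix f :: "'a bmeas" and x
  let ?\<Phi> = "ker \<mu> (\<lambda>_. 1)" and ?D = "capp (ker \<mu> (\<lambda>_. 1) ^ (m - 1) * ker \<mu> w) f x"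
  show "\<bar>?D\<bar> \<le> sqrt (I / real m) * norm f"
  proof (cases "norm f = 0")
    case True
    then show ?thesis using capp_abs_le[of "?\<Phi> ^ (m - 1) * ker \<mu> w" f x] by simp
  next
    case False
    let ?n = "norm f"
    have "\<bar>capp (?\<Phi> ^ m) (bmult f f) x\<bar> \<le> norm (?\<Phi> ^ m) * norm (bmult f f)" by (rule capp_abs_le)
    also have "\<dots> \<le> 1 * ?n\<^sup>2"
      using norm_power_le_one[OF norm_ker_prob_le[OF P sets]]
    proof (intro mult_mono bmeas_norm_le)
      show "\<bar>bapp (bmult f f) z\<bar> \<le> ?n\<^sup>2" for z
        using mult_mono[OF bapp_le_norm[of f z] bapp_le_norm[of f z]] by (simp add: power2_eq_square abs_mult)
    qed auto
    finally have le: "capp (?\<Phi> ^ m) (bmult f f) x \<le> ?n\<^sup>2" by simp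
    define r where "r = sqrt (real m * I)"
    have r: "r > 0" "r\<^sup>2 = real m * I" using I m by (auto simp: r_def)
    have *: "2 * \<tau> * real m * ?D \<le> ?n\<^sup>2 + \<tau>\<^sup>2 * r\<^sup>2" for \<tau>
      using score_quadratic[OF P sets w w0 w2 I(1), of m f x \<tau>] le by (simp add: r mult.assoc)
    \<comment> \<open>The optimal \<open>\<tau>\<close> is \<open>?n / r\<close> with the sign of
      \<open>?D\<close>, so both signs are inserted.\<close>
    have "2 * (?n / r) * (real m * \<bar>?D\<bar>) \<le> 2 * ?n\<^sup>2"
      using *[of "?n / r"] *[of "- (?n / r)"] r(1)
      by (cases "?D \<ge> 0") (auto simp: power_divide)
    then have "real m * \<bar>?D\<bar> \<le> r * ?n"
      using False r(1) by (simp add: field_simps power2_eq_square)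
    moreover have "r / real m = sqrt (I / real m)"
      using m by (simp add: r_def real_sqrt_mult real_sqrt_divide real_div_sqrt field_simps)
    ultimately show ?thesis using m by (simp add: field_simps)
  qed
qed (use I in auto)

section \<open>Words, moments and the Taylor expansion of an averaging operator\<close>

definition words :: "nat \<Rightarrow> 'n::finite list set" where
  "words k = {w. length w = k}"

lemma finite_words [simp]: "finite (words k)"
  using finite_lists_length_eq[of "UNIV :: 'a set" k] by (simp add: words_def)

lemma words_0 [simp]: "words 0 = {[]}"
  by (auto simp: words_def)

lemma sum_words_Suc: "(\<Sum>w\<in>words (Suc k). g w) = (\<Sum>i\<in>UNIV. \<Sum>w\<in>words k. g (i # w))"
proof -
  have "words (Suc k) = (\<lambda>(i, w). i # w) ` (UNIV \<times> words k)"
    by (auto simp: words_def length_Suc_conv)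
  moreover have "inj_on (\<lambda>(i, w). i # w) (UNIV \<times> words k)" by (auto simp: inj_on_def)
  ultimately show ?thesis
    by (subst (1) \<open>words (Suc k) = _\<close>, subst sum.reindex)
       (simp_all add: sum.cartesian_product case_prod_unfold)
qed

definition coord_prod :: "'n list \<Rightarrow> real^'n \<Rightarrow> real" where
  "coord_prod w y = prod_list (map (\<lambda>i. y $ i) w)"

definition op_prod :: "('n \<Rightarrow> 'n::finite cop) \<Rightarrow> 'n list \<Rightarrow> 'n cop" where
  "op_prod E w = prod_list (map E w)"

definition moment :: "(real^'n) measure \<Rightarrow> 'n list \<Rightarrow> real" where
  "moment \<mu> w = (LINT y|\<mu>. coord_prod w y)"

lemma coord_prod_simps [simp]: "coord_prod [] y = 1" "coord_prod (i # w) y = y $ i * coord_prod w y"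
  by (simp_all add: coord_prod_def)

lemma op_prod_simps [simp]: "op_prod E [] = 1" "op_prod E (i # w) = E i * op_prod E w"
  "op_prod E (w @ w') = op_prod E w * op_prod E w'"
  by (simp_all add: op_prod_def)

lemma coord_prod_measurable [measurable]: "coord_prod w \<in> borel_measurable borel"
  by (induct w) (simp_all add: coord_prod_def borel_measurable_continuous_onI continuous_intros)

lemma coord_prod_le: "\<bar>coord_prod w y\<bar> \<le> norm y ^ length w"
  by (induct w) (auto simp: abs_mult intro!: mult_mono component_le_norm_cart)

lemma pow_le_one_plus: "0 \<le> (a::real) \<Longrightarrow> j \<le> k \<Longrightarrow> a ^ j \<le> 1 + a ^ k"
proof (cases "a \<le> 1")
  case True
  assume "0 \<le> a"
  then show ?thesis using power_le_one[OF _ True, of j] zero_le_power[of a k] by linarith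
next
  case False
  assume "j \<le> k"
  then show ?thesis using False power_increasing[of j k a] by linarith
qed

lemma moment_integrable:
  assumes "prob_space \<mu>" "sets \<mu> = sets borel" "integrable \<mu> (\<lambda>y. norm y ^ q)" "length w \<le> q"
  shows "integrable \<mu> (coord_prod w)"
proof -
  interpret prob_space \<mu> by fact
  note [measurable_cong] = assms(2)
  show ?thesis
  proof (rule Bochner_Integration.integrable_bound[where f = "\<lambda>y. 1 + norm y ^ q"])
    show "AE y in \<mu>. norm (coord_prod w y) \<le> norm (1 + norm y ^ q)"
    proof (rule AE_I2)
      fix y
      have "\<bar>coord_prod w y\<bar> \<le> 1 + norm y ^ q"
        using order_trans[OF coord_prod_le pow_le_one_plus[OF _ assms(4)]] by auto
      then show "norm (coord_prod w y) \<le> norm (1 + norm y ^ q)" by simp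
    qed
  qed (use assms in auto)
qed

text \<open>Indexing by words instead of multi-indices repeats each mixed derivative as often as its
  letters can be ordered, so the Taylor coefficient is \<open>1 / fact k\<close> without a
  multinomial factor.\<close>

lemma op_power_words:
  fixes E :: "'n::finite \<Rightarrow> 'n cop"
  shows "(\<Sum>i\<in>UNIV. y $ i *\<^sub>R E i) ^ k = (\<Sum>w\<in>words k. coord_prod w y *\<^sub>R op_prod E w)"
proof (induct k)
  case (Suc k)
  show ?case
    unfolding power_Suc Suc sum_words_Suc
    by (simp add: sum_product) (simp add: mult.commute)
qed simp

text \<open>Maclaurin's formula on the segment from \<open>x\<close> to \<open>x + y\<close>. Each
  derivative consumes one of the \<open>q\<close> factors \<open>S\<close>, so \<open>S ^ q\<close>
  supports exactly \<open>q\<close> derivatives and the remainder has no undifferentiated factor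
  left.\<close>

lemma taylor_pointwise:
  assumes D: "deriv_fam S E" and q: "q > 0" and e: "(\<Sum>i\<in>UNIV. norm (E i)) \<le> e"
  shows "\<bar>capp (S ^ q) f (x + y)
     - (\<Sum>k<q. capp (S ^ (q - k) * (\<Sum>i\<in>UNIV. y $ i *\<^sub>R E i) ^ k) f x / fact k)\<bar>
    \<le> norm y ^ q * e ^ q / fact q * norm f"
proof -
  define Y where "Y = (\<Sum>i\<in>UNIV. y $ i *\<^sub>R E i)"
  define diff where "diff k t = capp (S ^ (q - k) * Y ^ k) f (x + t *\<^sub>R y)" for k t
  have "\<forall>m t. m < q \<and> 0 \<le> t \<and> t \<le> 1 \<longrightarrow> DERIV (diff m) t :> diff (Suc m) t"
  proof (intro allI impI, elim conjE)
    fix m and t :: real assume "m < q"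
    then obtain r where r: "q - m = Suc r" "q - Suc m = r" by (metis Suc_diff_Suc diff_Suc_Suc)
    have eq: "S ^ (q - m) * Y ^ m = (S ^ r * Y ^ m) * S" by (simp add: r mult_ac)
    have "(\<Sum>i\<in>UNIV. y $ i * capp (S ^ r * Y ^ m * E i) f (x + t *\<^sub>R y)) = diff (Suc m) t"
    proof -
      have "(\<Sum>i\<in>UNIV. y $ i * capp (S ^ r * Y ^ m * E i) f (x + t *\<^sub>R y))
          = capp (S ^ r * Y ^ m * (\<Sum>i\<in>UNIV. y $ i *\<^sub>R E i)) f (x + t *\<^sub>R y)"
        by (simp add: sum_distrib_left)
      then show ?thesis by (simp add: Y_def[symmetric] mult_ac diff_def r(2))
    qed
    then show "DERIV (diff m) t :> diff (Suc m) t"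
      using deriv_fam_at[OF deriv_fam_mult[OF D, of "S ^ r * Y ^ m"], of f x y t]
      unfolding diff_def[of m] eq by simp
  qed
  from Maclaurin[OF zero_less_one q _ this, of "diff 0"] obtain t where
    t: "diff 0 1 = (\<Sum>m<q. diff m 0 / fact m) + diff q t / fact q" by auto
  have nY: "norm Y \<le> norm y * e"
  proof -
    have "norm Y \<le> (\<Sum>i\<in>UNIV. norm (y $ i *\<^sub>R E i))" unfolding Y_def by (rule norm_sum)
    also have "\<dots> \<le> (\<Sum>i\<in>UNIV. norm y * norm (E i))"
      by (intro sum_mono) (auto intro!: mult_right_mono component_le_norm_cart)
    also have "\<dots> \<le> norm y * e" using e by (simp add: mult_left_mono flip: sum_distrib_left)
    finally show ?thesis .
  qed
  have "\<bar>diff q t\<bar> \<le> norm (Y ^ q) * norm f"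
    unfolding diff_def by (simp add: capp_abs_le)
  also have "\<dots> \<le> (norm y * e) ^ q * norm f"
    by (intro mult_right_mono order_trans[OF norm_power_ineq] power_mono nY) auto
  finally have "\<bar>diff q t / fact q\<bar> \<le> norm y ^ q * e ^ q / fact q * norm f"
    by (simp add: power_mult_distrib divide_right_mono)
  then show ?thesis
    using t unfolding diff_def by (simp add: Y_def)
qed

text \<open>Averaging the pointwise expansion over \<open>\<mu>\<close> turns the monomials in
  \<open>y\<close> into moments and the remainder into the absolute moment of order
  \<open>q\<close>.\<close>

lemma taylor_ker:
  assumes D: "deriv_fam S E" and q: "q > 0" and e: "(\<Sum>i\<in>UNIV. norm (E i)) \<le> e"
    and P: "prob_space \<mu>" and sets: "sets \<mu> = sets borel" and int: "integrable \<mu> (\<lambda>y. norm y ^ q)"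
  shows "norm (ker \<mu> (\<lambda>_. 1) * S ^ q
     - (\<Sum>k<q. \<Sum>w\<in>words k. (moment \<mu> w / fact k) *\<^sub>R (op_prod E w * S ^ (q - k))))
    \<le> (LINT y|\<mu>. norm y ^ q) * (e ^ q / fact q)"
proof (rule norm_cop_le)
  interpret prob_space \<mu> by (rule P)
  note [measurable_cong] = sets
  have e0: "0 \<le> e" using order_trans[OF sum_nonneg e] by auto
  fix f :: "'a bmeas" and x
  have ok1: "kernel_ok \<mu> (\<lambda>_. 1)" by (rule kernel_ok_prob[OF P sets])
  let ?T = "\<lambda>y. \<Sum>k<q. \<Sum>w\<in>words k. coord_prod w y * (capp (op_prod E w * S ^ (q - k)) f x / fact k)"
  have eq: "capp (S ^ (q - k) * (\<Sum>i\<in>UNIV. y $ i *\<^sub>R E i) ^ k) f x / fact k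
     = (\<Sum>w\<in>words k. coord_prod w y * (capp (op_prod E w * S ^ (q - k)) f x / fact k))" for y k
    by (simp add: op_power_words sum_distrib_left sum_divide_distrib mult.commute[of _ "S ^ _"])
  have intT: "integrable \<mu> (\<lambda>y. coord_prod w y * c)" if "k < q" "w \<in> words k" for w c k
    using moment_integrable[OF P sets int, of w] that by (auto simp: words_def)
  then have iT: "integrable \<mu> ?T" by (intro Bochner_Integration.integrable_sum) auto
  have iS: "integrable \<mu> (\<lambda>y. capp (S ^ q) f (x + y))"
    using kernel_integrable[OF ok1] by (simp add: capp_eq)
  have "capp (ker \<mu> (\<lambda>_. 1) * S ^ q
     - (\<Sum>k<q. \<Sum>w\<in>words k. (moment \<mu> w / fact k) *\<^sub>R (op_prod E w * S ^ (q - k)))) f x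
    = (LINT y|\<mu>. capp (S ^ q) f (x + y)) - (LINT y|\<mu>. ?T y)"
  proof -
    have "capp (ker \<mu> (\<lambda>_. 1) * S ^ q) f x = (LINT y|\<mu>. capp (S ^ q) f (x + y))"
      by (simp only: capp_times capp_ker[OF ok1] capp_eq[symmetric] mult_1_right)
    moreover have "(LINT y|\<mu>. ?T y) = (\<Sum>k<q. \<Sum>w\<in>words k.
        moment \<mu> w * (capp (op_prod E w * S ^ (q - k)) f x / fact k))"
    proof -
      have "(LINT y|\<mu>. ?T y) = (\<Sum>k<q. (LINT y|\<mu>. (\<Sum>w\<in>words k.
          coord_prod w y * (capp (op_prod E w * S ^ (q - k)) f x / fact k))))"
        using intT by (intro Bochner_Integration.integral_sum Bochner_Integration.integrable_sum) auto
      also have "\<dots> = (\<Sum>k<q. \<Sum>w\<in>words k. (LINT y|\<mu>.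
          coord_prod w y * (capp (op_prod E w * S ^ (q - k)) f x / fact k)))"
        by (rule sum.cong[OF refl], rule Bochner_Integration.integral_sum) (rule intT, auto)
      finally show ?thesis by (simp add: moment_def)
    qed
    ultimately show ?thesis by simp
  qed
  also have "\<dots> = (LINT y|\<mu>. capp (S ^ q) f (x + y) - ?T y)"
    using iS iT by simp
  finally have "\<bar>capp (ker \<mu> (\<lambda>_. 1) * S ^ q
     - (\<Sum>k<q. \<Sum>w\<in>words k. (moment \<mu> w / fact k) *\<^sub>R (op_prod E w * S ^ (q - k)))) f x\<bar>
     \<le> (LINT y|\<mu>. \<bar>capp (S ^ q) f (x + y) - ?T y\<bar>)" by simp
  also have "\<dots> \<le> (LINT y|\<mu>. norm y ^ q * (e ^ q / fact q * norm f))"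
  proof (intro integral_mono)
    show "\<bar>capp (S ^ q) f (x + y) - ?T y\<bar> \<le> norm y ^ q * (e ^ q / fact q * norm f)" for y
      using taylor_pointwise[OF D q e, of f x y] unfolding eq by simp
  qed (use iS iT int in auto)
  finally show "\<bar>capp (ker \<mu> (\<lambda>_. 1) * S ^ q
     - (\<Sum>k<q. \<Sum>w\<in>words k. (moment \<mu> w / fact k) *\<^sub>R (op_prod E w * S ^ (q - k)))) f x\<bar>
     \<le> (LINT y|\<mu>. norm y ^ q) * (e ^ q / fact q) * norm f" by simp
  show "0 \<le> (LINT y|\<mu>. norm y ^ q) * (e ^ q / fact q)" using e0 by simp
qed

definition finite_moment :: "nat \<Rightarrow> (real^'n) measure \<Rightarrow> bool" where
  "finite_moment q \<mu> \<longleftrightarrow> prob_space \<mu> \<and> sets \<mu> = sets borel \<and> integrable \<mu> (\<lambda>y. norm y ^ q)"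

abbreviation pker :: "(real^'n::finite) measure \<Rightarrow> 'n cop" where
  "pker \<mu> \<equiv> ker \<mu> (\<lambda>_. 1)"

lemma finite_moment_mono:
  assumes "finite_moment q \<mu>" "k \<le> q"
  shows "finite_moment k \<mu>"
proof -
  interpret prob_space \<mu> using assms by (simp add: finite_moment_def)
  have [measurable_cong]: "sets \<mu> = sets borel" using assms by (simp add: finite_moment_def)
  have "integrable \<mu> (\<lambda>y. norm y ^ k)"
    by (rule Bochner_Integration.integrable_bound[where f = "\<lambda>y. 1 + norm y ^ q"])
       (use assms pow_le_one_plus[OF norm_ge_zero assms(2)] in \<open>auto simp: finite_moment_def\<close>)
  then show ?thesis using assms by (simp add: finite_moment_def)
qed

lemma finite_moment_le:
  assumes "finite_moment q \<mu>" "k \<le> q"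
  shows "(LINT y|\<mu>. norm y ^ k) \<le> 1 + (LINT y|\<mu>. norm y ^ q)"
proof -
  interpret prob_space \<mu> using assms by (simp add: finite_moment_def)
  have "(LINT y|\<mu>. norm y ^ k) \<le> (LINT y|\<mu>. 1 + norm y ^ q)"
    using finite_moment_mono[OF assms] assms pow_le_one_plus[OF norm_ge_zero assms(2)]
    by (intro integral_mono) (auto simp: finite_moment_def)
  then show ?thesis using assms by (simp add: finite_moment_def prob_space)
qed

lemma norm_pker_le: "finite_moment q \<mu> \<Longrightarrow> norm (pker \<mu>) \<le> 1"
  by (rule norm_ker_prob_le) (auto simp: finite_moment_def)

lemma moment_abs_le:
  assumes "finite_moment q \<mu>" "length w \<le> q"
  shows "\<bar>moment \<mu> w\<bar> \<le> (LINT y|\<mu>. norm y ^ length w)"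
proof -
  have "\<bar>moment \<mu> w\<bar> \<le> (LINT y|\<mu>. \<bar>coord_prod w y\<bar>)"
    unfolding moment_def by simp
  also have "\<dots> \<le> (LINT y|\<mu>. norm y ^ length w)"
    using assms finite_moment_mono[OF assms] moment_integrable[of \<mu> q w]
    by (intro integral_mono coord_prod_le) (auto simp: finite_moment_def)
  finally show ?thesis .
qed

text \<open>Moments below order \<open>a\<close> cancel, so the difference of two laws acts like a
  differential operator of order at least \<open>a\<close>. It is used with \<open>a = 3\<close> for
  the normalized law against the Gaussian and with \<open>a = 2\<close> for the point mass at zero
  against the Gaussian.\<close>

lemma diff_taylor:
  fixes \<mu> \<nu> :: "(real^'n::finite) measure"
  assumes D: "deriv_fam S E" and e: "(\<Sum>i\<in>UNIV. norm (E i)) \<le> e"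
    and \<mu>: "finite_moment q \<mu>" and \<nu>: "finite_moment q \<nu>" and "0 < q" "a \<le> q"
    and eq: "\<And>w. length w < a \<Longrightarrow> moment \<mu> w = moment \<nu> w"
  shows "norm ((pker \<mu> - pker \<nu>) * S ^ q
      - (\<Sum>k\<in>{a..<q}. \<Sum>w\<in>words k. ((moment \<mu> w - moment \<nu> w) / fact k) *\<^sub>R (op_prod E w * S ^ (q - k))))
    \<le> ((LINT y|\<mu>. norm y ^ q) + (LINT y|\<nu>. norm y ^ q)) * e ^ q"
proof -
  let ?T = "\<lambda>\<mu>. \<Sum>k<q. \<Sum>w\<in>words k. (moment \<mu> w / fact k) *\<^sub>R (op_prod E w * S ^ (q - k))"
  have e0: "0 \<le> e" using order_trans[OF sum_nonneg e] by auto
  have "(\<Sum>k\<in>{a..<q}. \<Sum>w\<in>words k. ((moment \<mu> w - moment \<nu> w) / fact k) *\<^sub>R (op_prod E w * S ^ (q - k)))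
      = (\<Sum>k<q. \<Sum>w\<in>words k. ((moment \<mu> w - moment \<nu> w) / fact k) *\<^sub>R (op_prod E w * S ^ (q - k)))"
    by (rule sum.mono_neutral_left) (auto simp: words_def eq not_le intro!: sum.neutral)
  also have "\<dots> = ?T \<mu> - ?T \<nu>"
    by (simp add: diff_divide_distrib scaleR_left_diff_distrib sum_subtractf)
  finally have T: "(\<Sum>k\<in>{a..<q}. \<Sum>w\<in>words k. ((moment \<mu> w - moment \<nu> w) / fact k) *\<^sub>R (op_prod E w * S ^ (q - k)))
      = ?T \<mu> - ?T \<nu>" .
  have "norm ((pker \<mu> - pker \<nu>) * S ^ q
      - (\<Sum>k\<in>{a..<q}. \<Sum>w\<in>words k. ((moment \<mu> w - moment \<nu> w) / fact k) *\<^sub>R (op_prod E w * S ^ (q - k))))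
    = norm ((pker \<mu> * S ^ q - ?T \<mu>) - (pker \<nu> * S ^ q - ?T \<nu>))"
  proof -
    have "(A - B) * S ^ q - (C - D) = (A * S ^ q - C) - (B * S ^ q - D)" for A B C D :: "'n cop"
      by (simp add: algebra_simps)
    then show ?thesis by (simp only: T)
  qed
  also have "\<dots> \<le> norm (pker \<mu> * S ^ q - ?T \<mu>) + norm (pker \<nu> * S ^ q - ?T \<nu>)"
    by (rule norm_triangle_ineq4)
  also have "\<dots> \<le> (LINT y|\<mu>. norm y ^ q) * (e ^ q / fact q) + (LINT y|\<nu>. norm y ^ q) * (e ^ q / fact q)"
    using \<mu> \<nu> by (intro add_mono taylor_ker[OF D \<open>0 < q\<close> e]) (auto simp: finite_moment_def)
  also have "\<dots> \<le> (LINT y|\<mu>. norm y ^ q) * e ^ q + (LINT y|\<nu>. norm y ^ q) * e ^ q"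
  proof -
    have "e ^ q / fact q \<le> e ^ q / 1" using e0 fact_ge_1[of q] by (intro divide_left_mono) auto
    then show ?thesis by (intro add_mono mult_left_mono) auto
  qed
  finally show ?thesis by (simp add: distrib_right)
qed

lemma diff_taylor_small:
  assumes D: "deriv_fam S E" and e: "(\<Sum>i\<in>UNIV. norm (E i)) \<le> e"
    and \<mu>: "finite_moment q \<mu>" and \<nu>: "finite_moment q \<nu>" and "0 < q"
    and eq: "\<And>w. length w < q \<Longrightarrow> moment \<mu> w = moment \<nu> w"
  shows "norm ((pker \<mu> - pker \<nu>) * S ^ q)
    \<le> ((LINT y|\<mu>. norm y ^ q) + (LINT y|\<nu>. norm y ^ q)) * e ^ q"
  using diff_taylor[OF D e \<mu> \<nu> \<open>0 < q\<close> order_refl eq] by simp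

text \<open>\<open>w\<close> is, up to sign, the logarithmic derivative of \<open>\<mu>\<close>, and
  \<open>I\<close> bounds the diagonal of the Fisher information matrix. Integration by parts
  against bounded functions is the defining property, so no density is mentioned.\<close>

definition score_kernel :: "(real^'n::finite) measure \<Rightarrow> ('n \<Rightarrow> real^'n \<Rightarrow> real) \<Rightarrow> real \<Rightarrow> bool" where
  "score_kernel \<mu> w I \<longleftrightarrow> prob_space \<mu> \<and> sets \<mu> = sets borel \<and>
     (\<forall>i. integrable \<mu> (w i) \<and> integrable \<mu> (\<lambda>y. (w i y)\<^sup>2) \<and> (LINT y|\<mu>. (w i y)\<^sup>2) \<le> I) \<and>
     deriv_fam (pker \<mu>) (\<lambda>i. ker \<mu> (w i))"

text \<open>The average of a constant function does not depend on \<open>x\<close>; differentiating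
  it along an axis isolates the mean of \<open>w i\<close>.\<close>

lemma score_kernel_mean:
  assumes "score_kernel \<mu> w I"
  shows "(LINT y|\<mu>. w i y) = 0"
proof -
  have P: "prob_space \<mu>" "sets \<mu> = sets borel" and w: "\<And>i. integrable \<mu> (w i)"
    and D: "deriv_fam (pker \<mu>) (\<lambda>i. ker \<mu> (w i))"
    using assms by (auto simp: score_kernel_def)
  have ok: "kernel_ok \<mu> (w i)" for i using P w by (simp add: kernel_ok_def)
  have c: "capp (pker \<mu>) (bconst 1) x = 1" for x
    using capp_ker_const[OF P, of 1 1] by (simp add: capp_eq)
  have "((\<lambda>t. capp (pker \<mu>) (bconst 1) (0 + t *\<^sub>R axis i 1)) has_real_derivative
     (\<Sum>j\<in>UNIV. axis i 1 $ j * capp (ker \<mu> (w j)) (bconst 1) 0)) (at 0)"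
    using D unfolding deriv_fam_def by blast
  then have "(\<Sum>j\<in>UNIV. axis i 1 $ j * capp (ker \<mu> (w j)) (bconst 1) 0) = 0"
    unfolding c by (rule DERIV_unique) simp
  then show ?thesis
    by (simp add: axis_def if_distrib[of "\<lambda>z. z * _"] sum.delta capp_ker[OF ok] cong: if_cong)
qed

text \<open>A block of \<open>b\<close> factors, one of them differentiated, is the pair
  \<open>S\<close>, \<open>E\<close> for the Taylor expansion, with \<open>e\<close> of order
  \<open>1 / sqrt b\<close>.\<close>

lemma score_kernel_power:
  fixes \<mu> :: "(real^'n::finite) measure"
  assumes sk: "score_kernel \<mu> w I" and I: "I > 0" and b: "b \<ge> 1"
  shows "deriv_fam (pker \<mu> ^ b) (\<lambda>i. pker \<mu> ^ (b - 1) * ker \<mu> (w i))"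
    and "(\<Sum>i\<in>UNIV. norm (pker \<mu> ^ (b - 1) * ker \<mu> (w i))) \<le> real CARD('n) * sqrt (I / real b)"
proof -
  have "pker \<mu> ^ b = pker \<mu> ^ (b - 1) * pker \<mu>" using b by (cases b) (simp_all add: mult.commute)
  then show "deriv_fam (pker \<mu> ^ b) (\<lambda>i. pker \<mu> ^ (b - 1) * ker \<mu> (w i))"
    using sk by (auto intro!: deriv_fam_mult simp: score_kernel_def)
  have "norm (pker \<mu> ^ (b - 1) * ker \<mu> (w i)) \<le> sqrt (I / real b)" for i
    using sk by (intro norm_score_power score_kernel_mean[OF sk] I b) (auto simp: score_kernel_def)
  then show "(\<Sum>i\<in>UNIV. norm (pker \<mu> ^ (b - 1) * ker \<mu> (w i))) \<le> real CARD('n) * sqrt (I / real b)"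
    using sum_bounded_above[of UNIV "\<lambda>i. norm (pker \<mu> ^ (b - 1) * ker \<mu> (w i))"] by simp
qed

section \<open>Smoothing by powers of a smooth law and of a mixture\<close>

definition rsq :: "nat \<Rightarrow> real" where
  "rsq k = 1 / sqrt (real k + 1)"

lemma rsq_pos [simp]: "0 < rsq k"
  by (simp add: rsq_def)

lemma rsq_square: "rsq k ^ 2 = 1 / (real k + 1)"
  by (simp add: rsq_def power_divide)

lemma rsq_even: "rsq k ^ (2 * a) = 1 / (real k + 1) ^ a"
  unfolding power_mult rsq_square power_divide by simp

text \<open>The \<open>k\<close> factors are cut into \<open>3 * t\<close> blocks, three for each of
  the \<open>t\<close> differences, and every block pays for one derivative. For
  \<open>k < 3 * t\<close> there is no block; then \<open>rsq k\<close> is bounded below and absorbs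
  the trivial bound \<open>2 ^ t\<close>, which explains the second summand of the constant.\<close>

lemma norm_diff_power_smooth:
  fixes \<mu> \<nu> \<phi> :: "(real^'n::finite) measure"
  assumes sk: "score_kernel \<phi> w I" and I: "I > 0"
    and \<mu>: "finite_moment 3 \<mu>" and \<nu>: "finite_moment 3 \<nu>"
    and eq: "\<And>w. length w < 3 \<Longrightarrow> moment \<mu> w = moment \<nu> w"
    and T: "(LINT y|\<mu>. norm y ^ 3) + (LINT y|\<nu>. norm y ^ 3) \<le> T" "T \<ge> 1" and t: "t > 0"
  shows "norm ((pker \<mu> - pker \<nu>) ^ t * pker \<phi> ^ k)
    \<le> ((real CARD('n) * sqrt (6 * t * I)) ^ (3 * t) + 2 ^ t * sqrt (3 * t) ^ (3 * t)) * T ^ t * rsq k ^ (3 * t)"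
    (is "_ \<le> (?A + ?B) * _ * _")
proof -
  have n\<phi>: "norm (pker \<phi>) \<le> 1" using sk by (intro norm_ker_prob_le) (auto simp: score_kernel_def)
  have AB: "?A \<ge> 0" "?B \<ge> 0" using I by auto
  show ?thesis
  proof (cases "k \<ge> 3 * t")
    case True
    define b where "b = k div (3 * t)"
    have b: "b \<ge> 1" using True t by (simp add: b_def div_greater_zero_iff Suc_le_eq)
    have "k < (b + 1) * (3 * t)"
      using t dividend_less_div_times[of "3 * t" k] by (simp add: b_def algebra_simps)
    also have "\<dots> \<le> (2 * b) * (3 * t)" using b by (intro mult_right_mono) auto
    \<comment> \<open>Rounding down in \<open>b\<close> loses at most a factor two, whence 6 in
      place of 3.\<close>
    finally have "real k + 1 \<le> 6 * t * b" by (simp add: mult_ac flip: of_nat_mult of_nat_Suc)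
    then have "I / b \<le> 6 * t * I / (real k + 1)"
      using I b mult_left_mono[of "real k + 1" "6 * t * b" I] by (simp add: field_simps)
    then have sq: "sqrt (I / b) \<le> sqrt (6 * t * I) * rsq k"
      by (simp add: rsq_def flip: real_sqrt_divide real_sqrt_mult)
    define e where "e = real CARD('n) * sqrt (I / b)"
    have e: "0 \<le> e" "e \<le> real CARD('n) * sqrt (6 * t * I) * rsq k"
      using sq I by (auto simp: e_def mult.assoc)
    note sp = score_kernel_power[OF sk I b]
    have "norm ((pker \<mu> - pker \<nu>) * (pker \<phi> ^ b) ^ 3)
       \<le> ((LINT y|\<mu>. norm y ^ 3) + (LINT y|\<nu>. norm y ^ 3)) * e ^ 3"
      by (rule diff_taylor_small[OF sp(1) sp(2)[folded e_def] \<mu> \<nu> _ eq]) auto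
    also have "\<dots> \<le> T * e ^ 3" using T e by (intro mult_right_mono) auto
    finally have 1: "norm ((pker \<mu> - pker \<nu>) * (pker \<phi> ^ b) ^ 3) \<le> T * e ^ 3" .
    have "(pker \<mu> - pker \<nu>) ^ t * pker \<phi> ^ k
       = ((pker \<mu> - pker \<nu>) * (pker \<phi> ^ b) ^ 3) ^ t * pker \<phi> ^ (k - 3 * t * b)"
    proof -
      have "k = 3 * t * b + (k - 3 * t * b)" by (simp add: b_def)
      then have "pker \<phi> ^ k = pker \<phi> ^ (3 * t * b) * pker \<phi> ^ (k - 3 * t * b)"
        by (metis power_add)
      then show ?thesis by (simp add: power_mult_distrib mult_ac flip: power_mult)
    qed
    also have "norm \<dots> \<le> (T * e ^ 3) ^ t * 1"
      by (intro order_trans[OF norm_mult_ineq] mult_mono norm_power_le_one n\<phi>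
        order_trans[OF norm_power_ineq] power_mono 1) (use T e in auto)
    also have "\<dots> = T ^ t * e ^ (3 * t)" by (simp add: power_mult_distrib power_mult)
    also have "\<dots> \<le> T ^ t * (real CARD('n) * sqrt (6 * t * I) * rsq k) ^ (3 * t)"
      using T e by (intro mult_left_mono power_mono) auto
    also have "\<dots> = ?A * T ^ t * rsq k ^ (3 * t)" by (simp add: power_mult_distrib)
    also have "\<dots> \<le> (?A + ?B) * T ^ t * rsq k ^ (3 * t)"
      using AB T by (intro mult_right_mono) (auto simp: less_imp_le)
    finally show ?thesis .
  next
    case False
    then have "1 \<le> sqrt (3 * t) * rsq k"
      by (simp add: rsq_def field_simps flip: of_nat_Suc)
    then have one: "1 \<le> (sqrt (3 * t) * rsq k) ^ (3 * t)" by (rule one_le_power)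
    have "norm (pker \<mu> - pker \<nu>) \<le> 2"
      using norm_triangle_ineq4[of "pker \<mu>" "pker \<nu>"] norm_pker_le[OF \<mu>] norm_pker_le[OF \<nu>] by linarith
    then have "norm ((pker \<mu> - pker \<nu>) ^ t * pker \<phi> ^ k) \<le> 2 ^ t * 1"
      by (intro order_trans[OF norm_mult_ineq] mult_mono norm_power_le_one n\<phi>
        order_trans[OF norm_power_ineq] power_mono) auto
    also have "\<dots> \<le> 2 ^ t * T ^ t * (sqrt (3 * t) * rsq k) ^ (3 * t)"
      using mult_mono[OF one_le_power[OF T(2), of t] one] T(2) by simp
    also have "\<dots> = ?B * T ^ t * rsq k ^ (3 * t)" by (simp add: power_mult_distrib)
    also have "\<dots> \<le> (?A + ?B) * T ^ t * rsq k ^ (3 * t)"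
      using AB T by (intro mult_right_mono) (auto simp: less_imp_le)
    finally show ?thesis .
  qed
qed

text \<open>Either \<open>x\<close> is below \<open>y\<close>, or multiplication by
  \<open>x / y\<close> only enlarges it. This trades a power of \<open>rsq\<close> for twice that
  power, an integer power of \<open>1 / (k + 1)\<close> whose binomial mean is accessible.\<close>

lemma rsq_trick: "0 < y \<Longrightarrow> 0 < (x::real) \<Longrightarrow> x \<le> y + x\<^sup>2 / y"
proof (cases "x \<le> y")
  case False
  assume "0 < y" "0 < x"
  then have "x * y \<le> x * x" using False by (intro mult_left_mono) auto
  then have "x \<le> x\<^sup>2 / y" using \<open>0 < y\<close> by (simp add: field_simps power2_eq_square)
  then show ?thesis using \<open>0 < y\<close> by simp
qed (auto intro: add_increasing2)

lemma rsq_even_power_le: "rsq k ^ (2 * a) \<le> fact a * (fact k / fact (k + a))"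
proof -
  have "fact (k + a) \<le> fact k * fact a * (real k + 1) ^ a"
  proof (induct a)
    case (Suc a)
    have "fact (k + Suc a) = (real k + 1 + real a) * fact (k + a)" by simp
    also have "\<dots> \<le> ((real a + 1) * (real k + 1)) * (fact k * fact a * (real k + 1) ^ a)"
      using Suc by (intro mult_mono) (auto simp: algebra_simps)
    also have "\<dots> = fact k * fact (Suc a) * (real k + 1) ^ Suc a" by simp
    finally show ?case .
  qed simp
  then show ?thesis
    unfolding rsq_even by (simp add: field_simps)
qed

text \<open>The product of \<open>m choose i\<close> and \<open>fact i / fact (i + a)\<close> is a
  fixed multiple of \<open>(m + a) choose (i + a)\<close>. The resulting weights are part of a
  binomial law with \<open>m + a\<close> trials, so their sum is at most one.\<close>

lemma binomial_neg_moment: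
  assumes c: "0 < c" "c \<le> (1::real)"
  shows "(\<Sum>i\<le>m. real (m choose i) * c ^ i * (1 - c) ^ (m - i) * rsq i ^ a) \<le> (1 + fact a / c ^ a) * rsq m ^ a"
proof -
  let ?b = "\<lambda>i. real (m choose i) * c ^ i * (1 - c) ^ (m - i)"
  have b0: "?b i \<ge> 0" for i using c by simp
  have sum1: "(\<Sum>i\<le>m. ?b i) = 1"
    using binomial_ring[of c "1 - c" m] by simp
  have fact_m: "fact m / fact (m + a) \<le> rsq m ^ (2 * a)"
  proof -
    have "fact m * (real m + 1) ^ a \<le> fact (m + a)"
    proof (induct a)
      case (Suc a)
      have "fact m * (real m + 1) ^ Suc a = (real m + 1) * (fact m * (real m + 1) ^ a)" by simp
      also have "\<dots> \<le> (real m + 1 + real a) * fact (m + a)" using Suc by (intro mult_mono) auto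
      also have "\<dots> = fact (m + Suc a)" by simp
      finally show ?case .
    qed simp
    then show ?thesis unfolding rsq_even by (simp add: field_simps)
  qed
  have "(\<Sum>i\<le>m. ?b i * (fact i / fact (i + a)))
      = (\<Sum>i\<le>m. (fact m / fact (m + a) / c ^ a) * (real ((m + a) choose (i + a)) * c ^ (i + a) * (1 - c) ^ (m + a - (i + a))))"
  proof (rule sum.cong[OF refl])
    fix i assume "i \<in> {..m}"
    then have "real (m choose i) = fact m / (fact i * fact (m - i))"
      "real ((m + a) choose (i + a)) = fact (m + a) / (fact (i + a) * fact (m - i))"
      using binomial_fact[of i m, where 'a = real] binomial_fact[of "i + a" "m + a", where 'a = real] by auto
    then show "?b i * (fact i / fact (i + a))
       = (fact m / fact (m + a) / c ^ a) * (real ((m + a) choose (i + a)) * c ^ (i + a) * (1 - c) ^ (m + a - (i + a)))"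
      using c by (simp add: power_add) (simp add: mult_ac)
  qed
  also have "\<dots> = (fact m / fact (m + a) / c ^ a) * (\<Sum>i\<in>(\<lambda>i. i + a) ` {..m}. real ((m + a) choose i) * c ^ i * (1 - c) ^ (m + a - i))"
    by (subst sum.reindex) (auto simp: sum_distrib_left)
  also have "\<dots> \<le> (fact m / fact (m + a) / c ^ a) * (\<Sum>i\<le>m + a. real ((m + a) choose i) * c ^ i * (1 - c) ^ (m + a - i))"
    using c by (intro mult_left_mono sum_mono2) auto
  also have "(\<Sum>i\<le>m + a. real ((m + a) choose i) * c ^ i * (1 - c) ^ (m + a - i)) = 1"
    using binomial_ring[of c "1 - c" "m + a"] by simp
  finally have F: "(\<Sum>i\<le>m. ?b i * (fact i / fact (i + a))) \<le> rsq m ^ (2 * a) / c ^ a"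
    using divide_right_mono[OF fact_m, of "c ^ a"] c by simp
  have "(\<Sum>i\<le>m. ?b i * rsq i ^ a) \<le> (\<Sum>i\<le>m. ?b i * (rsq m ^ a + fact a * (fact i / fact (i + a)) / rsq m ^ a))"
  proof (intro sum_mono mult_left_mono b0)
    fix i
    have "rsq i ^ a \<le> rsq m ^ a + (rsq i ^ a)\<^sup>2 / rsq m ^ a"
      by (rule rsq_trick) auto
    also have "(rsq i ^ a)\<^sup>2 = rsq i ^ (2 * a)" by (simp add: mult.commute flip: power_mult)
    also have "rsq m ^ a + rsq i ^ (2 * a) / rsq m ^ a \<le> rsq m ^ a + fact a * (fact i / fact (i + a)) / rsq m ^ a"
      by (intro add_left_mono divide_right_mono rsq_even_power_le) (simp add: less_imp_le)
    finally show "rsq i ^ a \<le> rsq m ^ a + fact a * (fact i / fact (i + a)) / rsq m ^ a" .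
  qed
  also have "\<dots> = rsq m ^ a + fact a / rsq m ^ a * (\<Sum>i\<le>m. ?b i * (fact i / fact (i + a)))"
  proof -
    have "(\<Sum>i\<le>m. ?b i * rsq m ^ a) = rsq m ^ a" by (simp add: sum1 flip: sum_distrib_right)
    then show ?thesis by (simp only: distrib_left sum.distrib) (simp add: sum_distrib_left mult_ac)
  qed
  also have "\<dots> \<le> rsq m ^ a + fact a / rsq m ^ a * (rsq m ^ (2 * a) / c ^ a)"
    by (intro add_left_mono mult_left_mono F) (simp add: less_imp_le)
  also have "\<dots> = (1 + fact a / c ^ a) * rsq m ^ a"
  proof -
    have "rsq m ^ (2 * a) = rsq m ^ a * rsq m ^ a" by (simp add: mult_2 power_add)
    moreover have "rsq m ^ a \<noteq> 0" using rsq_pos[of m] by (intro power_not_zero) linarith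
    ultimately show ?thesis by (simp add: distrib_right)
  qed
  finally show ?thesis .
qed

lemma of_nat_mult_scaleR: "of_nat m * (x :: 'a::real_algebra_1) = real m *\<^sub>R x"
  by (metis of_real_of_nat_eq scaleR_conv_of_real)

text \<open>A convex combination that charges \<open>\<Phi>\<close> with weight \<open>c\<close> contains, in its \<open>m\<close>-th power,
  a binomially distributed number of factors \<open>\<Phi>\<close>.\<close>

lemma norm_mixture_power:
  fixes Z P \<Phi> :: "'n::finite cop"
  assumes c: "0 < c" "c \<le> 1" and N: "norm (P - c *\<^sub>R \<Phi>) \<le> 1 - c"
    and Z: "\<And>k. norm (Z * \<Phi> ^ k) \<le> g * rsq k ^ a" and g: "0 \<le> g"
  shows "norm (Z * P ^ m) \<le> g * (1 + fact a / c ^ a) * rsq m ^ a"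
proof -
  let ?N = "P - c *\<^sub>R \<Phi>"
  have "P ^ m = (c *\<^sub>R \<Phi> + ?N) ^ m" by simp
  also have "\<dots> = (\<Sum>k\<le>m. of_nat (m choose k) * (c *\<^sub>R \<Phi>) ^ k * ?N ^ (m - k))"
    by (rule binomial_ring)
  also have "\<dots> = (\<Sum>k\<le>m. (real (m choose k) * c ^ k) *\<^sub>R (\<Phi> ^ k * ?N ^ (m - k)))"
    by (simp add: scaleR_power of_nat_mult_scaleR[where 'a = "'n cop"]) (simp add: mult.commute)
  finally have "Z * P ^ m = (\<Sum>k\<le>m. (real (m choose k) * c ^ k) *\<^sub>R (Z * \<Phi> ^ k * ?N ^ (m - k)))"
    by (simp add: sum_distrib_left mult.assoc)
  also have "norm \<dots> \<le> (\<Sum>k\<le>m. norm ((real (m choose k) * c ^ k) *\<^sub>R (Z * \<Phi> ^ k * ?N ^ (m - k))))"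
    by (rule norm_sum)
  also have "\<dots> \<le> (\<Sum>k\<le>m. (real (m choose k) * c ^ k) * ((g * rsq k ^ a) * (1 - c) ^ (m - k)))"
  proof (rule sum_mono)
    fix k
    have "norm (Z * \<Phi> ^ k * ?N ^ (m - k)) \<le> (g * rsq k ^ a) * (1 - c) ^ (m - k)"
      by (intro order_trans[OF norm_mult_ineq] mult_mono Z order_trans[OF norm_power_ineq] power_mono N)
         (use g in \<open>auto simp: less_imp_le\<close>)
    then show "norm ((real (m choose k) * c ^ k) *\<^sub>R (Z * \<Phi> ^ k * ?N ^ (m - k)))
       \<le> (real (m choose k) * c ^ k) * ((g * rsq k ^ a) * (1 - c) ^ (m - k))"
      using c by (simp add: mult_left_mono)
  qed
  also have "\<dots> = g * (\<Sum>k\<le>m. real (m choose k) * c ^ k * (1 - c) ^ (m - k) * rsq k ^ a)"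
    by (simp add: sum_distrib_left mult_ac)
  also have "\<dots> \<le> g * ((1 + fact a / c ^ a) * rsq m ^ a)"
    by (intro mult_left_mono binomial_neg_moment c g)
  finally show ?thesis by (simp add: mult.assoc)
qed

section \<open>The remainder of the binomial expansion\<close>

fun tele :: "'a::comm_ring_1 \<Rightarrow> 'a \<Rightarrow> nat \<Rightarrow> nat \<Rightarrow> 'a" where
  "tele P Q 0 n = P ^ n"
| "tele P Q (Suc t) 0 = 0"
| "tele P Q (Suc t) (Suc n) = Q * tele P Q (Suc t) n + tele P Q t n"

text \<open>\<open>tele P Q t n\<close> is the divided difference of the \<open>n\<close>-th power
  at the node \<open>P\<close> and the \<open>t\<close>-fold node \<open>Q\<close>; for
  \<open>t > 0\<close> it is the sum over \<open>a + b + t = n\<close> of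
  \<open>(b + t - 1) choose (t - 1)\<close> times \<open>P ^ a * Q ^ b\<close>. Raising
  \<open>t\<close> by one is a step of Newton interpolation.\<close>

lemma tele_Suc: "tele P Q t n = of_nat (n choose t) * Q ^ (n - t) + (P - Q) * tele P Q (Suc t) n"
proof (induct n arbitrary: t)
  case 0
  then show ?case by (cases t) auto
next
  case (Suc n)
  show ?case
  proof (cases t)
    case 0
    have "P ^ n = Q ^ n + (P - Q) * tele P Q (Suc 0) n" using Suc[of 0] by simp
    then have "Q * P ^ n = Q * (Q ^ n + (P - Q) * tele P Q (Suc 0) n)" by (rule arg_cong)
    then show ?thesis using 0 by (simp add: algebra_simps)
  next
    case (Suc t')
    \<comment> \<open>For \<open>t' \<ge> n\<close> the truncated exponents do not match, but then
      the binomial coefficient is zero.\<close>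
    have *: "of_nat (n choose Suc t') * Q ^ (n - t') = of_nat (n choose Suc t') * (Q * Q ^ (n - Suc t'))"
      by (cases "t' < n") (simp_all add: Suc_diff_Suc binomial_eq_0 flip: power_Suc)
    have "Q * tele P Q (Suc t') n
        = of_nat (n choose Suc t') * Q ^ (n - t') + (P - Q) * (Q * tele P Q (Suc (Suc t')) n)"
      by (subst Suc.hyps[of "Suc t'"]) (simp only: *, simp add: algebra_simps)
    then have "tele P Q (Suc t') (Suc n)
        = of_nat (n choose Suc t') * Q ^ (n - t') + (P - Q) * (Q * tele P Q (Suc (Suc t')) n)
          + (of_nat (n choose t') * Q ^ (n - t') + (P - Q) * tele P Q (Suc t') n)"
      using Suc.hyps[of t'] by (simp only: tele.simps)
    also have "\<dots> = of_nat (Suc n choose Suc t') * Q ^ (Suc n - Suc t')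
        + (P - Q) * tele P Q (Suc (Suc t')) (Suc n)"
      by (simp add: distrib_left distrib_right)
    finally show ?thesis unfolding \<open>t = Suc t'\<close> .
  qed
qed

lemma power_tele:
  "P ^ n = (\<Sum>j<t. of_nat (n choose j) * Q ^ (n - j) * (P - Q) ^ j) + (P - Q) ^ t * tele P Q t n"
proof (induct t)
  case (Suc t)
  show ?case
    by (subst Suc, subst tele_Suc) (simp add: algebra_simps)
qed simp

text \<open>Counted with multiplicity, the divided difference has \<open>n choose t\<close>
  monomials, all with \<open>a + b + t = n\<close>. The operator \<open>Z\<close> is generalized
  because the induction moves powers of \<open>Q\<close> into it.\<close>

lemma norm_tele:
  fixes P Q :: "'n::finite cop"
  assumes "\<And>a b. a + b + t = n \<Longrightarrow> norm (Z * P ^ a * Q ^ b) \<le> \<beta>"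
  shows "norm (Z * tele P Q t n) \<le> real (n choose t) * \<beta>"
  using assms
proof (induct P Q t n arbitrary: Z rule: tele.induct)
  case (1 P Q n)
  then show ?case using "1"[of n 0] by simp
next
  case (3 P Q t n)
  have "norm (Z * Q * tele P Q (Suc t) n) \<le> real (n choose Suc t) * \<beta>"
    by (rule 3(1)) (use 3(3)[of _ "Suc _"] in \<open>simp add: mult_ac\<close>)
  moreover have "norm (Z * tele P Q t n) \<le> real (n choose t) * \<beta>"
    by (rule 3(2)) (use 3(3) in simp)
  ultimately show ?case
    using norm_triangle_ineq[of "Z * Q * tele P Q (Suc t) n" "Z * tele P Q t n"]
    by (simp add: algebra_simps)
qed simp

definition smooth_const :: "nat \<Rightarrow> nat \<Rightarrow> real \<Rightarrow> real" where
  "smooth_const d t I = (real d * sqrt (6 * t * I)) ^ (3 * t) + 2 ^ t * sqrt (3 * t) ^ (3 * t)"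

text \<open>In every monomial one of the exponents \<open>a\<close>, \<open>b\<close> is at least a
  quarter of \<open>n\<close>. That power smooths, through the mixture for \<open>\<mu>\<close> and
  directly for \<open>\<gamma>\<close>, while the other is a contraction. At most
  \<open>n ^ t\<close> monomials of size \<open>n powr (- 3 * t / 2)\<close> leave
  \<open>n powr (- t / 2)\<close>.\<close>

lemma norm_tele_remainder:
  fixes \<mu> \<gamma> \<phi> :: "(real^'n::finite) measure"
  assumes sk: "score_kernel \<phi> w I" "I > 0" and sg: "score_kernel \<gamma> w' J" "J > 0"
    and \<mu>: "finite_moment 3 \<mu>" and \<gamma>: "finite_moment 3 \<gamma>"
    and eq: "\<And>w. length w < 3 \<Longrightarrow> moment \<mu> w = moment \<gamma> w"
    and T: "(LINT y|\<mu>. norm y ^ 3) + (LINT y|\<gamma>. norm y ^ 3) \<le> T" "T \<ge> 1" and t: "t > 0"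
    and c: "0 < c" "c \<le> 1" and mix: "norm (pker \<mu> - c *\<^sub>R pker \<phi>) \<le> 1 - c"
    and n: "n \<ge> 2 * t"
  shows "norm ((pker \<mu> - pker \<gamma>) ^ t * tele (pker \<mu>) (pker \<gamma>) t n)
    \<le> (smooth_const CARD('n) t I * (1 + fact (3 * t) / c ^ (3 * t)) + smooth_const CARD('n) t J) * 4 ^ (3 * t)
       * T ^ t * (1 / sqrt n) ^ t"
proof -
  define v where "v = pker \<mu> - pker \<gamma>"
  define A B where "A = smooth_const CARD('n) t I * (1 + fact (3 * t) / c ^ (3 * t))"
    and "B = smooth_const CARD('n) t J"
  have nP: "norm (pker \<mu>) \<le> 1" "norm (pker \<gamma>) \<le> 1"
    using norm_pker_le[OF \<mu>] norm_pker_le[OF \<gamma>] by auto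
  have AB: "0 \<le> A" "0 \<le> B"
    using c sk(2) sg(2) by (auto simp: A_def B_def smooth_const_def)
  have P: "norm (v ^ t * pker \<mu> ^ m) \<le> A * T ^ t * rsq m ^ (3 * t)" for m
  proof -
    have "norm (v ^ t * pker \<mu> ^ m)
       \<le> (smooth_const CARD('n) t I * T ^ t) * (1 + fact (3 * t) / c ^ (3 * t)) * rsq m ^ (3 * t)"
    proof (rule norm_mixture_power[OF c mix])
      show "norm (v ^ t * pker \<phi> ^ k) \<le> smooth_const CARD('n) t I * T ^ t * rsq k ^ (3 * t)" for k
        using norm_diff_power_smooth[OF sk \<mu> \<gamma> eq T t] by (simp add: v_def smooth_const_def)
    qed (use T sk(2) in \<open>simp add: smooth_const_def\<close>)
    then show ?thesis by (simp add: A_def mult_ac)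
  qed
  have Q: "norm (v ^ t * pker \<gamma> ^ m) \<le> B * T ^ t * rsq m ^ (3 * t)" for m
    using norm_diff_power_smooth[OF sg \<mu> \<gamma> eq T t] by (simp add: v_def B_def smooth_const_def)
  have "norm (v ^ t * tele (pker \<mu>) (pker \<gamma>) t n)
     \<le> real (n choose t) * ((A + B) * T ^ t * (4 / sqrt n) ^ (3 * t))"
  proof (rule norm_tele)
    fix a b assume ab: "a + b + t = n"
    have big: "rsq k ^ (3 * t) \<le> (4 / sqrt n) ^ (3 * t)" if "a + b \<le> 2 * k" for k
    proof (rule power_mono)
      have "t \<le> a + b" using ab n by simp
      \<comment> \<open>Since \<open>t \<le> a + b\<close>, even \<open>n \<le> 4 * k\<close> holds;
        16 is a convenient square.\<close>
      then have "n \<le> 16 * (k + 1)" using that ab by simp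
      then have "real n \<le> real (16 * (k + 1))" by (simp only: of_nat_le_iff)
      then have "real n \<le> 16 * (real k + 1)" by simp
      then have "sqrt n \<le> sqrt 16 * sqrt (real k + 1)" by (simp only: real_sqrt_mult[symmetric] real_sqrt_le_iff)
      then show "rsq k \<le> 4 / sqrt n"
        using t n by (simp add: rsq_def field_simps)
    qed (simp add: less_imp_le)
    have "norm (v ^ t * pker \<mu> ^ a * pker \<gamma> ^ b) \<le> (A + B) * T ^ t * rsq (max a b) ^ (3 * t)"
    proof (cases "a \<le> b")
      case True
      have "norm (v ^ t * pker \<mu> ^ a * pker \<gamma> ^ b) = norm ((v ^ t * pker \<gamma> ^ b) * pker \<mu> ^ a)"
        by (simp add: mult_ac)
      also have "\<dots> \<le> (B * T ^ t * rsq b ^ (3 * t)) * 1"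
        by (intro order_trans[OF norm_mult_ineq] mult_mono Q norm_power_le_one nP)
           (use AB T in \<open>auto simp: less_imp_le\<close>)
      also have "\<dots> \<le> (A + B) * T ^ t * rsq b ^ (3 * t)"
        using AB T by (simp add: mult_right_mono less_imp_le)
      finally show ?thesis using True by (simp add: max_def)
    next
      case False
      have "norm (v ^ t * pker \<mu> ^ a * pker \<gamma> ^ b) \<le> (A * T ^ t * rsq a ^ (3 * t)) * 1"
        by (intro order_trans[OF norm_mult_ineq] mult_mono P norm_power_le_one nP)
           (use AB T in \<open>auto simp: less_imp_le\<close>)
      also have "\<dots> \<le> (A + B) * T ^ t * rsq a ^ (3 * t)"
        using AB T by (simp add: mult_right_mono less_imp_le)
      finally show ?thesis using False by (simp add: max_def)
    qed
    also have "\<dots> \<le> (A + B) * T ^ t * (4 / sqrt n) ^ (3 * t)"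
      using AB T by (intro mult_left_mono big) auto
    finally show "norm (v ^ t * pker \<mu> ^ a * pker \<gamma> ^ b) \<le> (A + B) * T ^ t * (4 / sqrt n) ^ (3 * t)" .
  qed
  also have "\<dots> \<le> real n ^ t * ((A + B) * T ^ t * (4 / sqrt n) ^ (3 * t))"
    using AB T t n by (intro mult_right_mono binomial_le_pow[THEN of_nat_mono, of _ _, unfolded of_nat_power]) auto
  also have "\<dots> = (A + B) * 4 ^ (3 * t) * T ^ t * (1 / sqrt n) ^ t"
  proof -
    have "real n > 0" using n t by simp
    have "real n ^ t * (4 / sqrt n) ^ (3 * t) = (real n * (4 / sqrt n) ^ 3) ^ t"
      by (simp add: power_mult power_mult_distrib)
    also have "real n * (4 / sqrt n) ^ 3 = 4 ^ 3 * (1 / sqrt n)"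
    proof -
      have "(sqrt n) ^ 3 = n * sqrt n" by (simp add: power3_eq_cube)
      then show ?thesis using \<open>real n > 0\<close> by (simp add: power_divide)
    qed
    also have "(4 ^ 3 * (1 / sqrt n)) ^ t = 4 ^ (3 * t) * (1 / sqrt n) ^ t"
      by (simp only: power_mult_distrib power_mult)
    finally have "real n ^ t * (4 / sqrt n) ^ (3 * t) = 4 ^ (3 * t) * (1 / sqrt n) ^ t" .
    then have "(A + B) * T ^ t * (real n ^ t * (4 / sqrt n) ^ (3 * t)) = (A + B) * T ^ t * (4 ^ (3 * t) * (1 / sqrt n) ^ t)"
      by (rule arg_cong)
    then show ?thesis by (simp only: mult_ac)
  qed
  finally show ?thesis by (simp add: v_def A_def B_def)
qed

section \<open>Symbols of differential operators\<close>

text \<open>An unreduced polynomial in commuting derivatives. It has to be formal because it is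
  evaluated in two ways: with blocks, where derivatives are small in norm, and with single Gaussian
  factors, where the outcome is an explicit density.\<close>

type_synonym 'n symbol = "(real \<times> 'n list) list"

text \<open>\<open>h\<close> is the supply of factors \<open>S\<close>: a word uses as many as it
  has letters and the others stay. The degree bounds in the rules below guarantee that the supply is
  large enough for the subtraction not to be truncated.\<close>

definition seval :: "('n \<Rightarrow> 'n::finite cop) \<Rightarrow> 'n cop \<Rightarrow> nat \<Rightarrow> 'n symbol \<Rightarrow> 'n cop" where
  "seval E S h p = (\<Sum>(a, w)\<leftarrow>p. a *\<^sub>R (op_prod E w * S ^ (h - length w)))"

definition snorm :: "'n symbol \<Rightarrow> real" where
  "snorm p = (\<Sum>(a, w)\<leftarrow>p. \<bar>a\<bar>)"

definition smul :: "'n symbol \<Rightarrow> 'n symbol \<Rightarrow> 'n symbol" where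
  "smul p q = concat (map (\<lambda>(a, u). map (\<lambda>(b, v). (a * b, u @ v)) q) p)"

primrec spow :: "'n symbol \<Rightarrow> nat \<Rightarrow> 'n symbol" where
  "spow p 0 = [(1, [])]"
| "spow p (Suc k) = smul p (spow p k)"

definition sdeg :: "nat \<Rightarrow> nat \<Rightarrow> 'n symbol \<Rightarrow> bool" where
  "sdeg lo hi p \<longleftrightarrow> (\<forall>(a, w)\<in>set p. lo \<le> length w \<and> length w \<le> hi)"

lemma seval_Nil [simp]: "seval E S h [] = 0"
  and seval_Cons: "seval E S h ((a, w) # p) = a *\<^sub>R (op_prod E w * S ^ (h - length w)) + seval E S h p"
  and seval_append [simp]: "seval E S h (p @ q) = seval E S h p + seval E S h q"
  by (simp_all add: seval_def)

lemma snorm_Nil [simp]: "snorm [] = 0"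
  and snorm_Cons: "snorm ((a, w) # p) = \<bar>a\<bar> + snorm p"
  and snorm_append [simp]: "snorm (p @ q) = snorm p + snorm q"
  by (simp_all add: snorm_def)

lemma snorm_nonneg [simp]: "0 \<le> snorm p"
  by (induct p) (auto simp: snorm_Cons)

lemma smul_Nil [simp]: "smul [] q = []"
  and smul_Cons: "smul ((a, u) # p) q = map (\<lambda>(b, v). (a * b, u @ v)) q @ smul p q"
  by (simp_all add: smul_def)

lemma sdeg_Nil [simp]: "sdeg lo hi []"
  and sdeg_Cons [simp]: "sdeg lo hi ((a, w) # p) \<longleftrightarrow> lo \<le> length w \<and> length w \<le> hi \<and> sdeg lo hi p"
  and sdeg_append [simp]: "sdeg lo hi (p @ q) \<longleftrightarrow> sdeg lo hi p \<and> sdeg lo hi q"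
  by (auto simp: sdeg_def)

lemma sdeg_mono: "sdeg lo hi p \<Longrightarrow> lo' \<le> lo \<Longrightarrow> hi \<le> hi' \<Longrightarrow> sdeg lo' hi' p"
  by (force simp: sdeg_def)

lemma snorm_smul: "snorm (smul p q) = snorm p * snorm q"
proof -
  have "snorm (map (\<lambda>(b, v). (a * b, u @ v)) q) = \<bar>a\<bar> * snorm q" for a u
    by (induct q) (auto simp: snorm_Cons abs_mult algebra_simps)
  then show ?thesis by (induct p) (auto simp: smul_Cons snorm_Cons algebra_simps)
qed

lemma snorm_spow: "snorm (spow p k) = snorm p ^ k"
  by (induct k) (auto simp: snorm_smul snorm_Cons)

lemma sdeg_smul:
  assumes "sdeg l h p" "sdeg l' h' q"
  shows "sdeg (l + l') (h + h') (smul p q)"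
proof -
  have "sdeg (l + l') (h + h') (map (\<lambda>(b, v). (a * b, u @ v)) q)" if "l \<le> length u" "length u \<le> h" for a u
    using assms(2) that by (induct q) auto
  then show ?thesis using assms(1) by (induct p) (auto simp: smul_Cons)
qed

lemma sdeg_spow: "sdeg l h p \<Longrightarrow> sdeg (l * k) (h * k) (spow p k)"
proof (induct k)
  case (Suc k)
  then show ?case using sdeg_smul[of l h p "l * k" "h * k"] by simp
qed simp

lemma seval_pad:
  assumes "sdeg l h p"
  shows "seval E S (h + k) p = seval E S h p * S ^ k"
  using assms
proof (induct p)
  case (Cons x p)
  obtain a w where x: "x = (a, w)" by force
  have "h + k - length w = (h - length w) + k" using Cons.prems by (simp add: x)
  then have "S ^ (h + k - length w) = S ^ (h - length w) * S ^ k" by (metis power_add)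
  then show ?case using Cons by (simp add: x seval_Cons distrib_right mult.assoc)
qed simp

text \<open>Supplies add in the same way as word lengths do, so evaluation is
  multiplicative.\<close>

lemma seval_smul:
  assumes "sdeg l h p" "sdeg l' h' q"
  shows "seval E S (h + h') (smul p q) = seval E S h p * seval E S h' q"
proof -
  have *: "seval E S (h + h') (map (\<lambda>(b, v). (a * b, u @ v)) q)
      = a *\<^sub>R (op_prod E u * S ^ (h - length u)) * seval E S h' q" if "length u \<le> h" for a u
    using assms(2)
  proof (induct q)
    case (Cons x q)
    obtain b v where x: "x = (b, v)" by force
    have "h + h' - length (u @ v) = (h - length u) + (h' - length v)" using Cons.prems that by (simp add: x)
    then have "S ^ (h + h' - length (u @ v)) = S ^ (h - length u) * S ^ (h' - length v)" by (metis power_add)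
    then show ?case using Cons by (simp add: x seval_Cons distrib_left mult_ac)
  qed simp
  show ?thesis using assms(1)
  proof (induct p)
    case (Cons x p)
    obtain a u where x: "x = (a, u)" by force
    then show ?case using Cons * by (simp add: smul_Cons seval_Cons distrib_right)
  qed simp
qed

lemma seval_spow:
  assumes "sdeg l h p"
  shows "seval E S (h * k) (spow p k) = seval E S h p ^ k"
proof (induct k)
  case 0
  then show ?case by (simp add: seval_Cons)
next
  case (Suc k)
  then show ?case using seval_smul[OF assms sdeg_spow[OF assms, of k]] by simp
qed

lemma norm_op_prod:
  fixes E :: "'n::finite \<Rightarrow> 'n cop"
  assumes "\<And>i. norm (E i) \<le> e"
  shows "norm (op_prod E w) \<le> e ^ length w"
proof (induct w)
  case (Cons i w)
  have "0 \<le> e" using assms[of i] norm_ge_zero order_trans by blast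
  then show ?case
    using Cons assms[of i] by (auto intro!: order_trans[OF norm_mult_ineq] mult_mono)
qed simp

text \<open>Because \<open>e \<le> 1\<close>, the lowest order occurring in the symbol
  decides.\<close>

lemma norm_seval:
  fixes E :: "'n::finite \<Rightarrow> 'n cop"
  assumes E: "\<And>i. norm (E i) \<le> e" and e: "0 \<le> e" "e \<le> 1" and S: "norm S \<le> 1" and "sdeg l h p"
  shows "norm (seval E S k p) \<le> snorm p * e ^ l"
  using assms(5)
proof (induct p)
  case (Cons x p)
  obtain a w where x: "x = (a, w)" by force
  have "norm (op_prod E w * S ^ (k - length w)) \<le> e ^ length w * 1"
    by (intro order_trans[OF norm_mult_ineq] mult_mono norm_op_prod E norm_power_le_one S) (use e in auto)
  also have "\<dots> \<le> e ^ l" using Cons.prems e by (simp add: x power_decreasing)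
  finally have "norm (a *\<^sub>R (op_prod E w * S ^ (k - length w))) \<le> \<bar>a\<bar> * e ^ l"
    by (simp add: mult_left_mono)
  then show ?case using Cons unfolding x seval_Cons snorm_Cons distrib_right
    by (intro order_trans[OF norm_triangle_ineq] add_mono) auto
qed simp

text \<open>Replacing \<open>Q\<close> by its power \<open>Q ^ b\<close> does not change the operator that a symbol stands for.\<close>

lemma seval_rescale:
  fixes Q :: "'n::finite cop"
  assumes "b \<ge> 1" "b * h \<le> n" "sdeg l h p"
  shows "seval (\<lambda>i. Q ^ (b - 1) * B i) (Q ^ b) h p * Q ^ (n - b * h) = seval B Q n p"
  using assms(3)
proof (induct p)
  case (Cons x p)
  obtain a w where x: "x = (a, w)" by force
  have op: "op_prod (\<lambda>i. Q ^ (b - 1) * B i) w = Q ^ ((b - 1) * length w) * op_prod B w"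
    by (induct w) (simp_all add: power_add mult_ac)
  have w: "length w \<le> h" using Cons.prems by (simp add: x)
  have "(b - 1) * length w + b * (h - length w) + (n - b * h) = n - length w"
  proof -
    obtain d where d: "b = Suc d" using assms(1) by (cases b) auto
    obtain k where k: "h = length w + k" using w le_Suc_ex by blast
    obtain m where m: "n = b * h + m" using assms(2) le_Suc_ex by blast
    show ?thesis unfolding m k d by (simp add: algebra_simps)
  qed
  then have "Q ^ (n - length w) = Q ^ ((b - 1) * length w) * Q ^ (b * (h - length w)) * Q ^ (n - b * h)"
    by (metis power_add)
  then have "a *\<^sub>R (op_prod B w * Q ^ (n - length w))
      = a *\<^sub>R (op_prod (\<lambda>i. Q ^ (b - 1) * B i) w * (Q ^ b) ^ (h - length w)) * Q ^ (n - b * h)"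
    by (simp only: op power_mult[symmetric] mult_scaleR_left) (simp only: mult_ac)
  moreover have "seval (\<lambda>i. Q ^ (b - 1) * B i) (Q ^ b) h p * Q ^ (n - b * h) = seval B Q n p"
    using Cons by (simp add: x)
  ultimately show ?case by (simp only: x seval_Cons distrib_right)
qed simp

text \<open>Symbols are lists, so the finite set of words has to be enumerated; every order
  serves.\<close>

definition word_list :: "nat \<Rightarrow> 'n::finite list list" where
  "word_list k = (SOME ws. set ws = words k \<and> distinct ws)"

lemma word_list: "set (word_list k) = words k" "distinct (word_list k)"
  using someI_ex[OF finite_distinct_list[OF finite_words[of k]]] by (auto simp: word_list_def)

definition taylor_symbol :: "(real^'n) measure \<Rightarrow> (real^'n) measure \<Rightarrow> nat \<Rightarrow> nat \<Rightarrow> 'n::finite symbol" where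
  "taylor_symbol \<mu> \<nu> a q =
     concat (map (\<lambda>k. map (\<lambda>w. ((moment \<mu> w - moment \<nu> w) / fact k, w)) (word_list k)) [a..<q])"

lemma sum_list_word_list: "(\<Sum>w\<leftarrow>word_list k. f w) = (\<Sum>w\<in>words k. f w)"
  using sum_list_distinct_conv_sum_set[OF word_list(2)] by (simp add: word_list(1))

lemma sum_list_concat_map: "sum_list (map f (concat (map g xs))) = (\<Sum>x\<leftarrow>xs. sum_list (map f (g x)))"
  by (induct xs) auto

lemma seval_taylor_symbol:
  "seval E S q (taylor_symbol \<mu> \<nu> a q)
   = (\<Sum>k\<in>{a..<q}. \<Sum>w\<in>words k. ((moment \<mu> w - moment \<nu> w) / fact k) *\<^sub>R (op_prod E w * S ^ (q - k)))"
proof -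
  have len: "w \<in> words k \<Longrightarrow> length w = k" for w :: "'a list" and k by (simp add: words_def)
  have "seval E S q (taylor_symbol \<mu> \<nu> a q)
    = (\<Sum>k\<leftarrow>[a..<q]. \<Sum>w\<leftarrow>word_list k. ((moment \<mu> w - moment \<nu> w) / fact k) *\<^sub>R (op_prod E w * S ^ (q - length w)))"
    unfolding taylor_symbol_def seval_def by (simp add: sum_list_concat_map o_def)
  also have "\<dots> = (\<Sum>k\<in>{a..<q}. \<Sum>w\<in>words k. ((moment \<mu> w - moment \<nu> w) / fact k) *\<^sub>R (op_prod E w * S ^ (q - length w)))"
    by (simp add: sum_list_word_list sum_list_distinct_conv_sum_set)
  finally show ?thesis by (simp add: len cong: sum.cong)
qed

lemma sdeg_taylor_symbol: "sdeg a q (taylor_symbol \<mu> \<nu> a q)"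
  by (auto simp: sdeg_def taylor_symbol_def word_list words_def)

text \<open>Each lower moment is at most one plus the absolute moment of order \<open>q\<close>; the
  2 in the bound for \<open>T\<close> pays for this once per law.\<close>

lemma snorm_taylor_symbol:
  fixes \<mu> \<nu> :: "(real^'n::finite) measure"
  assumes \<mu>: "finite_moment q \<mu>" and \<nu>: "finite_moment q \<nu>"
    and T: "2 + (LINT y|\<mu>. norm y ^ q) + (LINT y|\<nu>. norm y ^ q) \<le> T"
  shows "snorm (taylor_symbol \<mu> \<nu> a q) \<le> (\<Sum>k<q. real (card (words k :: 'n list set))) * T"
proof -
  have "snorm (taylor_symbol \<mu> \<nu> a q) = (\<Sum>k\<in>{a..<q}. \<Sum>w\<in>words k. \<bar>(moment \<mu> w - moment \<nu> w) / fact k\<bar>)"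
    unfolding taylor_symbol_def snorm_def
    by (simp add: sum_list_concat_map o_def sum_list_word_list sum_list_distinct_conv_sum_set)
  also have "\<dots> \<le> (\<Sum>k\<in>{a..<q}. \<Sum>w\<in>(words k :: 'n list set). T)"
  proof (intro sum_mono)
    fix k and w :: "'n list" assume "k \<in> {a..<q}" "w \<in> words k"
    then have w: "length w \<le> q" by (simp add: words_def)
    have "\<bar>(moment \<mu> w - moment \<nu> w) / fact k\<bar> \<le> \<bar>moment \<mu> w - moment \<nu> w\<bar> / 1"
      unfolding abs_divide using fact_ge_1[of k] by (intro divide_left_mono) auto
    also have "\<dots> \<le> T"
      using moment_abs_le[OF \<mu> w] moment_abs_le[OF \<nu> w] finite_moment_le[OF \<mu> w] finite_moment_le[OF \<nu> w] T
      by simp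
    finally show "\<bar>(moment \<mu> w - moment \<nu> w) / fact k\<bar> \<le> T" .
  qed
  also have "\<dots> \<le> (\<Sum>k<q. \<Sum>w\<in>(words k :: 'n list set). T)"
  proof (rule sum_mono2)
    have "0 \<le> T" using T by (smt (verit) Bochner_Integration.integral_nonneg norm_ge_zero zero_le_power)
    then show "0 \<le> (\<Sum>w\<in>(words k :: 'n list set). T)" for k by simp
  qed auto
  finally show ?thesis by (simp add: sum_distrib_right)
qed

section \<open>The truncated Neumann series\<close>

lemma norm_power_diff_le:
  fixes x y :: "'n::finite cop"
  assumes "norm x \<le> m" "norm y \<le> m"
  shows "norm (x ^ j - y ^ j) \<le> real j * m ^ (j - 1) * norm (x - y)"
proof (induct j)
  case (Suc j)
  have m: "0 \<le> m" using assms(1) norm_ge_zero order_trans by blast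
  have "x ^ Suc j - y ^ Suc j = x * (x ^ j - y ^ j) + (x - y) * y ^ j" by (simp add: algebra_simps)
  also have "norm \<dots> \<le> m * (real j * m ^ (j - 1) * norm (x - y)) + norm (x - y) * m ^ j"
    by (intro order_trans[OF norm_triangle_ineq] add_mono order_trans[OF norm_mult_ineq] mult_mono Suc assms
        order_trans[OF norm_power_ineq] power_mono m) auto
  also have "\<dots> = real (Suc j) * m ^ (Suc j - 1) * norm (x - y)"
    by (cases j) (simp_all add: algebra_simps)
  finally show ?case .
qed simp

text \<open>With \<open>U\<close> the symbol of \<open>1 - Q\<close>, this is the Neumann series of
  the inverse of \<open>Q\<close>, cut after \<open>s\<close> terms.\<close>

definition geom_symbol :: "nat \<Rightarrow> 'n symbol \<Rightarrow> 'n symbol" where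
  "geom_symbol s U = concat (map (spow U) [0..<s])"

lemma seval_concat: "seval E S h (concat (map f xs)) = (\<Sum>x\<leftarrow>xs. seval E S h (f x))"
  by (induct xs) auto

lemma snorm_concat: "snorm (concat (map f xs)) = (\<Sum>x\<leftarrow>xs. snorm (f x))"
  by (induct xs) auto

lemma sdeg_concat: "sdeg l h (concat (map f xs)) \<longleftrightarrow> (\<forall>x\<in>set xs. sdeg l h (f x))"
  by (induct xs) auto

lemma sdeg_geom_symbol:
  assumes "sdeg l h U" shows "sdeg 0 (h * s) (geom_symbol s U)"
  unfolding geom_symbol_def sdeg_concat
  by (auto intro!: sdeg_mono[OF sdeg_spow[OF assms]])

lemma snorm_geom_symbol:
  assumes "snorm U \<le> W" "1 \<le> W" shows "snorm (geom_symbol s U) \<le> real s * W ^ s"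
proof -
  have "snorm (geom_symbol s U) = (\<Sum>i<s. snorm U ^ i)"
    unfolding geom_symbol_def snorm_concat
    by (simp add: snorm_spow sum_list_distinct_conv_sum_set lessThan_atLeast0)
  also have "\<dots> \<le> (\<Sum>i<s. W ^ s)"
  proof (rule sum_mono)
    fix i assume "i \<in> {..<s}"
    then have "snorm U ^ i \<le> W ^ i" "W ^ i \<le> W ^ s"
      using assms by (auto intro: power_mono power_increasing)
    then show "snorm U ^ i \<le> W ^ s" by linarith
  qed
  finally show ?thesis by simp
qed

text \<open>All that matters about these constants is that they do not depend on the operators.\<close>

definition expC1 :: "nat \<Rightarrow> real \<Rightarrow> real" where
  "expC1 s W = real s * 2 ^ s + real s * real s * (2 * W) ^ s * W * W"

definition expC2 :: "nat \<Rightarrow> real \<Rightarrow> real" where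
  "expC2 s W = expC1 s W + real s * W ^ s * W"

text \<open>In the application \<open>v = P - Q\<close>, \<open>u = 1 - Q\<close>, \<open>S\<close>
  is a block \<open>Q ^ b\<close>, \<open>e\<close> is the size of one derivative, and
  \<open>U\<close>, \<open>V\<close> are Taylor symbols. \<open>U\<close> starts at order two
  because the Gaussian is centred, \<open>V\<close> at order three because the covariances agree as
  well.\<close>

context
  fixes S v u :: "'n::finite cop" and E :: "'n \<Rightarrow> 'n cop" and U V :: "'n symbol"
    and q s :: nat and e W T :: real
  assumes q: "3 \<le> q" and s: "1 \<le> s" and e: "0 \<le> e" "e \<le> 1" and W: "1 \<le> W" and T: "1 \<le> T"
    and S: "norm S \<le> 1" and E: "\<And>i. norm (E i) \<le> e"
    and V: "sdeg 3 q V" "snorm V \<le> W * T" "norm (v * S ^ q - seval E S q V) \<le> T * e ^ q"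
    and U: "sdeg 2 q U" "snorm U \<le> W" "norm (u * S ^ q - seval E S q U) \<le> W * e ^ q"
    and u2: "norm u \<le> 2"
begin

text \<open>All powers are compared at the common supply \<open>q * s\<close>; the lower ones are
  padded with powers of the contraction \<open>S\<close>.\<close>

lemma geom_diff:
  "norm ((\<Sum>i<s. u ^ i) * S ^ (q * s) - seval E S (q * s) (geom_symbol s U))
    \<le> real s * real s * (2 * W) ^ s * (W * e ^ q)"
proof -
  let ?x = "u * S ^ q" and ?y = "seval E S q U"
  have nx: "norm ?x \<le> 2 * W"
    using order_trans[OF norm_mult_ineq mult_mono[OF u2 norm_power_le_one[OF S]], of q] W by simp
  have ny: "norm ?y \<le> 2 * W"
  proof -
    have "norm ?y \<le> snorm U * e ^ 2" by (rule norm_seval[OF E e S U(1)])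
    also have "\<dots> \<le> W * 1" using U(2) e W by (intro mult_mono power_le_one) auto
    finally show ?thesis using W by simp
  qed
  have eq: "u ^ i * S ^ (q * s) - seval E S (q * s) (spow U i) = (?x ^ i - ?y ^ i) * S ^ (q * (s - i))"
    if "i < s" for i
  proof -
    have qs: "q * s = q * i + q * (s - i)" using that by (simp flip: distrib_left)
    show ?thesis
      unfolding qs seval_pad[OF sdeg_spow[OF U(1)]] seval_spow[OF U(1)]
      by (simp only: power_add power_mult[of S] power_mult_distrib left_diff_distrib) (simp only: mult_ac)
  qed
  have "(\<Sum>i<s. u ^ i) * S ^ (q * s) - seval E S (q * s) (geom_symbol s U)
     = (\<Sum>i<s. (?x ^ i - ?y ^ i) * S ^ (q * (s - i)))"
    unfolding geom_symbol_def seval_concat sum_distrib_right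
    by (simp add: sum_list_distinct_conv_sum_set lessThan_atLeast0 flip: sum_subtractf)
       (rule sum.cong, auto simp: eq)
  also have "norm \<dots> \<le> (\<Sum>i<s. norm ((?x ^ i - ?y ^ i) * S ^ (q * (s - i))))" by (rule norm_sum)
  also have "\<dots> \<le> (\<Sum>i<s. real s * (2 * W) ^ s * (W * e ^ q))"
  proof (rule sum_mono)
    fix i assume i: "i \<in> {..<s}"
    have "norm ((?x ^ i - ?y ^ i) * S ^ (q * (s - i))) \<le> (real i * (2 * W) ^ (i - 1) * norm (?x - ?y)) * 1"
      by (intro order_trans[OF norm_mult_ineq] mult_mono norm_power_diff_le nx ny norm_power_le_one S)
         (use W in auto)
    also have "\<dots> \<le> real s * (2 * W) ^ s * (W * e ^ q)"
      using i W U(3) by (simp, intro mult_mono power_increasing) auto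
    finally show "norm ((?x ^ i - ?y ^ i) * S ^ (q * (s - i))) \<le> real s * (2 * W) ^ s * (W * e ^ q)" .
  qed
  finally show ?thesis by simp
qed

text \<open>The supply \<open>q * (s + 1)\<close> splits into \<open>q * s\<close> for the Neumann
  series and \<open>q\<close> for \<open>v\<close>. In the decomposition of the product error each
  summand contains exactly one Taylor error \<open>e ^ q\<close> and is linear in \<open>T\<close>,
  the quantity that measures the law.\<close>

lemma main_factor:
  defines "D \<equiv> smul (geom_symbol s U) V" and "\<kappa> \<equiv> q * (s + 1)"
  shows "norm ((\<Sum>i<s. u ^ i) * v * S ^ \<kappa> - seval E S \<kappa> D) \<le> expC1 s W * T * e ^ q"
    and "norm (seval E S \<kappa> D) \<le> expC2 s W * T * e ^ 3"
    and "norm ((\<Sum>i<s. u ^ i) * v * S ^ \<kappa>) \<le> expC2 s W * T * e ^ 3"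
    and "sdeg 3 \<kappa> D"
    and "snorm D \<le> real s * W ^ s * (W * T)"
proof -
  let ?G = "(\<Sum>i<s. u ^ i) * S ^ (q * s)" and ?g = "seval E S (q * s) (geom_symbol s U)"
  let ?V = "v * S ^ q" and ?w = "seval E S q V"
  have \<kappa>: "\<kappa> = q * s + q" by (simp add: \<kappa>_def)
  have eq: "(\<Sum>i<s. u ^ i) * v * S ^ \<kappa> = ?G * ?V"
    unfolding \<kappa> power_add by (simp add: mult_ac)
  have eqD: "seval E S \<kappa> D = ?g * ?w"
    unfolding D_def \<kappa> by (rule seval_smul[OF sdeg_geom_symbol[OF U(1)] V(1)])
  have G: "norm ?G \<le> real s * 2 ^ s"
  proof -
    have "norm (\<Sum>i<s. u ^ i) \<le> (\<Sum>i<s. 2 ^ s)"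
    proof (rule sum_norm_le)
      fix i assume "i \<in> {..<s}"
      have "norm (u ^ i) \<le> 2 ^ i" by (intro order_trans[OF norm_power_ineq] power_mono u2) auto
      also have "\<dots> \<le> 2 ^ s" using \<open>i \<in> {..<s}\<close> by (intro power_increasing) auto
      finally show "norm (u ^ i) \<le> 2 ^ s" .
    qed
    then have "norm ?G \<le> (real s * 2 ^ s) * 1"
      by (intro order_trans[OF norm_mult_ineq] mult_mono norm_power_le_one S) auto
    then show ?thesis by simp
  qed
  have w: "norm ?w \<le> W * T"
  proof -
    have "norm ?w \<le> snorm V * e ^ 3" by (rule norm_seval[OF E e S V(1)])
    also have "\<dots> \<le> (W * T) * 1" using V(2) e W T by (intro mult_mono power_le_one) auto
    finally show ?thesis by simp
  qed
  have "?G * ?V - ?g * ?w = ?G * (?V - ?w) + (?G - ?g) * ?w" by (simp add: algebra_simps)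
  also have "norm \<dots> \<le> (real s * 2 ^ s) * (T * e ^ q) + (real s * real s * (2 * W) ^ s * (W * e ^ q)) * (W * T)"
    by (intro order_trans[OF norm_triangle_ineq] add_mono order_trans[OF norm_mult_ineq] mult_mono G w V(3) geom_diff)
       (use W e in auto)
  also have "\<dots> = expC1 s W * T * e ^ q" by (simp add: expC1_def algebra_simps)
  finally have 1: "norm ((\<Sum>i<s. u ^ i) * v * S ^ \<kappa> - seval E S \<kappa> D) \<le> expC1 s W * T * e ^ q"
    unfolding eqD eq .
  then show "norm ((\<Sum>i<s. u ^ i) * v * S ^ \<kappa> - seval E S \<kappa> D) \<le> expC1 s W * T * e ^ q" .
  show sd: "sdeg 3 \<kappa> D"
    using sdeg_smul[OF sdeg_geom_symbol[OF U(1), of s] V(1)] by (simp add: D_def \<kappa>)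
  show nD: "snorm D \<le> real s * W ^ s * (W * T)"
    unfolding D_def snorm_smul using W V(2) by (intro mult_mono snorm_geom_symbol U) auto
  have 2: "norm (seval E S \<kappa> D) \<le> real s * W ^ s * (W * T) * e ^ 3"
    using norm_seval[where E = E, OF E e S sd, where k = \<kappa>] mult_right_mono[OF nD, of "e ^ 3"] e by simp
  have c1: "0 \<le> expC1 s W" using W by (simp add: expC1_def)
  have 3: "expC2 s W * T * e ^ 3 = expC1 s W * T * e ^ 3 + real s * W ^ s * (W * T) * e ^ 3"
    by (simp add: expC2_def algebra_simps)
  have "0 \<le> expC1 s W * T * e ^ 3" using c1 T e by simp
  then show "norm (seval E S \<kappa> D) \<le> expC2 s W * T * e ^ 3"
    using 2 3 by linarith
  have "expC1 s W * T * e ^ q \<le> expC1 s W * T * e ^ 3"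
    using c1 T e q by (intro mult_left_mono power_decreasing) auto
  then show "norm ((\<Sum>i<s. u ^ i) * v * S ^ \<kappa>) \<le> expC2 s W * T * e ^ 3"
    using 1 2 norm_triangle_sub[of "(\<Sum>i<s. u ^ i) * v * S ^ \<kappa>" "seval E S \<kappa> D"]
    unfolding 3 by linarith
qed

text \<open>Of the \<open>j\<close> factors one carries the Taylor error \<open>e ^ q\<close>, the
  others their natural size \<open>e ^ 3\<close>.\<close>

lemma main_power:
  defines "D \<equiv> smul (geom_symbol s U) V" and "\<kappa> \<equiv> q * (s + 1)"
  assumes j: "1 \<le> j"
  shows "norm (((\<Sum>i<s. u ^ i) * v) ^ j * S ^ (\<kappa> * j) - seval E S (\<kappa> * j) (spow D j))
    \<le> real j * expC2 s W ^ j * T ^ j * e ^ (3 * (j - 1) + q)"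
proof -
  note mf = main_factor[folded D_def \<kappa>_def]
  let ?x = "(\<Sum>i<s. u ^ i) * v * S ^ \<kappa>" and ?y = "seval E S \<kappa> D"
  have c: "0 \<le> expC1 s W" "expC1 s W \<le> expC2 s W" using W by (auto simp: expC1_def expC2_def)
  have "((\<Sum>i<s. u ^ i) * v) ^ j * S ^ (\<kappa> * j) - seval E S (\<kappa> * j) (spow D j) = ?x ^ j - ?y ^ j"
    unfolding seval_spow[OF mf(4)] by (simp add: power_mult_distrib power_mult)
  also have "norm \<dots> \<le> real j * (expC2 s W * T * e ^ 3) ^ (j - 1) * norm (?x - ?y)"
    by (rule norm_power_diff_le[OF mf(3) mf(2)])
  also have "\<dots> \<le> real j * (expC2 s W * T * e ^ 3) ^ (j - 1) * (expC2 s W * T * e ^ q)"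
  proof (intro mult_left_mono)
    have "expC1 s W * T * e ^ q \<le> expC2 s W * T * e ^ q" using c T e by (intro mult_right_mono) auto
    then show "norm (?x - ?y) \<le> expC2 s W * T * e ^ q" using mf(1) by linarith
  qed (use c T e in auto)
  also have "\<dots> = real j * expC2 s W ^ j * T ^ j * e ^ (3 * (j - 1) + q)"
    using j by (cases j) (simp_all add: power_mult_distrib power_add mult_ac flip: power_mult)
  finally show ?thesis .
qed

text \<open>\<open>Q\<close> times the Neumann sum is \<open>1 - u ^ s\<close>. Replacing
  \<open>Q ^ (n - j)\<close> by \<open>Q ^ n\<close> times the \<open>j\<close>-th power of that sum
  therefore leaves a factor \<open>u ^ s\<close>, of order \<open>2 * s\<close> in the derivatives.
  The condition on \<open>n\<close> reserves \<open>q\<close> blocks for each of the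
  \<open>s\<close> factors \<open>u\<close> and the \<open>j\<close> factors
  \<open>v\<close>.\<close>

lemma inverse_power_diff:
  fixes Q :: "'n cop"
  assumes Q: "S = Q ^ b" "u = 1 - Q" "norm Q \<le> 1" and n: "j + b * (q * (s + j)) \<le> n"
  shows "norm (Q ^ (n - j) * v ^ j - Q ^ n * ((\<Sum>i<s. u ^ i) * v) ^ j)
    \<le> (2 * W) ^ s * (2 * W) ^ j * (real j * (1 + 2 ^ s) ^ j) * T ^ j * e ^ (3 * j + 2 * s)"
proof -
  let ?g = "\<Sum>i<s. u ^ i"
  have g: "Q * ?g = 1 - u ^ s" using one_diff_power_eq[of u s] Q(2) by simp
  have "Q ^ n = Q ^ (n - j) * Q ^ j" using n by (simp flip: power_add)
  then have "Q ^ n * (?g * v) ^ j = Q ^ (n - j) * v ^ j * (Q * ?g) ^ j"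
    by (simp add: power_mult_distrib mult_ac)
  then have "Q ^ (n - j) * v ^ j - Q ^ n * (?g * v) ^ j = Q ^ (n - j) * v ^ j * (1 - (1 - u ^ s) ^ j)"
    by (simp add: g algebra_simps)
  also have "\<dots> = Q ^ (n - j) * v ^ j * (u ^ s * (\<Sum>l<j. (1 - u ^ s) ^ l))"
    using one_diff_power_eq[of "1 - u ^ s" j] by simp
  also have "\<dots> = (u * S ^ q) ^ s * (v * S ^ q) ^ j * (\<Sum>l<j. (1 - u ^ s) ^ l) * Q ^ (n - j - b * (q * (s + j)))"
  proof -
    have "Q ^ (n - j) = S ^ (q * (s + j)) * Q ^ (n - j - b * (q * (s + j)))"
      using n by (simp add: Q(1) flip: power_mult power_add)
    also have "S ^ (q * (s + j)) = (S ^ q) ^ s * (S ^ q) ^ j"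
      by (simp only: power_mult power_add)
    finally have "Q ^ (n - j) = (S ^ q) ^ s * (S ^ q) ^ j * Q ^ (n - j - b * (q * (s + j)))" .
    then show ?thesis by (simp only: power_mult_distrib mult_ac)
  qed
  also have "norm \<dots> \<le> (2 * W * e ^ 2) ^ s * (2 * W * T * e ^ 3) ^ j * (real j * (1 + 2 ^ s) ^ j) * 1"
  proof -
    have eq: "e ^ q \<le> e ^ 3" "e ^ q \<le> e ^ 2" using e q by (auto intro: power_decreasing)
    have "norm (seval E S q U) \<le> W * e ^ 2"
      using norm_seval[where E = E, OF E e S U(1), where k = q] mult_right_mono[OF U(2), of "e ^ 2"] e by simp
    moreover have "W * e ^ q \<le> W * e ^ 2" using eq W by (intro mult_left_mono) auto
    ultimately have 1: "norm (u * S ^ q) \<le> 2 * W * e ^ 2"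
      using U(3) norm_triangle_sub[of "u * S ^ q" "seval E S q U"] by linarith
    have "norm (seval E S q V) \<le> W * T * e ^ 3"
      using norm_seval[where E = E, OF E e S V(1), where k = q] mult_right_mono[OF V(2), of "e ^ 3"] e by simp
    moreover have "T * e ^ q \<le> W * T * e ^ 3" using eq W T e by (intro mult_mono) auto
    ultimately have 2: "norm (v * S ^ q) \<le> 2 * W * T * e ^ 3"
      using V(3) norm_triangle_sub[of "v * S ^ q" "seval E S q V"] by linarith
    have us: "norm (1 - u ^ s) \<le> 1 + 2 ^ s"
    proof -
      have "norm (u ^ s) \<le> 2 ^ s" by (intro order_trans[OF norm_power_ineq] power_mono u2) auto
      then show ?thesis using norm_triangle_ineq4[of 1 "u ^ s"] by simp
    qed
    \<comment> \<open>Only boundedness of this cofactor is wanted, since the smallness sits in the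
      extracted \<open>u ^ s\<close> and \<open>v ^ j\<close>.\<close>
    have "norm (\<Sum>l<j. (1 - u ^ s) ^ l) \<le> (\<Sum>l<j. (1 + 2 ^ s) ^ j)"
    proof (rule sum_norm_le)
      fix l assume "l \<in> {..<j}"
      have "norm ((1 - u ^ s) ^ l) \<le> (1 + 2 ^ s) ^ l"
        by (intro order_trans[OF norm_power_ineq] power_mono us) auto
      also have "\<dots> \<le> (1 + 2 ^ s) ^ j" using \<open>l \<in> {..<j}\<close> by (intro power_increasing) auto
      finally show "norm ((1 - u ^ s) ^ l) \<le> (1 + 2 ^ s) ^ j" .
    qed
    then have 3: "norm (\<Sum>l<j. (1 - u ^ s) ^ l) \<le> real j * (1 + 2 ^ s) ^ j" by simp
    have 4: "norm ((u * S ^ q) ^ s) \<le> (2 * W * e ^ 2) ^ s"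
      by (rule order_trans[OF norm_power_ineq power_mono[OF 1]]) simp
    have 5: "norm ((v * S ^ q) ^ j) \<le> (2 * W * T * e ^ 3) ^ j"
      by (rule order_trans[OF norm_power_ineq power_mono[OF 2]]) simp
    have 6: "norm ((u * S ^ q) ^ s * (v * S ^ q) ^ j) \<le> (2 * W * e ^ 2) ^ s * (2 * W * T * e ^ 3) ^ j"
      by (rule order_trans[OF norm_mult_ineq mult_mono[OF 4 5]]) (use W in auto)
    have 7: "norm ((u * S ^ q) ^ s * (v * S ^ q) ^ j * (\<Sum>l<j. (1 - u ^ s) ^ l))
        \<le> (2 * W * e ^ 2) ^ s * (2 * W * T * e ^ 3) ^ j * (real j * (1 + 2 ^ s) ^ j)"
      by (rule order_trans[OF norm_mult_ineq mult_mono[OF 6 3]]) (use W T e in auto)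
    show ?thesis
      by (rule order_trans[OF norm_mult_ineq mult_mono[OF 7 norm_power_le_one[OF Q(3)]]]) (use W T e in auto)
  qed
  also have "\<dots> = (2 * W) ^ s * (2 * W) ^ j * (real j * (1 + 2 ^ s) ^ j) * T ^ j * e ^ (3 * j + 2 * s)"
  proof -
    have "e ^ (3 * j + 2 * s) = (e ^ 3) ^ j * (e ^ 2) ^ s" by (simp only: power_add power_mult)
    then show ?thesis by (simp only: power_mult_distrib mult_ac mult_1_right)
  qed
  finally show ?thesis .
qed

end

section \<open>The expansion of the operator power\<close>

abbreviation dirac0 :: "(real^'n::finite) measure" where
  "dirac0 \<equiv> return borel 0"

text \<open>The identity is the averaging operator of the point mass at zero. Hence
  \<open>1 - Q\<close> is a difference of two averaging operators and falls under the same Taylor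
  expansion as \<open>P - Q\<close>.\<close>

lemma pker_dirac0: "pker dirac0 = 1"
proof (rule cop_eqI)
  fix f :: "'a bmeas" and x
  have "kernel_ok (dirac0 :: (real^'a) measure) (\<lambda>_. 1)"
    by (rule kernel_ok_prob) (auto intro: prob_space_return)
  then show "capp (pker dirac0) f x = capp 1 f x"
    by (simp add: capp_ker integral_return)
qed

lemma finite_moment_dirac0: "finite_moment q (dirac0 :: (real^'n::finite) measure)"
  by (auto simp: finite_moment_def integrable_iff_bounded nn_integral_return intro: prob_space_return)

lemma moment_Nil: "prob_space \<mu> \<Longrightarrow> moment \<mu> [] = 1"
  by (simp add: moment_def prob_space.prob_space)

lemma moment_dirac0: "moment dirac0 w = (if w = [] then 1 else 0)"
  using moment_Nil[OF prob_space_return[of "0 :: real^'a" borel]]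
  by (cases w) (auto simp: moment_def integral_return)

text \<open>Symbol of the truncated inverse of \<open>Q\<close> times \<open>P - Q\<close>. The
  Taylor order \<open>s + 3\<close> exceeds the leading order three by \<open>s\<close>, which is
  the relative accuracy required.\<close>

definition expansion_symbol :: "nat \<Rightarrow> (real^'n::finite) measure \<Rightarrow> (real^'n) measure \<Rightarrow> 'n symbol" where
  "expansion_symbol s \<gamma> \<mu> =
     smul (geom_symbol s (taylor_symbol dirac0 \<gamma> 2 (s + 3))) (taylor_symbol \<mu> \<gamma> 3 (s + 3))"

lemma binomial_le_power: "real (n choose j) \<le> real n ^ j"
proof (cases "j \<le> n")
  case True
  then have "n choose j \<le> n ^ j" by (rule binomial_le_pow)
  then show ?thesis by (simp flip: of_nat_power)
qed (simp add: binomial_eq_0)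

text \<open>\<open>C\<close> and \<open>n0\<close> are found before the law \<open>\<mu>\<close>,
  which enters only through \<open>T\<close>. Two errors add up: passing from
  \<open>Q ^ (n - j)\<close> to the Neumann form, and passing from there to the symbol.\<close>

lemma expansion_term:
  fixes \<gamma> :: "(real^'n::finite) measure"
  assumes sg: "score_kernel \<gamma> w J" "J > 0" and \<gamma>: "finite_moment (s + 3) \<gamma>" "\<And>i. moment \<gamma> [i] = 0"
    and s: "1 \<le> s" and j: "1 \<le> j" "j \<le> s"
  shows "\<exists>C n0. 0 \<le> C \<and> (\<forall>\<mu> T n. finite_moment (s + 3) \<mu> \<longrightarrow> (\<forall>w. length w < 3 \<longrightarrow> moment \<mu> w = moment \<gamma> w) \<longrightarrow>
      2 + (LINT y|\<mu>. norm y ^ (s + 3)) + (LINT y|\<gamma>. norm y ^ (s + 3)) \<le> T \<longrightarrow> n0 \<le> n \<longrightarrow>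
      snorm (expansion_symbol s \<gamma> \<mu>) \<le> C * T \<and> sdeg 3 ((s + 3) * (s + 1)) (expansion_symbol s \<gamma> \<mu>) \<and>
      norm (real (n choose j) *\<^sub>R (pker \<gamma> ^ (n - j) * (pker \<mu> - pker \<gamma>) ^ j
          - seval (\<lambda>i. ker \<gamma> (w i)) (pker \<gamma>) n (spow (expansion_symbol s \<gamma> \<mu>) j)))
        \<le> C * T ^ j * (1 / sqrt n) ^ (s + 1))"
proof -
  define q where "q = s + 3"
  define \<kappa> where "\<kappa> = q * (s + 1)"
  \<comment> \<open>Enough blocks for both estimates below: \<open>\<kappa> * j\<close> of them for
    the symbol, and \<open>q * (s + j)\<close> for the inverse together with room for
    \<open>j\<close> single factors, whence the 2.\<close>
  define m0 where "m0 = 2 * q * (s + 1) * (s + 1)"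
  define Wq where "Wq = (\<Sum>k<q. real (card (words k :: 'n list set)))"
  define G where "G = (LINT y|\<gamma>. norm y ^ q)"
  define W where "W = Wq * (2 + G) + Wq + 1 + G"
  \<comment> \<open>The block length \<open>b\<close> is at least \<open>n / (2 * m0)\<close>, so
    \<open>K / sqrt n\<close> dominates the derivatives of a block.\<close>
  define K where "K = real CARD('n) * sqrt (2 * m0 * J)"
  define C where "C = real j * expC2 s W ^ j * K ^ (3 * j + s)
    + (2 * W) ^ s * (2 * W) ^ j * (real j * (1 + 2 ^ s) ^ j) * K ^ (3 * j + 2 * s)"
  define C' where "C' = C + real s * W ^ s * W"
  \<comment> \<open>The first entry makes \<open>b\<close> positive, the second gives
    \<open>e \<le> 1\<close>.\<close>
  define n0 where "n0 = max m0 (nat \<lceil>K ^ 2\<rceil>)"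
  have \<gamma>q: "finite_moment q \<gamma>" using \<gamma> by (simp add: q_def)
  have pG: "prob_space \<gamma>" using \<gamma>q by (simp add: finite_moment_def)
  have G0: "0 \<le> G" by (simp add: G_def)
  have Wq: "0 \<le> Wq" by (simp add: Wq_def sum_nonneg)
  have W: "1 \<le> W" "Wq \<le> W" "Wq * (2 + G) \<le> W" "G \<le> W" using G0 Wq by (auto simp: W_def)
  have K: "0 \<le> K" using sg(2) by (simp add: K_def)
  have C: "0 \<le> C" "C \<le> C'" "real s * W ^ s * W \<le> C'"
    using W K by (auto simp: C_def C'_def expC2_def expC1_def)
  define U where "U = taylor_symbol dirac0 \<gamma> 2 q"
  have U: "sdeg 2 q U" "snorm U \<le> W"
  proof -
    show "sdeg 2 q U" unfolding U_def by (rule sdeg_taylor_symbol)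
    have "snorm U \<le> Wq * (2 + G)"
      unfolding U_def Wq_def using finite_moment_dirac0 \<gamma>q
      by (rule snorm_taylor_symbol) (simp add: G_def integral_return q_def power_0_left)
    then show "snorm U \<le> W" using W by simp
  qed
  show ?thesis
  proof (intro exI[of _ C'] exI[of _ n0] conjI allI impI)
    show "0 \<le> C'" using C by simp
    fix \<mu> :: "(real^'n) measure" and T :: real and n :: nat
    assume "finite_moment (s + 3) \<mu>" and eq: "\<forall>w. length w < 3 \<longrightarrow> moment \<mu> w = moment \<gamma> w"
      and "2 + (LINT y|\<mu>. norm y ^ (s + 3)) + (LINT y|\<gamma>. norm y ^ (s + 3)) \<le> T" and n: "n0 \<le> n"
    then have \<mu>: "finite_moment q \<mu>" and T: "2 + (LINT y|\<mu>. norm y ^ q) + G \<le> T"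
      by (auto simp: q_def G_def)
    have "0 \<le> (LINT y|\<mu>. norm y ^ q)" by simp
    then have T1: "1 \<le> T" using T G0 by linarith
    define V where "V = taylor_symbol \<mu> \<gamma> 3 q"
    define D where "D = expansion_symbol s \<gamma> \<mu>"
    have D: "D = smul (geom_symbol s U) V" by (simp add: D_def U_def V_def expansion_symbol_def q_def)
    define b where "b = n div m0"
    have m0: "0 < m0" by (simp add: m0_def q_def)
    have nm: "m0 \<le> n" "K ^ 2 \<le> real n" using n by (auto simp: n0_def)
    have b: "1 \<le> b" using nm m0 by (simp add: b_def div_greater_zero_iff Suc_le_eq)
    have bm: "b * m0 \<le> n" by (simp add: b_def)
    have n1: "0 < n" using nm m0 by simp
    define e where "e = K / sqrt n"
    have e: "0 \<le> e" "e \<le> 1"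
      using K nm(2) n1 by (auto simp: e_def real_le_rsqrt)
    let ?Q = "pker \<gamma>" and ?B = "\<lambda>i. ker \<gamma> (w i)"
    let ?S = "?Q ^ b" and ?E = "\<lambda>i. ?Q ^ (b - 1) * ker \<gamma> (w i)"
    have nQ: "norm ?Q \<le> 1" "norm (pker \<mu>) \<le> 1" using norm_pker_le \<gamma>q \<mu> by auto
    have Es: "(\<Sum>i\<in>UNIV. norm (?E i)) \<le> e"
    proof -
      have "n < (b + 1) * m0" using m0 dividend_less_div_times[of m0 n] by (simp add: b_def algebra_simps)
      also have "\<dots> \<le> (2 * b) * m0" using b by (intro mult_right_mono) auto
      finally have "real n \<le> 2 * m0 * b" by (simp add: mult_ac flip: of_nat_mult)
      then have "J / b \<le> 2 * m0 * J / n"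
        using sg(2) b n1 mult_left_mono[of "real n" "2 * m0 * b" J] by (simp add: field_simps)
      then have "sqrt (J / b) \<le> sqrt (2 * m0 * J) / sqrt n"
        by (simp only: real_sqrt_divide[symmetric] real_sqrt_le_iff)
      then have "real CARD('n) * sqrt (J / b) \<le> e"
        by (simp add: e_def K_def mult_left_mono flip: times_divide_eq_right)
      then show ?thesis using score_kernel_power(2)[OF sg b] by simp
    qed
    note dE = score_kernel_power(1)[OF sg b]
    have Ei: "norm (?E i) \<le> e" for i
      using member_le_sum[of i UNIV "\<lambda>i. norm (?E i)"] Es by simp
    have S1: "norm ?S \<le> 1" by (rule norm_power_le_one[OF nQ(1)])
    have V: "sdeg 3 q V" "snorm V \<le> W * T"
    proof -
      show "sdeg 3 q V" unfolding V_def by (rule sdeg_taylor_symbol)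
      have "snorm V \<le> Wq * T" unfolding V_def Wq_def using \<mu> \<gamma>q by (rule snorm_taylor_symbol) (use T in \<open>simp add: G_def\<close>)
      also have "Wq * T \<le> W * T" using W(2) T1 by (intro mult_right_mono) auto
      finally show "snorm V \<le> W * T" .
    qed
    have V3: "norm ((pker \<mu> - ?Q) * ?S ^ q - seval ?E ?S q V) \<le> T * e ^ q"
    proof -
      have "norm ((pker \<mu> - ?Q) * ?S ^ q - seval ?E ?S q V) \<le> ((LINT y|\<mu>. norm y ^ q) + G) * e ^ q"
        unfolding V_def seval_taylor_symbol G_def
        by (rule diff_taylor[OF dE Es \<mu> \<gamma>q]) (use eq in \<open>auto simp: q_def\<close>)
      also have "\<dots> \<le> T * e ^ q" using T e by (intro mult_right_mono) auto
      finally show ?thesis .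
    qed
    have U3: "norm ((1 - ?Q) * ?S ^ q - seval ?E ?S q U) \<le> W * e ^ q"
    proof -
      \<comment> \<open>Agreement up to order one is the centring of \<open>\<gamma>\<close>; a
        point mass cannot match second moments, so \<open>U\<close> starts at order two.\<close>
      have "moment dirac0 v = moment \<gamma> v" if "length v < 2" for v
      proof (cases v)
        case (Cons i v')
        then have "v' = []" using that by (cases v') auto
        then show ?thesis using Cons \<gamma>(2) by (simp add: moment_dirac0)
      qed (simp add: moment_dirac0 moment_Nil[OF pG])
      then have "norm ((pker dirac0 - ?Q) * ?S ^ q - seval ?E ?S q U)
          \<le> ((LINT y|dirac0. norm (y::real^'n) ^ q) + G) * e ^ q"
        unfolding U_def seval_taylor_symbol G_def
        by (intro diff_taylor[OF dE Es finite_moment_dirac0 \<gamma>q]) (auto simp: q_def)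
      also have "\<dots> \<le> W * e ^ q" using W e by (simp add: integral_return q_def power_0_left mult_right_mono)
      finally show ?thesis by (simp add: pker_dirac0)
    qed
    have u2: "norm (1 - ?Q) \<le> 2" using norm_triangle_ineq4[of 1 ?Q] nQ by simp
    have q3: "3 \<le> q" by (simp add: q_def)
    note ctx = q3 s e W(1) T1 S1 Ei V V3 U U3 u2
    have mf: "sdeg 3 \<kappa> D" "snorm D \<le> real s * W ^ s * (W * T)"
      using main_factor(4,5)[OF ctx] by (simp_all add: D \<kappa>_def)
    show "snorm (expansion_symbol s \<gamma> \<mu>) \<le> C' * T"
    proof -
      have "(real s * W ^ s * W) * T \<le> C' * T" using C(3) T1 by (intro mult_right_mono) auto
      then show ?thesis using mf(2) by (simp add: D_def mult.assoc)
    qed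
    show "sdeg 3 ((s + 3) * (s + 1)) (expansion_symbol s \<gamma> \<mu>)"
      using mf(1) by (simp add: D_def \<kappa>_def q_def)
    let ?v = "pker \<mu> - ?Q"
    let ?gv = "(\<Sum>i<s. (1 - ?Q) ^ i) * ?v"
    have n\<kappa>: "b * (\<kappa> * j) \<le> n"
    proof -
      have "\<kappa> * j \<le> \<kappa> * (s + 1)" using j(2) by (intro mult_le_mono2) simp
      moreover have "m0 = 2 * (\<kappa> * (s + 1))" by (simp only: \<kappa>_def m0_def mult.assoc)
      ultimately have "\<kappa> * j \<le> m0" by linarith
      then show ?thesis using bm by (meson le_trans mult_le_mono2)
    qed
    have nj: "j + b * (q * (s + j)) \<le> n"
    proof -
      have "s + j \<le> (s + 1) * (s + 1)" using j(2) by simp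
      then have "q * (s + j) \<le> q * ((s + 1) * (s + 1))" by (rule mult_le_mono2)
      moreover have "m0 = 2 * (q * ((s + 1) * (s + 1)))" by (simp only: m0_def mult.assoc)
      ultimately have "2 * (q * (s + j)) \<le> m0" by linarith
      then have "b * (2 * (q * (s + j))) \<le> n" using bm by (meson le_trans mult_le_mono2)
      moreover have "b * (2 * (q * (s + j))) = 2 * (b * (q * (s + j)))" by (simp only: mult_ac)
      moreover have "s + j \<le> b * (q * (s + j))"
      proof -
        have "1 * (s + j) \<le> (b * q) * (s + j)" using b q3 by (intro mult_le_mono1) simp
        then show ?thesis by (simp only: mult.assoc mult_1)
      qed
      ultimately show ?thesis by linarith
    qed
    have A: "norm (?Q ^ n * ?gv ^ j - seval ?B ?Q n (spow D j))
        \<le> real j * expC2 s W ^ j * T ^ j * e ^ (3 * (j - 1) + q)"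
    proof -
      \<comment> \<open>Regrouping \<open>Q ^ n\<close> into \<open>\<kappa> * j\<close> blocks and
        a rest lets the norm estimate for blocks apply to the symbol with single factors.\<close>
      have Qn: "?Q ^ n = ?S ^ (\<kappa> * j) * ?Q ^ (n - b * (\<kappa> * j))"
        using n\<kappa> by (simp flip: power_mult power_add)
      note resc = seval_rescale[OF b n\<kappa> sdeg_spow[OF mf(1), of j], of ?Q ?B]
      have "?Q ^ n * ?gv ^ j - seval ?B ?Q n (spow D j)
         = (?gv ^ j * ?S ^ (\<kappa> * j) - seval ?E ?S (\<kappa> * j) (spow D j)) * ?Q ^ (n - b * (\<kappa> * j))"
        by (subst Qn) (simp only: left_diff_distrib[of _ _ "?Q ^ (n - b * (\<kappa> * j))"] resc, simp only: mult_ac)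
      also have "norm \<dots> \<le> (real j * expC2 s W ^ j * T ^ j * e ^ (3 * (j - 1) + q)) * 1"
        using main_power[OF ctx j(1)]
        by (intro order_trans[OF norm_mult_ineq mult_mono] norm_power_le_one nQ)
           (use W T1 e in \<open>auto simp: D \<kappa>_def expC2_def expC1_def\<close>)
      finally show ?thesis by simp
    qed
    have B: "norm (?Q ^ (n - j) * ?v ^ j - ?Q ^ n * ?gv ^ j)
       \<le> (2 * W) ^ s * (2 * W) ^ j * (real j * (1 + 2 ^ s) ^ j) * T ^ j * e ^ (3 * j + 2 * s)"
      by (rule inverse_power_diff[OF ctx refl refl nQ(1) nj])
    \<comment> \<open>The binomial coefficient contributes \<open>n ^ j\<close> and uses up
      \<open>2 * j\<close> of the \<open>3 * j\<close> derivatives; the exponent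
      \<open>j + d\<close> that remains is at least \<open>s + 1\<close>.\<close>
    have sig: "real n ^ j * e ^ (3 * j + d) \<le> K ^ (3 * j + d) * (1 / sqrt n) ^ (s + 1)" if "s \<le> d" for d
    proof -
      let ?r = "1 / sqrt n"
      have r: "0 \<le> ?r" "?r \<le> 1" using n1 by auto
      have "real n * ?r ^ 2 = 1" using n1 by (simp add: power_divide)
      then have "real n ^ j * ?r ^ (2 * j) = 1" by (simp only: power_mult power_mult_distrib[symmetric] power_one)
      moreover have "?r ^ (3 * j + d) = ?r ^ (2 * j) * ?r ^ (j + d)" by (simp flip: power_add)
      ultimately have "real n ^ j * ?r ^ (3 * j + d) = ?r ^ (j + d)" by (simp only: mult.assoc[symmetric] mult_1_left)
      also have "\<dots> \<le> ?r ^ (s + 1)" using r j that by (intro power_decreasing) auto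
      finally have "K ^ (3 * j + d) * (real n ^ j * ?r ^ (3 * j + d)) \<le> K ^ (3 * j + d) * ?r ^ (s + 1)"
        using K by (intro mult_left_mono) auto
      moreover have "e ^ (3 * j + d) = K ^ (3 * j + d) * ?r ^ (3 * j + d)"
        by (simp add: e_def power_divide)
      ultimately show ?thesis by (simp only: mult_ac)
    qed
    have "norm (real (n choose j) *\<^sub>R (?Q ^ (n - j) * ?v ^ j - seval ?B ?Q n (spow D j)))
      \<le> real n ^ j * (real j * expC2 s W ^ j * T ^ j * e ^ (3 * (j - 1) + q)
         + (2 * W) ^ s * (2 * W) ^ j * (real j * (1 + 2 ^ s) ^ j) * T ^ j * e ^ (3 * j + 2 * s))"
    proof -
      have "norm (?Q ^ (n - j) * ?v ^ j - seval ?B ?Q n (spow D j))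
        \<le> real j * expC2 s W ^ j * T ^ j * e ^ (3 * (j - 1) + q)
         + (2 * W) ^ s * (2 * W) ^ j * (real j * (1 + 2 ^ s) ^ j) * T ^ j * e ^ (3 * j + 2 * s)"
        using norm_triangle_ineq[of "?Q ^ (n - j) * ?v ^ j - ?Q ^ n * ?gv ^ j" "?Q ^ n * ?gv ^ j - seval ?B ?Q n (spow D j)"] A B
        by simp
      then show ?thesis unfolding norm_scaleR
        by (intro mult_mono) (use binomial_le_power in auto)
    qed
    also have "\<dots> = (real j * expC2 s W ^ j * T ^ j) * (real n ^ j * e ^ (3 * j + s))
         + ((2 * W) ^ s * (2 * W) ^ j * (real j * (1 + 2 ^ s) ^ j) * T ^ j) * (real n ^ j * e ^ (3 * j + 2 * s))"
    proof -
      have "3 * (j - 1) + q = 3 * j + s" using j by (simp add: q_def)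
      then show ?thesis by (simp only: distrib_left mult_ac)
    qed
    also have "\<dots> \<le> (real j * expC2 s W ^ j * T ^ j) * (K ^ (3 * j + s) * (1 / sqrt n) ^ (s + 1))
         + ((2 * W) ^ s * (2 * W) ^ j * (real j * (1 + 2 ^ s) ^ j) * T ^ j) * (K ^ (3 * j + 2 * s) * (1 / sqrt n) ^ (s + 1))"
      using W T1 by (intro add_mono mult_left_mono sig) (auto simp: expC2_def expC1_def)
    also have "\<dots> = C * T ^ j * (1 / sqrt n) ^ (s + 1)"
      unfolding C_def distrib_right by (simp only: mult_ac)
    also have "\<dots> \<le> C' * T ^ j * (1 / sqrt n) ^ (s + 1)"
      using C T1 by (intro mult_right_mono) auto
    finally show "norm (real (n choose j) *\<^sub>R (?Q ^ (n - j) * ?v ^ j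
          - seval ?B ?Q n (spow (expansion_symbol s \<gamma> \<mu>) j))) \<le> C' * T ^ j * (1 / sqrt n) ^ (s + 1)"
      by (simp only: D_def)
  qed
qed

text \<open>Symbols are evaluated at the supply \<open>n\<close>, so for Gaussian
  \<open>\<gamma>\<close> every summand is a combination of derivatives of the normal density of
  variance exactly \<open>n\<close>.\<close>

definition edgeworth_op :: "nat \<Rightarrow> (real^'n::finite) measure \<Rightarrow> ('n \<Rightarrow> real^'n \<Rightarrow> real) \<Rightarrow> (real^'n) measure \<Rightarrow> nat \<Rightarrow> 'n cop" where
  "edgeworth_op s \<gamma> w \<mu> n =
     (\<Sum>j\<le>s. real (n choose j) *\<^sub>R seval (\<lambda>i. ker \<gamma> (w i)) (pker \<gamma>) n (spow (expansion_symbol s \<gamma> \<mu>) j))"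

text \<open>The two moment parameters are kept apart: \<open>T3\<close> enters through the remainder
  with the power \<open>s + 1\<close>, \<open>T\<close> through the main terms with the power
  \<open>s\<close> only. A sharper estimate of \<open>T3\<close> can then be inserted later.\<close>

theorem edgeworth_operator:
  fixes \<gamma> :: "(real^'n::finite) measure"
  assumes sg: "score_kernel \<gamma> w J" "J > 0" and \<gamma>: "finite_moment (s + 3) \<gamma>" "\<And>i. moment \<gamma> [i] = 0"
    and I: "I > 0" and c: "0 < c" "c \<le> 1"
  shows "\<exists>C n0. 0 \<le> C \<and> (\<forall>\<mu> \<phi> \<psi> T T3. finite_moment (s + 3) \<mu> \<longrightarrow>
      (\<forall>w. length w < 3 \<longrightarrow> moment \<mu> w = moment \<gamma> w) \<longrightarrow>
      2 + (LINT y|\<mu>. norm y ^ (s + 3)) + (LINT y|\<gamma>. norm y ^ (s + 3)) \<le> T \<longrightarrow>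
      (LINT y|\<mu>. norm y ^ 3) + (LINT y|\<gamma>. norm y ^ 3) \<le> T3 \<longrightarrow> 1 \<le> T3 \<longrightarrow>
      score_kernel \<phi> \<psi> I \<longrightarrow> norm (pker \<mu> - c *\<^sub>R pker \<phi>) \<le> 1 - c \<longrightarrow>
      (1 \<le> s \<longrightarrow> snorm (expansion_symbol s \<gamma> \<mu>) \<le> C * T \<and>
         sdeg 3 ((s + 3) * (s + 1)) (expansion_symbol s \<gamma> \<mu>)) \<and>
      (\<forall>n\<ge>n0. norm (pker \<mu> ^ n - edgeworth_op s \<gamma> w \<mu> n) \<le> C * (T3 ^ (s + 1) + T ^ s) * (1 / sqrt n) ^ (s + 1)))"
proof -
  define ok where "ok j C n0 \<longleftrightarrow> 0 \<le> C \<and> (\<forall>\<mu> T n. finite_moment (s + 3) \<mu> \<longrightarrow>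
      (\<forall>w. length w < 3 \<longrightarrow> moment \<mu> w = moment \<gamma> w) \<longrightarrow>
      2 + (LINT y|\<mu>. norm y ^ (s + 3)) + (LINT y|\<gamma>. norm y ^ (s + 3)) \<le> T \<longrightarrow> n0 \<le> n \<longrightarrow>
      snorm (expansion_symbol s \<gamma> \<mu>) \<le> C * T \<and> sdeg 3 ((s + 3) * (s + 1)) (expansion_symbol s \<gamma> \<mu>) \<and>
      norm (real (n choose j) *\<^sub>R (pker \<gamma> ^ (n - j) * (pker \<mu> - pker \<gamma>) ^ j
          - seval (\<lambda>i. ker \<gamma> (w i)) (pker \<gamma>) n (spow (expansion_symbol s \<gamma> \<mu>) j)))
        \<le> C * T ^ j * (1 / sqrt n) ^ (s + 1))" for j C n0
  have "\<exists>C n0. ok j C n0" if "j \<in> {1..s}" for j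
    unfolding ok_def using that by (intro expansion_term[OF sg \<gamma>]) auto
  then have "\<forall>j\<in>{1..s}. \<exists>p. ok j (fst p) (snd p)" by auto
  then obtain p where p: "\<And>j. j \<in> {1..s} \<Longrightarrow> ok j (fst (p j)) (snd (p j))" by metis
  define R where "R = (smooth_const CARD('n) (s + 1) I * (1 + fact (3 * (s + 1)) / c ^ (3 * (s + 1)))
      + smooth_const CARD('n) (s + 1) J) * 4 ^ (3 * (s + 1))"
  define C where "C = R + (\<Sum>j\<in>{1..s}. fst (p j))"
  define n0 where "n0 = 2 * (s + 1) + (\<Sum>j\<in>{1..s}. snd (p j))"
  have R: "0 \<le> R" using c I sg(2) by (simp add: R_def smooth_const_def)
  have pC: "0 \<le> fst (p j)" if "j \<in> {1..s}" for j using p[OF that] by (simp add: ok_def)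
  have C: "0 \<le> C" "R \<le> C" using R pC by (auto simp: C_def intro!: sum_nonneg add_nonneg_nonneg)
  show ?thesis
  proof (intro exI[of _ C] exI[of _ n0] conjI allI impI C)
    fix \<mu> \<phi> :: "(real^'n) measure" and \<psi> and T T3 :: real
    assume \<mu>: "finite_moment (s + 3) \<mu>" and eq: "\<forall>w. length w < 3 \<longrightarrow> moment \<mu> w = moment \<gamma> w"
      and T: "2 + (LINT y|\<mu>. norm y ^ (s + 3)) + (LINT y|\<gamma>. norm y ^ (s + 3)) \<le> T"
      and T3: "(LINT y|\<mu>. norm y ^ 3) + (LINT y|\<gamma>. norm y ^ 3) \<le> T3" "1 \<le> T3"
      and sk: "score_kernel \<phi> \<psi> I" and mix: "norm (pker \<mu> - c *\<^sub>R pker \<phi>) \<le> 1 - c"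
    have "0 \<le> (LINT y|\<mu>. norm y ^ (s + 3))" "0 \<le> (LINT y|\<gamma>. norm y ^ (s + 3))" by simp_all
    then have T1: "1 \<le> T" using T by linarith
    note q = p[unfolded ok_def, THEN conjunct2, rule_format, OF _ \<mu> _ T]
    {
      assume "1 \<le> s"
      then have s: "s \<in> {1..s}" by simp
      have "fst (p s) \<le> (\<Sum>j\<in>{1..s}. fst (p j))" using pC s by (intro member_le_sum) auto
      then have "fst (p s) * T \<le> C * T" using R T1 by (intro mult_right_mono) (auto simp: C_def)
      then show "snorm (expansion_symbol s \<gamma> \<mu>) \<le> C * T"
        using q[OF s _ order_refl] eq by force
      show "sdeg 3 ((s + 3) * (s + 1)) (expansion_symbol s \<gamma> \<mu>)"
        using q[OF s _ order_refl] eq by blast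
    }
    fix n assume n: "n0 \<le> n"
    let ?v = "pker \<mu> - pker \<gamma>" and ?r = "(1 / sqrt n) ^ (s + 1)"
    let ?e = "\<lambda>j. seval (\<lambda>i. ker \<gamma> (w i)) (pker \<gamma>) n (spow (expansion_symbol s \<gamma> \<mu>) j)"
    let ?d = "\<lambda>j. real (n choose j) *\<^sub>R (pker \<gamma> ^ (n - j) * ?v ^ j - ?e j)"
    have r: "0 \<le> ?r" by simp
    have "pker \<mu> ^ n - edgeworth_op s \<gamma> w \<mu> n
       = (\<Sum>j\<le>s. real (n choose j) *\<^sub>R (pker \<gamma> ^ (n - j) * ?v ^ j)) + ?v ^ (s + 1) * tele (pker \<mu>) (pker \<gamma>) (s + 1) n
         - (\<Sum>j\<le>s. real (n choose j) *\<^sub>R ?e j)"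
      using power_tele[of "pker \<mu>" n "pker \<gamma>" "s + 1"]
      by (simp add: edgeworth_op_def of_nat_mult_scaleR[where 'a = "'n cop"] lessThan_Suc_atMost mult.assoc del: tele.simps)
    also have "\<dots> = (\<Sum>j\<le>s. ?d j) + ?v ^ (s + 1) * tele (pker \<mu>) (pker \<gamma>) (s + 1) n"
      by (simp add: scaleR_diff_right sum_subtractf del: tele.simps)
    \<comment> \<open>The term \<open>j = 0\<close> is exact: both of its parts equal
      \<open>Q ^ n\<close>.\<close>
    also have "(\<Sum>j\<le>s. ?d j) = (\<Sum>j\<in>{1..s}. ?d j)"
      by (rule sum.mono_neutral_right) (auto simp: seval_Cons not_le Suc_le_eq)
    finally have eq1: "pker \<mu> ^ n - edgeworth_op s \<gamma> w \<mu> n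
      = (\<Sum>j\<in>{1..s}. ?d j) + ?v ^ (s + 1) * tele (pker \<mu>) (pker \<gamma>) (s + 1) n" .
    have "norm (\<Sum>j\<in>{1..s}. ?d j) \<le> (\<Sum>j\<in>{1..s}. fst (p j) * T ^ s * ?r)"
    proof (rule sum_norm_le)
      fix j assume j: "j \<in> {1..s}"
      have "snd (p j) \<le> (\<Sum>j\<in>{1..s}. snd (p j))" using j by (intro member_le_sum) auto
      then have "snd (p j) \<le> n" using n by (simp add: n0_def)
      then have "norm (?d j) \<le> fst (p j) * T ^ j * ?r" using q[OF j, of n] eq by blast
      also have "\<dots> \<le> fst (p j) * T ^ s * ?r"
        using j T1 pC[OF j] by (intro mult_right_mono mult_left_mono power_increasing) auto
      finally show "norm (?d j) \<le> fst (p j) * T ^ s * ?r" .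
    qed
    also have "\<dots> = (\<Sum>j\<in>{1..s}. fst (p j)) * T ^ s * ?r"
      by (simp only: sum_distrib_right)
    also have "\<dots> \<le> C * T ^ s * ?r"
      using R T1 by (intro mult_right_mono) (auto simp: C_def)
    finally have 1: "norm (\<Sum>j\<in>{1..s}. ?d j) \<le> C * T ^ s * ?r" .
    have "norm (?v ^ (s + 1) * tele (pker \<mu>) (pker \<gamma>) (s + 1) n) \<le> R * T3 ^ (s + 1) * ?r"
      unfolding R_def
      by (rule norm_tele_remainder[OF sk I sg finite_moment_mono[OF \<mu>] finite_moment_mono[OF \<gamma>(1)] _ T3 _ c mix])
         (use eq n in \<open>auto simp: n0_def\<close>)
    also have "\<dots> \<le> C * T3 ^ (s + 1) * ?r"
      using C T3 by (intro mult_right_mono) auto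
    finally have 2: "norm (?v ^ (s + 1) * tele (pker \<mu>) (pker \<gamma>) (s + 1) n) \<le> C * T3 ^ (s + 1) * ?r" .
    have "norm (pker \<mu> ^ n - edgeworth_op s \<gamma> w \<mu> n) \<le> C * T ^ s * ?r + C * T3 ^ (s + 1) * ?r"
      unfolding eq1 by (rule order_trans[OF norm_triangle_ineq add_mono[OF 1 2]])
    also have "\<dots> = C * (T3 ^ (s + 1) + T ^ s) * ?r" by (simp only: distrib_left distrib_right add.commute)
    finally show "norm (pker \<mu> ^ n - edgeworth_op s \<gamma> w \<mu> n) \<le> C * (T3 ^ (s + 1) + T ^ s) * ?r" .
  qed
qed

section \<open>Product densities on \<open>real^'n\<close>\<close>

lemma vec_lambda_measurable:
  "(\<lambda>x. vec_lambda x) \<in> measurable (\<Pi>\<^sub>M i\<in>(UNIV :: 'n::finite set). lborel) (borel :: (real^'n) measure)"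
proof (subst borel_measurable_euclidean_space, rule ballI)
  fix b :: "real^'n" assume "b \<in> Basis"
  then obtain i where "b = axis i 1" by (auto simp: Basis_vec_def)
  then have "(\<lambda>x. vec_lambda x \<bullet> b) = (\<lambda>x. x i)" by (auto simp: inner_axis)
  then show "(\<lambda>x. vec_lambda x \<bullet> b) \<in> borel_measurable (\<Pi>\<^sub>M i\<in>(UNIV :: 'n set). lborel)"
    by simp
qed

text \<open>Lebesgue measure is determined by its values on boxes, and these agree. As an image of a
  product measure it inherits product integration.\<close>

lemma lborel_vec_eq:
  "(lborel :: (real^'n::finite) measure) = distr (\<Pi>\<^sub>M i\<in>UNIV. lborel) borel (\<lambda>x. vec_lambda x)"
proof (rule lborel_eqI)
  interpret product_sigma_finite "\<lambda>_ :: 'n. lborel :: real measure" ..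
  fix l u :: "real^'n" assume lu: "\<And>b. b \<in> Basis \<Longrightarrow> l \<bullet> b \<le> u \<bullet> b"
  have le: "l $ i \<le> u $ i" for i
    using lu[of "axis i 1"] by (auto simp: inner_axis Basis_vec_def)
  have "(\<lambda>x. vec_lambda x) -` box l u \<inter> space (\<Pi>\<^sub>M i\<in>(UNIV :: 'n set). lborel) = (\<Pi>\<^sub>E i\<in>UNIV. {l $ i <..< u $ i})"
    by (auto simp: mem_box_cart space_PiM PiE_iff)
  then have "emeasure (distr (\<Pi>\<^sub>M i\<in>UNIV. lborel) borel (\<lambda>x. vec_lambda x)) (box l u)
      = emeasure (\<Pi>\<^sub>M i\<in>(UNIV :: 'n set). lborel) (\<Pi>\<^sub>E i\<in>UNIV. {l $ i <..< u $ i})"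
    by (subst emeasure_distr[OF vec_lambda_measurable]) auto
  also have "\<dots> = (\<Prod>i\<in>UNIV. ennreal (u $ i - l $ i))"
    by (subst emeasure_PiM) (auto simp: le)
  also have "\<dots> = ennreal (\<Prod>i\<in>UNIV. u $ i - l $ i)"
    by (rule prod_ennreal) (simp add: le)
  also have "(\<Prod>i\<in>UNIV. u $ i - l $ i) = (\<Prod>b\<in>Basis. (u - l) \<bullet> b)"
  proof -
    have B: "Basis = (\<lambda>i. axis i (1::real) :: real^'n) ` UNIV" by (auto simp: Basis_vec_def)
    have inj: "inj (\<lambda>i. axis i (1::real) :: real^'n)" by (auto simp: inj_on_def axis_eq_axis)
    have "(\<Prod>b\<in>Basis. (u - l) \<bullet> b) = (\<Prod>i\<in>UNIV. (u - l) \<bullet> axis i 1)"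
      unfolding B by (subst prod.reindex[OF inj]) (simp add: o_def)
    then show ?thesis by (simp add: inner_axis)
  qed
  finally show "emeasure (distr (\<Pi>\<^sub>M i\<in>UNIV. lborel) borel (\<lambda>x. vec_lambda x)) (box l u)
      = (\<Prod>b\<in>Basis. (u - l) \<bullet> b)" .
qed simp

lemma prod_integrable_vec:
  fixes h :: "'n::finite \<Rightarrow> real \<Rightarrow> real"
  assumes "\<And>i. integrable lborel (h i)"
  shows "integrable lborel (\<lambda>y :: real^'n. \<Prod>i\<in>UNIV. h i (y $ i))"
    and "(LINT y|lborel. (\<Prod>i\<in>UNIV. h i ((y :: real^'n) $ i))) = (\<Prod>i\<in>UNIV. (LINT x|lborel. h i x))"
proof -
  interpret product_sigma_finite "\<lambda>_ :: 'n. lborel :: real measure" ..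
  have [measurable]: "h i \<in> borel_measurable borel" for i
    using borel_measurable_integrable[OF assms[of i]] by simp
  have m: "(\<lambda>y :: real^'n. \<Prod>i\<in>UNIV. h i (y $ i)) \<in> borel_measurable borel"
    by measurable
  show "integrable lborel (\<lambda>y :: real^'n. \<Prod>i\<in>UNIV. h i (y $ i))"
    unfolding lborel_vec_eq
    by (subst integrable_distr_eq[OF vec_lambda_measurable m])
       (use product_integrable_prod[of UNIV h] assms in simp)
  show "(LINT y|lborel. (\<Prod>i\<in>UNIV. h i ((y :: real^'n) $ i))) = (\<Prod>i\<in>UNIV. (LINT x|lborel. h i x))"
    unfolding lborel_vec_eq
    by (subst integral_distr[OF vec_lambda_measurable m])
       (use product_integral_prod[of UNIV h] assms in simp)
qed

section \<open>Differentiating convolutions of bounded functions with smooth densities\<close>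

lemma lborel_integral_shift:
  fixes F :: "real^'n::finite \<Rightarrow> real"
  assumes "F \<in> borel_measurable borel"
  shows "(LINT y|lborel. F (c + y)) = (LINT y|lborel. F y)"
  using integral_distr[of "(+) c" lborel borel F] assms by (simp add: lborel_distr_plus)

lemma lborel_integrable_shift:
  fixes F :: "real^'n::finite \<Rightarrow> real"
  assumes "F \<in> borel_measurable borel" "integrable lborel F"
  shows "integrable lborel (\<lambda>y. F (c + y))"
  using integrable_distr_eq[of "(+) c" lborel borel F] assms by (simp add: lborel_distr_plus)

text \<open>\<open>f\<close> is merely measurable, so translation invariance first moves the shift
  onto \<open>\<psi>\<close>. Then dominated convergence applies, with the majorant supplied by the
  mean value theorem. \<open>\<psi>'\<close> is the derivative along \<open>- v\<close>, which fixes
  the signs from here on.\<close>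

lemma derivative_convolution:
  fixes \<psi> \<psi>' g :: "real^'n::finite \<Rightarrow> real"
  assumes [measurable]: "f \<in> borel_measurable borel" "\<psi>' \<in> borel_measurable borel"
    and f: "\<And>x. \<bar>f x\<bar> \<le> B" and \<psi>: "integrable lborel \<psi>" and g: "integrable lborel g"
    and d: "\<And>z t. ((\<lambda>t. \<psi> (z - t *\<^sub>R v)) has_real_derivative \<psi>' (z - t *\<^sub>R v)) (at t)"
    and dom: "\<And>z t. \<bar>t\<bar> \<le> 1 \<Longrightarrow> \<bar>\<psi>' (z - t *\<^sub>R v)\<bar> \<le> g z"
  shows "((\<lambda>t. LINT y|lborel. f (x + t *\<^sub>R v + y) * \<psi> y) has_real_derivative
           (LINT y|lborel. f (x + y) * \<psi>' y)) (at 0)"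
proof -
  have [measurable]: "\<psi> \<in> borel_measurable borel" "g \<in> borel_measurable borel"
    using borel_measurable_integrable[OF \<psi>] borel_measurable_integrable[OF g] by auto
  have B0: "0 \<le> B" using f[of 0] by linarith
  define F where "F t = (LINT y|lborel. f (x + t *\<^sub>R v + y) * \<psi> y)" for t
  have F: "F t = (LINT y|lborel. f (x + y) * \<psi> (y - t *\<^sub>R v))" for t
    using lborel_integral_shift[of "\<lambda>y. f (x + y) * \<psi> (y - t *\<^sub>R v)" "t *\<^sub>R v"]
    by (simp add: F_def add.assoc)
  have \<psi>t: "integrable lborel (\<lambda>y. \<psi> (y - t *\<^sub>R v))" for t
    using lborel_integrable_shift[of \<psi> "- (t *\<^sub>R v)"] \<psi> by simp
  have int: "integrable lborel (\<lambda>y. f (x + y) * \<psi> (y - t *\<^sub>R v))" for t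
    by (rule Bochner_Integration.integrable_bound[where f = "\<lambda>y. B * \<psi> (y - t *\<^sub>R v)"])
       (use \<psi>t f B0 in \<open>auto simp: abs_mult intro!: mult_right_mono\<close>)
  have mvt: "\<bar>\<psi> (y - h *\<^sub>R v) - \<psi> y\<bar> \<le> \<bar>h\<bar> * g y" if "\<bar>h\<bar> \<le> 1" for y h
  proof -
    have "\<exists>\<xi>. \<bar>\<xi>\<bar> \<le> 1 \<and> \<psi> (y - h *\<^sub>R v) - \<psi> y = h * \<psi>' (y - \<xi> *\<^sub>R v)"
    proof (cases "h = 0")
      case False
      consider "h > 0" | "h < 0" using False by linarith
      then show ?thesis
      proof cases
        case 1
        from MVT2[of 0 h "\<lambda>t. \<psi> (y - t *\<^sub>R v)" "\<lambda>t. \<psi>' (y - t *\<^sub>R v)"] 1 d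
        obtain z where "0 < z" "z < h" "\<psi> (y - h *\<^sub>R v) - \<psi> (y - 0 *\<^sub>R v) = (h - 0) * \<psi>' (y - z *\<^sub>R v)"
          by blast
        then show ?thesis using that by (intro exI[of _ z]) auto
      next
        case 2
        from MVT2[of h 0 "\<lambda>t. \<psi> (y - t *\<^sub>R v)" "\<lambda>t. \<psi>' (y - t *\<^sub>R v)"] 2 d
        obtain z where "h < z" "z < 0" "\<psi> (y - 0 *\<^sub>R v) - \<psi> (y - h *\<^sub>R v) = (0 - h) * \<psi>' (y - z *\<^sub>R v)"
          by blast
        then show ?thesis using that by (intro exI[of _ z]) (auto simp: algebra_simps)
      qed
    qed (auto intro: exI[of _ 0])
    then show ?thesis using dom by (auto simp: abs_mult intro!: mult_left_mono)
  qed
  have "((\<lambda>h. (F (0 + h) - F 0) / h) \<longlongrightarrow> (LINT y|lborel. f (x + y) * \<psi>' y)) (at 0)"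
    unfolding tendsto_at_iff_sequentially o_def
  proof (intro allI impI)
    fix X :: "nat \<Rightarrow> real" assume X0: "\<forall>i. X i \<in> UNIV - {0}" and X: "X \<longlonglongrightarrow> 0"
    have "\<forall>\<^sub>F n in sequentially. \<bar>X n\<bar> < 1"
      using tendstoD[OF X, of 1] by simp
    then obtain N where N: "\<And>n. N \<le> n \<Longrightarrow> \<bar>X n\<bar> < 1" by (auto simp: eventually_sequentially)
    show "(\<lambda>n. (F (0 + X n) - F 0) / X n) \<longlonglongrightarrow> (LINT y|lborel. f (x + y) * \<psi>' y)"
    \<comment> \<open>The majorant covers only shifts of size at most one, so the first
      \<open>N\<close> terms are dropped.\<close>
    proof (rule LIMSEQ_offset[of _ N])
      have eq: "(F (0 + X n) - F 0) / X n = (LINT y|lborel. f (x + y) * ((\<psi> (y - X n *\<^sub>R v) - \<psi> y) / X n))" for n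
      proof -
        have "F (X n) - F 0 = (LINT y|lborel. f (x + y) * (\<psi> (y - X n *\<^sub>R v) - \<psi> y))"
          using int[of "X n"] int[of 0] by (simp add: F right_diff_distrib)
        then show ?thesis by simp
      qed
      show "(\<lambda>n. (F (0 + X (n + N)) - F 0) / X (n + N)) \<longlonglongrightarrow> (LINT y|lborel. f (x + y) * \<psi>' y)"
        unfolding eq
      proof (rule integral_dominated_convergence[where w = "\<lambda>y. B * g y"])
        show "AE y in lborel. (\<lambda>n. f (x + y) * ((\<psi> (y - X (n + N) *\<^sub>R v) - \<psi> y) / X (n + N))) \<longlonglongrightarrow> f (x + y) * \<psi>' y"
        proof (rule AE_I2, rule tendsto_mult_left)
          fix y
          have "((\<lambda>h. (\<psi> (y - h *\<^sub>R v) - \<psi> y) / h) \<longlongrightarrow> \<psi>' y) (at 0)"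
            using d[of y 0] by (simp add: has_field_derivative_iff)
          then have "(\<lambda>n. (\<psi> (y - X n *\<^sub>R v) - \<psi> y) / X n) \<longlonglongrightarrow> \<psi>' y"
            using X0 X unfolding tendsto_at_iff_sequentially o_def by blast
          then show "(\<lambda>n. (\<psi> (y - X (n + N) *\<^sub>R v) - \<psi> y) / X (n + N)) \<longlonglongrightarrow> \<psi>' y"
            by (rule LIMSEQ_ignore_initial_segment)
        qed
        show "AE y in lborel. norm (f (x + y) * ((\<psi> (y - X (n + N) *\<^sub>R v) - \<psi> y) / X (n + N))) \<le> B * g y" for n
        proof (rule AE_I2)
          fix y
          have bd: "\<bar>(\<psi> (y - X (n + N) *\<^sub>R v) - \<psi> y) / X (n + N)\<bar> \<le> g y"
            using mvt[of "X (n + N)" y] N[of "n + N"] X0 by (simp add: field_simps)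
          show "norm (f (x + y) * ((\<psi> (y - X (n + N) *\<^sub>R v) - \<psi> y) / X (n + N))) \<le> B * g y"
            unfolding real_norm_def abs_mult by (intro mult_mono f bd B0) simp
        qed
      qed (use g in auto)
    qed
  qed
  then show ?thesis unfolding has_field_derivative_iff F_def by simp
qed

text \<open>A majorant is required for every range \<open>a\<close> of shifts because the direction
  \<open>v\<close> is not normalized.\<close>

definition dominated_pair :: "(real \<Rightarrow> real) \<Rightarrow> (real \<Rightarrow> real) \<Rightarrow> bool" where
  "dominated_pair h h' \<longleftrightarrow> h' \<in> borel_measurable borel \<and> (\<forall>x. (h has_real_derivative h' x) (at x)) \<and>
     (\<forall>a. \<exists>G. integrable lborel G \<and> (\<forall>x s. \<bar>s\<bar> \<le> a \<longrightarrow> \<bar>h (x - s)\<bar> \<le> G x \<and> \<bar>h' (x - s)\<bar> \<le> G x))"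

lemma dominated_pair_integrable:
  assumes "dominated_pair h h'"
  shows "integrable lborel h" "integrable lborel h'" "h \<in> borel_measurable borel" "h' \<in> borel_measurable borel"
proof -
  have "isCont h x" for x using assms by (auto simp: dominated_pair_def intro: DERIV_isCont)
  then show m: "h \<in> borel_measurable borel"
    by (intro borel_measurable_continuous_onI) (simp add: continuous_at_imp_continuous_on)
  show m': "h' \<in> borel_measurable borel" using assms by (simp add: dominated_pair_def)
  obtain G where G: "integrable lborel G" "\<And>x. \<bar>h x\<bar> \<le> G x \<and> \<bar>h' x\<bar> \<le> G x"
    using assms unfolding dominated_pair_def by (metis abs_zero diff_zero order_refl)
  show "integrable lborel h" "integrable lborel h'"
    by (rule Bochner_Integration.integrable_bound[OF G(1)],
        use m m' G(2) in \<open>auto intro!: order_trans[OF _ abs_ge_self]\<close>)+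
qed

text \<open>By the product rule each partial derivative is again a product, with one
  \<open>h i\<close> replaced by \<open>h' i\<close>, so integrability and domination can be checked
  coordinate by coordinate.\<close>

lemma product_derivative_convolution:
  fixes h h' :: "'n::finite \<Rightarrow> real \<Rightarrow> real"
  assumes h: "\<And>i. dominated_pair (h i) (h' i)"
    and [measurable]: "f \<in> borel_measurable borel" and f: "\<And>x. \<bar>f x\<bar> \<le> B"
  shows "((\<lambda>t. LINT y|lborel. f (x + t *\<^sub>R v + y) * (\<Prod>i\<in>UNIV. h i (y $ i))) has_real_derivative
     (\<Sum>i\<in>UNIV. v $ i * (LINT y|lborel. f (x + y) * - (h' i (y $ i) * (\<Prod>j\<in>UNIV - {i}. h j (y $ j)))))) (at 0)"
proof -
  note hm[measurable] = dominated_pair_integrable(3,4)[OF h]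
  define P where "P i y = h' i (y $ i) * (\<Prod>j\<in>UNIV - {i}. h j (y $ j))" for i and y :: "real^'n"
  have P: "P i y = (\<Prod>j\<in>UNIV. (if j = i then h' j else h j) (y $ j))" for i y
    unfolding P_def by (subst prod.remove[of UNIV i]) auto
  have Pm[measurable]: "P i \<in> borel_measurable borel" for i
    unfolding P_def[abs_def] by measurable
  have Pint: "integrable lborel (P i)" for i
    unfolding P[abs_def] using dominated_pair_integrable(1,2)[OF h] by (intro prod_integrable_vec) auto
  have "\<exists>G. integrable lborel G \<and> (\<forall>x s. \<bar>s\<bar> \<le> norm v \<longrightarrow> \<bar>h i (x - s)\<bar> \<le> G x \<and> \<bar>h' i (x - s)\<bar> \<le> G x)" for i
    using h[of i] unfolding dominated_pair_def by blast
  then obtain G where G: "\<And>i. integrable lborel (G i)"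
    "\<And>i x s. \<bar>s\<bar> \<le> norm v \<Longrightarrow> \<bar>h i (x - s)\<bar> \<le> G i x \<and> \<bar>h' i (x - s)\<bar> \<le> G i x" by metis
  let ?\<psi> = "\<lambda>y :: real^'n. \<Prod>i\<in>UNIV. h i (y $ i)"
  let ?\<psi>' = "\<lambda>y :: real^'n. \<Sum>i\<in>UNIV. - v $ i * P i y"
  have "((\<lambda>t. LINT y|lborel. f (x + t *\<^sub>R v + y) * ?\<psi> y) has_real_derivative
           (LINT y|lborel. f (x + y) * ?\<psi>' y)) (at 0)"
  proof (rule derivative_convolution[where g = "\<lambda>y. (\<Sum>i\<in>UNIV. \<bar>v $ i\<bar>) * (\<Prod>j\<in>UNIV. G j (y $ j))"])
    show "integrable lborel ?\<psi>"
      by (intro prod_integrable_vec dominated_pair_integrable(1)[OF h])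
    show "integrable lborel (\<lambda>y :: real^'n. (\<Sum>i\<in>UNIV. \<bar>v $ i\<bar>) * (\<Prod>j\<in>UNIV. G j (y $ j)))"
      by (intro integrable_mult_right prod_integrable_vec G)
    show "((\<lambda>t. ?\<psi> (z - t *\<^sub>R v)) has_real_derivative ?\<psi>' (z - t *\<^sub>R v)) (at t)" for z t
    proof -
      have d: "((\<lambda>t. h i (z $ i - t * v $ i)) has_real_derivative h' i (z $ i - t * v $ i) * (- v $ i)) (at t)" for i
        using h[of i] by (intro DERIV_chain2[where f = "h i"]) (auto simp: dominated_pair_def intro!: derivative_eq_intros)
      from has_field_derivative_prod[where A = UNIV, OF d]
      show ?thesis by (simp add: P_def mult_ac)
    qed
    show "\<bar>?\<psi>' (z - t *\<^sub>R v)\<bar> \<le> (\<Sum>i\<in>UNIV. \<bar>v $ i\<bar>) * (\<Prod>j\<in>UNIV. G j (z $ j))" if t: "\<bar>t\<bar> \<le> 1" for z t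
    proof -
      have s: "\<bar>t * v $ j\<bar> \<le> norm v" for j
        using mult_mono[OF t component_le_norm_cart[of v j]] by (simp add: abs_mult)
      have "\<bar>P i (z - t *\<^sub>R v)\<bar> \<le> (\<Prod>j\<in>UNIV. G j (z $ j))" for i
        unfolding P abs_prod using G(2)[OF s] by (intro prod_mono) auto
      then have "\<bar>?\<psi>' (z - t *\<^sub>R v)\<bar> \<le> (\<Sum>i\<in>UNIV. \<bar>v $ i\<bar> * (\<Prod>j\<in>UNIV. G j (z $ j)))"
        by (intro order_trans[OF sum_abs] sum_mono) (auto simp: abs_mult mult_left_mono)
      then show ?thesis by (simp add: sum_distrib_right)
    qed
  qed (use f in auto)
  also have "(LINT y|lborel. f (x + y) * ?\<psi>' y) = (\<Sum>i\<in>UNIV. v $ i * (LINT y|lborel. f (x + y) * - P i y))"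
  proof -
    have i: "integrable lborel (\<lambda>y. f (x + y) * P i y)" for i
      by (rule Bochner_Integration.integrable_bound[where f = "\<lambda>y. B * P i y"])
         (use Pint f order_trans[OF abs_ge_zero f] in \<open>auto simp: abs_mult intro!: mult_right_mono\<close>)
    have "(LINT y|lborel. f (x + y) * ?\<psi>' y) = (LINT y|lborel. (\<Sum>i\<in>UNIV. - v $ i * (f (x + y) * P i y)))"
      by (simp add: sum_distrib_left mult_ac)
    also have "\<dots> = (\<Sum>i\<in>UNIV. - v $ i * (LINT y|lborel. f (x + y) * P i y))"
      using i by (subst Bochner_Integration.integral_sum) auto
    finally show ?thesis by simp
  qed
  finally show ?thesis by (simp add: P_def)
qed

section \<open>The Gaussian kernel\<close>

text \<open>The probabilists' Hermite polynomials, normalized to leading coefficient one;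
  differentiating polynomial times Gaussian gives this recursion.\<close>

fun hermite :: "nat \<Rightarrow> real poly" where
  "hermite 0 = [:1:]"
| "hermite (Suc k) = pCons 0 (hermite k) - pderiv (hermite k)"

lemma degree_hermite: "degree (hermite k) \<le> k"
proof (induct k)
  case (Suc k)
  have "degree (pCons 0 (hermite k)) \<le> Suc k"
    using Suc degree_pCons_le[of 0 "hermite k"] by linarith
  moreover have "degree (pderiv (hermite k)) \<le> Suc k"
    using Suc degree_pderiv[of "hermite k"] by simp
  ultimately show ?case by (simp add: degree_diff_le)
qed simp

text \<open>\<open>gh t k\<close> is, up to the sign \<open>(-1) ^ k\<close>, the \<open>k\<close>-th derivative of the centred normal
  density with variance \<open>t\<close>.\<close>

definition gh :: "real \<Rightarrow> nat \<Rightarrow> real \<Rightarrow> real" where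
  "gh t k x = (1 / sqrt t) ^ k * poly (hermite k) (x / sqrt t) * normal_density 0 (sqrt t) x"

lemma gh_deriv:
  assumes t: "t > 0"
  shows "(gh t k has_real_derivative - gh t (Suc k) x) (at x)"
proof -
  let ?r = "1 / sqrt t" and ?p = "hermite k"
  have N: "(normal_density 0 (sqrt t) has_real_derivative normal_density 0 (sqrt t) x * (- x / t)) (at x)"
  proof -
    define c where "c = 1 / sqrt (2 * pi * t)"
    have nd: "normal_density 0 (sqrt t) = (\<lambda>x. c * exp (- (x * x) / (2 * t)))"
      using t by (auto simp: normal_density_def c_def power2_eq_square)
    show ?thesis unfolding nd using t by (auto intro!: derivative_eq_intros)
  qed
  have P: "((\<lambda>x. poly ?p (x / sqrt t)) has_real_derivative poly (pderiv ?p) (x / sqrt t) * ?r) (at x)"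
    by (rule DERIV_chain2[OF poly_DERIV]) (rule DERIV_cdivide[OF DERIV_ident])
  have D: "(gh t k has_real_derivative
     ?r ^ k * (poly (pderiv ?p) (x / sqrt t) * ?r * normal_density 0 (sqrt t) x
       + poly ?p (x / sqrt t) * (normal_density 0 (sqrt t) x * (- x / t)))) (at x)"
    unfolding gh_def[abs_def] mult.assoc
    by (rule DERIV_cmult) (use DERIV_mult[OF P N] in \<open>simp add: algebra_simps\<close>)
  show ?thesis
    by (rule DERIV_cong[OF D]) (use t in \<open>simp add: gh_def algebra_simps\<close>)
qed

text \<open>Each \<open>pCons\<close> multiplies by \<open>y\<close>, which is paid for with half of
  the exponent; hence \<open>c\<close> is arbitrary in the induction.\<close>

lemma poly_abs_le_exp: "0 < c \<Longrightarrow> \<exists>C\<ge>0. \<forall>y. \<bar>poly p y\<bar> \<le> C * exp (c * y\<^sup>2)" for c :: real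
proof (induct p arbitrary: c)
  case 0
  then show ?case by (intro exI[of _ 0]) auto
next
  case (pCons a p)
  obtain C where C: "C \<ge> 0" "\<And>y. \<bar>poly p y\<bar> \<le> C * exp (c / 2 * y\<^sup>2)"
    using pCons(2)[of "c / 2"] pCons(3) by auto
  have y: "\<bar>y\<bar> \<le> (1 + 2 / c) * exp (c / 2 * y\<^sup>2)" for y
  proof -
    have "\<bar>y\<bar> \<le> 1 + y\<^sup>2" using zero_le_power2[of "\<bar>y\<bar> - 1"] zero_le_power2[of y]
      by (simp add: power2_eq_square algebra_simps abs_mult_self_eq)
    also have "\<dots> \<le> (1 + 2 / c) * (1 + c / 2 * y\<^sup>2)"
      using pCons(3) by (simp add: field_simps)
    also have "\<dots> \<le> (1 + 2 / c) * exp (c / 2 * y\<^sup>2)"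
      using pCons(3) exp_ge_add_one_self[of "c / 2 * y\<^sup>2"] by (intro mult_left_mono) auto
    finally show ?thesis .
  qed
  show ?case
  proof (intro exI[of _ "\<bar>a\<bar> + (1 + 2 / c) * C"] conjI allI)
    fix y
    have e: "exp (c / 2 * y\<^sup>2) * exp (c / 2 * y\<^sup>2) = exp (c * y\<^sup>2)" by (simp flip: exp_add)
    have "\<bar>poly (pCons a p) y\<bar> \<le> \<bar>a\<bar> + \<bar>y\<bar> * \<bar>poly p y\<bar>"
      using abs_triangle_ineq[of a "y * poly p y"] by (simp add: abs_mult)
    also have "\<dots> \<le> \<bar>a\<bar> * exp (c * y\<^sup>2) + ((1 + 2 / c) * exp (c / 2 * y\<^sup>2)) * (C * exp (c / 2 * y\<^sup>2))"
    proof (intro add_mono mult_mono y C)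
      show "\<bar>a\<bar> \<le> \<bar>a\<bar> * exp (c * y\<^sup>2)" using pCons(3) mult_left_mono[of 1 "exp (c * y\<^sup>2)" "\<bar>a\<bar>"] by simp
    qed (use pCons(3) in auto)
    also have "\<dots> = \<bar>a\<bar> * exp (c * y\<^sup>2) + (1 + 2 / c) * C * (exp (c / 2 * y\<^sup>2) * exp (c / 2 * y\<^sup>2))"
      by (simp only: mult_ac)
    also have "\<dots> = (\<bar>a\<bar> + (1 + 2 / c) * C) * exp (c * y\<^sup>2)"
      unfolding e by (simp add: algebra_simps)
    finally show "\<bar>poly (pCons a p) y\<bar> \<le> (\<bar>a\<bar> + (1 + 2 / c) * C) * exp (c * y\<^sup>2)" .
  qed (use C pCons(3) in auto)
qed

text \<open>Half of the Gaussian exponent absorbs the polynomial, and half of the rest absorbs the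
  shift through \<open>x\<^sup>2 \<le> 2 * (x - s)\<^sup>2 + 2 * s\<^sup>2\<close>. The majorant is
  a multiple of the normal density of variance \<open>4 * t\<close>.\<close>

lemma gh_bound:
  assumes t: "t > 0"
  shows "\<exists>G. integrable lborel G \<and> (\<forall>x s. \<bar>s\<bar> \<le> a \<longrightarrow> \<bar>gh t k (x - s)\<bar> \<le> G x)"
proof -
  obtain C where C: "C \<ge> 0" "\<And>y. \<bar>poly (hermite k) y\<bar> \<le> C * exp (1 / 4 * y\<^sup>2)"
    using poly_abs_le_exp[of "1 / 4" "hermite k"] by auto
  define D where "D = (1 / sqrt t) ^ k * C / sqrt (2 * pi * t) * exp (a\<^sup>2 / (4 * t))"
  have D0: "0 \<le> D" using C t by (simp add: D_def)
  have bound: "\<bar>gh t k (x - s)\<bar> \<le> D * exp (- x\<^sup>2 / (8 * t))" if s: "\<bar>s\<bar> \<le> a" for x s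
  proof -
    let ?y = "x - s"
    have sa: "s\<^sup>2 \<le> a\<^sup>2" using s by (metis abs_ge_zero order_trans power2_abs power_mono)
    have "x\<^sup>2 \<le> 2 * ?y\<^sup>2 + 2 * s\<^sup>2"
      using zero_le_power2[of "x - 2 * s"] by (simp add: power2_eq_square algebra_simps)
    then have "- ?y\<^sup>2 / (4 * t) \<le> a\<^sup>2 / (4 * t) + - x\<^sup>2 / (8 * t)"
      using t sa by (simp add: field_simps)
    then have e: "exp (- ?y\<^sup>2 / (4 * t)) \<le> exp (a\<^sup>2 / (4 * t)) * exp (- x\<^sup>2 / (8 * t))"
      by (simp flip: exp_add)
    have "\<bar>gh t k ?y\<bar> = (1 / sqrt t) ^ k * \<bar>poly (hermite k) (?y / sqrt t)\<bar> * (1 / sqrt (2 * pi * t) * exp (- ?y\<^sup>2 / (2 * t)))"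
      using t by (simp add: gh_def normal_density_def abs_mult)
    also have "\<dots> \<le> (1 / sqrt t) ^ k * (C * exp (1 / 4 * (?y / sqrt t)\<^sup>2)) * (1 / sqrt (2 * pi * t) * exp (- ?y\<^sup>2 / (2 * t)))"
      using t C(1) by (intro mult_mono C) auto
    also have "\<dots> = (1 / sqrt t) ^ k * C / sqrt (2 * pi * t) * (exp (1 / 4 * (?y / sqrt t)\<^sup>2) * exp (- ?y\<^sup>2 / (2 * t)))"
      by simp
    also have "exp (1 / 4 * (?y / sqrt t)\<^sup>2) * exp (- ?y\<^sup>2 / (2 * t)) = exp (- ?y\<^sup>2 / (4 * t))"
      using t by (simp add: power_divide field_simps flip: exp_add)
    also have "(1 / sqrt t) ^ k * C / sqrt (2 * pi * t) * exp (- ?y\<^sup>2 / (4 * t)) \<le> (1 / sqrt t) ^ k * C / sqrt (2 * pi * t) * (exp (a\<^sup>2 / (4 * t)) * exp (- x\<^sup>2 / (8 * t)))"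
      using C t by (intro mult_left_mono e) auto
    finally show ?thesis by (simp add: D_def)
  qed
  have "integrable lborel (\<lambda>x. D * sqrt (2 * pi * (4 * t)) * normal_density 0 (2 * sqrt t) x)"
    by (intro integrable_mult_right integrable_normal_density) (use t in simp)
  moreover have "D * sqrt (2 * pi * (4 * t)) * normal_density 0 (2 * sqrt t) x = D * exp (- x\<^sup>2 / (8 * t))" for x
    using t by (simp add: normal_density_def power_mult_distrib)
  ultimately have "integrable lborel (\<lambda>x. D * exp (- x\<^sup>2 / (8 * t)))" by (simp only:)
  then show ?thesis using bound by (intro exI[of _ "\<lambda>x. D * exp (- x\<^sup>2 / (8 * t))"]) auto
qed

lemma gh_measurable [measurable]: "gh t k \<in> borel_measurable borel"
proof -
  have "poly (hermite k) \<in> borel_measurable borel"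
    by (intro borel_measurable_continuous_onI continuous_intros)
  then have "(\<lambda>x. poly (hermite k) (x / sqrt t)) \<in> borel_measurable borel"
    by (rule measurable_compose[rotated]) measurable
  then show ?thesis unfolding gh_def[abs_def] by measurable
qed

lemma gh_dominated_pair:
  assumes t: "t > 0"
  shows "dominated_pair (gh t k) (\<lambda>x. - gh t (Suc k) x)"
  unfolding dominated_pair_def
proof (intro conjI allI)
  show "(\<lambda>x. - gh t (Suc k) x) \<in> borel_measurable borel" by measurable
  show "(gh t k has_real_derivative - gh t (Suc k) x) (at x)" for x by (rule gh_deriv[OF t])
  fix a
  obtain G1 where G1: "integrable lborel G1" "\<And>x s. \<bar>s\<bar> \<le> a \<Longrightarrow> \<bar>gh t k (x - s)\<bar> \<le> G1 x"
    using gh_bound[OF t] by blast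
  obtain G2 where G2: "integrable lborel G2" "\<And>x s. \<bar>s\<bar> \<le> a \<Longrightarrow> \<bar>gh t (Suc k) (x - s)\<bar> \<le> G2 x"
    using gh_bound[OF t] by blast
  show "\<exists>G. integrable lborel G \<and> (\<forall>x s. \<bar>s\<bar> \<le> a \<longrightarrow> \<bar>gh t k (x - s)\<bar> \<le> G x \<and> \<bar>- gh t (Suc k) (x - s)\<bar> \<le> G x)"
  proof (intro exI[of _ "\<lambda>x. \<bar>G1 x\<bar> + \<bar>G2 x\<bar>"] conjI allI impI)
    show "integrable lborel (\<lambda>x. \<bar>G1 x\<bar> + \<bar>G2 x\<bar>)" using G1 G2 by simp
    fix x s assume "\<bar>s\<bar> \<le> a"
    then have "\<bar>gh t k (x - s)\<bar> \<le> G1 x" "\<bar>gh t (Suc k) (x - s)\<bar> \<le> G2 x" using G1 G2 by auto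
    then show "\<bar>gh t k (x - s)\<bar> \<le> \<bar>G1 x\<bar> + \<bar>G2 x\<bar>" "\<bar>- gh t (Suc k) (x - s)\<bar> \<le> \<bar>G1 x\<bar> + \<bar>G2 x\<bar>"
      by linarith+
  qed
qed

lemma gh_integrable: "t > 0 \<Longrightarrow> integrable lborel (gh t k)"
  using dominated_pair_integrable(1)[OF gh_dominated_pair] .

lemma gh_0: "gh t 0 x = normal_density 0 (sqrt t) x"
  by (simp add: gh_def)

lemma std_gauss_density_gh: "std_gauss_density y = (\<Prod>i\<in>UNIV. gh 1 0 (y $ i))"
  by (simp add: std_gauss_density_def gh_0)

lemma std_gauss_density_nonneg [simp]: "0 \<le> std_gauss_density y"
  by (simp add: std_gauss_density_def prod_nonneg)

lemma std_gauss_density_measurable [measurable]: "std_gauss_density \<in> borel_measurable borel"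
  unfolding std_gauss_density_def[abs_def] by measurable

lemma std_gauss_density_integrable:
  "integrable lborel (std_gauss_density :: real^'n::finite \<Rightarrow> real)"
  "(LINT y|lborel. std_gauss_density (y :: real^'n)) = 1"
  using prod_integrable_vec[of "\<lambda>_ :: 'n. std_normal_density"]
  by (simp_all add: std_gauss_density_def[abs_def])

section \<open>The standard Gaussian law and its score\<close>

definition gaussian :: "(real^'n::finite) measure" where
  "gaussian = density lborel std_gauss_density"

lemma prob_space_density:
  fixes \<psi> :: "real^'n::finite \<Rightarrow> real"
  assumes "integrable lborel \<psi>" "\<And>y. 0 \<le> \<psi> y" "(LINT y|lborel. \<psi> y) = 1"
  shows "prob_space (density lborel \<psi>)"
proof
  have "emeasure (density lborel \<psi>) (space (density lborel \<psi>)) = (\<integral>\<^sup>+ y. \<psi> y \<partial>lborel)"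
    using borel_measurable_integrable[OF assms(1)] by (simp add: emeasure_density)
  also have "\<dots> = 1" using assms by (simp add: nn_integral_eq_integral)
  finally show "emeasure (density lborel \<psi>) (space (density lborel \<psi>)) = 1" .
qed

lemma gaussian_prob: "prob_space gaussian" and sets_gaussian [simp, measurable_cong]: "sets gaussian = sets borel"
  unfolding gaussian_def by (rule prob_space_density) (auto simp: std_gauss_density_integrable)

lemma gaussian_integral:
  assumes "g \<in> borel_measurable borel"
  shows "(LINT y|gaussian. g y) = (LINT y|lborel. std_gauss_density y * g y)"
    "integrable gaussian g \<longleftrightarrow> integrable lborel (\<lambda>y. std_gauss_density y * g y)"
  using assms unfolding gaussian_def by (auto simp: integral_density integrable_density)

lemma gaussian_coord_integral:
  fixes p :: "'n::finite \<Rightarrow> real \<Rightarrow> real"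
  assumes "\<And>i. p i \<in> borel_measurable borel" "\<And>i. integrable lborel (\<lambda>x. std_normal_density x * p i x)"
  shows "integrable gaussian (\<lambda>y. \<Prod>i\<in>UNIV. p i (y $ i))"
    "(LINT y|gaussian. (\<Prod>i\<in>UNIV. p i (y $ i))) = (\<Prod>i\<in>UNIV. (LINT x|lborel. std_normal_density x * p i x))"
  using prod_integrable_vec[of "\<lambda>i x. std_normal_density x * p i x", OF assms(2)] assms(1)
  by (simp_all add: gaussian_integral std_gauss_density_def prod.distrib)

lemma std_normal_integrals:
  "(LINT x|lborel. std_normal_density x * x) = 0"
  "(LINT x|lborel. std_normal_density x * x\<^sup>2) = 1"
  "integrable lborel (\<lambda>x. std_normal_density x * x)"
  "integrable lborel (\<lambda>x. std_normal_density x * x\<^sup>2)"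
  using integral_std_normal_moment_odd[of 0] integral_std_normal_moment_even[of 1]
    integrable_std_normal_moment[of 1] integrable_std_normal_moment[of 2] by simp_all

lemma gaussian_coord_power:
  fixes i :: "'n::finite"
  shows "integrable gaussian (\<lambda>y :: real^'n. \<bar>y $ i\<bar> ^ q)" "integrable gaussian (\<lambda>y :: real^'n. (y $ i) ^ q)"
    "(LINT y|gaussian. ((y :: real^'n) $ i) ^ q) = (LINT x|lborel. std_normal_density x * x ^ q)"
proof -
  have eq: "(\<Prod>j\<in>UNIV. (if j = i then g else (\<lambda>_. 1)) (y $ j)) = (g (y $ i) :: real)" for g and y :: "real^'n"
    by (subst prod.remove[of UNIV i]) auto
  have eq': "(\<Prod>j\<in>UNIV. (LINT x|lborel. std_normal_density x * (if j = i then g else (\<lambda>_. 1)) x))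
      = (LINT x|lborel. std_normal_density x * g x)" for g
    by (subst prod.remove[of UNIV i]) auto
  show "integrable gaussian (\<lambda>y :: real^'n. \<bar>y $ i\<bar> ^ q)"
    using gaussian_coord_integral(1)[of "\<lambda>j. if j = i then (\<lambda>x. \<bar>x\<bar> ^ q) else (\<lambda>_. 1)"]
      integrable_std_normal_moment_abs[of q] unfolding eq by auto
  show "integrable gaussian (\<lambda>y :: real^'n. (y $ i) ^ q)"
    using gaussian_coord_integral(1)[of "\<lambda>j. if j = i then (\<lambda>x. x ^ q) else (\<lambda>_. 1)"]
      integrable_std_normal_moment[of q] unfolding eq by auto
  show "(LINT y|gaussian. ((y :: real^'n) $ i) ^ q) = (LINT x|lborel. std_normal_density x * x ^ q)"
    using gaussian_coord_integral(2)[of "\<lambda>j. if j = i then (\<lambda>x. x ^ q) else (\<lambda>_. 1)"]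
      integrable_std_normal_moment[of q] unfolding eq eq' by auto
qed

text \<open>The norm is at most the dimension times the largest coordinate, so one-dimensional
  absolute moments suffice.\<close>

lemma gaussian_finite_moment: "finite_moment q (gaussian :: (real^'n::finite) measure)"
proof -
  have "integrable gaussian (\<lambda>y :: real^'n. norm y ^ q)"
  proof (rule Bochner_Integration.integrable_bound[where f = "\<lambda>y. real CARD('n) ^ q * (\<Sum>i\<in>UNIV. \<bar>y $ i\<bar> ^ q)"])
    show "integrable gaussian (\<lambda>y :: real^'n. real CARD('n) ^ q * (\<Sum>i\<in>UNIV. \<bar>y $ i\<bar> ^ q))"
      by (intro integrable_mult_right Bochner_Integration.integrable_sum gaussian_coord_power)
    show "AE y in gaussian. norm (norm (y :: real^'n) ^ q) \<le> norm (real CARD('n) ^ q * (\<Sum>i\<in>UNIV. \<bar>y $ i\<bar> ^ q))"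
    proof (rule AE_I2)
      fix y :: "real^'n"
      obtain i where i: "\<And>j. \<bar>y $ j\<bar> \<le> \<bar>y $ i\<bar>"
      proof -
        have "Max (range (\<lambda>j. \<bar>y $ j\<bar>)) \<in> range (\<lambda>j. \<bar>y $ j\<bar>)" by (rule Max_in) auto
        then obtain i where "Max (range (\<lambda>j. \<bar>y $ j\<bar>)) = \<bar>y $ i\<bar>" by (rule rangeE)
        then have "\<bar>y $ j\<bar> \<le> \<bar>y $ i\<bar>" for j using Max_ge[of "range (\<lambda>j. \<bar>y $ j\<bar>)" "\<bar>y $ j\<bar>"] by auto
        then show ?thesis by (rule that)
      qed
      have "norm y \<le> (\<Sum>j\<in>UNIV. \<bar>y $ j\<bar>)" by (rule norm_le_l1_cart)
      also have "\<dots> \<le> real CARD('n) * \<bar>y $ i\<bar>" using sum_bounded_above[of UNIV "\<lambda>j. \<bar>y $ j\<bar>", OF i] by simp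
      finally have "norm y ^ q \<le> (real CARD('n) * \<bar>y $ i\<bar>) ^ q" by (rule power_mono) simp
      also have "\<dots> \<le> real CARD('n) ^ q * (\<Sum>j\<in>UNIV. \<bar>y $ j\<bar> ^ q)"
        unfolding power_mult_distrib by (intro mult_left_mono member_le_sum) auto
      finally show "norm (norm y ^ q) \<le> norm (real CARD('n) ^ q * (\<Sum>j\<in>UNIV. \<bar>y $ j\<bar> ^ q))"
        by (simp add: sum_nonneg)
    qed
  qed measurable
  then show ?thesis by (simp add: finite_moment_def gaussian_prob)
qed

lemma gaussian_moment_1: "moment gaussian [i] = 0"
  using gaussian_coord_power(3)[of i 1] std_normal_integrals by (simp add: moment_def)

lemma gaussian_moment_2: "moment gaussian [i, j] = (if i = j then 1 else 0)"
proof (cases "i = j")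
  case True
  then show ?thesis
    using gaussian_coord_power(3)[of i 2] std_normal_integrals by (simp add: moment_def power2_eq_square)
next
  case False
  let ?p = "\<lambda>k. if k = i \<or> k = j then (\<lambda>x :: real. x) else (\<lambda>_. 1)"
  have "(\<Prod>k\<in>UNIV. ?p k (y $ k)) = y $ i * y $ j" for y
    using False by (subst prod.remove[of UNIV i]; simp; subst prod.remove[of _ j]; simp)
  moreover have "(\<Prod>k\<in>UNIV. (LINT x|lborel. std_normal_density x * ?p k x)) = 0"
    using std_normal_integrals by (intro prod_zero) (auto intro: exI[of _ i])
  ultimately show ?thesis
    using False gaussian_coord_integral(2)[of ?p] std_normal_integrals(3) by (simp add: moment_def)
qed

lemma density_ker_apply:
  fixes \<psi> w :: "real^'n::finite \<Rightarrow> real"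
  assumes "integrable lborel \<psi>" "\<And>y. 0 \<le> \<psi> y" "(LINT y|lborel. \<psi> y) = 1"
    and "w \<in> borel_measurable borel" "integrable lborel (\<lambda>y. \<psi> y * w y)"
  shows "kernel_ok (density lborel \<psi>) w"
    and "capp (ker (density lborel \<psi>) w) f x = (LINT y|lborel. bapp f (x + y) * (\<psi> y * w y))"
proof -
  have [measurable]: "\<psi> \<in> borel_measurable borel" using borel_measurable_integrable[OF assms(1)] by simp
  note [measurable] = assms(4)
  show ok: "kernel_ok (density lborel \<psi>) w"
    using assms prob_space_density[OF assms(1-3)] by (simp add: kernel_ok_def integrable_density)
  show "capp (ker (density lborel \<psi>) w) f x = (LINT y|lborel. bapp f (x + y) * (\<psi> y * w y))"
    unfolding capp_ker[OF ok] using assms(2) by (subst integral_density) (auto simp: mult_ac)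
qed

lemma gaussian_apply:
  fixes f :: "'n::finite bmeas"
  shows "capp (pker gaussian) f x = (LINT y|lborel. bapp f (x + y) * std_gauss_density y)"
  using density_ker_apply(2)[of "std_gauss_density :: real^'n \<Rightarrow> real" "\<lambda>_. 1" f x] std_gauss_density_integrable
  by (simp add: gaussian_def)

text \<open>The score is the coordinate itself, since \<open>gh 1 1 x = x * gh 1 0 x\<close>, and
  its variance gives Fisher information one.\<close>

lemma gaussian_score: "score_kernel (gaussian :: (real^'n::finite) measure) (\<lambda>i y. y $ i) 1"
proof -
  let ?g = "std_gauss_density :: real^'n \<Rightarrow> real"
  have wi: "integrable gaussian (\<lambda>y :: real^'n. y $ i)" "integrable gaussian (\<lambda>y :: real^'n. (y $ i)\<^sup>2)" for i
    using gaussian_coord_power(2)[of i 1] gaussian_coord_power(2)[of i 2] by simp_all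
  have w2: "(LINT y|gaussian. ((y :: real^'n) $ i)\<^sup>2) \<le> 1" for i
    using gaussian_coord_power(3)[of i 2] std_normal_integrals by simp
  have k1: "capp (pker gaussian) f x = (LINT y|lborel. bapp f (x + y) * (\<Prod>i\<in>UNIV. gh 1 0 (y $ i)))"
    for f :: "'n bmeas" and x
    by (simp add: gaussian_apply std_gauss_density_gh)
  have ki: "capp (ker gaussian (\<lambda>y. y $ i)) f x
      = (LINT y|lborel. bapp f (x + y) * - (- gh 1 (Suc 0) (y $ i) * (\<Prod>j\<in>UNIV - {i}. gh 1 0 (y $ j))))"
    for f :: "'n bmeas" and x i
  proof -
    have "?g y * y $ i = gh 1 (Suc 0) (y $ i) * (\<Prod>j\<in>UNIV - {i}. gh 1 0 (y $ j))" for y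
    proof -
      have "gh 1 (Suc 0) (y $ i) = y $ i * gh 1 0 (y $ i)" by (simp add: gh_def)
      then show ?thesis unfolding std_gauss_density_gh by (subst prod.remove[of UNIV i]) auto
    qed
    moreover have "integrable lborel (\<lambda>y. ?g y * y $ i)"
      using wi(1)[of i] by (subst (asm) gaussian_integral) auto
    ultimately show ?thesis
      using density_ker_apply(2)[of ?g "\<lambda>y. y $ i" f x] std_gauss_density_integrable
      by (simp add: gaussian_def)
  qed
  have "deriv_fam (pker gaussian) (\<lambda>i. ker (gaussian :: (real^'n) measure) (\<lambda>y. y $ i))"
    unfolding deriv_fam_def k1 ki
    by (intro allI product_derivative_convolution[OF gh_dominated_pair _ bapp_le_norm]) auto
  then show ?thesis
    using wi w2 by (simp add: score_kernel_def gaussian_prob)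
qed

section \<open>Powers of the Gaussian operator and Hermite functions\<close>

lemma gh_convolution:
  assumes "0 < t"
  shows "(LINT y|lborel. gh t 0 (u - y) * gh 1 0 y) = gh (t + 1) 0 u"
    "integrable lborel (\<lambda>y. gh t 0 (u - y) * gh 1 0 y)"
proof -
  have "(\<integral>\<^sup>+y. ennreal (normal_density 0 (sqrt t) (u - y) * normal_density 0 1 y) \<partial>lborel)
      = ennreal (normal_density 0 (sqrt ((sqrt t)\<^sup>2 + 1\<^sup>2)) u)"
    using conv_normal_density_zero_mean[of "sqrt t" 1] assms by (auto dest!: fun_cong[of _ _ u])
  then have "has_bochner_integral lborel (\<lambda>y. gh t 0 (u - y) * gh 1 0 y) (gh (t + 1) 0 u)"
    using assms by (intro has_bochner_integral_nn_integral) (auto simp: gh_0)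
  then show "(LINT y|lborel. gh t 0 (u - y) * gh 1 0 y) = gh (t + 1) 0 u"
    "integrable lborel (\<lambda>y. gh t 0 (u - y) * gh 1 0 y)"
    by (auto simp: has_bochner_integral_iff)
qed

text \<open>Variances of independent normal vectors add. Shifting the inner integral and exchanging
  the order of integration reduces the step to one-dimensional convolutions, coordinate by
  coordinate.\<close>

lemma gaussian_power:
  fixes f :: "'n::finite bmeas"
  assumes "n \<ge> 1"
  shows "capp (pker gaussian ^ n) f x = (LINT y|lborel. bapp f (x + y) * (\<Prod>i\<in>UNIV. gh n 0 (y $ i)))"
  using assms
proof (induct n arbitrary: x rule: dec_induct)
  case base
  show ?case
    by (simp add: gaussian_apply std_gauss_density_gh)
next
  case (step n)
  let ?g = "\<lambda>y :: real^'n. \<Prod>i\<in>UNIV. gh n 0 (y $ i)" and ?\<gamma> = "std_gauss_density :: real^'n \<Rightarrow> real"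
  have n: "0 < real n" using step by simp
  have g0: "0 \<le> ?g y" for y by (intro prod_nonneg) (auto simp: gh_0)
  have gm[measurable]: "?g \<in> borel_measurable borel" by measurable
  have gi: "integrable lborel ?g" by (intro prod_integrable_vec gh_integrable n)
  have gs: "integrable lborel (\<lambda>u. ?g (u - y))" "(LINT u|lborel. ?g (u - y)) = (LINT u|lborel. ?g u)" for y
    using lborel_integrable_shift[OF gm gi, of "- y"] lborel_integral_shift[OF gm, of "- y"] by simp_all
  have "capp (pker gaussian ^ Suc n) f x = (LINT y|lborel. (LINT z|lborel. bapp f (x + y + z) * ?g z) * ?\<gamma> y)"
  proof -
    have "capp (pker gaussian ^ Suc n) f x = (LINT y|lborel. bapp (cfun (pker gaussian ^ n) f) (x + y) * ?\<gamma> y)"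
      by (simp add: capp_times gaussian_apply)
    then show ?thesis by (simp add: step(3) flip: capp_eq)
  qed
  also have "\<dots> = (LINT y|lborel. (LINT u|lborel. bapp f (x + u) * ?g (u - y) * ?\<gamma> y))"
  proof (intro Bochner_Integration.integral_cong refl)
    fix y
    have "(LINT z|lborel. bapp f (x + y + z) * ?g z) = (LINT u|lborel. bapp f (x + u) * ?g (u - y))"
      using lborel_integral_shift[of "\<lambda>u. bapp f (x + u) * ?g (u - y)" y] by (simp add: add.assoc)
    then show "(LINT z|lborel. bapp f (x + y + z) * ?g z) * ?\<gamma> y = (LINT u|lborel. bapp f (x + u) * ?g (u - y) * ?\<gamma> y)"
      by simp
  qed
  also have "\<dots> = (LINT u|lborel. (LINT y|lborel. bapp f (x + u) * ?g (u - y) * ?\<gamma> y))"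
  proof (rule lborel_pair.Fubini_integral[symmetric])
    have m[measurable]: "(\<lambda>(y, u). bapp f (x + u) * ?g (u - y) * ?\<gamma> y) \<in> borel_measurable (lborel \<Otimes>\<^sub>M lborel)"
      by measurable
    have i1: "integrable lborel (\<lambda>u. bapp f (x + u) * ?g (u - y) * ?\<gamma> y)" for y
    proof (rule Bochner_Integration.integrable_bound[where f = "\<lambda>u. norm f * ?\<gamma> y * ?g (u - y)"])
      show "integrable lborel (\<lambda>u. norm f * ?\<gamma> y * ?g (u - y))" using gs(1) by simp
      show "AE u in lborel. norm (bapp f (x + u) * ?g (u - y) * ?\<gamma> y) \<le> norm (norm f * ?\<gamma> y * ?g (u - y))"
      proof (rule AE_I2)
        fix u
        have "\<bar>bapp f (x + u)\<bar> * (\<bar>?g (u - y)\<bar> * \<bar>?\<gamma> y\<bar>) \<le> norm f * (\<bar>?g (u - y)\<bar> * \<bar>?\<gamma> y\<bar>)"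
          by (intro mult_right_mono bapp_le_norm) simp
        then show "norm (bapp f (x + u) * ?g (u - y) * ?\<gamma> y) \<le> norm (norm f * ?\<gamma> y * ?g (u - y))"
          by (simp add: abs_mult mult_ac)
      qed
    qed measurable
    show "integrable (lborel \<Otimes>\<^sub>M lborel) (\<lambda>(y, u). bapp f (x + u) * ?g (u - y) * ?\<gamma> y)"
    proof (rule lborel_pair.Fubini_integrable[OF m])
      show "AE y in lborel. integrable lborel (\<lambda>u. case (y, u) of (y, u) \<Rightarrow> bapp f (x + u) * ?g (u - y) * ?\<gamma> y)"
        using i1 by simp
      show "integrable lborel (\<lambda>y. LINT u|lborel. norm (case (y, u) of (y, u) \<Rightarrow> bapp f (x + u) * ?g (u - y) * ?\<gamma> y))"
      proof (rule Bochner_Integration.integrable_bound[where f = "\<lambda>y. norm f * (LINT u|lborel. ?g u) * ?\<gamma> y"])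
        show "integrable lborel (\<lambda>y. norm f * (LINT u|lborel. ?g u) * ?\<gamma> y)"
          using std_gauss_density_integrable(1)[where 'n = 'n] by simp
        show "(\<lambda>y. LINT u|lborel. norm (case (y, u) of (y, u) \<Rightarrow> bapp f (x + u) * ?g (u - y) * ?\<gamma> y)) \<in> borel_measurable lborel"
          using m by (intro lborel.borel_measurable_lebesgue_integral) measurable
        show "AE y in lborel. norm (LINT u|lborel. norm (case (y, u) of (y, u) \<Rightarrow> bapp f (x + u) * ?g (u - y) * ?\<gamma> y))
            \<le> norm (norm f * (LINT u|lborel. ?g u) * ?\<gamma> y)"
        proof (rule AE_I2)
          fix y
          have "(LINT u|lborel. \<bar>bapp f (x + u) * ?g (u - y) * ?\<gamma> y\<bar>) \<le> (LINT u|lborel. norm f * ?\<gamma> y * ?g (u - y))"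
          proof (rule integral_mono)
            fix u
            have "\<bar>bapp f (x + u)\<bar> * (?g (u - y) * ?\<gamma> y) \<le> norm f * (?g (u - y) * ?\<gamma> y)"
              using g0[of "u - y"] by (intro mult_right_mono bapp_le_norm) simp
            then show "\<bar>bapp f (x + u) * ?g (u - y) * ?\<gamma> y\<bar> \<le> norm f * ?\<gamma> y * ?g (u - y)"
              using g0[of "u - y"] by (simp add: abs_mult mult_ac)
          qed (use i1 gs in auto)
          also have "\<dots> = norm f * (LINT u|lborel. ?g u) * ?\<gamma> y" using gs(2) by simp
          finally show "norm (LINT u|lborel. norm (case (y, u) of (y, u) \<Rightarrow> bapp f (x + u) * ?g (u - y) * ?\<gamma> y))
            \<le> norm (norm f * (LINT u|lborel. ?g u) * ?\<gamma> y)" by simp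
        qed
      qed
    qed
  qed
  also have "\<dots> = (LINT u|lborel. bapp f (x + u) * (\<Prod>i\<in>UNIV. gh (Suc n) 0 (u $ i)))"
  proof (intro Bochner_Integration.integral_cong refl)
    fix u :: "real^'n"
    have "(LINT y|lborel. bapp f (x + u) * ?g (u - y) * ?\<gamma> y) = bapp f (x + u) * (LINT y|lborel. ?g (u - y) * ?\<gamma> y)"
      by (simp add: mult.assoc)
    also have "(LINT y|lborel. ?g (u - y) * ?\<gamma> y) = (LINT y|lborel. (\<Prod>i\<in>UNIV. gh n 0 (u $ i - y $ i) * gh 1 0 (y $ i)))"
      by (simp add: std_gauss_density_gh prod.distrib)
    also have "\<dots> = (\<Prod>i\<in>UNIV. gh (Suc n) 0 (u $ i))"
      using gh_convolution[OF n] by (subst prod_integrable_vec(2)) (auto simp: add.commute)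
    finally show "(LINT y|lborel. bapp f (x + u) * ?g (u - y) * ?\<gamma> y) = bapp f (x + u) * (\<Prod>i\<in>UNIV. gh (Suc n) 0 (u $ i))" .
  qed
  finally show ?case .
qed

text \<open>A letter is added by computing one directional derivative in two ways: on the operator
  side through \<open>deriv_fam\<close>, on the density side by differentiating the explicit kernel.
  Uniqueness of the derivative identifies the results.\<close>

lemma gaussian_word_apply:
  fixes f :: "'n::finite bmeas"
  assumes "length w \<le> n" "n \<ge> 1"
  shows "capp (op_prod (\<lambda>i. ker gaussian (\<lambda>y. y $ i)) w * pker gaussian ^ (n - length w)) f x
     = (LINT y|lborel. bapp f (x + y) * (\<Prod>i\<in>UNIV. gh n (count_list w i) (y $ i)))"
  using assms
proof (induct w arbitrary: x)
  case Nil
  then show ?case by (simp add: gaussian_power)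
next
  case (Cons i w)
  let ?Q = "pker (gaussian :: (real^'n) measure)" and ?B = "\<lambda>i. ker (gaussian :: (real^'n) measure) (\<lambda>y. y $ i)"
  let ?R = "op_prod ?B w * ?Q ^ (n - Suc (length w))"
  have "deriv_fam (?R * ?Q) (\<lambda>i. ?R * ?B i)"
    using gaussian_score[where 'n = 'n] by (intro deriv_fam_mult) (simp add: score_kernel_def)
  moreover have RQ: "?R * ?Q = op_prod ?B w * ?Q ^ (n - length w)"
  proof -
    \<comment> \<open>One Gaussian factor is set aside; it is the one that receives the new
      derivative.\<close>
    have "n - length w = Suc (n - Suc (length w))" using Cons by simp
    then show ?thesis by (simp add: mult_ac)
  qed
  ultimately have 1: "((\<lambda>t. capp (?R * ?Q) f (x + t *\<^sub>R axis i 1)) has_real_derivative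
      (\<Sum>j\<in>UNIV. axis i 1 $ j * capp (?R * ?B j) f x)) (at 0)"
    unfolding deriv_fam_def by blast
  have n: "0 < real n" using Cons by simp
  let ?h = "\<lambda>j. gh n (count_list w j)"
  have 2: "((\<lambda>t. capp (?R * ?Q) f (x + t *\<^sub>R axis i 1)) has_real_derivative
     (\<Sum>j\<in>UNIV. axis i 1 $ j * (LINT y|lborel. bapp f (x + y) *
        - (- gh n (Suc (count_list w j)) (y $ j) * (\<Prod>k\<in>UNIV - {j}. ?h k (y $ k)))))) (at 0)"
    unfolding RQ using Cons product_derivative_convolution[where f = "bapp f" and B = "norm f" and v = "axis i 1" and x = x,
      OF gh_dominated_pair[OF n] bapp_measurable bapp_le_norm, of "count_list w"]
    by simp
  have ax: "(\<Sum>j\<in>UNIV. axis i 1 $ j * F j) = F i" for F :: "'n \<Rightarrow> real"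
    by (simp add: axis_def if_distrib[of "\<lambda>z. z * _"] sum.delta cong: if_cong)
  have "capp (?R * ?B i) f x = (LINT y|lborel. bapp f (x + y) *
        - (- gh n (Suc (count_list w i)) (y $ i) * (\<Prod>k\<in>UNIV - {i}. ?h k (y $ k))))"
    using DERIV_unique[OF 1 2] unfolding ax .
  moreover have "(\<Prod>j\<in>UNIV. gh n (count_list (i # w) j) (y $ j))
      = gh n (Suc (count_list w i)) (y $ i) * (\<Prod>k\<in>UNIV - {i}. ?h k (y $ k))" for y
    by (subst prod.remove[of UNIV i]) (auto intro!: prod.cong)
  ultimately show ?case by (simp add: mult_ac)
qed

text \<open>Only the letter counts matter, that is, the multi-index of the derivative.\<close>

definition hermite_word :: "'n::finite list \<Rightarrow> real^'n \<Rightarrow> real" where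
  "hermite_word w z = (\<Prod>i\<in>UNIV. poly (hermite (count_list w i)) (z $ i))"

lemma sum_count_list_UNIV: "(\<Sum>i\<in>UNIV. count_list w (i :: 'n::finite)) = length w"
proof (induct w)
  case (Cons a w)
  have "count_list (a # w) i = count_list w i + (if a = i then 1 else 0)" for i by simp
  then show ?case using Cons by (simp only: sum.distrib) simp
qed simp

lemma hermite_word_integrable: "integrable lborel (\<lambda>z :: real^'n::finite. std_gauss_density z * hermite_word w z)"
proof -
  have "integrable lborel (\<lambda>z :: real^'n. \<Prod>i\<in>UNIV. gh 1 (count_list w i) (z $ i))"
    by (intro prod_integrable_vec gh_integrable) simp
  moreover have "(\<Prod>i\<in>UNIV. gh 1 (count_list w i) (z $ i)) = std_gauss_density z * hermite_word w z" for z :: "real^'n"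
    by (simp add: hermite_word_def std_gauss_density_def gh_def prod.distrib mult.commute)
  ultimately show ?thesis by simp
qed

text \<open>Substituting \<open>sqrt n *\<^sub>R z\<close> reduces variance \<open>n\<close> to
  variance one, and every derivative yields a factor \<open>1 / sqrt n\<close>.\<close>

lemma gaussian_word_scaled:
  fixes f :: "'n::finite bmeas"
  assumes "length w \<le> n" "n \<ge> 1"
  shows "capp (op_prod (\<lambda>i. ker gaussian (\<lambda>y. y $ i)) w * pker gaussian ^ (n - length w)) f 0
     = (1 / sqrt n) ^ length w * (LINT z|lborel. bapp f (sqrt n *\<^sub>R z) * (std_gauss_density z * hermite_word w z))"
proof -
  let ?r = "sqrt (real n)"
  have n: "0 < ?r" using assms by simp
  let ?F = "\<lambda>y :: real^'n. bapp f y * (\<Prod>i\<in>UNIV. gh n (count_list w i) (y $ i))"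
  have "(LINT y|lborel. ?F y) = (LINT y|density (distr lborel borel (\<lambda>x. 0 + ?r *\<^sub>R x)) (\<lambda>_. \<bar>?r\<bar> ^ DIM(real^'n)). ?F y)"
    using lborel_affine[of ?r "0 :: real^'n"] n by simp
  also have "\<dots> = (LINT z|lborel. ?r ^ CARD('n) * ?F (?r *\<^sub>R z))"
    using n by (subst integral_density) (auto simp: integral_distr)
  also have "\<dots> = (LINT z|lborel. (1 / ?r) ^ length w * (bapp f (?r *\<^sub>R z) * (std_gauss_density z * hermite_word w z)))"
  proof (intro Bochner_Integration.integral_cong refl)
    fix z :: "real^'n"
    have "gh n k (?r * s) = (1 / ?r) ^ k * poly (hermite k) s * (std_normal_density s / ?r)" for k s
      using n by (simp add: gh_def normal_density_def power_mult_distrib real_sqrt_mult)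
    then have "(\<Prod>i\<in>UNIV. gh n (count_list w i) ((?r *\<^sub>R z) $ i))
      = (1 / ?r) ^ (\<Sum>i\<in>UNIV. count_list w i) * hermite_word w z * (std_gauss_density z / ?r ^ CARD('n))"
      by (simp add: hermite_word_def std_gauss_density_def prod.distrib prod_dividef power_sum power_divide)
    then show "?r ^ CARD('n) * ?F (?r *\<^sub>R z) = (1 / ?r) ^ length w * (bapp f (?r *\<^sub>R z) * (std_gauss_density z * hermite_word w z))"
      using n by (simp add: sum_count_list_UNIV)
  qed
  finally show ?thesis using gaussian_word_apply[OF assms, of f 0] by simp
qed

text \<open>Expanding the product gives multi-indices in a box. The box lies in the simplex of total
  degree \<open>length w\<close>, and outside it some coefficient vanishes.\<close>

lemma polynomial_deg_le_hermite_word: "polynomial_deg_le (length w) (hermite_word (w :: 'n::finite list))"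
proof -
  define c where "c \<alpha> = (\<Prod>i\<in>UNIV. coeff (hermite (count_list w i)) (\<alpha> i))" for \<alpha> :: "'n \<Rightarrow> nat"
  let ?S = "PiE (UNIV :: 'n set) (\<lambda>i. {..count_list w i})"
  have "hermite_word w x = (\<Sum>\<alpha> | (\<Sum>i\<in>UNIV. \<alpha> i) \<le> length w. c \<alpha> * (\<Prod>i\<in>UNIV. (x $ i) ^ \<alpha> i))" for x
  proof -
    have "hermite_word w x = (\<Prod>i\<in>UNIV. \<Sum>k\<le>count_list w i. coeff (hermite (count_list w i)) k * (x $ i) ^ k)"
    proof -
      have "poly p y = (\<Sum>k\<le>m. coeff p k * y ^ k)" if "degree p \<le> m" for p :: "real poly" and m y
        unfolding poly_altdef using that by (intro sum.mono_neutral_left) (auto simp: coeff_eq_0)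
      then show ?thesis unfolding hermite_word_def using degree_hermite by (intro prod.cong) auto
    qed
    also have "\<dots> = (\<Sum>\<alpha>\<in>?S. \<Prod>i\<in>UNIV. coeff (hermite (count_list w i)) (\<alpha> i) * (x $ i) ^ \<alpha> i)"
      by (rule prod_sum_PiE) auto
    also have "\<dots> = (\<Sum>\<alpha>\<in>?S. c \<alpha> * (\<Prod>i\<in>UNIV. (x $ i) ^ \<alpha> i))"
      by (simp add: c_def prod.distrib)
    also have "\<dots> = (\<Sum>\<alpha> | (\<Sum>i\<in>UNIV. \<alpha> i) \<le> length w. c \<alpha> * (\<Prod>i\<in>UNIV. (x $ i) ^ \<alpha> i))"
    proof (rule sum.mono_neutral_left)
      show "?S \<subseteq> {\<alpha>. (\<Sum>i\<in>UNIV. \<alpha> i) \<le> length w}"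
        by (auto simp: PiE_iff simp flip: sum_count_list_UNIV intro!: sum_mono)
      show "\<forall>\<alpha>\<in>{\<alpha>. (\<Sum>i\<in>UNIV. \<alpha> i) \<le> length w} - ?S. c \<alpha> * (\<Prod>i\<in>UNIV. (x $ i) ^ \<alpha> i) = 0"
      proof
        fix \<alpha> assume "\<alpha> \<in> {\<alpha>. (\<Sum>i\<in>UNIV. \<alpha> i) \<le> length w} - ?S"
        then obtain i where "count_list w i < \<alpha> i" by (auto simp: PiE_iff not_le)
        then have "coeff (hermite (count_list w i)) (\<alpha> i) = 0"
          using degree_hermite[of "count_list w i"] by (intro coeff_eq_0) linarith
        then have "c \<alpha> = 0" unfolding c_def by (intro prod_zero) auto
        then show "c \<alpha> * (\<Prod>i\<in>UNIV. (x $ i) ^ \<alpha> i) = 0" by simp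
      qed
    qed (rule finite_multi_indices)
    finally show ?thesis .
  qed
  then show ?thesis unfolding polynomial_deg_le_def by (intro exI[of _ c]) blast
qed

lemma polynomial_deg_le_zero: "polynomial_deg_le d (\<lambda>_. 0)"
  unfolding polynomial_deg_le_def by (intro exI[of _ "\<lambda>_. 0"]) simp

lemma polynomial_deg_le_add:
  "polynomial_deg_le d p \<Longrightarrow> polynomial_deg_le d q \<Longrightarrow> polynomial_deg_le d (\<lambda>x. p x + q x)"
  unfolding polynomial_deg_le_def
  by (elim exE, rule_tac x = "\<lambda>\<alpha>. c \<alpha> + ca \<alpha>" in exI) (simp add: distrib_right sum.distrib)

lemma polynomial_deg_le_cmult: "polynomial_deg_le d p \<Longrightarrow> polynomial_deg_le d (\<lambda>x. a * p x)"
  unfolding polynomial_deg_le_def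
  by (elim exE, rule_tac x = "\<lambda>\<alpha>. a * c \<alpha>" in exI) (simp add: sum_distrib_left mult.assoc)

lemma polynomial_deg_le_mono:
  assumes "polynomial_deg_le d p" "d \<le> e" shows "polynomial_deg_le e (p :: real^'n::finite \<Rightarrow> real)"
proof -
  obtain c where c: "\<And>x. p x = (\<Sum>\<alpha> | (\<Sum>i\<in>UNIV. \<alpha> i) \<le> d. c \<alpha> * (\<Prod>i\<in>UNIV. (x $ i) ^ \<alpha> i))"
    using assms by (auto simp: polynomial_deg_le_def)
  have "p x = (\<Sum>\<alpha> | (\<Sum>i\<in>UNIV. \<alpha> i) \<le> e. (if (\<Sum>i\<in>UNIV. \<alpha> i) \<le> d then c \<alpha> else 0) * (\<Prod>i\<in>UNIV. (x $ i) ^ \<alpha> i))" for x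
    unfolding c using assms(2) by (intro sum.mono_neutral_cong_left) (auto simp: finite_multi_indices)
  then show ?thesis unfolding polynomial_deg_le_def
    by (intro exI[of _ "\<lambda>\<alpha>. if (\<Sum>i\<in>UNIV. \<alpha> i) \<le> d then c \<alpha> else 0"]) blast
qed

section \<open>A compactly supported density with finite Fisher information\<close>

text \<open>Squaring makes the bump vanish to second order at the edge of its support: it becomes
  continuously differentiable, and the squared derivative divided by the function stays
  bounded.\<close>

definition cap2 :: "real \<Rightarrow> real" where
  "cap2 s = (max 0 s)\<^sup>2"

lemma cap2_deriv: "(cap2 has_real_derivative 2 * max 0 s) (at s)"
proof -
  consider "s > 0" | "s < 0" | "s = 0" by linarith
  then show ?thesis
  proof cases
    case 1
    have "((\<lambda>s. s\<^sup>2) has_real_derivative 2 * max 0 s) (at s)"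
      using 1 by (auto intro!: derivative_eq_intros)
    then show ?thesis
      by (rule has_field_derivative_transform_within_open[where S = "{0<..}"]) (use 1 in \<open>auto simp: cap2_def\<close>)
  next
    case 2
    have "((\<lambda>s. 0) has_real_derivative 2 * max 0 s) (at s)" using 2 by simp
    then show ?thesis
      by (rule has_field_derivative_transform_within_open[where S = "{..<0}"]) (use 2 in \<open>auto simp: cap2_def\<close>)
  next
    case 3
    \<comment> \<open>At the kink the difference quotient is itself a continuous function of
      \<open>z\<close>, so Caratheodory's criterion applies.\<close>
    have "cap2 z - cap2 0 = max 0 z * (z - 0)" for z
      by (simp add: cap2_def power2_eq_square max_def)
    moreover have "isCont (\<lambda>z::real. max 0 z) 0" by (intro continuous_intros)
    ultimately show ?thesis unfolding 3 CARAT_DERIV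
      by (intro exI[of _ "\<lambda>z. max 0 z"]) auto
  qed
qed

definition bump :: "real \<Rightarrow> real \<Rightarrow> real \<Rightarrow> real" where
  "bump \<rho> c x = cap2 (1 - ((x - c) / \<rho>)\<^sup>2)"

definition bump' :: "real \<Rightarrow> real \<Rightarrow> real \<Rightarrow> real" where
  "bump' \<rho> c x = 2 * max 0 (1 - ((x - c) / \<rho>)\<^sup>2) * (- (2 * ((x - c) / \<rho>) / \<rho>))"

lemma bump_deriv: "(bump \<rho> c has_real_derivative bump' \<rho> c x) (at x)"
  unfolding bump_def[abs_def] bump'_def
proof (rule DERIV_chain2[OF cap2_deriv])
  have u: "((\<lambda>x. (x - c) / \<rho>) has_real_derivative 1 / \<rho>) (at x)"
    by (rule DERIV_cdivide) (auto intro!: derivative_eq_intros)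
  show "((\<lambda>x. 1 - ((x - c) / \<rho>)\<^sup>2) has_real_derivative - (2 * ((x - c) / \<rho>) / \<rho>)) (at x)"
    using DERIV_diff[OF DERIV_const[of 1] DERIV_power[OF u, of 2]] by simp
qed

text \<open>The sixth claim bounds the Fisher integrand: numerator and denominator share powers of
  \<open>m\<close>, which cancel. Where the bump vanishes, division by zero yields 0, which is the
  value wanted.\<close>

lemma bump_props:
  assumes "\<rho> > 0"
  shows "0 \<le> bump \<rho> c x" "bump \<rho> c x \<le> 1" "\<bar>bump' \<rho> c x\<bar> \<le> 4 / \<rho>"
    "\<bar>x - c\<bar> \<ge> \<rho> \<Longrightarrow> bump \<rho> c x = 0" "\<bar>x - c\<bar> \<ge> \<rho> \<Longrightarrow> bump' \<rho> c x = 0"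
    "(bump' \<rho> c x / bump \<rho> c x)\<^sup>2 * bump \<rho> c x \<le> 16 / \<rho>\<^sup>2"
    "bump \<rho> c x = 0 \<Longrightarrow> bump' \<rho> c x = 0"
proof -
  let ?u = "(x - c) / \<rho>"
  define m where "m = max 0 (1 - ?u\<^sup>2)"
  have m: "0 \<le> m" "m \<le> 1" by (auto simp: m_def)
  have b: "bump \<rho> c x = m\<^sup>2" "bump' \<rho> c x = 2 * m * (- (2 * ?u / \<rho>))"
    by (simp_all add: bump_def bump'_def cap2_def m_def)
  show "0 \<le> bump \<rho> c x" "bump \<rho> c x \<le> 1" using m by (auto simp: b power_le_one)
  have z: "m = 0" if "1 \<le> \<bar>?u\<bar>"
  proof -
    have "1 \<le> ?u\<^sup>2" using that by (metis abs_le_square_iff abs_one power_one)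
    then show ?thesis by (simp add: m_def)
  qed
  have u: "\<bar>?u\<bar> \<le> 1" if "m \<noteq> 0" using z that by linarith
  have mu: "m * \<bar>?u\<bar> \<le> 1" using m u mult_mono[of m 1 "\<bar>?u\<bar>" 1] by (cases "m = 0") auto
  have "\<bar>bump' \<rho> c x\<bar> = 4 / \<rho> * (m * \<bar>?u\<bar>)"
  proof -
    have "\<bar>2 * m * (- (2 * t / \<rho>))\<bar> = 4 / \<rho> * (m * \<bar>t\<bar>)" for t using m assms by (simp add: abs_mult)
    then show ?thesis unfolding b .
  qed
  also have "\<dots> \<le> 4 / \<rho> * 1" using assms by (intro mult_left_mono mu) auto
  finally show "\<bar>bump' \<rho> c x\<bar> \<le> 4 / \<rho>" by simp
  have "1 \<le> \<bar>?u\<bar>" if "\<bar>x - c\<bar> \<ge> \<rho>" using that assms by simp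
  then show "\<bar>x - c\<bar> \<ge> \<rho> \<Longrightarrow> bump \<rho> c x = 0" "\<bar>x - c\<bar> \<ge> \<rho> \<Longrightarrow> bump' \<rho> c x = 0"
    using z by (auto simp: b)
  show "bump \<rho> c x = 0 \<Longrightarrow> bump' \<rho> c x = 0" by (simp add: b)
  show "(bump' \<rho> c x / bump \<rho> c x)\<^sup>2 * bump \<rho> c x \<le> 16 / \<rho>\<^sup>2"
  proof (cases "m = 0")
    case False
    have "(bump' \<rho> c x / bump \<rho> c x)\<^sup>2 * bump \<rho> c x = 16 / \<rho>\<^sup>2 * ?u\<^sup>2"
    proof -
      have "(2 * m * (- (2 * t / \<rho>)) / m\<^sup>2)\<^sup>2 * m\<^sup>2 = 16 / \<rho>\<^sup>2 * t\<^sup>2" for t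
        using False assms by (simp add: power2_eq_square)
      then show ?thesis unfolding b .
    qed
    also have "\<dots> \<le> 16 / \<rho>\<^sup>2 * 1"
      using u[OF False] by (intro mult_left_mono) (auto simp: abs_square_le_1)
    finally show ?thesis by simp
  qed (simp add: b)
qed

lemma indicator_interval_integrable: "integrable lborel (\<lambda>x::real. C * indicator {a..b} x :: real)"
  by (intro integrable_mult_right integrable_real_indicator) (auto simp: emeasure_lborel_Icc_eq)

lemma bump_dominated_pair:
  assumes \<rho>: "\<rho> > 0"
  shows "dominated_pair (\<lambda>x. r * bump \<rho> c x) (\<lambda>x. r * bump' \<rho> c x)"
  unfolding dominated_pair_def
proof (intro conjI allI)
  show "(\<lambda>x. r * bump' \<rho> c x) \<in> borel_measurable borel" unfolding bump'_def by measurable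
  show "((\<lambda>x. r * bump \<rho> c x) has_real_derivative r * bump' \<rho> c x) (at x)" for x
    by (rule DERIV_cmult[OF bump_deriv])
  fix a :: real
  let ?G = "\<lambda>x. (\<bar>r\<bar> * (1 + 4 / \<rho>)) * indicator {c - \<rho> - a..c + \<rho> + a} x :: real"
  show "\<exists>G. integrable lborel G \<and> (\<forall>x s. \<bar>s\<bar> \<le> a \<longrightarrow> \<bar>r * bump \<rho> c (x - s)\<bar> \<le> G x \<and> \<bar>r * bump' \<rho> c (x - s)\<bar> \<le> G x)"
  proof (intro exI[of _ ?G] conjI allI impI)
    show "integrable lborel ?G" by (rule indicator_interval_integrable)
    fix x s :: real assume s: "\<bar>s\<bar> \<le> a"
    have 0: "bump \<rho> c (x - s) = 0" "bump' \<rho> c (x - s) = 0" if "x \<notin> {c - \<rho> - a..c + \<rho> + a}"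
      using bump_props(4,5)[OF \<rho>, of "x - s" c] that s by auto
    have "\<bar>bump \<rho> c (x - s)\<bar> \<le> 1 + 4 / \<rho>" "\<bar>bump' \<rho> c (x - s)\<bar> \<le> 1 + 4 / \<rho>"
      using bump_props(1-3)[OF \<rho>, of c "x - s"] \<rho> by (auto intro: order_trans[OF _ add_increasing2] order_trans)
    then have "\<bar>r * bump \<rho> c (x - s)\<bar> \<le> \<bar>r\<bar> * (1 + 4 / \<rho>)" "\<bar>r * bump' \<rho> c (x - s)\<bar> \<le> \<bar>r\<bar> * (1 + 4 / \<rho>)"
      unfolding abs_mult by (intro mult_left_mono; simp)+
    then show "\<bar>r * bump \<rho> c (x - s)\<bar> \<le> ?G x" "\<bar>r * bump' \<rho> c (x - s)\<bar> \<le> ?G x"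
      using 0 by (cases "x \<in> {c - \<rho> - a..c + \<rho> + a}"; simp)+
  qed
qed

lemma bump_integral_pos:
  assumes \<rho>: "\<rho> > 0"
  shows "0 < (LINT x|lborel. bump \<rho> c x)"
proof -
  have i: "integrable lborel (bump \<rho> c)"
    using dominated_pair_integrable(1)[OF bump_dominated_pair[OF \<rho>, of 1 c]] by simp
  \<comment> \<open>On the middle half of the support the squared rescaled variable is at most
    \<open>1 / 4\<close>, and \<open>9 / 16\<close> is the square of \<open>3 / 4\<close>.\<close>
  have "9 / 16 * indicator {c - \<rho> / 2..c + \<rho> / 2} x \<le> bump \<rho> c x" for x
  proof (cases "x \<in> {c - \<rho> / 2..c + \<rho> / 2}")
    case True
    have "\<bar>x - c\<bar> \<le> \<rho> / 2" using True by (simp only: atLeastAtMost_iff abs_le_iff) linarith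
    then have "\<bar>(x - c) / \<rho>\<bar> \<le> 1 / 2" using \<rho> by (simp add: field_simps)
    then have "((x - c) / \<rho>)\<^sup>2 \<le> (1 / 2)\<^sup>2" by (metis abs_ge_zero power2_abs power_mono)
    also have "(1 / 2)\<^sup>2 = (1 / 4 :: real)" by (simp add: power2_eq_square)
    finally have "3 / 4 \<le> max 0 (1 - ((x - c) / \<rho>)\<^sup>2)" by (intro max.coboundedI2) linarith
    then have "(3 / 4)\<^sup>2 \<le> bump \<rho> c x" unfolding bump_def cap2_def by (rule power_mono) simp
    then show ?thesis using True by (simp add: power2_eq_square)
  qed (use bump_props(1)[OF \<rho>] in simp)
  then have "(LINT x|lborel. 9 / 16 * indicator {c - \<rho> / 2..c + \<rho> / 2} x) \<le> (LINT x|lborel. bump \<rho> c x)"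
    by (intro integral_mono indicator_interval_integrable i)
  moreover have "(LINT x|lborel. 9 / 16 * indicator {c - \<rho> / 2..c + \<rho> / 2} x :: real) = 9 / 16 * \<rho>"
    using \<rho> by simp
  ultimately show ?thesis using \<rho> by linarith
qed

definition bump_density :: "real \<Rightarrow> real^'n::finite \<Rightarrow> real^'n \<Rightarrow> real" where
  "bump_density \<rho> c y = (\<Prod>i\<in>UNIV. bump \<rho> (c $ i) (y $ i) / (LINT x|lborel. bump \<rho> (c $ i) x))"

text \<open>The sign belongs to a derivative along \<open>- v\<close>. Off the support, division by
  zero makes the score 0.\<close>

definition bump_score :: "real \<Rightarrow> real^'n::finite \<Rightarrow> 'n \<Rightarrow> real^'n \<Rightarrow> real" where
  "bump_score \<rho> c i y = - (bump' \<rho> (c $ i) (y $ i) / bump \<rho> (c $ i) (y $ i))"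

lemma bump_measurable [measurable]: "bump \<rho> c \<in> borel_measurable borel" "bump' \<rho> c \<in> borel_measurable borel"
  unfolding bump_def[abs_def] bump'_def[abs_def] cap2_def by measurable

lemma bump_score_measurable [measurable]: "bump_score \<rho> c i \<in> borel_measurable borel"
  unfolding bump_score_def[abs_def] by measurable

context
  fixes \<rho> :: real and c :: "real^'n::finite"
  assumes \<rho>: "\<rho> > 0"
begin

abbreviation (input) "bz i \<equiv> 1 / (LINT x|lborel. bump \<rho> (c $ i) x)"

lemma bump_density_alt: "bump_density \<rho> c y = (\<Prod>i\<in>UNIV. bz i * bump \<rho> (c $ i) (y $ i))"
  by (simp add: bump_density_def)

lemma bz_pos: "0 < bz i"
  using bump_integral_pos[OF \<rho>] by simp

lemma bump_dp: "dominated_pair (\<lambda>x. bz i * bump \<rho> (c $ i) x) (\<lambda>x. bz i * bump' \<rho> (c $ i) x)"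
  by (rule bump_dominated_pair[OF \<rho>])

lemma bump_density_basic:
  "integrable lborel (bump_density \<rho> c)" "0 \<le> bump_density \<rho> c y" "(LINT y|lborel. bump_density \<rho> c y) = 1"
proof -
  note i = dominated_pair_integrable(1)[OF bump_dp]
  show "integrable lborel (bump_density \<rho> c)"
    unfolding bump_density_alt[abs_def] by (intro prod_integrable_vec i)
  show "0 \<le> bump_density \<rho> c y"
    unfolding bump_density_alt using bz_pos bump_props(1)[OF \<rho>] by (intro prod_nonneg) (simp add: less_imp_le)
  show "(LINT y|lborel. bump_density \<rho> c y) = 1"
    unfolding bump_density_alt using prod_integrable_vec(2)[of "\<lambda>i x. bz i * bump \<rho> (c $ i) x", OF i]
      bump_integral_pos[OF \<rho>] by (simp add: less_imp_neq[THEN not_sym])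
qed

text \<open>The singular quotient disappears against the density, because the derivative of the bump
  vanishes wherever the bump does.\<close>

lemma bump_score_mult:
  "bump_density \<rho> c y * bump_score \<rho> c i y
    = - (bz i * bump' \<rho> (c $ i) (y $ i) * (\<Prod>j\<in>UNIV - {i}. bz j * bump \<rho> (c $ j) (y $ j)))"
proof -
  have "bump \<rho> (c $ i) (y $ i) * (bump' \<rho> (c $ i) (y $ i) / bump \<rho> (c $ i) (y $ i)) = bump' \<rho> (c $ i) (y $ i)"
    using bump_props(7)[OF \<rho>, of "c $ i" "y $ i"] by (cases "bump \<rho> (c $ i) (y $ i) = 0") auto
  then show ?thesis
    unfolding bump_density_alt bump_score_def
    by (subst prod.remove[of UNIV i]) (auto simp: mult_ac)
qed

lemma bump_score_integrable:
  "integrable lborel (\<lambda>y. bump_density \<rho> c y * bump_score \<rho> c i y)"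
  "integrable lborel (\<lambda>y. bump_density \<rho> c y * (bump_score \<rho> c i y)\<^sup>2)"
proof -
  let ?f = "\<lambda>g j x. bz j * (if j = i then g else bump \<rho> (c $ j)) x"
  have eq: "(\<Prod>j\<in>UNIV. ?f g j (y $ j)) = bz i * g (y $ i) * (\<Prod>j\<in>UNIV - {i}. bz j * bump \<rho> (c $ j) (y $ j))" for g y
    by (subst prod.remove[of UNIV i]) auto
  note i = dominated_pair_integrable(1,2)[OF bump_dp]
  have "integrable lborel (\<lambda>y :: real^'n. \<Prod>j\<in>UNIV. ?f (bump' \<rho> (c $ i)) j (y $ j))"
    using i by (intro prod_integrable_vec) (auto split: if_split)
  then show "integrable lborel (\<lambda>y. bump_density \<rho> c y * bump_score \<rho> c i y)"
    unfolding bump_score_mult eq by simp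
  let ?g = "\<lambda>x. (bump' \<rho> (c $ i) x / bump \<rho> (c $ i) x)\<^sup>2 * bump \<rho> (c $ i) x"
  have g: "integrable lborel ?g"
  proof (rule Bochner_Integration.integrable_bound[OF indicator_interval_integrable])
    show "AE x in lborel. norm (?g x) \<le> norm (16 / \<rho>\<^sup>2 * indicator {c $ i - \<rho>..c $ i + \<rho>} x :: real)"
    proof (rule AE_I2)
      fix x
      have "?g x = 0" if "x \<notin> {c $ i - \<rho>..c $ i + \<rho>}"
      proof -
        have "\<rho> \<le> \<bar>x - c $ i\<bar>" using that by (simp only: atLeastAtMost_iff) linarith
        then show ?thesis using bump_props(4)[OF \<rho>, of x "c $ i"] by simp
      qed
      moreover have "0 \<le> ?g x" using bump_props(1)[OF \<rho>] by simp
      ultimately show "norm (?g x) \<le> norm (16 / \<rho>\<^sup>2 * indicator {c $ i - \<rho>..c $ i + \<rho>} x :: real)"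
        using bump_props(6)[OF \<rho>, of "c $ i" x] by (cases "x \<in> {c $ i - \<rho>..c $ i + \<rho>}") auto
    qed
  qed measurable
  have "integrable lborel (\<lambda>y :: real^'n. \<Prod>j\<in>UNIV. ?f ?g j (y $ j))"
  proof (rule prod_integrable_vec(1))
    show "integrable lborel (?f ?g j)" for j using i(1)[of j] g by (cases "j = i") auto
  qed
  moreover have "bump_density \<rho> c y * (bump_score \<rho> c i y)\<^sup>2 = (\<Prod>j\<in>UNIV. ?f ?g j (y $ j))" for y
    unfolding eq bump_density_alt bump_score_def by (subst prod.remove[of UNIV i]) (auto simp: mult_ac)
  ultimately show "integrable lborel (\<lambda>y. bump_density \<rho> c y * (bump_score \<rho> c i y)\<^sup>2)" by simp
qed

lemma bump_translation_derivative:
  assumes [measurable]: "f \<in> borel_measurable borel" and f: "\<And>x. \<bar>f x\<bar> \<le> B"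
  shows "((\<lambda>t. LINT y|lborel. f (x + t *\<^sub>R v + y) * bump_density \<rho> c y) has_real_derivative
     (\<Sum>i\<in>UNIV. v $ i * (LINT y|lborel. f (x + y) * (bump_density \<rho> c y * bump_score \<rho> c i y)))) (at 0)"
  unfolding bump_score_mult unfolding bump_density_alt
  using product_derivative_convolution[where h = "\<lambda>i x. bz i * bump \<rho> (c $ i) x"
      and h' = "\<lambda>i x. bz i * bump' \<rho> (c $ i) x", OF bump_dp assms, of x v] .

end

section \<open>Linear images of the bump and domination of laws\<close>

lemma matrix_vector_measurable [measurable]: "(\<lambda>y. (A :: real^'n^'m) *v y) \<in> borel_measurable borel"
  by (intro borel_measurable_continuous_onI continuous_intros)

definition bump_measure :: "real \<Rightarrow> real^'n::finite \<Rightarrow> (real^'n) measure" where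
  "bump_measure \<rho> c = density lborel (bump_density \<rho> c)"

lemma bump_measure_basic:
  assumes "\<rho> > 0"
  shows "prob_space (bump_measure \<rho> c)" "sets (bump_measure \<rho> c) = sets borel"
    and "g \<in> borel_measurable borel \<Longrightarrow> (LINT y|bump_measure \<rho> c. g y) = (LINT y|lborel. bump_density \<rho> c y * g y)"
    and "g \<in> borel_measurable borel \<Longrightarrow> integrable (bump_measure \<rho> c) g \<longleftrightarrow> integrable lborel (\<lambda>y. bump_density \<rho> c y * g y)"
  unfolding bump_measure_def
  using bump_density_basic[OF assms, of c] prob_space_density[of "bump_density \<rho> c"]
  by (auto simp: integral_density integrable_density)

text \<open>The bump is chosen below the original law and then normalized along with it. Its radius,
  centre and weight thus depend only on the witnesses of the domination and not on the
  covariance.\<close>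

definition bump_image :: "real^'n::finite^'n \<Rightarrow> real \<Rightarrow> real^'n \<Rightarrow> (real^'n) measure" where
  "bump_image A \<rho> c = distr (bump_measure \<rho> c) borel (\<lambda>y. A *v y)"

definition bump_fisher :: "real \<Rightarrow> real^'n::finite \<Rightarrow> real" where
  "bump_fisher \<rho> c = (\<Sum>j\<in>UNIV. LINT y|lborel. bump_density \<rho> c y * (bump_score \<rho> c j y)\<^sup>2)"

text \<open>A translation by \<open>v\<close> after \<open>A\<close> is a translation by
  \<open>B *v v\<close> before it, so the score transforms with the transpose of \<open>B\<close>.
  Cauchy-Schwarz bounds the new information by the squared norm of \<open>B\<close> times the old
  total.\<close>

lemma bump_image_score:
  fixes A B :: "real^'n::finite^'n"
  assumes \<rho>: "\<rho> > 0" and inv: "A ** B = mat 1" "B ** A = mat 1"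
    and L: "\<And>v. norm (B *v v) \<le> L * norm v"
  shows "score_kernel (bump_image A \<rho> c)
      (\<lambda>i z. \<Sum>j\<in>UNIV. B $ j $ i * bump_score \<rho> c j (B *v z)) (L\<^sup>2 * bump_fisher \<rho> c)"
proof -
  note bm = bump_measure_basic[where c = c, OF \<rho>]
  note [measurable_cong] = bm(2)
  interpret \<beta>: prob_space "bump_measure \<rho> c" by (rule bm(1))
  let ?s = "bump_score \<rho> c" and ?\<psi> = "bump_density \<rho> c" and ?\<beta> = "bump_measure \<rho> c"
  let ?w = "\<lambda>i z. \<Sum>j\<in>UNIV. B $ j $ i * ?s j (B *v z)"
  let ?wA = "\<lambda>i y. \<Sum>j\<in>UNIV. B $ j $ i * ?s j y"
  have BA: "B *v (A *v y) = y" and AB: "A *v (B *v y) = y" for y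
    using inv by (simp_all add: matrix_vector_mul_assoc)
  have Am: "(\<lambda>y. A *v y) \<in> measurable ?\<beta> borel" by measurable
  have wm[measurable]: "?w i \<in> borel_measurable borel" for i by measurable
  have PA: "prob_space (bump_image A \<rho> c)" unfolding bump_image_def by (rule \<beta>.prob_space_distr[OF Am])
  have SA: "sets (bump_image A \<rho> c) = sets borel" by (simp add: bump_image_def)
  have s1: "integrable ?\<beta> (?s j)" "integrable ?\<beta> (\<lambda>y. (?s j y)\<^sup>2)" for j
    using bump_score_integrable[OF \<rho>, of c j] by (simp_all add: bm(4))
  have i1: "integrable ?\<beta> (?wA i)" for i using s1 by auto
  have sq: "(?wA i y)\<^sup>2 \<le> L\<^sup>2 * (\<Sum>j\<in>UNIV. (?s j y)\<^sup>2)" for i y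
  proof -
    have "(?wA i y)\<^sup>2 \<le> (\<Sum>j\<in>UNIV. (B $ j $ i)\<^sup>2) * (\<Sum>j\<in>UNIV. (?s j y)\<^sup>2)"
      by (rule Cauchy_Schwarz_ineq_sum)
    also have "(\<Sum>j\<in>UNIV. (B $ j $ i)\<^sup>2) \<le> L\<^sup>2"
    proof -
      have "B *v axis i 1 = (\<chi> j. B $ j $ i)"
        by (simp add: matrix_vector_mult_basis column_def)
      then have "(norm (B *v axis i 1))\<^sup>2 = (\<Sum>j\<in>UNIV. (B $ j $ i)\<^sup>2)"
        by (simp add: norm_vec_def L2_set_def sum_nonneg)
      moreover have "(norm (B *v axis i 1))\<^sup>2 \<le> L\<^sup>2"
        using L[of "axis i 1"] by (intro power_mono) auto
      ultimately show ?thesis by simp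
    qed
    finally show ?thesis by (simp add: mult_right_mono sum_nonneg)
  qed
  have i2': "integrable ?\<beta> (\<lambda>y. L\<^sup>2 * (\<Sum>j\<in>UNIV. (?s j y)\<^sup>2))" using s1 by auto
  have i2: "integrable ?\<beta> (\<lambda>y. (?wA i y)\<^sup>2)" for i
    by (rule Bochner_Integration.integrable_bound[OF i2']) (use sq in \<open>auto intro!: order_trans[OF _ abs_ge_self]\<close>)
  have w1: "integrable (bump_image A \<rho> c) (?w i)" for i
    unfolding bump_image_def by (subst integrable_distr_eq[OF Am]) (use i1 in \<open>auto simp: BA\<close>)
  have w2: "integrable (bump_image A \<rho> c) (\<lambda>z. (?w i z)\<^sup>2)" for i
    unfolding bump_image_def by (subst integrable_distr_eq[OF Am]) (use i2 in \<open>auto simp: BA\<close>)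
  have w3: "(LINT z|bump_image A \<rho> c. (?w i z)\<^sup>2) \<le> L\<^sup>2 * bump_fisher \<rho> c" for i
  proof -
    have "(LINT z|bump_image A \<rho> c. (?w i z)\<^sup>2) = (LINT y|?\<beta>. (?wA i y)\<^sup>2)"
      unfolding bump_image_def by (subst integral_distr[OF Am]) (auto simp: BA)
    also have "\<dots> \<le> (LINT y|?\<beta>. L\<^sup>2 * (\<Sum>j\<in>UNIV. (?s j y)\<^sup>2))"
      by (rule integral_mono[OF i2 i2' sq])
    also have "\<dots> = L\<^sup>2 * (\<Sum>j\<in>UNIV. (LINT y|?\<beta>. (?s j y)\<^sup>2))"
      using s1 by simp
    also have "\<dots> = L\<^sup>2 * bump_fisher \<rho> c" by (simp add: bump_fisher_def bm(3))
    finally show ?thesis .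
  qed
  have ok1: "kernel_ok (bump_image A \<rho> c) (\<lambda>_. 1)" by (rule kernel_ok_prob[OF PA SA])
  have okw: "kernel_ok (bump_image A \<rho> c) (?w i)" for i using PA SA w1 by (simp add: kernel_ok_def)
  have k1: "capp (pker (bump_image A \<rho> c)) f x = (LINT y|lborel. bapp f (x + A *v y) * ?\<psi> y)" for f x
    unfolding capp_ker[OF ok1] unfolding bump_image_def by (subst integral_distr[OF Am]) (auto simp: bm(3) mult.commute)
  have kw: "capp (ker (bump_image A \<rho> c) (?w i)) f x = (\<Sum>j\<in>UNIV. B $ j $ i * (LINT y|lborel. bapp f (x + A *v y) * (?\<psi> y * ?s j y)))" for f x i
  proof -
    have int: "integrable lborel (\<lambda>y. bapp f (x + A *v y) * (?\<psi> y * ?s j y))" for j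
      by (rule Bochner_Integration.integrable_bound[where f = "\<lambda>y. norm f * (?\<psi> y * ?s j y)"])
         (use bump_score_integrable(1)[OF \<rho>, of c j] in \<open>auto simp: abs_mult intro!: mult_right_mono bapp_le_norm\<close>)
    have "capp (ker (bump_image A \<rho> c) (?w i)) f x = (LINT y|?\<beta>. bapp f (x + A *v y) * ?wA i y)"
      unfolding capp_ker[OF okw] unfolding bump_image_def by (subst integral_distr[OF Am]) (auto simp: BA)
    also have "\<dots> = (LINT y|lborel. (\<Sum>j\<in>UNIV. B $ j $ i * (bapp f (x + A *v y) * (?\<psi> y * ?s j y))))"
      by (simp add: bm(3) sum_distrib_left mult_ac)
    also have "\<dots> = (\<Sum>j\<in>UNIV. B $ j $ i * (LINT y|lborel. bapp f (x + A *v y) * (?\<psi> y * ?s j y)))"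
      using int by (subst Bochner_Integration.integral_sum) auto
    finally show ?thesis .
  qed
  have "deriv_fam (pker (bump_image A \<rho> c)) (\<lambda>i. ker (bump_image A \<rho> c) (?w i))"
    unfolding deriv_fam_def k1 kw
  proof (intro allI)
    fix f :: "'n bmeas" and x v
    have "((\<lambda>t. LINT y|lborel. bapp f (x + A *v (0 + t *\<^sub>R (B *v v) + y)) * ?\<psi> y) has_real_derivative
      (\<Sum>j\<in>UNIV. (B *v v) $ j * (LINT y|lborel. bapp f (x + A *v (0 + y)) * (?\<psi> y * ?s j y)))) (at 0)"
      by (rule bump_translation_derivative[OF \<rho>, where B = "norm f"]) (auto intro: bapp_le_norm)
    moreover have "x + A *v (0 + t *\<^sub>R (B *v v) + y) = x + t *\<^sub>R v + A *v y" for t y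
      by (simp add: matrix_vector_right_distrib matrix_vector_mult_scaleR AB)
    moreover have "x + A *v (0 + y) = x + A *v y" for y by simp
    moreover have "(\<Sum>j\<in>UNIV. (B *v v) $ j * G j) = (\<Sum>i\<in>UNIV. v $ i * (\<Sum>j\<in>UNIV. B $ j $ i * G j))" for G :: "'n \<Rightarrow> real"
    proof -
      have "(\<Sum>j\<in>UNIV. (B *v v) $ j * G j) = (\<Sum>j\<in>UNIV. \<Sum>i\<in>UNIV. v $ i * (B $ j $ i * G j))"
        by (simp add: matrix_vector_mult_def sum_distrib_left sum_distrib_right mult_ac)
      also have "\<dots> = (\<Sum>i\<in>UNIV. \<Sum>j\<in>UNIV. v $ i * (B $ j $ i * G j))" by (rule sum.swap)
      finally show ?thesis by (simp add: sum_distrib_left)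
    qed
    ultimately show "((\<lambda>t. LINT y|lborel. bapp f (x + t *\<^sub>R v + A *v y) * ?\<psi> y) has_real_derivative
      (\<Sum>i\<in>UNIV. v $ i * (\<Sum>j\<in>UNIV. B $ j $ i * (LINT y|lborel. bapp f (x + A *v y) * (?\<psi> y * ?s j y))))) (at 0)"
      by (simp only:)
  qed
  then show ?thesis using PA SA w1 w2 w3 by (simp add: score_kernel_def)
qed

text \<open>The order of quantifiers matters: \<open>\<rho>\<close> and \<open>k\<close> come from
  \<open>\<epsilon>\<close>, \<open>D\<close> and \<open>c\<close> alone and serve all dominated
  laws at once.\<close>

lemma bump_measure_dominated:
  assumes D: "open D" "c \<in> D" and \<epsilon>: "\<epsilon> > 0"
  shows "\<exists>\<rho> k. 0 < \<rho> \<and> 0 < k \<and> k \<le> (1 :: real) \<and> (\<forall>\<mu> g b. dominates_Leb_on \<epsilon> D \<mu> \<longrightarrow> prob_space \<mu> \<longrightarrow> sets \<mu> = sets borel \<longrightarrow>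
    g \<in> borel_measurable borel \<longrightarrow> (\<forall>y. 0 \<le> g y \<and> g y \<le> b) \<longrightarrow> k * (LINT y|bump_measure \<rho> (c :: real^'n::finite). g y) \<le> (LINT y|\<mu>. g y))"
proof -
  obtain r where r: "r > 0" "ball c r \<subseteq> D" using D open_contains_ball by blast
  \<comment> \<open>The norm is at most the sum of the coordinates, so the open cube of this half
    side around \<open>c\<close> lies in the ball.\<close>
  define \<rho> where "\<rho> = r / real CARD('n)"
  have \<rho>: "\<rho> > 0" using r by (simp add: \<rho>_def)
  define K where "K = (\<Prod>i\<in>UNIV. 1 / (LINT x|lborel. bump \<rho> (c $ i) x))"
  have K: "K > 0" unfolding K_def using bump_integral_pos[OF \<rho>] by (intro prod_pos) auto
  \<comment> \<open>\<open>K\<close> bounds the bump density, so \<open>k\<close> times it stays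
    below \<open>\<epsilon>\<close> on \<open>D\<close>; the minimum with 1 keeps \<open>k\<close> a
    mixture weight.\<close>
  define k where "k = min 1 (\<epsilon> / K)"
  have k: "0 < k" "k \<le> 1" "k * K \<le> \<epsilon>" using K \<epsilon> by (auto simp: k_def min_def field_simps)
  have dens: "k * bump_density \<rho> c y \<le> \<epsilon> * indicator D y" for y
  proof (cases "y \<in> D")
    case True
    have "bump_density \<rho> c y \<le> K"
      unfolding bump_density_def K_def using bump_integral_pos[OF \<rho>] bump_props(1,2)[OF \<rho>]
      by (intro prod_mono) (auto simp: divide_right_mono less_imp_le)
    then have "k * bump_density \<rho> c y \<le> k * K" using k by (intro mult_left_mono) auto
    then show ?thesis using k(3) True by (simp only: indicator_simps)
  next
    case False
    then have "r \<le> norm (y - c)" using r by (auto simp: dist_norm norm_minus_commute not_less)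
    then have "r \<le> (\<Sum>i\<in>UNIV. \<bar>(y - c) $ i\<bar>)" using norm_le_l1_cart[of "y - c"] by linarith
    have "\<exists>i. \<rho> \<le> \<bar>y $ i - c $ i\<bar>"
    proof (rule ccontr)
      assume "\<not> ?thesis"
      then have "(\<Sum>i\<in>UNIV. \<bar>(y - c) $ i\<bar>) < (\<Sum>i\<in>(UNIV :: 'n set). \<rho>)"
        by (intro sum_strict_mono) (auto simp: not_le)
      then show False using \<open>r \<le> (\<Sum>i\<in>UNIV. \<bar>(y - c) $ i\<bar>)\<close> by (simp add: \<rho>_def)
    qed
    then obtain i where "bump \<rho> (c $ i) (y $ i) = 0" using bump_props(4)[OF \<rho>] by blast
    then have "bump_density \<rho> c y = 0" unfolding bump_density_def by (intro prod_zero) auto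
    then show ?thesis using False by simp
  qed
  have "k * (LINT y|bump_measure \<rho> c. g y) \<le> (LINT y|\<mu>. g y)"
    if dom: "dominates_Leb_on \<epsilon> D \<mu>" and P: "prob_space \<mu>" and S: "sets \<mu> = sets borel"
      and g[measurable]: "g \<in> borel_measurable borel" and b: "\<forall>y. 0 \<le> g y \<and> g y \<le> b" for \<mu> g b
  proof -
    interpret prob_space \<mu> by (rule P)
    note [measurable_cong] = S
    have [measurable]: "D \<in> sets borel" using D by simp
    have g0: "0 \<le> g y" and gb: "\<bar>g y\<bar> \<le> b" for y using b by auto
    have gi: "integrable \<mu> g" by (rule integrable_const_bound[where B = b]) (use gb in auto)
    have gi\<beta>: "integrable (bump_measure \<rho> c) g"
    proof -
      interpret \<beta>: prob_space "bump_measure \<rho> c" by (rule bump_measure_basic[OF \<rho>])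
      note [measurable_cong] = bump_measure_basic(2)[OF \<rho>, of c]
      show ?thesis by (rule \<beta>.integrable_const_bound[where B = b]) (use gb in auto)
    qed
    let ?\<nu> = "density lborel (\<lambda>y. ennreal \<epsilon> * indicator D y)"
    have "emeasure ?\<nu> A \<le> emeasure \<mu> A" for A
    proof (cases "A \<in> sets borel")
      case True
      then have "emeasure ?\<nu> A = (\<integral>\<^sup>+ y. ennreal \<epsilon> * indicator (A \<inter> D) y \<partial>lborel)"
        by (subst emeasure_density) (auto intro!: nn_integral_cong split: split_indicator)
      also have "\<dots> = ennreal \<epsilon> * emeasure lborel (A \<inter> D)" using True by (simp add: nn_integral_cmult)
      also have "\<dots> \<le> emeasure \<mu> A" using dom True by (simp add: dominates_Leb_on_def)
      finally show ?thesis .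
    qed (simp add: emeasure_notin_sets S)
    then have le: "?\<nu> \<le> \<mu>" by (subst le_measure) (auto simp: S)
    have "ennreal (k * (LINT y|bump_measure \<rho> c. g y)) = (\<integral>\<^sup>+ y. ennreal (k * bump_density \<rho> c y * g y) \<partial>lborel)"
    proof -
      have "integrable lborel (\<lambda>y. k * bump_density \<rho> c y * g y)"
        using gi\<beta> by (simp add: bump_measure_basic[OF \<rho>] mult.assoc)
      moreover have "0 \<le> k * bump_density \<rho> c y * g y" for y
        using k g0[of y] bump_density_basic(2)[OF \<rho>, of c y] by simp
      ultimately have "(\<integral>\<^sup>+ y. ennreal (k * bump_density \<rho> c y * g y) \<partial>lborel)
          = ennreal (LINT y|lborel. k * bump_density \<rho> c y * g y)" by (intro nn_integral_eq_integral) auto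
      then show ?thesis by (simp add: bump_measure_basic[OF \<rho>] mult.assoc)
    qed
    also have "\<dots> \<le> (\<integral>\<^sup>+ y. (ennreal \<epsilon> * indicator D y) * ennreal (g y) \<partial>lborel)"
    proof (rule nn_integral_mono)
      fix y
      have "ennreal (k * bump_density \<rho> c y * g y) \<le> ennreal ((\<epsilon> * indicator D y) * g y)"
        by (intro ennreal_leI mult_right_mono dens g0)
      then show "ennreal (k * bump_density \<rho> c y * g y) \<le> (ennreal \<epsilon> * indicator D y) * ennreal (g y)"
        using \<epsilon> g0[of y] by (auto simp: ennreal_mult split: split_indicator)
    qed
    also have "\<dots> = (\<integral>\<^sup>+ y. ennreal (g y) \<partial>?\<nu>)" by (subst nn_integral_density) auto
    also have "\<dots> \<le> (\<integral>\<^sup>+ y. ennreal (g y) \<partial>\<mu>)" by (rule nn_integral_mono_measure[OF _ le]) (simp add: S)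
    also have "\<dots> = ennreal (LINT y|\<mu>. g y)" using gi g0 by (simp add: nn_integral_eq_integral)
    finally show ?thesis
      using g0 by (subst (asm) ennreal_le_iff) (auto intro: Bochner_Integration.integral_nonneg)
  qed
  then show ?thesis using \<rho> k by blast
qed

text \<open>The law minus \<open>k\<close> times the bump is positive of mass \<open>1 - k\<close>.
  Positivity is used only through the nonnegative bounded functions \<open>norm f - f\<close> and
  \<open>norm f + f\<close>.\<close>

lemma norm_mixture_defect:
  fixes A :: "real^'n::finite^'n"
  assumes \<rho>: "\<rho> > 0" and k: "0 < k" "k \<le> 1" and P: "prob_space \<mu>" and S: "sets \<mu> = sets borel"
    and dom: "\<And>g b. g \<in> borel_measurable borel \<Longrightarrow> (\<And>y. 0 \<le> g y \<and> g y \<le> b) \<Longrightarrow>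
      k * (LINT y|bump_measure \<rho> c. g y) \<le> (LINT y|\<mu>. g y)"
  shows "norm (pker (distr \<mu> borel (\<lambda>y. A *v y)) - k *\<^sub>R pker (bump_image A \<rho> c)) \<le> 1 - k"
proof (rule norm_cop_le)
  interpret prob_space \<mu> by (rule P)
  interpret \<beta>: prob_space "bump_measure \<rho> c" by (rule bump_measure_basic[OF \<rho>])
  note [measurable_cong] = S bump_measure_basic(2)[OF \<rho>, of c]
  have Am: "(\<lambda>y. A *v y) \<in> measurable \<mu> borel" "(\<lambda>y. A *v y) \<in> measurable (bump_measure \<rho> c) borel" by measurable
  have ok: "kernel_ok (distr \<mu> borel (\<lambda>y. A *v y)) (\<lambda>_. 1)" "kernel_ok (bump_image A \<rho> c) (\<lambda>_. 1)"
    unfolding bump_image_def using prob_space_distr[OF Am(1)] \<beta>.prob_space_distr[OF Am(2)] by (auto intro: kernel_ok_prob)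
  fix f :: "'n bmeas" and x
  let ?h = "\<lambda>y. bapp f (x + A *v y)"
  have hb: "\<bar>?h y\<bar> \<le> norm f" for y by (rule bapp_le_norm)
  have hi: "integrable \<mu> ?h" "integrable (bump_measure \<rho> c) ?h"
    by (rule integrable_const_bound[where B = "norm f"] \<beta>.integrable_const_bound[where B = "norm f"]; use hb in simp)+
  have "capp (pker (distr \<mu> borel (\<lambda>y. A *v y))) f x = (LINT y|\<mu>. ?h y)"
    unfolding capp_ker[OF ok(1)] by (subst integral_distr[OF Am(1)]) auto
  moreover have "capp (pker (bump_image A \<rho> c)) f x = (LINT y|bump_measure \<rho> c. ?h y)"
    unfolding capp_ker[OF ok(2)] unfolding bump_image_def by (subst integral_distr[OF Am(2)]) auto
  ultimately have "capp (pker (distr \<mu> borel (\<lambda>y. A *v y)) - k *\<^sub>R pker (bump_image A \<rho> c)) f x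
      = (LINT y|\<mu>. ?h y) - k * (LINT y|bump_measure \<rho> c. ?h y)" by simp
  then have cap: "\<bar>capp (pker (distr \<mu> borel (\<lambda>y. A *v y)) - k *\<^sub>R pker (bump_image A \<rho> c)) f x\<bar>
      = \<bar>(LINT y|\<mu>. ?h y) - k * (LINT y|bump_measure \<rho> c. ?h y)\<bar>" by simp
  have b: "0 \<le> norm f - ?h y \<and> norm f - ?h y \<le> 2 * norm f" "0 \<le> norm f + ?h y \<and> norm f + ?h y \<le> 2 * norm f" for y
    using hb[of y] by (auto simp: abs_le_iff)
  have "k * (LINT y|bump_measure \<rho> c. norm f - ?h y) \<le> (LINT y|\<mu>. norm f - ?h y)"
    by (rule dom[OF _ b(1)]) simp
  moreover have "k * (LINT y|bump_measure \<rho> c. norm f + ?h y) \<le> (LINT y|\<mu>. norm f + ?h y)"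
    by (rule dom[OF _ b(2)]) simp
  ultimately show "\<bar>capp (pker (distr \<mu> borel (\<lambda>y. A *v y)) - k *\<^sub>R pker (bump_image A \<rho> c)) f x\<bar> \<le> (1 - k) * norm f"
    unfolding cap using hi by (simp add: prob_space \<beta>.prob_space algebra_simps abs_le_iff)
qed (use k in simp)

section \<open>Sums of independent vectors\<close>

lemma indep_vars_sum_vec:
  fixes X :: "nat \<Rightarrow> 'a \<Rightarrow> real^'n::finite"
  assumes "prob_space M" and I: "finite I" "i \<notin> I" and indep: "prob_space.indep_vars M (\<lambda>_. borel) X (insert i I)"
  shows "prob_space.indep_var M borel (X i) borel (\<lambda>\<omega>. \<Sum>i\<in>I. X i \<omega>)"
proof -
  interpret prob_space M by fact
  have "indep_var
    borel ((\<lambda>f. f i) \<circ> (\<lambda>\<omega>. restrict (\<lambda>i. X i \<omega>) {i}))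
    borel ((\<lambda>f. \<Sum>i\<in>I. f i) \<circ> (\<lambda>\<omega>. restrict (\<lambda>i. X i \<omega>) I))"
    using I by (intro indep_var_compose[OF indep_var_restrict[OF indep]]) auto
  also have "((\<lambda>f. f i) \<circ> (\<lambda>\<omega>. restrict (\<lambda>i. X i \<omega>) {i})) = X i"
    by auto
  also have "((\<lambda>f. \<Sum>i\<in>I. f i) \<circ> (\<lambda>\<omega>. restrict (\<lambda>i. X i \<omega>) I)) = (\<lambda>\<omega>. \<Sum>i\<in>I. X i \<omega>)"
    by (auto cong: rev_conj_cong)
  finally show ?thesis .
qed

text \<open>Splitting off one summand makes the joint law a product, and Fubini adds one application
  of the averaging operator. The base point is generalized because the inner integral starts at
  \<open>x + y\<close>.\<close>

lemma pker_power_expectation: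
  fixes X :: "nat \<Rightarrow> 'a \<Rightarrow> real^'n::finite"
  assumes M: "prob_space M" and indep: "prob_space.indep_vars M (\<lambda>_. borel) X {1..n}"
    and law: "\<And>k. k \<in> {1..n} \<Longrightarrow> distr M borel (X k) = \<mu>"
    and \<mu>: "prob_space \<mu>" "sets \<mu> = sets borel"
  shows "(LINT \<omega>|M. bapp f (x + (\<Sum>k=1..n. X k \<omega>))) = capp (pker \<mu> ^ n) f x"
  using indep law
proof (induct n arbitrary: x)
  case 0
  interpret prob_space M by (rule M)
  show ?case by (simp add: prob_space)
next
  case (Suc n)
  interpret prob_space M by (rule M)
  let ?S = "\<lambda>\<omega>. \<Sum>k=1..n. X k \<omega>"
  have ins: "{1..Suc n} = insert (Suc n) {1..n}" by auto
  have rv: "X k \<in> borel_measurable M" if "k \<in> {1..Suc n}" for k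
    using Suc.prems(1) that by (auto simp: indep_vars_def)
  have mX: "X (Suc n) \<in> borel_measurable M" and mS: "?S \<in> borel_measurable M"
    using rv by (auto intro!: borel_measurable_sum)
  have iv: "indep_var borel (X (Suc n)) borel ?S"
    using Suc.prems(1) unfolding ins by (intro indep_vars_sum_vec M) auto
  interpret D1: prob_space "distr M borel (X (Suc n))" by (rule prob_space_distr[OF mX])
  interpret D2: prob_space "distr M borel ?S" by (rule prob_space_distr[OF mS])
  interpret pair_sigma_finite "distr M borel (X (Suc n))" "distr M borel ?S" ..
  interpret D12: prob_space "distr M borel (X (Suc n)) \<Otimes>\<^sub>M distr M borel ?S"
    by (rule prob_space_pair[OF D1.prob_space_axioms D2.prob_space_axioms])
  have joint: "distr M borel (X (Suc n)) \<Otimes>\<^sub>M distr M borel ?S = distr M (borel \<Otimes>\<^sub>M borel) (\<lambda>\<omega>. (X (Suc n) \<omega>, ?S \<omega>))"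
    using iv by (simp add: indep_var_distribution_eq)
  have gm: "(\<lambda>(y, z). bapp f (x + y + z)) \<in> borel_measurable (borel \<Otimes>\<^sub>M borel)" by measurable
  have IH: "(LINT \<omega>|M. bapp f (x' + ?S \<omega>)) = capp (pker \<mu> ^ n) f x'" for x'
    by (rule Suc.hyps) (use Suc.prems in \<open>auto intro: indep_vars_subset\<close>)
  have "(LINT \<omega>|M. bapp f (x + (\<Sum>k=1..Suc n. X k \<omega>))) = (LINT \<omega>|M. (case (X (Suc n) \<omega>, ?S \<omega>) of (y, z) \<Rightarrow> bapp f (x + y + z)))"
  proof -
    have "(\<Sum>k=1..Suc n. X k \<omega>) = X (Suc n) \<omega> + ?S \<omega>" for \<omega> by (simp add: add.commute)
    then show ?thesis by (simp only: prod.case add.assoc)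
  qed
  also have "\<dots> = (LINT p|(distr M borel (X (Suc n)) \<Otimes>\<^sub>M distr M borel ?S). (case p of (y, z) \<Rightarrow> bapp f (x + y + z)))"
    unfolding joint using mX mS by (subst integral_distr[OF _ gm]) auto
  also have "\<dots> = (LINT y|distr M borel (X (Suc n)). (LINT z|distr M borel ?S. bapp f (x + y + z)))"
  proof -
    have "integrable (distr M borel (X (Suc n)) \<Otimes>\<^sub>M distr M borel ?S) (\<lambda>(y, z). bapp f (x + y + z))"
      by (rule D12.integrable_const_bound[where B = "norm f"]) (auto intro: bapp_le_norm)
    then show ?thesis by (rule integral_fst[symmetric])
  qed
  also have "\<dots> = (LINT y|\<mu>. capp (pker \<mu> ^ n) f (x + y))"
  proof -
    have "(LINT z|distr M borel ?S. bapp f (x + y + z)) = capp (pker \<mu> ^ n) f (x + y)" for y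
      using IH[of "x + y"] by (subst integral_distr[OF mS]) auto
    then show ?thesis using Suc.prems(2)[of "Suc n"] by simp
  qed
  also have "\<dots> = capp (pker \<mu> ^ Suc n) f x"
    by (simp add: capp_times capp_ker[OF kernel_ok_prob[OF \<mu>]] flip: capp_eq)
  finally show ?case .
qed

section \<open>Symmetric matrices and the covariance normalization\<close>

definition self_adjoint :: "real^'n^'n \<Rightarrow> bool" where
  "self_adjoint S \<longleftrightarrow> (\<forall>x y. x \<bullet> (S *v y) = (S *v x) \<bullet> y)"

lemma self_adjoint_transpose: "transpose S = S \<Longrightarrow> self_adjoint (S :: real^'n::finite^'n)"
  unfolding self_adjoint_def by (metis dot_lmul_matrix vector_transpose_matrix)

lemma transpose_self_adjoint:
  assumes "self_adjoint (S :: real^'n::finite^'n)" shows "transpose S = S"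
proof -
  have "S $ j $ i = S $ i $ j" for i j
  proof -
    have "axis j 1 \<bullet> (S *v axis i 1) = (S *v axis j 1) \<bullet> axis i 1"
      using assms by (simp add: self_adjoint_def)
    then show ?thesis by (simp add: matrix_vector_mult_basis column_def inner_axis inner_axis')
  qed
  then show ?thesis by (simp add: transpose_def vec_eq_iff)
qed

text \<open>The quadratic form attains its maximum on the unit sphere of \<open>V\<close>. If
  \<open>z = S *v v - l *\<^sub>R v\<close> were not zero there, moving from \<open>v\<close> in the
  direction \<open>z\<close> would exceed that maximum.\<close>

lemma self_adjoint_eigenvector:
  fixes S :: "real^'n::finite^'n"
  assumes S: "self_adjoint S" and V: "subspace V" "\<And>x. x \<in> V \<Longrightarrow> S *v x \<in> V" and w: "w \<in> V" "w \<noteq> 0"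
  shows "\<exists>v\<in>V. norm v = 1 \<and> (\<exists>l. S *v v = l *\<^sub>R v)"
proof -
  let ?q = "\<lambda>x. x \<bullet> (S *v x)" and ?K = "sphere 0 1 \<inter> V"
  have K: "compact ?K" using closed_subspace[OF V(1)] by (intro compact_Int_closed) auto
  have "(1 / norm w) *\<^sub>R w \<in> ?K" using w subspace_scale[OF V(1)] by auto
  then have ne: "?K \<noteq> {}" by blast
  have cont: "continuous_on ?K ?q" by (intro continuous_intros)
  obtain v where v: "v \<in> ?K" and max: "\<And>x. x \<in> ?K \<Longrightarrow> ?q x \<le> ?q v"
    using continuous_attains_sup[OF K ne cont] by blast
  define l where "l = ?q v"
  have v1: "v \<in> V" "norm v = 1" "v \<bullet> v = 1" using v by (auto simp: norm_eq_1)
  have le: "?q x \<le> l * (x \<bullet> x)" if "x \<in> V" for x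
  proof (cases "x = 0")
    case False
    have "(1 / norm x) *\<^sub>R x \<in> ?K" using False that subspace_scale[OF V(1)] by auto
    from max[OF this] have "?q x / (norm x)\<^sup>2 \<le> l"
      by (simp add: l_def matrix_vector_mult_scaleR power2_eq_square divide_simps)
    then show ?thesis using False by (simp add: field_simps power2_norm_eq_inner)
  qed simp
  define z where "z = S *v v - l *\<^sub>R v"
  have zV: "z \<in> V" unfolding z_def using V v1 by (intro subspace_diff subspace_scale) auto
  have "2 * t * (z \<bullet> z) + t\<^sup>2 * (?q z - l * (z \<bullet> z)) \<le> 0" for t
  proof -
    have "v + t *\<^sub>R z \<in> V" using zV v1 V by (intro subspace_add subspace_scale) auto
    from le[OF this] have "?q v + 2 * t * (z \<bullet> (S *v v)) + t\<^sup>2 * ?q z \<le> l * (v \<bullet> v + 2 * t * (z \<bullet> v) + t\<^sup>2 * (z \<bullet> z))"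
      using S[unfolded self_adjoint_def, rule_format, of v z]
      by (simp add: matrix_vector_right_distrib matrix_vector_mult_scaleR inner_add_left inner_add_right
          power2_eq_square inner_commute algebra_simps)
    moreover have "z \<bullet> (S *v v) = z \<bullet> z + l * (z \<bullet> v)" by (simp add: z_def inner_diff_right inner_diff_left)
    ultimately show ?thesis using v1 by (simp add: l_def algebra_simps)
  qed
  note quad = this
  have "z \<bullet> z \<le> 0"
  proof (rule ccontr)
    assume "\<not> z \<bullet> z \<le> 0"
    then have p: "z \<bullet> z > 0" by linarith
    \<comment> \<open>The step \<open>t\<close> is so small that the quadratic term cannot outweigh
      half of the linear one.\<close>
    define a where "a = \<bar>?q z - l * (z \<bullet> z)\<bar> + 1"
    have a: "a > 0" by (simp add: a_def)
    define t where "t = (z \<bullet> z) / a"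
    have t: "t > 0" using p a by (simp add: t_def)
    have "t * (2 * (z \<bullet> z) + t * (?q z - l * (z \<bullet> z))) \<le> 0"
      using quad[of t] by (simp only: power2_eq_square distrib_left mult_ac)
    then have "2 * (z \<bullet> z) + t * (?q z - l * (z \<bullet> z)) \<le> 0"
      using t by (simp only: mult_le_0_iff) linarith
    moreover have "- (t * (?q z - l * (z \<bullet> z))) \<le> t * a" using t by (simp add: a_def flip: mult_minus_right)
    moreover have "t * a = z \<bullet> z" using a by (simp add: t_def)
    ultimately show False using p by linarith
  qed
  then have "z \<bullet> z = 0" using inner_ge_zero[of z] by linarith
  then have "z = 0" by simp
  then show ?thesis using v1 by (intro bexI[of _ v]) (auto simp: z_def)
qed

text \<open>An orthonormal set of eigenvectors of largest size exists, because the dimension bounds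
  the size. If it did not span, its orthogonal complement, invariant by self-adjointness, would
  contain a further eigenvector.\<close>

lemma spectral_basis:
  fixes S :: "real^'n::finite^'n"
  assumes S: "self_adjoint S"
  obtains B m where "finite B" "pairwise orthogonal B" "\<forall>b\<in>B. norm b = 1" "span B = UNIV"
    "\<forall>b\<in>B. S *v b = m b *\<^sub>R b"
proof -
  define P where "P B \<longleftrightarrow> finite B \<and> pairwise orthogonal B \<and> (\<forall>b\<in>B. norm b = 1 \<and> (\<exists>l. S *v b = l *\<^sub>R b))" for B
  have indep: "independent B" if "P B" for B
  proof (rule pairwise_orthogonal_independent)
    show "pairwise orthogonal B" "0 \<notin> B" using that by (force simp: P_def)+
  qed
  have bound: "card B \<le> DIM(real^'n)" if "P B" for B
    using independent_bound[OF indep[OF that]] by blast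
  have "P {}" by (simp add: P_def)
  then have "\<exists>B. P B \<and> (\<forall>B'. P B' \<longrightarrow> card B' \<le> card B)"
    by (rule ex_has_greatest_nat[where b = "Suc DIM(real^'n)"]) (use bound in \<open>simp only: less_Suc_eq_le, blast\<close>)
  then obtain B where B: "P B" and max: "\<And>B'. P B' \<Longrightarrow> card B' \<le> card B"
    by blast
  have "span B = UNIV"
  proof (rule ccontr)
    assume "span B \<noteq> UNIV"
    then have "span B \<subset> span UNIV" by auto
    then obtain w where w: "w \<noteq> 0" "\<And>y. y \<in> span B \<Longrightarrow> orthogonal w y"
      using orthogonal_to_subspace_exists_gen by (metis span_UNIV)
    define V where "V = {x. \<forall>b\<in>B. b \<bullet> x = 0}"
    have "subspace V" by (auto simp: V_def subspace_def inner_add_right)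
    moreover have "S *v x \<in> V" if "x \<in> V" for x
    proof -
      have "b \<bullet> (S *v x) = 0" if b: "b \<in> B" for b
      proof -
        have "\<exists>l. S *v b = l *\<^sub>R b" using B b unfolding P_def by blast
        then obtain l where "S *v b = l *\<^sub>R b" ..
        then show ?thesis using S \<open>x \<in> V\<close> b by (simp add: self_adjoint_def V_def)
      qed
      then show ?thesis by (simp add: V_def)
    qed
    moreover have "w \<in> V" using w(2)[OF span_base] by (auto simp: V_def orthogonal_def inner_commute)
    ultimately obtain v where v: "v \<in> V" "norm v = 1" "\<exists>l. S *v v = l *\<^sub>R v"
      using self_adjoint_eigenvector[OF S] w(1) by blast
    have "v \<notin> B" using v by (auto simp: V_def norm_eq_1)
    moreover have "P (insert v B)"
      using B v by (auto simp: P_def pairwise_insert orthogonal_def V_def inner_commute)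
    ultimately show False using max[of "insert v B"] B by (simp add: P_def)
  qed
  moreover obtain m where "\<forall>b\<in>B. S *v b = m b *\<^sub>R b" using B unfolding P_def by metis
  moreover have "finite B" "pairwise orthogonal B" "\<forall>b\<in>B. norm b = 1" using B by (auto simp: P_def)
  ultimately show ?thesis using that by blast
qed

lemma orthonormal_expand:
  assumes "finite B" "pairwise orthogonal B" "\<forall>b\<in>B. norm b = 1" "span B = (UNIV :: (real^'n::finite) set)"
  shows "(\<Sum>b\<in>B. (x \<bullet> b) *\<^sub>R b) = x"
  using assms by (intro orthonormal_basis_expand) auto

lemma matrix_vector_mult_sum:
  "(A :: real^'n::finite^'m) *v (\<Sum>b\<in>B. c b *\<^sub>R g b) = (\<Sum>b\<in>B. c b *\<^sub>R (A *v g b))"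
  by (induct B rule: infinite_finite_induct) (simp_all add: matrix_vector_right_distrib matrix_vector_mult_scaleR)

text \<open>The root multiplies each vector of an orthonormal eigenbasis by the root of its
  eigenvalue; written with inner products it is visibly linear and symmetric.\<close>

lemma pos_semidef_sqrt_exists:
  fixes C :: "real^'n::finite^'n"
  assumes C: "self_adjoint C" and pos: "\<And>x. 0 \<le> x \<bullet> (C *v x)"
  shows "\<exists>R. pos_semidef R \<and> R ** R = C"
proof -
  obtain B m where B: "finite B" "pairwise orthogonal B" "\<forall>b\<in>B. norm b = 1" "span B = UNIV"
    and mB': "\<forall>b\<in>B. C *v b = m b *\<^sub>R b" by (rule spectral_basis[OF C])
  note m = bspec[OF mB']
  note ex = orthonormal_expand[OF B]
  have m0: "0 \<le> m b" if "b \<in> B" for b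
    using pos[of b] m[OF that] B(3) that by (simp add: norm_eq_1)
  define r where "r x = (\<Sum>b\<in>B. (sqrt (m b) * (x \<bullet> b)) *\<^sub>R b)" for x
  have lin: "linear r" unfolding r_def
    by (intro linearI) (simp_all add: inner_add_left distrib_left scaleR_add_left sum.distrib scaleR_sum_right mult_ac)
  define R where "R = matrix r"
  have R: "R *v x = r x" for x unfolding R_def using fun_cong[OF matrix_vector_mul(2)[OF lin], of x] .
  have rb: "r b = sqrt (m b) *\<^sub>R b" if "b \<in> B" for b
  proof -
    have "r b = (\<Sum>b'\<in>B. if b' = b then sqrt (m b) *\<^sub>R b else 0)"
      unfolding r_def
    proof (rule sum.cong[OF refl])
      fix b' assume "b' \<in> B"
      then show "(sqrt (m b') * (b \<bullet> b')) *\<^sub>R b' = (if b' = b then sqrt (m b) *\<^sub>R b else 0)"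
        using B(2,3) that by (auto simp: norm_eq_1 pairwise_def orthogonal_def)
    qed
    then show ?thesis using B(1) that by simp
  qed
  have ip: "x \<bullet> r y = (\<Sum>b\<in>B. sqrt (m b) * (x \<bullet> b) * (y \<bullet> b))" for x y
    by (simp add: r_def inner_sum_right mult_ac)
  have "self_adjoint R"
    unfolding self_adjoint_def R by (simp add: ip inner_commute[of "r _"]) (simp add: mult_ac)
  then have "pos_semidef R"
    unfolding pos_semidef_def using transpose_self_adjoint m0
    by (auto simp: R ip mult.assoc intro!: sum_nonneg)
  moreover have "R ** R = C"
  proof -
    have "(R ** R) *v x = C *v x" for x
    proof -
      have "(R ** R) *v (\<Sum>b\<in>B. (x \<bullet> b) *\<^sub>R b) = C *v (\<Sum>b\<in>B. (x \<bullet> b) *\<^sub>R b)"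
        unfolding matrix_vector_mult_sum
      proof (rule sum.cong[OF refl])
        fix b assume b: "b \<in> B"
        have "(R ** R) *v b = R *v (R *v b)" by (simp add: matrix_vector_mul_assoc)
        also have "\<dots> = (sqrt (m b) * sqrt (m b)) *\<^sub>R b"
          using rb[OF b] by (simp add: R[of b] matrix_vector_mult_scaleR)
        finally show "(x \<bullet> b) *\<^sub>R ((R ** R) *v b) = (x \<bullet> b) *\<^sub>R (C *v b)" using m[OF b] m0[OF b] by simp
      qed
      then show ?thesis by (simp only: ex)
    qed
    then show ?thesis by (simp add: matrix_eq)
  qed
  ultimately show ?thesis by blast
qed

text \<open>On an eigenvector \<open>b\<close> of \<open>R - R'\<close>, equality of the squares
  gives \<open>m b * (b \<bullet> (R *v b) + b \<bullet> (R' *v b)) = 0\<close>. If the bracket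
  vanishes, so do its two nonnegative terms, and \<open>m b\<close> is their difference.\<close>

lemma pos_semidef_sqrt_unique:
  fixes R R' :: "real^'n::finite^'n"
  assumes R: "pos_semidef R" and R': "pos_semidef R'" and eq: "R ** R = R' ** R'"
  shows "R = R'"
proof -
  have sa: "self_adjoint R" "self_adjoint R'" using R R' by (auto simp: pos_semidef_def intro: self_adjoint_transpose)
  let ?D = "R - R'"
  have Dv: "?D *v x = R *v x - R' *v x" for x by (rule matrix_vector_mult_diff_rdistrib)
  have Dsa: "self_adjoint ?D" using sa by (simp add: self_adjoint_def Dv inner_diff_left inner_diff_right)
  obtain B m where B: "finite B" "pairwise orthogonal B" "\<forall>b\<in>B. norm b = 1" "span B = UNIV"
    and mB': "\<forall>b\<in>B. ?D *v b = m b *\<^sub>R b" by (rule spectral_basis[OF Dsa])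
  note m = bspec[OF mB']
  note ex = orthonormal_expand[OF B]
  have D0: "?D *v b = 0" if b: "b \<in> B" for b
  proof -
    have Rb: "R *v b = R' *v b + m b *\<^sub>R b" using m[OF b] by (simp add: Dv algebra_simps)
    have "R *v (R *v b) = R' *v (R' *v b)" using eq by (simp add: matrix_vector_mul_assoc)
    then have "(R *v b) \<bullet> (R *v b) = (R' *v b) \<bullet> (R' *v b)"
      using sa unfolding self_adjoint_def by metis
    then have "m b * (2 * (b \<bullet> (R' *v b)) + m b) = 0"
      unfolding Rb using B(3) b by (simp add: inner_add_left inner_add_right inner_commute norm_eq_1 algebra_simps)
    moreover have "2 * (b \<bullet> (R' *v b)) + m b = b \<bullet> (R *v b) + b \<bullet> (R' *v b)"
      unfolding Rb using B(3) b by (simp add: inner_add_right norm_eq_1)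
    moreover have "0 \<le> b \<bullet> (R *v b)" "0 \<le> b \<bullet> (R' *v b)" using R R' by (auto simp: pos_semidef_def)
    ultimately have "m b = 0" by (auto simp: mult_eq_0_iff)
    then show ?thesis using m[OF b] by simp
  qed
  have "?D *v x = 0" for x
  proof -
    have "?D *v (\<Sum>b\<in>B. (x \<bullet> b) *\<^sub>R b) = 0"
      unfolding matrix_vector_mult_sum using D0 by simp
    then show ?thesis by (simp only: ex)
  qed
  then have "R *v x = R' *v x" for x by (simp add: Dv)
  then show ?thesis by (simp add: matrix_eq)
qed

text \<open>An eigenvector has a nonzero coefficient at some \<open>b\<close>, so its eigenvalue is
  among the \<open>m b\<close>, whence finiteness. In the basis the quadratic form is a sum of
  squares weighted by eigenvalues.\<close>

lemma eigenvalue_bounds: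
  fixes S :: "real^'n::finite^'n"
  assumes S: "self_adjoint S"
  shows "finite (eigenvalues S)" "eigenvalues S \<noteq> {}"
    "Min (eigenvalues S) * (x \<bullet> x) \<le> x \<bullet> (S *v x)" "x \<bullet> (S *v x) \<le> Max (eigenvalues S) * (x \<bullet> x)"
proof -
  obtain B m where B: "finite B" "pairwise orthogonal B" "\<forall>b\<in>B. norm b = 1" "span B = UNIV"
    and mB': "\<forall>b\<in>B. S *v b = m b *\<^sub>R b" by (rule spectral_basis[OF S])
  note m = bspec[OF mB']
  note ex = orthonormal_expand[OF B]
  have mB: "m b \<in> eigenvalues S" if "b \<in> B" for b
    using m[OF that] B(3) that by (auto simp: eigenvalues_def intro!: exI[of _ b])
  have sub: "eigenvalues S \<subseteq> m ` B"
  proof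
    fix l assume "l \<in> eigenvalues S"
    then obtain v where v: "v \<noteq> 0" "S *v v = l *\<^sub>R v" by (auto simp: eigenvalues_def)
    have "\<exists>b\<in>B. v \<bullet> b \<noteq> 0"
    proof (rule ccontr)
      assume "\<not> ?thesis"
      then have "(\<Sum>b\<in>B. (v \<bullet> b) *\<^sub>R b) = 0" by simp
      then show False using v ex by simp
    qed
    then obtain b where b: "b \<in> B" "v \<bullet> b \<noteq> 0" by blast
    have "v \<bullet> (S *v b) = (S *v v) \<bullet> b" using S by (simp add: self_adjoint_def)
    then have "m b = l" using v b m by simp
    then show "l \<in> m ` B" using b by blast
  qed
  show fin: "finite (eigenvalues S)" using sub B(1) finite_surj by blast
  have "B \<noteq> {}"
  proof
    assume "B = {}"
    then have "(UNIV :: (real^'n) set) = {0}" using B(4) by simp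
    moreover have "axis undefined 1 \<noteq> (0 :: real^'n)" by (simp add: axis_eq_0_iff)
    ultimately show False by blast
  qed
  then show ne: "eigenvalues S \<noteq> {}" using mB by blast
  have xx: "x \<bullet> x = (\<Sum>b\<in>B. (x \<bullet> b)\<^sup>2)"
  proof -
    have "x \<bullet> x = x \<bullet> (\<Sum>b\<in>B. (x \<bullet> b) *\<^sub>R b)" by (simp only: ex)
    then show ?thesis by (simp add: inner_sum_right power2_eq_square)
  qed
  have xSx: "x \<bullet> (S *v x) = (\<Sum>b\<in>B. m b * (x \<bullet> b)\<^sup>2)"
  proof -
    have "x \<bullet> (S *v x) = x \<bullet> (S *v (\<Sum>b\<in>B. (x \<bullet> b) *\<^sub>R b))" by (simp only: ex)
    also have "\<dots> = (\<Sum>b\<in>B. m b * (x \<bullet> b)\<^sup>2)"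
      unfolding matrix_vector_mult_sum using m by (simp add: inner_sum_right power2_eq_square mult_ac)
    finally show ?thesis .
  qed
  show "Min (eigenvalues S) * (x \<bullet> x) \<le> x \<bullet> (S *v x)"
    unfolding xx xSx sum_distrib_left by (intro sum_mono mult_right_mono Min_le fin mB) auto
  show "x \<bullet> (S *v x) \<le> Max (eigenvalues S) * (x \<bullet> x)"
    unfolding xx xSx sum_distrib_left by (intro sum_mono mult_right_mono Max_ge fin mB) auto
qed

lemma matrix_inv_mult:
  fixes A :: "real^'n::finite^'n"
  assumes "invertible A"
  shows "A ** matrix_inv A = mat 1" "matrix_inv A ** A = mat 1"
  using someI_ex[OF assms[unfolded invertible_def]] by (simp_all add: matrix_inv_def)

text \<open>The largest eigenvalue of the inverse covariance controls \<open>A\<close>, hence the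
  moments of the normalized law; the smallest one controls the inverse \<open>R\<close> of
  \<open>A\<close>, hence the Fisher information of the transported bump.\<close>

lemma pos_def_normalizer:
  fixes C :: "real^'n::finite^'n"
  assumes C: "self_adjoint C" and pos: "\<And>x. x \<noteq> 0 \<Longrightarrow> 0 < x \<bullet> (C *v x)"
  defines "R \<equiv> matrix_sqrt C" and "A \<equiv> matrix_inv (matrix_sqrt C)"
    and "l \<equiv> Min (eigenvalues (matrix_inv C))" and "u \<equiv> Max (eigenvalues (matrix_inv C))"
  shows "A ** R = mat 1" "R ** A = mat 1" "self_adjoint A" "C *v (A *v (A *v x)) = x"
    "0 < l" "(norm (A *v x))\<^sup>2 \<le> u * (norm x)\<^sup>2" "norm (R *v x) \<le> (1 / sqrt l) * norm x"
proof -
  have pos0: "0 \<le> x \<bullet> (C *v x)" for x using pos[of x] by (cases "x = 0") auto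
  obtain R0 where R0: "pos_semidef R0" "R0 ** R0 = C" using pos_semidef_sqrt_exists[OF C pos0] by blast
  have "matrix_sqrt C = R0"
    unfolding matrix_sqrt_def using R0 pos_semidef_sqrt_unique by (intro the_equality) auto
  then have R: "pos_semidef R" "R ** R = C" using R0 by (auto simp: R_def)
  have Rsa: "self_adjoint R" using R(1) by (auto simp: pos_semidef_def intro: self_adjoint_transpose)
  have RR: "R *v (R *v x) = C *v x" for x using R(2) by (simp add: matrix_vector_mul_assoc)
  have "x = 0" if "R *v x = 0" for x
  proof (rule ccontr)
    assume "x \<noteq> 0"
    then have "0 < x \<bullet> (R *v (R *v x))" using pos RR by simp
    then show False using that by simp
  qed
  then have "invertible R" by (simp add: invertible_left_inverse matrix_left_invertible_ker)
  then show AR: "A ** R = mat 1" and RA: "R ** A = mat 1"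
    unfolding A_def R_def[symmetric] by (auto simp: matrix_inv_mult)
  have ARv: "A *v (R *v x) = x" and RAv: "R *v (A *v x) = x" for x
    using AR RA by (simp_all add: matrix_vector_mul_assoc)
  show Asa: "self_adjoint A"
    unfolding self_adjoint_def
  proof (intro allI)
    fix x y
    have "(A *v x) \<bullet> (R *v (A *v y)) = (R *v (A *v x)) \<bullet> (A *v y)" using Rsa by (simp add: self_adjoint_def)
    then show "x \<bullet> (A *v y) = (A *v x) \<bullet> y" by (simp add: RAv)
  qed
  show CAA: "C *v (A *v (A *v x)) = x" for x by (simp add: RAv flip: RR)
  have AAC: "A *v (A *v (C *v x)) = x" for x by (simp add: ARv flip: RR)
  have "C ** (A ** A) = mat 1" "(A ** A) ** C = mat 1"
    using CAA AAC by (simp_all add: matrix_eq flip: matrix_vector_mul_assoc)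
  then have "matrix_inv C = A ** A"
    by (metis invertible_def matrix_inv_mult(1) matrix_mul_assoc matrix_mul_lid matrix_mul_rid)
  then have Ci: "matrix_inv C *v x = A *v (A *v x)" for x by (simp add: matrix_vector_mul_assoc)
  have Cisa: "self_adjoint (matrix_inv C)" using Asa by (simp add: self_adjoint_def Ci)
  have q: "x \<bullet> (matrix_inv C *v x) = (norm (A *v x))\<^sup>2" for x
    using Asa by (simp add: Ci self_adjoint_def power2_norm_eq_inner)
  note eb = eigenvalue_bounds[OF Cisa]
  show "(norm (A *v x))\<^sup>2 \<le> u * (norm x)\<^sup>2"
    using eb(4)[of x] by (simp add: q u_def power2_norm_eq_inner)
  have "l \<in> eigenvalues (matrix_inv C)" unfolding l_def by (rule Min_in[OF eb(1,2)])
  then obtain v where v: "v \<noteq> 0" "matrix_inv C *v v = l *\<^sub>R v" by (auto simp: eigenvalues_def)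
  have "A *v v \<noteq> 0" using v(1) RAv[of v] by auto
  then have "0 < l * (v \<bullet> v)" using q[of v] v(2) by simp
  moreover have "0 < v \<bullet> v" using v(1) by simp
  ultimately show l: "0 < l" by (simp only: zero_less_mult_iff) linarith
  have "l * (norm (R *v x))\<^sup>2 \<le> (norm x)\<^sup>2"
    using eb(3)[of "R *v x"] by (simp add: q l_def ARv power2_norm_eq_inner)
  then have "(sqrt l * norm (R *v x))\<^sup>2 \<le> (norm x)\<^sup>2" using l by (simp add: power_mult_distrib)
  then have "sqrt l * norm (R *v x) \<le> norm x" by (rule power2_le_imp_le) simp
  then show "norm (R *v x) \<le> (1 / sqrt l) * norm x" using l by (simp add: field_simps)
qed

section \<open>The correction polynomials\<close>

text \<open>The coefficients must be free of \<open>n\<close>, because the correction polynomials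
  are fixed while \<open>n\<close> varies.\<close>

lemma binomial_as_polynomial: "\<exists>c. \<forall>n. real (n choose j) = (\<Sum>l\<le>j. c l * real n ^ l)"
proof -
  define p where "p = smult (1 / fact j) (\<Prod>i<j. [:- real i, 1:])"
  have deg: "degree p \<le> j"
  proof -
    have "degree (\<Prod>i<j. [:- real i, 1:]) \<le> (\<Sum>i<j. degree [:- real i, 1:])"
      using degree_prod_sum_le[of "{..<j}" "\<lambda>i. [:- real i, 1:]"] by (simp add: o_def)
    then show ?thesis by (simp add: p_def)
  qed
  have "real (n choose j) = poly p (real n)" for n
  proof -
    have "real (n choose j) = (\<Prod>i<j. real n - real i) / fact j"
      by (simp add: binomial_gbinomial gbinomial_prod_rev lessThan_atLeast0)
    then show ?thesis by (simp add: p_def poly_prod)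
  qed
  moreover have "poly p x = (\<Sum>l\<le>j. coeff p l * x ^ l)" for x
    unfolding poly_altdef using deg by (intro sum.mono_neutral_left) (auto simp: coeff_eq_0)
  ultimately show ?thesis by (intro exI[of _ "coeff p"]) simp
qed

lemma polynomial_deg_le_sum:
  "(\<And>i. i \<in> A \<Longrightarrow> polynomial_deg_le d (p i)) \<Longrightarrow> polynomial_deg_le d (\<lambda>x. \<Sum>i\<in>A. p i x)"
  by (induct A rule: infinite_finite_induct) (auto intro: polynomial_deg_le_zero polynomial_deg_le_add)

lemma polynomial_deg_le_sum_list:
  "(\<And>i. i \<in> set xs \<Longrightarrow> polynomial_deg_le d (p i)) \<Longrightarrow> polynomial_deg_le d (\<lambda>x. \<Sum>i\<leftarrow>xs. p i x)"
  by (induct xs) (auto intro: polynomial_deg_le_zero polynomial_deg_le_add)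

text \<open>A word of length \<open>k\<close> carries \<open>n powr (- k / 2)\<close>, a term of the
  binomial coefficient carries \<open>n ^ l\<close>; the pairs with \<open>k = m + 2 * l\<close> are
  those of total order \<open>n powr (- m / 2)\<close>.\<close>

definition correction :: "(nat \<Rightarrow> nat \<Rightarrow> real) \<Rightarrow> nat \<Rightarrow> 'n::finite symbol \<Rightarrow> nat \<Rightarrow> real^'n \<Rightarrow> real" where
  "correction c s D m z = (\<Sum>j\<in>{1..s}. \<Sum>l\<le>j. c j l *
     (\<Sum>(a, w)\<leftarrow>spow D j. if length w = m + 2 * l then a * hermite_word w z else 0))"

text \<open>Words of the \<open>j\<close>-th power have length at least \<open>3 * j\<close>, hence
  at least \<open>3 * l\<close>. Together with \<open>length w = m + 2 * l\<close> this forces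
  \<open>l \<le> m\<close>, so the length is at most \<open>3 * m\<close>.\<close>

lemma correction_degree:
  assumes D: "sdeg 3 \<kappa> D"
  shows "polynomial_deg_le (3 * m) (correction c s D m)"
  unfolding correction_def[abs_def]
proof (intro polynomial_deg_le_sum polynomial_deg_le_cmult polynomial_deg_le_sum_list)
  fix j l x assume l: "l \<in> {..j}" and x: "x \<in> set (spow D j)"
  obtain a w where aw: "x = (a, w)" by force
  have "3 * j \<le> length w" using sdeg_spow[OF D, of j] x by (auto simp: sdeg_def aw)
  then have "length w = m + 2 * l \<Longrightarrow> length w \<le> 3 * m" using l by simp
  then show "polynomial_deg_le (3 * m) (\<lambda>z. case x of (a, w) \<Rightarrow> if length w = m + 2 * l then a * hermite_word w z else 0)"
    by (cases "length w = m + 2 * l")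
       (auto simp: aw intro!: polynomial_deg_le_zero polynomial_deg_le_cmult intro: polynomial_deg_le_mono[OF polynomial_deg_le_hermite_word])
qed

text \<open>A sum over all words stands in for a maximum; the type argument carries the dimension,
  which no other argument determines.\<close>

definition hermite_norm :: "nat \<Rightarrow> 'n::finite itself \<Rightarrow> real" where
  "hermite_norm h _ = (\<Sum>k\<le>h. \<Sum>w\<in>(words k :: 'n list set). LINT z|lborel. \<bar>std_gauss_density z * hermite_word w z\<bar>)"

lemma hermite_norm_le:
  fixes w :: "'n::finite list"
  assumes "length w \<le> h"
  shows "(LINT z|lborel. \<bar>std_gauss_density z * hermite_word w z\<bar>) \<le> hermite_norm h TYPE('n)"
proof -
  let ?F = "\<lambda>w :: 'n list. LINT z|lborel. \<bar>std_gauss_density z * hermite_word w z\<bar>"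
  have "?F w \<le> (\<Sum>w\<in>(words (length w) :: 'n list set). ?F w)"
    by (rule member_le_sum) (auto simp: words_def finite_words[unfolded words_def])
  also have "\<dots> \<le> hermite_norm h TYPE('n)"
    unfolding hermite_norm_def
    by (rule member_le_sum[where f = "\<lambda>k. \<Sum>w\<in>words k. ?F w"]) (use assms in \<open>auto intro!: sum_nonneg\<close>)
  finally show ?thesis .
qed

lemma hermite_norm_nonneg: "0 \<le> hermite_norm h TYPE('n::finite)"
  unfolding hermite_norm_def by (intro sum_nonneg) auto

text \<open>A polynomial of degree at most \<open>s\<close> in the symbol norm. That norm grows
  linearly in the moment, so the bound grows like its power \<open>s\<close>.\<close>

definition correction_bound :: "(nat \<Rightarrow> nat \<Rightarrow> real) \<Rightarrow> nat \<Rightarrow> nat \<Rightarrow> 'n::finite symbol \<Rightarrow> real" where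
  "correction_bound c s \<kappa> D = (\<Sum>j\<in>{1..s}. \<Sum>l\<le>j. \<bar>c j l\<bar> * (snorm D ^ j * hermite_norm (\<kappa> * s) TYPE('n)))"

section \<open>Testing the corrections against a bounded function\<close>

definition gint :: "(real^'n::finite \<Rightarrow> real) \<Rightarrow> bool" where
  "gint h \<longleftrightarrow> integrable lborel (\<lambda>z. std_gauss_density z * h z)"

context
  fixes g :: "real^'n::finite \<Rightarrow> real" and b :: real
  assumes gm [measurable]: "g \<in> borel_measurable borel" and gb: "\<And>z. \<bar>g z\<bar> \<le> b"
begin

definition act :: "(real^'n \<Rightarrow> real) \<Rightarrow> real" where
  "act h = (LINT z|lborel. g z * (std_gauss_density z * h z))"

lemma act_integrable:
  assumes "gint h" shows "integrable lborel (\<lambda>z. g z * (std_gauss_density z * h z))"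
proof (rule Bochner_Integration.integrable_bound[where f = "\<lambda>z. b * (std_gauss_density z * h z)"])
  show "integrable lborel (\<lambda>z. b * (std_gauss_density z * h z))" using assms by (simp add: gint_def)
  show "(\<lambda>z. g z * (std_gauss_density z * h z)) \<in> borel_measurable lborel"
    using borel_measurable_integrable[OF assms[unfolded gint_def]] by measurable
  show "AE z in lborel. norm (g z * (std_gauss_density z * h z)) \<le> norm (b * (std_gauss_density z * h z))"
    using order_trans[OF gb abs_ge_self] unfolding norm_mult real_norm_def abs_mult[of "g _"] abs_mult[of b]
    by (intro AE_I2 mult_right_mono) auto
qed

lemma act_add: "gint h \<Longrightarrow> gint h' \<Longrightarrow> act (\<lambda>z. h z + h' z) = act h + act h' \<and> gint (\<lambda>z. h z + h' z)"
  using act_integrable[of h] act_integrable[of h'] by (simp add: act_def gint_def distrib_left)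

lemma act_cmult: "gint h \<Longrightarrow> act (\<lambda>z. a * h z) = a * act h \<and> gint (\<lambda>z. a * h z)"
  by (simp add: act_def gint_def mult.left_commute[of _ a])

lemma act_zero: "act (\<lambda>_. 0) = 0" "gint (\<lambda>_. 0)"
  by (simp_all add: act_def gint_def)

lemma act_sum:
  assumes "\<And>i. i \<in> A \<Longrightarrow> gint (h i)"
  shows "act (\<lambda>z. \<Sum>i\<in>A. h i z) = (\<Sum>i\<in>A. act (h i)) \<and> gint (\<lambda>z. \<Sum>i\<in>A. h i z)"
  using assms by (induct A rule: infinite_finite_induct) (auto simp: act_zero act_add)

lemma act_sum_list:
  assumes "\<And>i. i \<in> set xs \<Longrightarrow> gint (h i)"
  shows "act (\<lambda>z. \<Sum>i\<leftarrow>xs. h i z) = (\<Sum>i\<leftarrow>xs. act (h i)) \<and> gint (\<lambda>z. \<Sum>i\<leftarrow>xs. h i z)"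
  using assms by (induct xs) (auto simp: act_zero act_add)

lemma gint_hermite: "gint (hermite_word w)" and gint_one: "gint (\<lambda>_. 1)"
  using hermite_word_integrable std_gauss_density_integrable(1) by (simp_all add: gint_def)

lemma act_abs_le:
  assumes "gint h" shows "\<bar>act h\<bar> \<le> b * (LINT z|lborel. \<bar>std_gauss_density z * h z\<bar>)"
proof -
  have "\<bar>act h\<bar> \<le> (LINT z|lborel. \<bar>g z * (std_gauss_density z * h z)\<bar>)"
    unfolding act_def by simp
  also have "\<dots> \<le> (LINT z|lborel. b * \<bar>std_gauss_density z * h z\<bar>)"
  proof (rule integral_mono)
    show "integrable lborel (\<lambda>z. \<bar>g z * (std_gauss_density z * h z)\<bar>)" using act_integrable[OF assms] by simp
    show "integrable lborel (\<lambda>z. b * \<bar>std_gauss_density z * h z\<bar>)"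
      by (intro integrable_mult_right integrable_abs) (use assms in \<open>simp only: gint_def\<close>)
    show "\<bar>g z * (std_gauss_density z * h z)\<bar> \<le> b * \<bar>std_gauss_density z * h z\<bar>" for z
      unfolding abs_mult[of "g z"] by (intro mult_right_mono gb) simp
  qed
  finally show ?thesis by simp
qed

lemma b_nonneg: "0 \<le> b"
  using gb[of 0] by linarith

lemma act_hermite_le: "length w \<le> h \<Longrightarrow> \<bar>act (hermite_word w)\<bar> \<le> b * hermite_norm h TYPE('n)"
  by (intro order_trans[OF act_abs_le[OF gint_hermite]] mult_left_mono hermite_norm_le b_nonneg)

lemma act_correction:
  shows "act (correction c s D m) = (\<Sum>j\<in>{1..s}. \<Sum>l\<le>j. c j l *
     (\<Sum>(a, w)\<leftarrow>spow D j. (if length w = m + 2 * l then 1 else 0) * (a * act (hermite_word w))))"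
  and gint_correction: "gint (correction c s D m)"
proof -
  let ?h = "\<lambda>l x z. case x of (a, w) \<Rightarrow> if length w = m + 2 * l then a * hermite_word w z else 0"
  have 1: "act (?h l (a, w)) = (if length w = m + 2 * l then 1 else 0) * (a * act (hermite_word w)) \<and> gint (?h l (a, w))" for l a w
    using act_cmult[OF gint_hermite, of a w] act_zero by (cases "length w = m + 2 * l") auto
  have gh1: "gint (?h l x)" for l and x :: "real \<times> 'n list" using 1 by (cases x) blast
  have 2: "act (\<lambda>z. \<Sum>x\<leftarrow>spow D j. ?h l x z) = (\<Sum>(a, w)\<leftarrow>spow D j. (if length w = m + 2 * l then 1 else 0) * (a * act (hermite_word w)))
     \<and> gint (\<lambda>z. \<Sum>x\<leftarrow>spow D j. ?h l x z)" for j l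
  proof -
    have "(\<Sum>x\<leftarrow>spow D j. act (?h l x)) = (\<Sum>(a, w)\<leftarrow>spow D j. (if length w = m + 2 * l then 1 else 0) * (a * act (hermite_word w)))"
      by (rule arg_cong[of _ _ sum_list], rule map_cong[OF refl]) (use 1 in \<open>auto split: prod.split\<close>)
    then show ?thesis using act_sum_list[of "spow D j" "?h l", OF gh1] by simp
  qed
  define H where "H j l = (\<lambda>z. \<Sum>x\<leftarrow>spow D j. ?h l x z)" for j l
  define G where "G j = (\<lambda>z. \<Sum>l\<le>j. c j l * H j l z)" for j
  have H: "act (H j l) = (\<Sum>(a, w)\<leftarrow>spow D j. (if length w = m + 2 * l then 1 else 0) * (a * act (hermite_word w)))"
    "gint (H j l)" for j l using 2 unfolding H_def by blast+
  have cH: "act (\<lambda>z. c j l * H j l z) = c j l * act (H j l)" "gint (\<lambda>z. c j l * H j l z)" for j l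
    using act_cmult[OF H(2)] by blast+
  have G: "act (G j) = (\<Sum>l\<le>j. c j l * act (H j l))" "gint (G j)" for j
    using act_sum[of "{..j}" "\<lambda>l z. c j l * H j l z", OF cH(2)] unfolding G_def cH(1) by blast+
  have C: "correction c s D m = (\<lambda>z. \<Sum>j\<in>{1..s}. G j z)"
    by (simp add: fun_eq_iff correction_def G_def H_def)
  have "act (correction c s D m) = (\<Sum>j\<in>{1..s}. act (G j)) \<and> gint (correction c s D m)"
    unfolding C by (rule act_sum) (rule G(2))
  then show "act (correction c s D m) = (\<Sum>j\<in>{1..s}. \<Sum>l\<le>j. c j l *
     (\<Sum>(a, w)\<leftarrow>spow D j. (if length w = m + 2 * l then 1 else 0) * (a * act (hermite_word w))))"
    "gint (correction c s D m)"
    by (simp_all only: G H)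
qed

text \<open>The weights \<open>d\<close> are free so that one estimate serves both the corrections,
  with indicator weights, and the discrepancy left after sorting by powers of
  \<open>n\<close>.\<close>

lemma weighted_hermite_sum_le:
  assumes D: "sdeg 3 \<kappa> D" and j: "j \<le> s" and d: "\<And>w. (\<exists>a. (a, w) \<in> set (spow D j)) \<Longrightarrow> \<bar>d w\<bar> \<le> (\<delta> :: real)" and \<delta>: "0 \<le> \<delta>"
  shows "\<bar>\<Sum>(a, w)\<leftarrow>spow D j. d w * (a * act (hermite_word w))\<bar> \<le> \<delta> * b * (snorm D ^ j * hermite_norm (\<kappa> * s) TYPE('n))"
proof -
  let ?h = "hermite_norm (\<kappa> * s) TYPE('n)"
  have "length w \<le> \<kappa> * s" if "(a, w) \<in> set (spow D j)" for a w
  proof -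
    have "length w \<le> \<kappa> * j" using sdeg_spow[OF D, of j] that by (auto simp: sdeg_def)
    also have "\<dots> \<le> \<kappa> * s" by (rule mult_le_mono2[OF j])
    finally show ?thesis .
  qed
  then have main: "\<bar>\<Sum>(a, w)\<leftarrow>p. d w * (a * act (hermite_word w))\<bar> \<le> \<delta> * b * (snorm p * ?h)"
    if "set p \<subseteq> set (spow D j)" for p
    using that
  proof (induct p)
    case (Cons x p)
    obtain a w where x: "x = (a, w)" by force
    have "\<bar>d w * (a * act (hermite_word w))\<bar> \<le> \<delta> * (\<bar>a\<bar> * (b * ?h))"
      unfolding abs_mult
      by (intro mult_mono d act_hermite_le Cons(2)) (use Cons(3) x \<delta> b_nonneg hermite_norm_nonneg in auto)
    moreover have "\<bar>\<Sum>(a, w)\<leftarrow>p. d w * (a * act (hermite_word w))\<bar> \<le> \<delta> * b * (snorm p * ?h)"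
      using Cons by simp
    ultimately show ?case by (simp add: x snorm_Cons distrib_left distrib_right mult_ac)
  qed simp
  show ?thesis using main[OF subset_refl] unfolding snorm_spow .
qed

lemma act_correction_le:
  assumes D: "sdeg 3 \<kappa> D"
  shows "\<bar>act (correction c s D m)\<bar> \<le> b * correction_bound c s \<kappa> D"
proof -
  have "\<bar>act (correction c s D m)\<bar> \<le> (\<Sum>j\<in>{1..s}. \<Sum>l\<le>j. \<bar>c j l\<bar> * (1 * b * (snorm D ^ j * hermite_norm (\<kappa> * s) TYPE('n))))"
    unfolding act_correction
    by (intro order_trans[OF sum_abs] sum_mono)
       (simp only: abs_mult, intro mult_left_mono weighted_hermite_sum_le[OF D], auto)
  also have "\<dots> = b * correction_bound c s \<kappa> D"
    by (simp add: correction_bound_def sum_distrib_left mult_ac)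
  finally show ?thesis .
qed

text \<open>Apart from the leading Gaussian term, every term has a positive order \<open>m\<close>
  in \<open>1 / sqrt n\<close> once the binomial coefficients are expanded. Those with
  \<open>m \<le> s\<close> are the corrections; the finitely many others form the error.\<close>

lemma edgeworth_op_density:
  fixes f :: "'n bmeas"
  assumes c: "\<And>j n. real (n choose j) = (\<Sum>l\<le>j. c j l * real n ^ l)"
    and D: "D = expansion_symbol s gaussian \<mu>" and deg: "1 \<le> s \<Longrightarrow> sdeg 3 \<kappa> D"
    and n: "1 \<le> n" "\<kappa> * s \<le> n" and f: "\<And>z. bapp f (sqrt n *\<^sub>R z) = g z"
  shows "\<bar>capp (edgeworth_op s gaussian (\<lambda>i y. y $ i) \<mu> n) f 0
      - act (\<lambda>z. 1 + (\<Sum>m=1..s. (1 / sqrt n) ^ m * correction c s D m z))\<bar>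
    \<le> b * correction_bound c s \<kappa> D * (1 / sqrt n) ^ (s + 1)"
proof -
  let ?r = "1 / sqrt (real n)" and ?B = "\<lambda>i. ker (gaussian :: (real^'n) measure) (\<lambda>y. y $ i)"
    and ?Q = "pker (gaussian :: (real^'n) measure)" and ?H = "\<lambda>w. act (hermite_word w)"
  have r: "0 < ?r" "?r \<le> 1" using n by auto
  have nr: "real n * ?r ^ 2 = 1" using n by (simp add: power_divide)
  have word: "capp (op_prod ?B w * ?Q ^ (n - length w)) f 0 = ?r ^ length w * ?H w" if "length w \<le> n" for w
    using gaussian_word_scaled[OF that n(1), of f] by (simp add: f act_def)
  have seval: "capp (seval ?B ?Q n p) f 0 = (\<Sum>(a, w)\<leftarrow>p. ?r ^ length w * (a * ?H w))" if "sdeg lo n p" for p lo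
    using that
  proof (induct p)
    case (Cons x p)
    then show ?case by (cases x) (simp add: seval_Cons word)
  qed simp
  have lens: "3 * j \<le> length w" "length w \<le> n" if "j \<in> {1..s}" "(a, w) \<in> set (spow D j)" for j a w
  proof -
    have "sdeg (3 * j) (\<kappa> * j) (spow D j)" using sdeg_spow[OF deg] that by simp
    moreover have "\<kappa> * j \<le> n"
    proof -
      have "\<kappa> * j \<le> \<kappa> * s" using that(1) by (intro mult_le_mono2) simp
      then show ?thesis using n(2) by (rule le_trans)
    qed
    ultimately show "3 * j \<le> length w" "length w \<le> n" using that by (force simp: sdeg_def)+
  qed
  have E0: "capp (seval ?B ?Q n (spow D 0)) f 0 = act (\<lambda>_. 1)"
  proof -
    have "hermite_word [] = (\<lambda>_ :: real^'n. 1)" by (simp add: hermite_word_def fun_eq_iff)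
    then show ?thesis using word[of "[]"] by (simp add: seval_Cons)
  qed
  have Ej: "capp (seval ?B ?Q n (spow D j)) f 0 = (\<Sum>(a, w)\<leftarrow>spow D j. ?r ^ length w * (a * ?H w))" if "j \<in> {1..s}" for j
    by (rule seval[of 0]) (use lens[OF that] in \<open>auto simp: sdeg_def\<close>)
  have "{..s} = insert 0 {1..s}" by auto
  then have cap: "capp (edgeworth_op s gaussian (\<lambda>i y. y $ i) \<mu> n) f 0
    = act (\<lambda>_. 1) + (\<Sum>j\<in>{1..s}. \<Sum>l\<le>j. c j l * (\<Sum>(a, w)\<leftarrow>spow D j. (real n ^ l * ?r ^ length w) * (a * ?H w)))"
  proof -
    have "capp (edgeworth_op s gaussian (\<lambda>i y. y $ i) \<mu> n) f 0
      = (\<Sum>j\<in>insert 0 {1..s}. real (n choose j) * capp (seval ?B ?Q n (spow D j)) f 0)"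
      unfolding edgeworth_op_def D[symmetric] \<open>{..s} = _\<close> by simp
    also have "\<dots> = act (\<lambda>_. 1) + (\<Sum>j\<in>{1..s}. real (n choose j) * capp (seval ?B ?Q n (spow D j)) f 0)"
      using E0 by (subst sum.insert) auto
    also have "(\<Sum>j\<in>{1..s}. real (n choose j) * capp (seval ?B ?Q n (spow D j)) f 0)
      = (\<Sum>j\<in>{1..s}. \<Sum>l\<le>j. c j l * (\<Sum>(a, w)\<leftarrow>spow D j. (real n ^ l * ?r ^ length w) * (a * ?H w)))"
    proof (rule sum.cong[OF refl])
      fix j assume j: "j \<in> {1..s}"
      have "(\<Sum>(a, w)\<leftarrow>p. (t * ?r ^ length w) * (a * ?H w)) = t * (\<Sum>(a, w)\<leftarrow>p. ?r ^ length w * (a * ?H w))" for t and p :: "'n symbol"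
        by (induct p) (auto simp: distrib_left mult.assoc)
      then show "real (n choose j) * capp (seval ?B ?Q n (spow D j)) f 0
        = (\<Sum>l\<le>j. c j l * (\<Sum>(a, w)\<leftarrow>spow D j. (real n ^ l * ?r ^ length w) * (a * ?H w)))"
        unfolding Ej[OF j] c[where n = n] by (simp add: sum_distrib_right mult.assoc)
    qed
    finally show ?thesis .
  qed
  let ?i = "\<lambda>l m w. if length w = m + 2 * l then 1 else (0::real)"
  have act: "act (\<lambda>z. 1 + (\<Sum>m=1..s. ?r ^ m * correction c s D m z))
    = act (\<lambda>_. 1) + (\<Sum>j\<in>{1..s}. \<Sum>l\<le>j. c j l * (\<Sum>(a, w)\<leftarrow>spow D j. (\<Sum>m=1..s. ?r ^ m * ?i l m w) * (a * ?H w)))"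
  proof -
    note gc = act_cmult[OF gint_correction, THEN conjunct2]
    have "act (\<lambda>z. 1 + (\<Sum>m=1..s. ?r ^ m * correction c s D m z)) = act (\<lambda>_. 1) + (\<Sum>m=1..s. ?r ^ m * act (correction c s D m))"
      using act_add[OF gint_one conjunct2[OF act_sum[of "{1..s}" "\<lambda>m z. ?r ^ m * correction c s D m z", OF gc]]]
        act_sum[of "{1..s}" "\<lambda>m z. ?r ^ m * correction c s D m z", OF gc] act_cmult[OF gint_correction] by simp
    also have "(\<Sum>m=1..s. ?r ^ m * act (correction c s D m))
      = (\<Sum>m=1..s. \<Sum>j\<in>{1..s}. \<Sum>l\<le>j. c j l * (?r ^ m * (\<Sum>(a, w)\<leftarrow>spow D j. ?i l m w * (a * ?H w))))"
      unfolding act_correction by (simp add: sum_distrib_left mult.left_commute)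
    also have "\<dots> = (\<Sum>j\<in>{1..s}. \<Sum>l\<le>j. \<Sum>m=1..s. c j l * (?r ^ m * (\<Sum>(a, w)\<leftarrow>spow D j. ?i l m w * (a * ?H w))))"
      by (subst sum.swap, rule sum.cong[OF refl], rule sum.swap)
    also have "\<dots> = (\<Sum>j\<in>{1..s}. \<Sum>l\<le>j. c j l * (\<Sum>(a, w)\<leftarrow>spow D j. (\<Sum>m=1..s. ?r ^ m * ?i l m w) * (a * ?H w)))"
    proof (intro sum.cong refl)
      fix j l
      have "(\<Sum>m=1..s. ?r ^ m * (\<Sum>(a, w)\<leftarrow>p. ?i l m w * (a * ?H w))) = (\<Sum>(a, w)\<leftarrow>p. (\<Sum>m=1..s. ?r ^ m * ?i l m w) * (a * ?H w))" for p :: "'n symbol"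
      proof (induct p)
        case (Cons x p)
        obtain a w where x: "x = (a, w)" by force
        have "(\<Sum>m=1..s. ?r ^ m * (\<Sum>(a, w)\<leftarrow>x # p. ?i l m w * (a * ?H w)))
          = (\<Sum>m=1..s. ?r ^ m * ?i l m w * (a * ?H w)) + (\<Sum>m=1..s. ?r ^ m * (\<Sum>(a, w)\<leftarrow>p. ?i l m w * (a * ?H w)))"
          by (simp only: x list.map sum_list.Cons prod.case distrib_left sum.distrib mult.assoc)
        then show ?case by (simp only: Cons x list.map sum_list.Cons prod.case sum_distrib_right)
      qed simp
      then show "(\<Sum>m=1..s. c j l * (?r ^ m * (\<Sum>(a, w)\<leftarrow>spow D j. ?i l m w * (a * ?H w))))
        = c j l * (\<Sum>(a, w)\<leftarrow>spow D j. (\<Sum>m=1..s. ?r ^ m * ?i l m w) * (a * ?H w))"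
        by (simp only: sum_distrib_left[symmetric])
    qed
    finally show ?thesis .
  qed
  let ?d = "\<lambda>l w. real n ^ l * ?r ^ length w - (\<Sum>m=1..s. ?r ^ m * ?i l m w)"
  have d: "\<bar>?d l w\<bar> \<le> ?r ^ (s + 1)" if "j \<in> {1..s}" "l \<le> j" "(a, w) \<in> set (spow D j)" for j l a w
  proof -
    have len: "3 * j \<le> length w" using lens that by blast
    \<comment> \<open>The order of the term; it is positive because
      \<open>length w \<ge> 3 * j\<close> and \<open>l \<le> j\<close>.\<close>
    define m where "m = length w - 2 * l"
    have m: "length w = m + 2 * l" using len that by (simp add: m_def)
    have m1: "1 \<le> m" using len that m by simp
    have "real n ^ l * ?r ^ length w = (real n * ?r ^ 2) ^ l * ?r ^ m"
      unfolding m power_add power_mult power_mult_distrib by (simp only: mult_ac)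
    then have A: "real n ^ l * ?r ^ length w = ?r ^ m" by (simp only: nr power_one mult_1)
    have "(\<Sum>m'=1..s. ?r ^ m' * ?i l m' w) = (\<Sum>m'\<in>{1..s}. if m' = m then ?r ^ m else 0)"
      by (rule sum.cong) (auto simp: m)
    then have B: "(\<Sum>m'=1..s. ?r ^ m' * ?i l m' w) = (if m \<le> s then ?r ^ m else 0)"
      using m1 by simp
    show ?thesis
    proof (cases "m \<le> s")
      case False
      then have "?r ^ m \<le> ?r ^ (s + 1)" using r by (intro power_decreasing) auto
      then show ?thesis unfolding A B using False r by simp
    qed (use r in \<open>simp only: A B, simp\<close>)
  qed
  have diff: "capp (edgeworth_op s gaussian (\<lambda>i y. y $ i) \<mu> n) f 0 - act (\<lambda>z. 1 + (\<Sum>m=1..s. ?r ^ m * correction c s D m z))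
    = (\<Sum>j\<in>{1..s}. \<Sum>l\<le>j. c j l * (\<Sum>(a, w)\<leftarrow>spow D j. ?d l w * (a * ?H w)))"
  proof -
    have "(\<Sum>(a, w)\<leftarrow>p. x w * (a * ?H w)) - (\<Sum>(a, w)\<leftarrow>p. y w * (a * ?H w)) = (\<Sum>(a, w)\<leftarrow>p. (x w - y w) * (a * ?H w))" for x y and p :: "'n symbol"
      by (induct p) (auto simp: algebra_simps)
    then have pw: "t * (\<Sum>(a, w)\<leftarrow>p. x w * (a * ?H w)) - t * (\<Sum>(a, w)\<leftarrow>p. y w * (a * ?H w)) = t * (\<Sum>(a, w)\<leftarrow>p. (x w - y w) * (a * ?H w))" for t x y and p :: "'n symbol"
      by (simp only: right_diff_distrib[symmetric])
    show ?thesis unfolding cap act add_diff_cancel_left sum_subtractf[symmetric]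
      by (intro sum.cong refl pw)
  qed
  have "\<bar>\<Sum>j\<in>{1..s}. \<Sum>l\<le>j. c j l * (\<Sum>(a, w)\<leftarrow>spow D j. ?d l w * (a * ?H w))\<bar>
    \<le> (\<Sum>j\<in>{1..s}. \<Sum>l\<le>j. \<bar>c j l\<bar> * (?r ^ (s + 1) * b * (snorm D ^ j * hermite_norm (\<kappa> * s) TYPE('n))))"
  proof (intro order_trans[OF sum_abs] sum_mono)
    fix j l assume jl: "j \<in> {1..s}" "l \<in> {..j}"
    have "\<bar>\<Sum>(a, w)\<leftarrow>spow D j. ?d l w * (a * ?H w)\<bar> \<le> ?r ^ (s + 1) * b * (snorm D ^ j * hermite_norm (\<kappa> * s) TYPE('n))"
      by (rule weighted_hermite_sum_le) (use deg d jl r in auto)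
    then show "\<bar>c j l * (\<Sum>(a, w)\<leftarrow>spow D j. ?d l w * (a * ?H w))\<bar>
       \<le> \<bar>c j l\<bar> * (?r ^ (s + 1) * b * (snorm D ^ j * hermite_norm (\<kappa> * s) TYPE('n)))"
      unfolding abs_mult[of "c j l"] by (rule mult_left_mono) simp
  qed
  also have "\<dots> = b * correction_bound c s \<kappa> D * ?r ^ (s + 1)"
    by (simp only: correction_bound_def sum_distrib_left sum_distrib_right mult_ac)
  finally show ?thesis unfolding diff .
qed

end

section \<open>Moments of the normalized variable\<close>

lemma open_emeasure_lborel_pos:
  fixes U :: "'a::euclidean_space set"
  assumes "open U" "U \<noteq> {}"
  shows "0 < emeasure lborel U"
proof -
  obtain x e where e: "e > 0" "ball x e \<subseteq> U" using assms by (meson all_not_in_conv openE)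
  have "0 < measure lborel (ball x e)" using content_ball_pos[OF e(1)] by simp
  then have "0 < emeasure lborel (ball x e)" by (simp add: measure_def enn2real_positive_iff)
  also have "\<dots> \<le> emeasure lborel U" using e assms by (intro emeasure_mono) auto
  finally show ?thesis .
qed

text \<open>From a point of the hyperplane inside \<open>D\<close> one can move off along the normal
  without leaving \<open>D\<close>, so a nonempty open part of \<open>D\<close> avoids the
  hyperplane.\<close>

lemma dominated_not_hyperplane:
  fixes a :: "real^'n::finite"
  assumes dom: "dominates_Leb_on \<epsilon> D \<mu>" and a: "a \<noteq> 0"
  shows "emeasure \<mu> {y. a \<bullet> y \<noteq> 0} \<noteq> 0"
proof -
  have D: "open D" "D \<noteq> {}" "\<epsilon> > 0" using dom by (auto simp: dominates_Leb_on_def)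
  obtain y where y: "y \<in> D" using D by blast
  let ?U = "{y. a \<bullet> y \<noteq> 0} \<inter> D"
  have op: "open {y. a \<bullet> y \<noteq> 0}"
    by (intro open_Collect_neq continuous_intros)
  obtain e where e: "e > 0" "ball y e \<subseteq> D" using D y open_contains_ball by blast
  have "?U \<noteq> {}"
  proof (cases "a \<bullet> y = 0")
    case False
    then show ?thesis using y by blast
  next
    case True
    let ?z = "y + (e / (2 * norm a)) *\<^sub>R a"
    have "?z \<in> ball y e" using e a by (simp add: dist_norm)
    moreover have "a \<bullet> ?z \<noteq> 0" using True e a by (simp add: inner_add_right)
    ultimately show ?thesis using e by blast
  qed
  then have "0 < emeasure lborel ?U" using op D by (intro open_emeasure_lborel_pos) auto
  then have "0 < ennreal \<epsilon> * emeasure lborel ({y. a \<bullet> y \<noteq> 0} \<inter> D)" using D by (simp add: ennreal_zero_less_mult_iff)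
  also have "\<dots> \<le> emeasure \<mu> {y. a \<bullet> y \<noteq> 0}" using dom op by (simp add: dominates_Leb_on_def)
  finally show ?thesis by simp
qed

definition nlaw :: "'a measure \<Rightarrow> ('a \<Rightarrow> real^'n::finite) \<Rightarrow> (real^'n) measure" where
  "nlaw M F = distr (distr M borel F) borel (\<lambda>y. normalizer M F *v y)"

context
  fixes M :: "'a measure" and F :: "'a \<Rightarrow> real^'n::finite" and p :: nat and \<epsilon> :: real and D :: "(real^'n) set"
  assumes M: "prob_space M" and F [measurable]: "F \<in> borel_measurable M"
    and dom: "dominates_Leb_on \<epsilon> D (distr M borel F)" and p: "2 \<le> p"
    and int: "integrable M (\<lambda>\<omega>. norm (F \<omega>) ^ p)" and mean: "(LINT \<omega>|M. F \<omega>) = 0"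
begin

interpretation prob_space M by (rule M)

lemma norm_pow_integrable: "k \<le> p \<Longrightarrow> integrable M (\<lambda>\<omega>. norm (F \<omega>) ^ k)"
  by (rule Bochner_Integration.integrable_bound[where f = "\<lambda>\<omega>. 1 + norm (F \<omega>) ^ p"])
     (use int pow_le_one_plus[OF norm_ge_zero] in auto)

lemma F_integrable: "integrable M F"
  using norm_pow_integrable[of 1] p by (simp add: integrable_norm_iff)

lemma inner_integrable: "integrable M (\<lambda>\<omega>. (a \<bullet> F \<omega>) * (b \<bullet> F \<omega>))"
proof (rule Bochner_Integration.integrable_bound[where f = "\<lambda>\<omega>. (norm a * norm b) * norm (F \<omega>) ^ 2"])
  show "integrable M (\<lambda>\<omega>. (norm a * norm b) * norm (F \<omega>) ^ 2)" using norm_pow_integrable[of 2] p by simp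
  have "\<bar>a \<bullet> y\<bar> * \<bar>b \<bullet> y\<bar> \<le> (norm a * norm b) * norm y ^ 2" for y
  proof -
    have "\<bar>a \<bullet> y\<bar> * \<bar>b \<bullet> y\<bar> \<le> (norm a * norm y) * (norm b * norm y)"
      by (intro mult_mono Cauchy_Schwarz_ineq2) auto
    then show ?thesis by (simp only: power2_eq_square mult_ac)
  qed
  then show "AE \<omega> in M. norm ((a \<bullet> F \<omega>) * (b \<bullet> F \<omega>)) \<le> norm ((norm a * norm b) * norm (F \<omega>) ^ 2)"
    by (intro AE_I2) (simp add: abs_mult)
qed measurable

lemma inner_mean: "(LINT \<omega>|M. a \<bullet> F \<omega>) = 0"
  using integral_inner_left[of a M F] F_integrable mean by simp

lemma cov_entry: "cov_matrix M F $ i $ j = (LINT \<omega>|M. (axis i 1 \<bullet> F \<omega>) * (axis j 1 \<bullet> F \<omega>))"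
proof -
  have "(LINT \<omega>|M. F \<omega> $ k) = 0" for k using inner_mean[of "axis k 1"] by (simp add: inner_axis')
  then show ?thesis by (simp add: cov_matrix_def inner_axis')
qed

lemma cov_bilinear: "(LINT \<omega>|M. (a \<bullet> F \<omega>) * (b \<bullet> F \<omega>)) = a \<bullet> (cov_matrix M F *v b)"
proof -
  let ?e = "\<lambda>i. axis i (1::real) :: real^'n"
  have "(a \<bullet> y) * (b \<bullet> y) = (\<Sum>i\<in>UNIV. \<Sum>j\<in>UNIV. (a $ i * b $ j) * ((?e i \<bullet> y) * (?e j \<bullet> y)))" for y
    by (simp add: inner_vec_def[of a] inner_vec_def[of b] sum_product inner_axis' mult_ac)
  then have "(LINT \<omega>|M. (a \<bullet> F \<omega>) * (b \<bullet> F \<omega>))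
     = (LINT \<omega>|M. (\<Sum>i\<in>UNIV. \<Sum>j\<in>UNIV. (a $ i * b $ j) * ((?e i \<bullet> F \<omega>) * (?e j \<bullet> F \<omega>))))" by simp
  also have "\<dots> = (\<Sum>i\<in>UNIV. \<Sum>j\<in>UNIV. (a $ i * b $ j) * cov_matrix M F $ i $ j)"
    unfolding cov_entry using inner_integrable by (simp add: Bochner_Integration.integral_sum)
  also have "\<dots> = a \<bullet> (cov_matrix M F *v b)"
    by (simp add: inner_vec_def matrix_vector_mult_def sum_distrib_left mult_ac)
  finally show ?thesis .
qed

lemma cov_self_adjoint: "self_adjoint (cov_matrix M F)"
  unfolding self_adjoint_def
  by (simp add: inner_commute[of "cov_matrix M F *v _"] mult.commute flip: cov_bilinear)

text \<open>A zero of the quadratic form would concentrate the law of \<open>F\<close> on a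
  hyperplane, against the domination.\<close>

lemma cov_pos:
  assumes "a \<noteq> 0" shows "0 < a \<bullet> (cov_matrix M F *v a)"
proof -
  have "(LINT \<omega>|M. (a \<bullet> F \<omega>) * (a \<bullet> F \<omega>)) \<noteq> 0"
  proof
    assume "(LINT \<omega>|M. (a \<bullet> F \<omega>) * (a \<bullet> F \<omega>)) = 0"
    then have "AE \<omega> in M. (a \<bullet> F \<omega>) * (a \<bullet> F \<omega>) = 0"
      by (subst (asm) integral_nonneg_eq_0_iff_AE[OF inner_integrable]) auto
    then have "AE \<omega> in M. a \<bullet> F \<omega> = 0" by simp
    then have "AE y in distr M borel F. a \<bullet> y = 0" by (subst AE_distr_iff) auto
    then have "emeasure (distr M borel F) {y \<in> space (distr M borel F). a \<bullet> y \<noteq> 0} = 0"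
      by (subst (asm) AE_iff_measurable[OF _ refl]) auto
    then show False using dominated_not_hyperplane[OF dom assms] by simp
  qed
  moreover have "0 \<le> (LINT \<omega>|M. (a \<bullet> F \<omega>) * (a \<bullet> F \<omega>))" by (intro Bochner_Integration.integral_nonneg) simp
  ultimately show ?thesis unfolding cov_bilinear by simp
qed

lemma nlaw_integral:
  fixes g :: "real^'n \<Rightarrow> real"
  assumes "g \<in> borel_measurable borel"
  shows "(LINT y|nlaw M F. g y) = (LINT \<omega>|M. g (normalizer M F *v F \<omega>))"
    "integrable (nlaw M F) g \<longleftrightarrow> integrable M (\<lambda>\<omega>. g (normalizer M F *v F \<omega>))"
proof -
  have A: "(\<lambda>y. normalizer M F *v y) \<in> measurable (distr M borel F) borel" by measurable
  have gA: "(\<lambda>y. g (normalizer M F *v y)) \<in> borel_measurable borel" using assms by measurable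
  show "(LINT y|nlaw M F. g y) = (LINT \<omega>|M. g (normalizer M F *v F \<omega>))"
    unfolding nlaw_def integral_distr[OF A assms] integral_distr[OF F gA] ..
  show "integrable (nlaw M F) g \<longleftrightarrow> integrable M (\<lambda>\<omega>. g (normalizer M F *v F \<omega>))"
    unfolding nlaw_def integrable_distr_eq[OF A assms] integrable_distr_eq[OF F gA] ..
qed

lemma nlaw_prob: "prob_space (nlaw M F)" "sets (nlaw M F) = sets borel"
proof -
  interpret L: prob_space "distr M borel F" by (rule prob_space_distr) simp
  show "prob_space (nlaw M F)" unfolding nlaw_def by (rule L.prob_space_distr) simp
qed (simp add: nlaw_def)

lemmas nrm = pos_def_normalizer[OF cov_self_adjoint cov_pos, folded normalizer_def min_eig_inv_cov_def max_eig_inv_cov_def]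

lemma normalizer_norm_pow:
  assumes u: "max_eig_inv_cov M F = u" shows "norm (normalizer M F *v x) ^ k \<le> sqrt u ^ k * norm x ^ k"
proof -
  have "(norm (normalizer M F *v x))\<^sup>2 \<le> u * (norm x)\<^sup>2" using nrm(6)[of x] u by simp
  then have "norm (normalizer M F *v x) \<le> sqrt (u * (norm x)\<^sup>2)" by (rule real_le_rsqrt)
  then have "norm (normalizer M F *v x) \<le> sqrt u * norm x" by (simp add: real_sqrt_mult)
  then show ?thesis unfolding power_mult_distrib[symmetric] by (rule power_mono) simp
qed

lemma nlaw_moment_le:
  assumes u: "max_eig_inv_cov M F = u"
  shows "finite_moment p (nlaw M F)" "(LINT y|nlaw M F. norm y ^ p) \<le> sqrt u ^ p * (LINT \<omega>|M. norm (F \<omega>) ^ p)"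
proof -
  have i: "integrable M (\<lambda>\<omega>. norm (normalizer M F *v F \<omega>) ^ p)"
    by (rule Bochner_Integration.integrable_bound[where f = "\<lambda>\<omega>. sqrt u ^ p * norm (F \<omega>) ^ p"])
       (use int normalizer_norm_pow[OF u, of _ p] in \<open>auto intro: order_trans[OF _ abs_ge_self]\<close>)
  then show "finite_moment p (nlaw M F)" by (simp add: finite_moment_def nlaw_prob nlaw_integral)
  have "(LINT \<omega>|M. norm (normalizer M F *v F \<omega>) ^ p) \<le> (LINT \<omega>|M. sqrt u ^ p * norm (F \<omega>) ^ p)"
    by (rule integral_mono[OF i]) (use int normalizer_norm_pow[OF u, of _ p] in auto)
  then show "(LINT y|nlaw M F. norm y ^ p) \<le> sqrt u ^ p * (LINT \<omega>|M. norm (F \<omega>) ^ p)"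
    by (simp add: nlaw_integral)
qed

text \<open>The normalizer is self-adjoint, so it passes through the inner products; the covariance
  between two normalizers is the identity.\<close>

lemma nlaw_moments:
  shows "moment (nlaw M F) [i] = 0" "moment (nlaw M F) [i, j] = (if i = j then 1 else 0)"
proof -
  let ?A = "normalizer M F"
  have sa: "(?A *v x) $ i = (?A *v axis i 1) \<bullet> x" for x i
    using nrm(3)[unfolded self_adjoint_def, rule_format, of "axis i 1" x] by (simp add: inner_axis')
  show "moment (nlaw M F) [i] = 0"
    by (simp add: moment_def nlaw_integral sa inner_mean)
  have "moment (nlaw M F) [i, j] = (LINT \<omega>|M. ((?A *v axis i 1) \<bullet> F \<omega>) * ((?A *v axis j 1) \<bullet> F \<omega>))"
    by (simp add: moment_def nlaw_integral sa)
  also have "\<dots> = axis i 1 \<bullet> (?A *v (cov_matrix M F *v (?A *v axis j 1)))"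
    unfolding cov_bilinear using nrm(3) by (simp add: self_adjoint_def)
  also have "cov_matrix M F *v (?A *v axis j 1) = matrix_sqrt (cov_matrix M F) *v axis j 1"
  proof -
    have "?A *v (?A *v (matrix_sqrt (cov_matrix M F) *v axis j 1)) = ?A *v axis j 1"
      using nrm(1) by (simp add: matrix_vector_mul_assoc)
    then show ?thesis using nrm(4)[of "matrix_sqrt (cov_matrix M F) *v axis j 1"] by simp
  qed
  also have "?A *v (matrix_sqrt (cov_matrix M F) *v axis j 1) = axis j 1"
    using nrm(1) by (simp add: matrix_vector_mul_assoc)
  finally show "moment (nlaw M F) [i, j] = (if i = j then 1 else 0)" by (simp add: inner_axis_axis)
qed

lemma nlaw_match:
  assumes "length w < 3" shows "moment (nlaw M F) w = moment gaussian w"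
proof -
  consider "w = []" | i where "w = [i]" | i j where "w = [i, j]"
  proof (cases w)
    case (Cons i w')
    show ?thesis
    proof (cases w')
      case Nil
      then show ?thesis using Cons that by blast
    next
      case Cons': (Cons j w'')
      then have "w'' = []" using assms \<open>w = i # w'\<close> by (cases w'') auto
      then show ?thesis using Cons' \<open>w = i # w'\<close> that by blast
    qed
  qed (use that in blast)
  then show ?thesis
    by cases (simp_all add: nlaw_moments gaussian_moment_1 gaussian_moment_2 moment_Nil nlaw_prob gaussian_prob)
qed

text \<open>The trace of the identity covariance: a value independent of the size of
  \<open>F\<close>, on which the interpolation below rests.\<close>

lemma nlaw_second_moment: "(LINT y|nlaw M F. norm y ^ 2) = real CARD('n)"
proof -
  have fm: "finite_moment p (nlaw M F)" by (rule nlaw_moment_le[OF refl])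
  have "(LINT y|nlaw M F. norm y ^ 2) = (LINT y|nlaw M F. (\<Sum>i\<in>UNIV. coord_prod [i, i] y))"
    by (simp add: power2_norm_eq_inner inner_vec_def)
  also have "\<dots> = (\<Sum>i\<in>UNIV. moment (nlaw M F) [i, i])"
    unfolding moment_def using fm p
    by (intro Bochner_Integration.integral_sum moment_integrable[of _ p]) (auto simp: finite_moment_def)
  finally show ?thesis by (simp add: nlaw_moments)
qed

text \<open>Interpolation between the second moment, which is normalized, and the fourth one; it is what
  keeps the power of the moment in the final bound at \<open>s\<close> instead of \<open>s + 1\<close>.\<close>

lemma nlaw_third_moment:
  assumes "4 \<le> p" and L: "1 \<le> L" "1 + (LINT y|nlaw M F. norm y ^ p) \<le> B * L\<^sup>2"
  shows "(LINT y|nlaw M F. norm y ^ 3) \<le> (real CARD('n) + B) * L"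
proof -
  have fm: "finite_moment p (nlaw M F)" by (rule nlaw_moment_le[OF refl])
  have i: "integrable (nlaw M F) (\<lambda>y. norm y ^ k)" if "k \<le> p" for k
    using finite_moment_mono[OF fm that] by (simp add: finite_moment_def)
  have "norm y ^ 3 \<le> L * norm y ^ 2 + norm y ^ 4 / L" for y :: "real^'n"
  proof (cases "norm y \<le> L")
    case True
    then have "norm y * norm y ^ 2 \<le> L * norm y ^ 2" by (intro mult_right_mono) auto
    moreover have "0 \<le> norm y ^ 4 / L" using L by simp
    ultimately show ?thesis by (simp add: power3_eq_cube power2_eq_square)
  next
    case False
    then have "norm y ^ 3 * L \<le> norm y ^ 3 * norm y" by (intro mult_left_mono) auto
    then have "norm y ^ 3 \<le> norm y ^ 4 / L" using L by (simp add: field_simps power_Suc[symmetric] numeral_eq_Suc)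
    moreover have "0 \<le> L * norm y ^ 2" using L by simp
    ultimately show ?thesis by linarith
  qed
  then have "(LINT y|nlaw M F. norm y ^ 3) \<le> (LINT y|nlaw M F. L * norm y ^ 2 + norm y ^ 4 / L)"
    using i[of 2] i[of 3] i[of 4] assms(1) by (intro integral_mono) auto
  also have "\<dots> = L * real CARD('n) + (LINT y|nlaw M F. norm y ^ 4) / L"
    using i[of 2] i[of 4] assms(1) by (simp add: nlaw_second_moment)
  also have "\<dots> \<le> L * real CARD('n) + (B * L\<^sup>2) / L"
    using finite_moment_le[OF fm assms(1)] L by (intro add_left_mono divide_right_mono) auto
  also have "\<dots> = (real CARD('n) + B) * L" using L by (simp add: power2_eq_square algebra_simps)
  finally show ?thesis .
qed

end

section \<open>The total variation bound\<close>

lemma powr_half_nat: "n \<ge> 1 \<Longrightarrow> 1 / real n powr (real k / 2) = (1 / sqrt (real n)) ^ k"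
proof -
  assume n: "n \<ge> 1"
  have "sqrt (real n) ^ k = (real n powr (1 / 2)) powr real k"
    using n by (simp add: powr_realpow powr_half_sqrt)
  also have "\<dots> = real n powr (real k / 2)" by (simp add: powr_powr)
  finally show ?thesis by (simp add: power_divide)
qed

text \<open>Both components are instances of one computation, for \<open>c = 1\<close> and for
  \<open>c = - 1\<close>, and recombine because \<open>max 0 h - max 0 (- h) = h\<close>.\<close>

lemma signed_density_integral:
  fixes h :: "real^'n::finite \<Rightarrow> real"
  assumes h: "integrable lborel h" and [measurable]: "f \<in> borel_measurable borel" and f: "\<And>x. \<bar>f x\<bar> \<le> b"
  shows "signed_integral (signed_density h) f = (LINT x|lborel. f x * h x)"
proof -
  have [measurable]: "h \<in> borel_measurable borel" using borel_measurable_integrable[OF h] by simp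
  have int: "integrable lborel (\<lambda>x. max 0 (c * h x) * f x)" for c
  proof (rule Bochner_Integration.integrable_bound[where f = "\<lambda>x. b * (c * h x)"])
    have "\<bar>max 0 (c * h x)\<bar> * \<bar>f x\<bar> \<le> \<bar>c * h x\<bar> * \<bar>b\<bar>" for x
      by (intro mult_mono order_trans[OF f abs_ge_self]) auto
    then show "AE x in lborel. norm (max 0 (c * h x) * f x) \<le> norm (b * (c * h x))"
      by (intro AE_I2) (simp only: real_norm_def abs_mult[of b] abs_mult[of "max _ _"] mult.commute[of "\<bar>b\<bar>"])
  qed (use h in auto)
  have d: "density lborel (\<lambda>x. ennreal (c * h x)) = density lborel (\<lambda>x. ennreal (max 0 (c * h x)))" for c
    by (rule density_cong) (auto simp: max_def ennreal_neg)
  have "(LINT x|density lborel (\<lambda>x. ennreal (c * h x)). f x) = (LINT x|lborel. max 0 (c * h x) * f x)" for c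
    unfolding d by (subst integral_density) auto
  from this[of 1] this[of "-1"] have "signed_integral (signed_density h) f
      = (LINT x|lborel. max 0 (h x) * f x) - (LINT x|lborel. max 0 (- h x) * f x)"
    by (simp add: signed_integral_def signed_density_def)
  also have "\<dots> = (LINT x|lborel. max 0 (h x) * f x - max 0 (- h x) * f x)"
    using int[of 1] int[of "-1"] by simp
  also have "\<dots> = (LINT x|lborel. f x * h x)"
    by (intro Bochner_Integration.integral_cong refl) (auto simp: max_def algebra_simps)
  finally show ?thesis .
qed

lemma signed_of_measure: "signed_integral (of_measure \<mu>) f = (LINT x|\<mu>. f x)"
proof -
  have "(LINT x|null_measure \<mu>. f x) = 0"
    by (rule integral_eq_zero_AE) (auto simp: AE_iff_null null_sets_def intro!: AE_I[of _ _ "space \<mu>"])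
  then show ?thesis by (simp add: signed_integral_def of_measure_def)
qed

text \<open>The factor \<open>1 / sqrt n\<close> is moved into the test function, so the operator
  power handles the unscaled sum.\<close>

lemma normalized_sum_expectation:
  fixes F :: "'a \<Rightarrow> real^'n::finite" and f :: "real^'n \<Rightarrow> real"
  assumes M: "prob_space M" and [measurable]: "F \<in> borel_measurable M"
    and indep: "prob_space.indep_vars M (\<lambda>_. borel) Fs {1..}"
    and law: "\<forall>k\<ge>1. distr M borel (Fs k) = distr M borel F"
    and [measurable]: "f \<in> borel_measurable borel" and f: "\<And>x. \<bar>f x\<bar> \<le> b" and n: "n \<ge> 1"
  defines "g \<equiv> Bmeas (\<lambda>x. f ((1 / sqrt (real n)) *\<^sub>R x))"
  shows "(LINT x|distr M borel (normalized_sum M F Fs n). f x) = capp (pker (nlaw M F) ^ n) g 0"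
    and "\<And>z. bapp g (sqrt (real n) *\<^sub>R z) = f z" and "norm g \<le> b"
proof -
  interpret prob_space M by (rule M)
  let ?A = "normalizer M F"
  have g: "bapp g x = f ((1 / sqrt (real n)) *\<^sub>R x)" for x
    unfolding g_def by (subst bapp_Bmeas[of _ b]) (auto simp: f)
  show "bapp g (sqrt (real n) *\<^sub>R z) = f z" for z using n by (simp add: g)
  show "norm g \<le> b" by (rule bmeas_norm_le) (simp add: g f)
  have Fk: "Fs k \<in> borel_measurable M" if "k \<ge> 1" for k
    using indep that by (auto simp: indep_vars_def)
  have ind: "indep_vars (\<lambda>_. borel) (\<lambda>k \<omega>. ?A *v Fs k \<omega>) {1..n}"
  proof -
    have "indep_vars (\<lambda>_. borel) Fs {1..n}" by (rule indep_vars_subset[OF indep]) auto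
    then show ?thesis by (rule indep_vars_compose2) simp
  qed
  have lw: "distr M borel (\<lambda>\<omega>. ?A *v Fs k \<omega>) = nlaw M F" if "k \<in> {1..n}" for k
  proof -
    have k: "k \<ge> 1" using that by simp
    have "distr M borel (\<lambda>\<omega>. ?A *v Fs k \<omega>) = distr (distr M borel (Fs k)) borel (\<lambda>y. ?A *v y)"
      using Fk[OF k] by (subst distr_distr) (auto simp: o_def)
    also have "\<dots> = distr (distr M borel F) borel (\<lambda>y. ?A *v y)" using law k by simp
    finally show ?thesis
      by (simp only: nlaw_def)
  qed
  have "prob_space (nlaw M F)" "sets (nlaw M F) = sets borel"
    using prob_space_distr[of "\<lambda>\<omega>. ?A *v Fs 1 \<omega>" borel] lw[of 1] n Fk[of 1] by (auto simp: nlaw_def)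
  note E = pker_power_expectation[OF M ind lw this, of g 0]
  have Sm: "normalized_sum M F Fs n \<in> borel_measurable M"
    unfolding normalized_sum_def[abs_def] using Fk by (intro borel_measurable_scaleR borel_measurable_sum) auto
  show "(LINT x|distr M borel (normalized_sum M F Fs n). f x) = capp (pker (nlaw M F) ^ n) g 0"
    using E by (subst integral_distr[OF Sm]) (auto simp: g normalized_sum_def)
qed

text \<open>For \<open>n \<ge> N\<close> the operator estimate is evaluated at the origin. For
  smaller \<open>n\<close> crude bounds suffice, since \<open>sqrt N / sqrt n \<ge> 1\<close> there;
  they account for the summand with \<open>sqrt N\<close>.\<close>

lemma expansion_total_variation:
  fixes \<nu> :: "(real^'n::finite) measure" and N :: nat
  assumes c: "\<And>j n. real (n choose j) = (\<Sum>l\<le>j. c j l * real n ^ l)"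
    and \<nu>: "prob_space \<nu>" "sets \<nu> = sets borel"
    and D: "D = expansion_symbol s gaussian \<nu>" and deg: "1 \<le> s \<Longrightarrow> sdeg 3 \<kappa> D"
    and N: "1 \<le> N" "\<kappa> * s \<le> N"
    and E: "\<And>n. N \<le> n \<Longrightarrow> norm (pker \<nu> ^ n - edgeworth_op s gaussian (\<lambda>i y. y $ i) \<nu> n) \<le> R * (1 / sqrt n) ^ (s + 1)"
    and R: "0 \<le> R"
    and g: "g \<in> borel_measurable borel" "\<And>z. \<bar>g z\<bar> \<le> 1"
    and f: "\<And>z. bapp f (sqrt n *\<^sub>R z) = g z" "norm f \<le> 1" and n: "1 \<le> n"
  shows "\<bar>capp (pker \<nu> ^ n) f 0 - (LINT z|lborel. g z * (std_gauss_density z * (1 + (\<Sum>m=1..s. (1 / sqrt n) ^ m * correction c s D m z))))\<bar>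
    \<le> (R + correction_bound c s \<kappa> D + (2 + real s * correction_bound c s \<kappa> D) * sqrt N ^ (s + 1)) * (1 / sqrt n) ^ (s + 1)"
    (is "_ \<le> ?rhs")
proof -
  let ?r = "1 / sqrt (real n)" and ?K = "correction_bound c s \<kappa> D"
  let ?h = "\<lambda>z. 1 + (\<Sum>m=1..s. ?r ^ m * correction c s D m z)"
  have r: "0 < ?r" "?r \<le> 1" using n by auto
  have K: "0 \<le> ?K" unfolding correction_bound_def by (intro sum_nonneg mult_nonneg_nonneg hermite_norm_nonneg) auto
  have a: "(LINT z|lborel. g z * (std_gauss_density z * ?h z)) = act g ?h"
    by (simp add: act_def[OF g])
  have "\<bar>capp (pker \<nu> ^ n) f 0 - act g ?h\<bar> \<le> ?rhs"
  proof (cases "N \<le> n")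
    case True
    have "\<bar>capp (pker \<nu> ^ n - edgeworth_op s gaussian (\<lambda>i y. y $ i) \<nu> n) f 0\<bar> \<le> R * ?r ^ (s + 1) * 1"
      by (rule order_trans[OF capp_abs_le]) (intro mult_mono E[OF True] f mult_nonneg_nonneg R; use r in simp)
    moreover have "\<bar>capp (edgeworth_op s gaussian (\<lambda>i y. y $ i) \<nu> n) f 0 - act g ?h\<bar> \<le> 1 * ?K * ?r ^ (s + 1)"
      by (rule edgeworth_op_density[OF g c D deg n _ f(1)]) (use True N in auto)
    ultimately have "\<bar>capp (pker \<nu> ^ n) f 0 - act g ?h\<bar> \<le> (R + ?K) * ?r ^ (s + 1)"
      by (simp only: capp_diff distrib_right)
    also have "\<dots> \<le> ?rhs" using K N r by (intro mult_right_mono) auto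
    finally show ?thesis .
  next
    case False
    have "norm (pker \<nu> ^ n) \<le> 1" by (intro norm_power_le_one norm_ker_prob_le \<nu>)
    then have 1: "\<bar>capp (pker \<nu> ^ n) f 0\<bar> \<le> 1"
      using capp_abs_le[of "pker \<nu> ^ n" f 0] mult_mono[of "norm (pker \<nu> ^ n)" 1 "norm f" 1] f(2) by simp
    have 2: "\<bar>act g ?h\<bar> \<le> 1 + real s * ?K"
    proof (cases "1 \<le> s")
      case True
      note gc = act_cmult[OF g gint_correction[OF g], THEN conjunct2]
      have "act g ?h = act g (\<lambda>_. 1) + (\<Sum>m=1..s. ?r ^ m * act g (correction c s D m))"
        using act_add[OF g gint_one[OF g] conjunct2[OF act_sum[OF g, of "{1..s}" "\<lambda>m z. ?r ^ m * correction c s D m z", OF gc]]]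
          act_sum[OF g, of "{1..s}" "\<lambda>m z. ?r ^ m * correction c s D m z", OF gc] act_cmult[OF g gint_correction[OF g]] by simp
      moreover have "\<bar>act g (\<lambda>_. 1)\<bar> \<le> 1"
        using act_abs_le[OF g gint_one[OF g]] std_gauss_density_integrable(2)[where 'n = 'n] by simp
      moreover have "\<bar>\<Sum>m=1..s. ?r ^ m * act g (correction c s D m)\<bar> \<le> (\<Sum>m=1..s. ?K)"
      proof (intro order_trans[OF sum_abs] sum_mono)
        fix m
        have "?r ^ m * \<bar>act g (correction c s D m)\<bar> \<le> 1 * (1 * ?K)"
          using r K by (intro mult_mono power_le_one act_correction_le[OF g deg[OF True]]) auto
        then show "\<bar>?r ^ m * act g (correction c s D m)\<bar> \<le> ?K" using r by (simp add: abs_mult)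
      qed
      ultimately show ?thesis by simp
    next
      case False
      then have "s = 0" by simp
      then show ?thesis
        using act_abs_le[OF g gint_one[OF g]] std_gauss_density_integrable(2)[where 'n = 'n] by simp
    qed
    have "1 \<le> sqrt N * ?r" using False n by (simp add: field_simps)
    then have p: "1 \<le> (sqrt N * ?r) ^ (s + 1)" by (rule one_le_power)
    have "\<bar>capp (pker \<nu> ^ n) f 0 - act g ?h\<bar> \<le> 1 + (1 + real s * ?K)"
      by (rule order_trans[OF abs_triangle_ineq4 add_mono[OF 1 2]])
    also have "\<dots> = (2 + real s * ?K) * 1" by simp
    also have "\<dots> \<le> (2 + real s * ?K) * (sqrt N * ?r) ^ (s + 1)" using p K by (intro mult_left_mono) auto
    also have "\<dots> = ((2 + real s * ?K) * sqrt N ^ (s + 1)) * ?r ^ (s + 1)" by (simp only: power_mult_distrib mult.assoc)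
    also have "\<dots> \<le> ?rhs" using K R r by (intro mult_right_mono) auto
    finally show ?thesis .
  qed
  then show ?thesis unfolding a .
qed

text \<open>The witnesses \<open>\<epsilon>\<^sub>0\<close> and \<open>D\<^sub>0\<close> are
  parameters beside the eigenvalues because \<open>C\<close> is built from a bump that fits below
  them. The polynomials come after the law, as their coefficients are made of its moments.\<close>

theorem theorem2p7:
  fixes r :: nat and \<epsilon>\<^sub>0 l u :: real and D\<^sub>0 :: "(real^'n) set"
  assumes "r \<ge> 2"
  shows "\<exists>C>0. \<forall>(M :: 'a measure) (F :: 'a \<Rightarrow> real^'n) (Fs :: nat \<Rightarrow> 'a \<Rightarrow> real^'n).
    prob_space M \<longrightarrow>
    F \<in> borel_measurable M \<longrightarrow>
    dominates_Leb_on \<epsilon>\<^sub>0 D\<^sub>0 (distr M borel F) \<longrightarrow>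
    integrable M (\<lambda>\<omega>. norm (F \<omega>) ^ (r + 1)) \<longrightarrow>
    (LINT \<omega>|M. F \<omega>) = 0 \<longrightarrow>
    min_eig_inv_cov M F = l \<longrightarrow>
    max_eig_inv_cov M F = u \<longrightarrow>
    prob_space.indep_vars M (\<lambda>_. borel) Fs {1..} \<longrightarrow>
    (\<forall>k\<ge>1. distr M borel (Fs k) = distr M borel F) \<longrightarrow>
    (\<exists>K :: nat \<Rightarrow> real^'n \<Rightarrow> real.
       (\<forall>m\<in>{1..r div 3}. polynomial_deg_le (3 * m) (K m)) \<and>
       (\<forall>n\<ge>1. d_TV (of_measure (distr M borel (normalized_sum M F Fs n))) (Gamma_signed n r K)
          \<le> C * (1 + (LINT \<omega>|M. norm (F \<omega>) ^ (r + 1))) ^ max (r div 3) 1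
              * (1 / real n powr (real (r div 3 + 1) / 2))))"
proof (cases "0 < \<epsilon>\<^sub>0 \<and> open D\<^sub>0 \<and> D\<^sub>0 \<noteq> {} \<and> 0 < l")
  \<comment> \<open>Without these conditions no variable satisfies the hypotheses,
    \<open>0 < l\<close> being forced by the positive covariance, so any constant will do.\<close>
  case False
  have p2: "2 \<le> r + 1" using assms by simp
  have False if "prob_space M" "F \<in> borel_measurable M" "dominates_Leb_on \<epsilon>\<^sub>0 D\<^sub>0 (distr M borel F)"
      "integrable M (\<lambda>\<omega>. norm (F \<omega>) ^ (r + 1))" "(LINT \<omega>|M. F \<omega>) = 0" "min_eig_inv_cov M F = l"
    for M :: "'a measure" and F :: "'a \<Rightarrow> real^'n"
  proof -
    have "0 < l" using nrm(5)[OF that(1-3) p2 that(4,5)] that(6) by simp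
    then show False using False that(3) by (auto simp: dominates_Leb_on_def)
  qed
  then show ?thesis by (intro exI[of _ 1]) (simp, blast)
next
  case True
  define s where "s = r div 3"
  define p where "p = r + 1"
  define \<kappa> where "\<kappa> = (s + 3) * (s + 1)"
  define e where "e = max s 1"
  \<comment> \<open>From \<open>r \<ge> 2\<close> follows \<open>r div 3 + 3 \<le> r + 1\<close>:
    the Taylor order never exceeds the available moment.\<close>
  have sp: "s + 3 \<le> p" "3 \<le> p" "2 \<le> p" using assms by (auto simp: s_def p_def)
  \<comment> \<open>As soon as a correction occurs, \<open>r \<ge> 3\<close>, and the fourth moment
    used for interpolation exists.\<close>
  have s4: "4 \<le> p" if "1 \<le> s" using that by (auto simp: s_def p_def)
  obtain c where c: "c \<in> D\<^sub>0" using True by blast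
  obtain \<rho> k :: real where \<rho>: "0 < \<rho>" and k: "0 < k" "k \<le> 1"
    and dom': "\<forall>\<mu> g b. dominates_Leb_on \<epsilon>\<^sub>0 D\<^sub>0 \<mu> \<longrightarrow> prob_space \<mu> \<longrightarrow> sets \<mu> = sets borel \<longrightarrow>
      g \<in> borel_measurable borel \<longrightarrow> (\<forall>y. 0 \<le> g y \<and> g y \<le> b) \<longrightarrow>
      k * (LINT y|bump_measure \<rho> c. g y) \<le> (LINT y|\<mu>. g y)"
    using bump_measure_dominated[OF conjunct1[OF conjunct2[OF True]] c conjunct1[OF True]]
    by (elim exE conjE) (rule that, assumption, assumption, assumption, assumption)
  have dom: "k * (LINT y|bump_measure \<rho> c. g y) \<le> (LINT y|\<mu>. g y)"
    if "dominates_Leb_on \<epsilon>\<^sub>0 D\<^sub>0 \<mu>" "prob_space \<mu>" "sets \<mu> = sets borel"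
      "g \<in> borel_measurable borel" "\<And>y. 0 \<le> g y \<and> g y \<le> b" for \<mu> g b
    using dom' that by blast
  \<comment> \<open>\<open>1 / sqrt l\<close> bounds the norm of the square root of the covariance;
    the added 1 makes \<open>I\<close> positive.\<close>
  define I where "I = (1 / sqrt l)\<^sup>2 * bump_fisher \<rho> c + 1"
  have "0 \<le> bump_fisher \<rho> c"
    unfolding bump_fisher_def
    by (intro sum_nonneg Bochner_Integration.integral_nonneg mult_nonneg_nonneg bump_density_basic(2)[OF \<rho>]) simp
  then have I: "0 < I" by (simp add: I_def add_nonneg_pos)
  obtain C0 n0 where C0: "0 \<le> C0" and EO: "\<And>\<mu> \<phi> \<psi> T T3. finite_moment (s + 3) \<mu> \<Longrightarrow>
      (\<forall>w. length w < 3 \<longrightarrow> moment \<mu> w = moment (gaussian :: (real^'n) measure) w) \<Longrightarrow>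
      2 + (LINT y|\<mu>. norm y ^ (s + 3)) + (LINT y|(gaussian :: (real^'n) measure). norm y ^ (s + 3)) \<le> T \<Longrightarrow>
      (LINT y|\<mu>. norm y ^ 3) + (LINT y|(gaussian :: (real^'n) measure). norm y ^ 3) \<le> T3 \<Longrightarrow> 1 \<le> T3 \<Longrightarrow>
      score_kernel \<phi> \<psi> I \<Longrightarrow> norm (pker \<mu> - k *\<^sub>R pker \<phi>) \<le> 1 - k \<Longrightarrow>
      (1 \<le> s \<longrightarrow> snorm (expansion_symbol s gaussian \<mu>) \<le> C0 * T \<and>
         sdeg 3 ((s + 3) * (s + 1)) (expansion_symbol s gaussian \<mu>)) \<and>
      (\<forall>n\<ge>n0. norm (pker \<mu> ^ n - edgeworth_op s gaussian (\<lambda>i y. y $ i) \<mu> n) \<le> C0 * (T3 ^ (s + 1) + T ^ s) * (1 / sqrt n) ^ (s + 1))"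
    using edgeworth_operator[OF gaussian_score zero_less_one gaussian_finite_moment gaussian_moment_1 I k, of s] by blast
  obtain cf where cf: "\<And>j n. real (n choose j) = (\<Sum>l\<le>j. cf j l * real n ^ l)"
    using binomial_as_polynomial by metis
  define Gq where "Gq = (LINT y|(gaussian :: (real^'n) measure). norm y ^ (s + 3))"
  define G3 where "G3 = (LINT y|(gaussian :: (real^'n) measure). norm y ^ 3)"
  \<comment> \<open>Here \<open>u\<close> is still an arbitrary real, whose \<open>sqrt\<close> may
    be negative; hence the absolute value.\<close>
  define U where "U = \<bar>sqrt u ^ p\<bar>"
  define K3 where "K3 = real CARD('n) + 2 + U + G3"
  define KT where "KT = 3 + Gq + U"
  define Kc where "Kc = (\<Sum>j\<in>{1..s}. \<Sum>l\<le>j. \<bar>cf j l\<bar> * ((1 + C0 * KT) ^ s * hermite_norm (\<kappa> * s) TYPE('n)))"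
  define N where "N = 1 + n0 + \<kappa> * s"
  define R where "R = C0 * (K3 ^ (s + 1) + KT ^ s)"
  \<comment> \<open>The summands account for the operator error, the discrepancy of the densities,
    and the crude bound for \<open>n < N\<close>.\<close>
  define C where "C = R + Kc + (2 + real s * Kc) * sqrt N ^ (s + 1)"
  have nn: "0 \<le> Gq" "0 \<le> G3" "0 \<le> U" by (simp_all add: Gq_def G3_def U_def)
  then have K0: "1 \<le> K3" "1 \<le> KT" by (auto simp: K3_def KT_def)
  have Kc: "0 \<le> Kc" unfolding Kc_def using C0 K0
    by (intro sum_nonneg mult_nonneg_nonneg hermite_norm_nonneg) auto
  have R0: "0 \<le> R" using C0 K0 by (simp add: R_def)
  have Cpos: "0 < C"
  proof -
    have "0 < (2 + real s * Kc) * sqrt N ^ (s + 1)" using Kc by (intro mult_pos_pos zero_less_power) (auto simp: N_def add_pos_nonneg)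
    then show ?thesis using R0 Kc by (simp add: C_def)
  qed
  show ?thesis
  proof (intro exI[of _ C] conjI Cpos allI impI)
    fix M :: "'a measure" and F :: "'a \<Rightarrow> real^'n" and Fs :: "nat \<Rightarrow> 'a \<Rightarrow> real^'n"
    assume M: "prob_space M" and F: "F \<in> borel_measurable M"
      and domF: "dominates_Leb_on \<epsilon>\<^sub>0 D\<^sub>0 (distr M borel F)"
      and int': "integrable M (\<lambda>\<omega>. norm (F \<omega>) ^ (r + 1))" and mean: "(LINT \<omega>|M. F \<omega>) = 0"
      and l: "min_eig_inv_cov M F = l" and u: "max_eig_inv_cov M F = u"
      and indep: "prob_space.indep_vars M (\<lambda>_. borel) Fs {1..}"
      and law: "\<forall>k\<ge>1. distr M borel (Fs k) = distr M borel F"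
    have int: "integrable M (\<lambda>\<omega>. norm (F \<omega>) ^ p)" using int' by (simp only: p_def)
    note ctx = M F domF sp(3) int mean
    interpret prob_space M by (rule M)
    define m where "m = (LINT \<omega>|M. norm (F \<omega>) ^ p)"
    have m: "0 \<le> m" by (simp add: m_def)
    define L where "L = 1 + m"
    have L: "1 \<le> L" using m by (simp add: L_def)
    let ?\<nu> = "nlaw M F" and ?\<gamma> = "gaussian :: (real^'n) measure"
    note \<nu> = nlaw_prob[OF ctx]
    note fm = nlaw_moment_le(1)[OF ctx u]
    have mom: "(LINT y|?\<nu>. norm y ^ p) \<le> U * m"
      using nlaw_moment_le(2)[OF ctx u] mult_right_mono[OF abs_ge_self m, of "sqrt u ^ p"] by (simp add: U_def m_def)
    define T where "T = 2 + (LINT y|?\<nu>. norm y ^ (s + 3)) + Gq"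
    define T3 where "T3 = (LINT y|?\<nu>. norm y ^ 3) + G3 + 1"
    have TL: "T \<le> KT * L"
    proof -
      have "T \<le> 3 + U * m + Gq" using finite_moment_le[OF fm sp(1)] mom by (simp add: T_def)
      also have "\<dots> \<le> KT * L" using m nn by (simp add: KT_def L_def algebra_simps)
      finally show ?thesis .
    qed
    have T1: "1 \<le> T"
    proof -
      have "0 \<le> (LINT y|?\<nu>. norm y ^ (s + 3))" by simp
      then show ?thesis using nn by (simp add: T_def)
    qed
    have T31: "1 \<le> T3"
    proof -
      have "0 \<le> (LINT y|?\<nu>. norm y ^ 3)" by simp
      then show ?thesis using nn by (simp add: T3_def)
    qed
    \<comment> \<open>For \<open>s = 0\<close> the single power of \<open>T3\<close> fits
      \<open>e = 1\<close>. For \<open>s \<ge> 1\<close> interpolation makes \<open>T3\<close> grow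
      only like \<open>sqrt L\<close>, and \<open>s + 1 \<le> 2 * s\<close> gives the power
      \<open>s\<close> of \<open>L\<close>.\<close>
    have T3L: "T3 ^ (s + 1) \<le> K3 ^ (s + 1) * L ^ e"
    proof (cases "1 \<le> s")
      case False
      then have s0: "s = 0" by simp
      have "T3 \<le> 2 + U * m + G3" using finite_moment_le[OF fm sp(2)] mom by (simp add: T3_def)
      also have "\<dots> \<le> K3 * L" using m nn by (simp add: K3_def L_def algebra_simps)
      finally show ?thesis by (simp add: s0 e_def)
    next
      case True
      define q where "q = sqrt L"
      have q: "1 \<le> q" "q\<^sup>2 = L" using L by (auto simp: q_def)
      have "1 + (LINT y|?\<nu>. norm y ^ p) \<le> (1 + U) * q\<^sup>2"
        using mom m nn unfolding q(2) by (simp add: L_def algebra_simps)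
      from nlaw_third_moment[OF ctx s4[OF True] q(1) this]
      have "T3 \<le> (real CARD('n) + (1 + U)) * q + (G3 + 1) * 1" by (simp add: T3_def)
      also have "\<dots> \<le> (real CARD('n) + (1 + U)) * q + (G3 + 1) * q"
        using q nn by (intro add_left_mono mult_left_mono) auto
      also have "\<dots> = K3 * q" by (simp add: K3_def algebra_simps)
      finally have "T3 ^ (s + 1) \<le> (K3 * q) ^ (s + 1)" using T31 by (intro power_mono) auto
      also have "\<dots> = K3 ^ (s + 1) * q ^ (s + 1)" by (rule power_mult_distrib)
      also have "\<dots> \<le> K3 ^ (s + 1) * q ^ (2 * s)"
        using q True K0 by (intro mult_left_mono power_increasing) auto
      also have "q ^ (2 * s) = L ^ e" using True by (simp add: power_mult q e_def max_def)
      finally show ?thesis .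
    qed
    have Le: "L ^ s \<le> L ^ e" using L by (intro power_increasing) (auto simp: e_def)
    have TsL: "T ^ s \<le> KT ^ s * L ^ e"
    proof -
      have "T ^ s \<le> (KT * L) ^ s" using TL T1 by (intro power_mono) auto
      also have "\<dots> \<le> KT ^ s * L ^ e" unfolding power_mult_distrib using Le K0 by (intro mult_left_mono) auto
      finally show ?thesis .
    qed
    let ?A = "normalizer M F" and ?B = "matrix_sqrt (cov_matrix M F)"
    define \<psi> where "\<psi> = (\<lambda>i z. \<Sum>j\<in>UNIV. ?B $ j $ i * bump_score \<rho> c j (?B *v z))"
    have sk: "score_kernel (bump_image ?A \<rho> c) \<psi> I"
    proof -
      have "score_kernel (bump_image ?A \<rho> c) \<psi> ((1 / sqrt l)\<^sup>2 * bump_fisher \<rho> c)"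
        unfolding \<psi>_def using nrm(7)[OF ctx, unfolded l]
        by (intro bump_image_score[OF \<rho> nrm(1)[OF ctx] nrm(2)[OF ctx]]) simp
      then show ?thesis unfolding score_kernel_def I_def by (auto intro: order_trans)
    qed
    have mix: "norm (pker ?\<nu> - k *\<^sub>R pker (bump_image ?A \<rho> c)) \<le> 1 - k"
      unfolding nlaw_def
    proof (rule norm_mixture_defect[OF \<rho> k prob_space_distr[OF F]])
      fix g :: "real^'n \<Rightarrow> real" and b :: real
      assume "g \<in> borel_measurable borel" "\<And>y. 0 \<le> g y \<and> g y \<le> b"
      then show "k * (LINT y|bump_measure \<rho> c. g y) \<le> (LINT y|distr M borel F. g y)"
        by (intro dom[OF domF prob_space_distr[OF F]]) auto
    qed simp
    have match: "\<forall>w. length w < 3 \<longrightarrow> moment ?\<nu> w = moment ?\<gamma> w"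
      using nlaw_match[OF ctx] by blast
    define D where "D = expansion_symbol s gaussian ?\<nu>"
    have eo: "1 \<le> s \<Longrightarrow> snorm D \<le> C0 * T" "1 \<le> s \<Longrightarrow> sdeg 3 \<kappa> D"
      "\<And>n. n0 \<le> n \<Longrightarrow> norm (pker ?\<nu> ^ n - edgeworth_op s gaussian (\<lambda>i y. y $ i) ?\<nu> n) \<le> C0 * (T3 ^ (s + 1) + T ^ s) * (1 / sqrt n) ^ (s + 1)"
      using EO[OF finite_moment_mono[OF fm sp(1)] match _ _ T31 sk mix, of T]
      by (auto simp: T_def T3_def Gq_def G3_def D_def \<kappa>_def)
    have RL: "norm (pker ?\<nu> ^ n - edgeworth_op s gaussian (\<lambda>i y. y $ i) ?\<nu> n) \<le> (R * L ^ e) * (1 / sqrt n) ^ (s + 1)" if "N \<le> n" for n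
    proof -
      have "T3 ^ (s + 1) + T ^ s \<le> (K3 ^ (s + 1) + KT ^ s) * L ^ e" using T3L TsL by (simp only: distrib_right)
      then have "C0 * (T3 ^ (s + 1) + T ^ s) \<le> R * L ^ e" unfolding R_def mult.assoc using C0 by (rule mult_left_mono)
      then have "C0 * (T3 ^ (s + 1) + T ^ s) * (1 / sqrt n) ^ (s + 1) \<le> (R * L ^ e) * (1 / sqrt n) ^ (s + 1)"
        by (rule mult_right_mono) simp
      then show ?thesis using eo(3)[of n] that by (simp add: N_def)
    qed
    have bound: "correction_bound cf s \<kappa> D \<le> Kc * L ^ e"
    proof -
      have "snorm D ^ j * hermite_norm (\<kappa> * s) TYPE('n) \<le> ((1 + C0 * KT) ^ s * hermite_norm (\<kappa> * s) TYPE('n)) * L ^ e" if "j \<in> {1..s}" for j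
      proof -
        have s1: "1 \<le> s" using that by simp
        have "snorm D \<le> C0 * (KT * L)" using eo(1)[OF s1] mult_left_mono[OF TL C0] by linarith
        also have "\<dots> \<le> (1 + C0 * KT) * L" using L by (simp add: algebra_simps)
        finally have "snorm D ^ j \<le> ((1 + C0 * KT) * L) ^ j" by (rule power_mono) simp
        also have "\<dots> \<le> ((1 + C0 * KT) * L) ^ s"
        proof (rule power_increasing)
          have "1 * 1 \<le> (1 + C0 * KT) * L" using L C0 K0 by (intro mult_mono) auto
          then show "1 \<le> (1 + C0 * KT) * L" by simp
        qed (use that in simp)
        also have "\<dots> \<le> (1 + C0 * KT) ^ s * L ^ e"
          unfolding power_mult_distrib using Le C0 K0 by (intro mult_left_mono) auto
        finally have "snorm D ^ j * hermite_norm (\<kappa> * s) TYPE('n) \<le> ((1 + C0 * KT) ^ s * L ^ e) * hermite_norm (\<kappa> * s) TYPE('n)"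
          by (rule mult_right_mono) (rule hermite_norm_nonneg)
        then show ?thesis by (simp only: mult_ac)
      qed
      then have "correction_bound cf s \<kappa> D \<le> (\<Sum>j\<in>{1..s}. \<Sum>l\<le>j. \<bar>cf j l\<bar> * (((1 + C0 * KT) ^ s * hermite_norm (\<kappa> * s) TYPE('n)) * L ^ e))"
        unfolding correction_bound_def by (intro sum_mono mult_left_mono) auto
      also have "\<dots> = Kc * L ^ e" by (simp only: Kc_def sum_distrib_right mult.assoc)
      finally show ?thesis .
    qed
    show "\<exists>K :: nat \<Rightarrow> real^'n \<Rightarrow> real.
       (\<forall>m\<in>{1..r div 3}. polynomial_deg_le (3 * m) (K m)) \<and>
       (\<forall>n\<ge>1. d_TV (of_measure (distr M borel (normalized_sum M F Fs n))) (Gamma_signed n r K)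
          \<le> C * (1 + (LINT \<omega>|M. norm (F \<omega>) ^ (r + 1))) ^ max (r div 3) 1
              * (1 / real n powr (real (r div 3 + 1) / 2)))"
      unfolding s_def[symmetric] p_def[symmetric] m_def[symmetric] L_def[symmetric] e_def[symmetric]
    proof (intro exI[of _ "correction cf s D"] conjI ballI allI impI)
      fix m assume "m \<in> {1..s}"
      then show "polynomial_deg_le (3 * m) (correction cf s D m)" by (intro correction_degree[OF eo(2)]) simp
    next
      fix n :: nat assume n: "1 \<le> n"
      let ?h = "\<lambda>z. 1 + (\<Sum>m=1..s. (1 / sqrt n) ^ m * correction cf s D m z)"
      have Ge: "Gamma_signed n r (correction cf s D) = signed_density (\<lambda>z. std_gauss_density z * ?h z)"
        unfolding Gamma_signed_def s_def[symmetric] powr_half_nat[OF n] ..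
      show "d_TV (of_measure (distr M borel (normalized_sum M F Fs n))) (Gamma_signed n r (correction cf s D))
          \<le> C * L ^ e * (1 / real n powr (real (s + 1) / 2))"
        unfolding d_TV_def powr_half_nat[OF n]
      proof (rule cSUP_least)
        show "{f :: real^'n \<Rightarrow> real. f \<in> borel_measurable borel \<and> (\<forall>x. \<bar>f x\<bar> \<le> 1)} \<noteq> {}"
          by (auto intro!: exI[of _ "\<lambda>_. 0"])
        fix f :: "real^'n \<Rightarrow> real" assume "f \<in> {f. f \<in> borel_measurable borel \<and> (\<forall>x. \<bar>f x\<bar> \<le> 1)}"
        then have f: "f \<in> borel_measurable borel" "\<And>x. \<bar>f x\<bar> \<le> 1" by auto
        let ?g = "Bmeas (\<lambda>x. f ((1 / sqrt (real n)) *\<^sub>R x))"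
        note ns = normalized_sum_expectation[OF M F indep law f n]
        have "integrable lborel (\<lambda>z. std_gauss_density z * ?h z)"
          using act_add[OF f gint_one[OF f] conjunct2[OF act_sum[OF f, of "{1..s}" "\<lambda>m z. (1 / sqrt n) ^ m * correction cf s D m z",
              OF act_cmult[OF f gint_correction[OF f], THEN conjunct2]]]]
          by (simp add: gint_def)
        then have si: "signed_integral (Gamma_signed n r (correction cf s D)) f = (LINT z|lborel. f z * (std_gauss_density z * ?h z))"
          unfolding Ge by (rule signed_density_integral[OF _ f])
        have "\<bar>capp (pker ?\<nu> ^ n) ?g 0 - (LINT z|lborel. f z * (std_gauss_density z * ?h z))\<bar>
          \<le> (R * L ^ e + correction_bound cf s \<kappa> D + (2 + real s * correction_bound cf s \<kappa> D) * sqrt N ^ (s + 1)) * (1 / sqrt n) ^ (s + 1)"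
          by (rule expansion_total_variation[OF cf \<nu> D_def eo(2) _ _ RL _ f ns(2) ns(3) n])
             (use R0 L in \<open>auto simp: N_def\<close>)
        also have "\<dots> \<le> (C * L ^ e) * (1 / sqrt n) ^ (s + 1)"
        proof (rule mult_right_mono)
          have L1: "1 \<le> L ^ e" using L by (rule one_le_power)
          \<comment> \<open>Raising 2 to \<open>2 * L ^ e\<close> allows the common factor
            \<open>L ^ e\<close> to be taken out.\<close>
          have "2 + real s * correction_bound cf s \<kappa> D \<le> 2 * L ^ e + real s * (Kc * L ^ e)"
            using L1 bound by (intro add_mono mult_left_mono) auto
          then have "(2 + real s * correction_bound cf s \<kappa> D) * sqrt N ^ (s + 1) \<le> (2 * L ^ e + real s * (Kc * L ^ e)) * sqrt N ^ (s + 1)"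
            by (rule mult_right_mono) simp
          moreover have "C * L ^ e = R * L ^ e + Kc * L ^ e + (2 * L ^ e + real s * (Kc * L ^ e)) * sqrt N ^ (s + 1)"
            by (simp add: C_def algebra_simps)
          ultimately show "R * L ^ e + correction_bound cf s \<kappa> D + (2 + real s * correction_bound cf s \<kappa> D) * sqrt N ^ (s + 1) \<le> C * L ^ e"
            using bound by linarith
        qed simp
        finally show "\<bar>signed_integral (of_measure (distr M borel (normalized_sum M F Fs n))) f
            - signed_integral (Gamma_signed n r (correction cf s D)) f\<bar> \<le> C * L ^ e * (1 / sqrt (real n)) ^ (s + 1)"
          unfolding si signed_of_measure ns(1) .
      qed
    qed
  qed
qed

end
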